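(* Let $m$ be a positive integer and $i,a\in\{0,1,\dots,n-1\}$. Then in $\widetilde{FK}_n$, $$s_i({\bf p}_m(a))=\begin{cases}{\bf p}_m(a)& \text{if } i\neq a,\\ {\bf p}_m(i)+\tilde\theta_{i+1}^m-\tilde\theta_i^m & \text{if } i=a.\end{cases}$$
   Context: Fix $n\ge2$. $\widetilde S_n$ is the affine symmetric group: bijections $w:\mathbb Z\to\mathbb Z$ with $w(i+n)=w(i)+n$, $\sum_{i=1}^nw(i)=\sum_{i=1}^ni$, Coxeter generators $s_0,\dots,s_{n-1}$ where $s_i$ swaps $i+rn$ and $i+1+rn$ for all $r$; length $\ell$; $t_{ij}$ swaps $i+rn,j+rn$ for all $r$. Let $\mathcal S$ be the set of symbols $[ij]$, $i<j$ integers with $i\not\equiv j\pmod n$; for $i>j$ put $[ij]:=-[ji]$. $\mathcal A$ is the completion of the free algebra on $\mathcal S$ along the filtration by subalgebras generated by $[ij]$ with $|i|,|j|\ge N$. $\mathbb A$ is the affine nilCoxeter algebra with basis $A_w$; $[ij]$ acts on the right by $A_w\cdot[ij]=A_{wt_{ij}}$ if $\ell(wt_{ij})=\ell(w)-1$, else $0$; $\mathcal E\subset\mathcal A$ is the subalgebra of elements whose action on each $A_w$ has finitely many nonzero terms. $\widetilde{FK}_n$ is the quotient of $\mathcal E$ by: (a) $[ij]^2=0$; (b) $[ij][kl]=[kl][ij]$ if $i,j,k,l$ have distinct residues; (c) for $i,j,k$ with distinct residues, $[ij][jk]=[jk][ik]+[ik][ij]$ and $[jk][ij]=[ik][jk]+[ik][ij]$;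 (d) for $i\not\equiv j$, $\sum_{i'\equiv i,\,j'\equiv j}[ij'][ji']=0$; (e) $[i,j]=[i+n,j+n]$. $\widetilde S_n$ acts on $\widetilde{FK}_n$ by algebra automorphisms via $w[ij]=[w(i)\,w(j)]$. $\tilde\theta_i=\sum_{j\in\mathbb Z,\,j\not\equiv i}[ij]$. MN elements: for $a\in\mathbb Z$, a connected tree on $\mathcal D_a$ is a finite set $D$ of boxes $(i,j)$ with $i\le a<j$ such that the graph on $\mathbb Z$ with an edge $\{i,j\}$ per box has its non-isolated vertices forming a single tree with pairwise distinct residues mod $n$; $c(D)$ is the number of tree vertices $\le a$. For a bijection $L:\{1,\dots,|D|\}\to D$, $L(t)=(i_t,j_t)$, set $x_{D_L}=[i_1j_1]\cdots[i_{|D|}j_{|D|}]$; labelings are equivalent if their words differ by swaps of adjacent letters with disjoint supports. With $l$ the number of distinct second coordinates in $D$ and $v=|D|-l$, $M(D)$ is a set of one representative from each equivalence class containing a labeling with $i_1,\dots,i_{l-1}$ distinct, $j_1\le\dots\le j_{l-1}$, $j_l,\dots,j_{l+v}$ distinct, $i_l\le\dots\le i_{l+v}$. ${\bf p}_m(a)=\sum_D\sum_{L\in M(D)}(-1)^{c(D)-1}x_{D_L}$ over connected trees on $\mathcal D_a$ with $m$ boxes.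
   Formalization: In M(D), l counts distinct first (not second) coordinates; the second identity in (c) ends in [ij][ik], not [ik][ij]; E is replaced by its largest invariant subalgebra, since E is not stable under the group; the ideal is closed under infinite sums admissible for the nilCoxeter action. *)

theory Defs
  imports "HOL-Algebra.QuotRing" "HOL-Number_Theory.Cong" "HOL-Library.Function_Algebras"
begin

section \<open>The affine symmetric group and its action on the nilCoxeter algebra\<close>

definition aff_sym :: "nat \<Rightarrow> (int \<Rightarrow> int) set" where
  "aff_sym n = {w. bij w \<and> (\<forall>i. w (i + int n) = w i + int n) \<and>
                   (\<Sum>i=1..int n. w i) = (\<Sum>i=1..int n. i)}"

definition aff_refl :: "nat \<Rightarrow> int \<Rightarrow> int \<Rightarrow> int \<Rightarrow> int" where
  "aff_refl n i j x =
     (if [x = i] (mod int n) then x + (j - i)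
      else if [x = j] (mod int n) then x - (j - i) else x)"

definition aff_gen :: "nat \<Rightarrow> int \<Rightarrow> int \<Rightarrow> int" where
  "aff_gen n i = aff_refl n i (i + 1)"

definition aff_prod :: "nat \<Rightarrow> int list \<Rightarrow> int \<Rightarrow> int" where
  "aff_prod n is = foldr (\<circ>) (map (aff_gen n) is) id"

definition aff_len :: "nat \<Rightarrow> (int \<Rightarrow> int) \<Rightarrow> nat" where
  "aff_len n w = (LEAST k. \<exists>is. length is = k \<and> set is \<subseteq> {0..<int n} \<and> w = aff_prod n is)"

text \<open>
  A pair \<open>(i, j)\<close> stands for the symbol \<open>[ij]\<close>. A word of symbols sends a basis element \<open>A_w\<close> of
  the affine nilCoxeter algebra either to a basis element \<open>A_w'\<close>, rendered as \<open>Some w'\<close>, or to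
  zero, rendered as \<open>None\<close>.
\<close>

fun nil_act :: "nat \<Rightarrow> (int \<Rightarrow> int) \<Rightarrow> (int \<times> int) list \<Rightarrow> (int \<Rightarrow> int) option" where
  "nil_act n w [] = Some w"
| "nil_act n w ((i, j) # u) =
     (if aff_len n (w \<circ> aff_refl n i j) + 1 = aff_len n w
      then nil_act n (w \<circ> aff_refl n i j) u else None)"


section \<open>The completed free algebra\<close>

definition letters :: "nat \<Rightarrow> (int \<times> int) set" where
  "letters n = {(i, j). i < j \<and> \<not> [i = j] (mod int n)}"

text \<open>
  A formal series is the family of its coefficients. The completed free algebra is the inverse
  limit of the free algebras on the finite alphabets of all \<open>[ij]\<close> with \<open>\<bar>i\<bar>, \<bar>j\<bar> < N\<close>. This is
  the completion in which the sums \<open>\<Sum>j. [ij]\<close> converge.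
\<close>

type_synonym 'k series = "(int \<times> int) list \<Rightarrow> 'k"

definition bounded_words :: "int \<Rightarrow> (int \<times> int) list set" where
  "bounded_words N = {u. \<forall>(i, j) \<in> set u. \<bar>i\<bar> < N \<and> \<bar>j\<bar> < N}"

definition compl_alg :: "nat \<Rightarrow> 'k::comm_ring_1 series set" where
  "compl_alg n = {f. (\<forall>u. f u \<noteq> 0 \<longrightarrow> set u \<subseteq> letters n) \<and>
                     (\<forall>N. finite {u \<in> bounded_words N. f u \<noteq> 0})}"

definition word :: "(int \<times> int) list \<Rightarrow> 'k::comm_ring_1 series" where
  "word u = (\<lambda>v. if v = u then 1 else 0)"

definition br :: "int \<Rightarrow> int \<Rightarrow> 'k::comm_ring_1 series" where
  "br i j = (if i < j then word [(i, j)] else - word [(j, i)])"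

definition series_mult :: "'k::comm_ring_1 series \<Rightarrow> 'k series \<Rightarrow> 'k series" (infixl "\<odot>" 70) where
  "f \<odot> g = (\<lambda>u. \<Sum>k\<le>length u. f (take k u) * g (drop k u))"

text \<open>The sum of a family of series in which every word occurs in finitely many members only.\<close>

definition series_sum :: "('b \<Rightarrow> 'k::comm_ring_1 series) \<Rightarrow> 'b set \<Rightarrow> 'k series" where
  "series_sum F I = (\<lambda>u. \<Sum>x | x \<in> I \<and> F x u \<noteq> 0. F x u)"

text \<open>
  The substitution \<open>[ij] \<mapsto> [w(i) w(j)]\<close>. The coefficient of \<open>u\<close> in the image is, up to sign, the
  coefficient of the word obtained from \<open>u\<close> by applying the inverse of \<open>w\<close> and sorting each symbol.
  Each symbol whose order gets reversed contributes a sign, as \<open>[ij] = -[ji]\<close>.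
\<close>

definition pull_word :: "(int \<Rightarrow> int) \<Rightarrow> (int \<times> int) list \<Rightarrow> (int \<times> int) list" where
  "pull_word p u = map (\<lambda>(i, j). (min (p i) (p j), max (p i) (p j))) u"

definition pull_sign :: "(int \<Rightarrow> int) \<Rightarrow> (int \<times> int) list \<Rightarrow> 'k::comm_ring_1" where
  "pull_sign p u = (\<Prod>(i, j)\<leftarrow>u. if p i < p j then 1 else - 1)"

definition series_act :: "(int \<Rightarrow> int) \<Rightarrow> 'k::comm_ring_1 series \<Rightarrow> 'k series" where
  "series_act w f = (\<lambda>u. if \<forall>(i, j) \<in> set u. i < j
     then pull_sign (inv_into UNIV w) u * f (pull_word (inv_into UNIV w) u) else 0)"

definition fin_act_alg :: "nat \<Rightarrow> 'k::comm_ring_1 series set" where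
  "fin_act_alg n =
     {f \<in> compl_alg n. \<forall>w\<in>aff_sym n. finite {u. f u \<noteq> 0 \<and> nil_act n w u \<noteq> None}}"

text \<open>
  \<open>fin_act_alg n\<close> is not mapped to itself by the affine symmetric group. For \<open>n = 3\<close> the words
  \<open>u_r = [1+3r,2+3r][1+3r,3+3r][1+3r,2+3r]\<close> annihilate every \<open>A_w\<close>, so their sum over all \<open>r\<close> is
  an element, but \<open>s_1\<close> turns \<open>u_r\<close> into \<open>\<plusminus>[1+3r,2+3r][2+3r,3+3r][1+3r,2+3r]\<close>, all of
  which act in the same way as \<open>\<plusminus>[12][23][12]\<close>, which does not annihilate \<open>A_w\<close> for \<open>w = s_1 s_2 s_1\<close>.
  For the group to act, one has to work in the largest invariant subalgebra.
\<close>

definition inv_alg :: "nat \<Rightarrow> 'k::comm_ring_1 series set" where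
  "inv_alg n = {f \<in> fin_act_alg n. \<forall>v\<in>aff_sym n. series_act v f \<in> fin_act_alg n}"

definition inv_ring :: "nat \<Rightarrow> 'k::comm_ring_1 series ring" where
  "inv_ring n = \<lparr>carrier = inv_alg n, monoid.mult = (\<odot>), one = word [], zero = 0, add = (+)\<rparr>"


section \<open>The affine Fomin-Kirillov algebra\<close>

text \<open>
  A relation is recorded as the pair of its two sides. The symbols \<open>[ij]\<close> with \<open>i > j\<close> are covered
  by \<open>br\<close>. In \<open>c2\<close> the last product is \<open>[ij][ik]\<close>: it is the identity \<open>c1\<close>
  for the triple \<open>(k, j, i)\<close>. With \<open>[ik][ij]\<close> in its place the nilCoxeter action would violate it,
  for instance on \<open>A_w\<close> with \<open>w\<close> the longest element of the symmetric group on \<open>1, 2, 3\<close>.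
\<close>

inductive_set fk_rels :: "nat \<Rightarrow> ('k::comm_ring_1 series \<times> 'k series) set" for n where
  a: "\<not> [i = j] (mod int n) \<Longrightarrow> (br i j \<odot> br i j, 0) \<in> fk_rels n"
| b: "distinct [i mod int n, j mod int n, k mod int n, l mod int n] \<Longrightarrow>
      (br i j \<odot> br k l, br k l \<odot> br i j) \<in> fk_rels n"
| c1: "distinct [i mod int n, j mod int n, k mod int n] \<Longrightarrow>
      (br i j \<odot> br j k, br j k \<odot> br i k + br i k \<odot> br i j) \<in> fk_rels n"
| c2: "distinct [i mod int n, j mod int n, k mod int n] \<Longrightarrow>
      (br j k \<odot> br i j, br i k \<odot> br j k + br i j \<odot> br i k) \<in> fk_rels n"
| d: "\<not> [i = j] (mod int n) \<Longrightarrow>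
      (series_sum (\<lambda>(i', j'). br i j' \<odot> br j i')
         {(i', j'). [i' = i] (mod int n) \<and> [j' = j] (mod int n)}, 0) \<in> fk_rels n"
| e: "\<not> [i = j] (mod int n) \<Longrightarrow> (br i j, br (i + int n) (j + int n)) \<in> fk_rels n"

text \<open>
  The relations have to be imposed on infinite sums as well: already the independence of a
  Murnaghan-Nakayama element of the choice of representatives uses infinitely many instances of
  the commutation relation \<open>b\<close>. The admissible sums are those that converge in the completed free
  algebra and in which, also after translation by a group element, all but finitely many members
  have only terms annihilating a given \<open>A_w\<close>. Convergence in the completed free algebra alone would
  be too weak a requirement: the sum over all \<open>r \<ge> 0\<close> of \<open>[i+rn,j+rn] - [i+(r+1)n,j+(r+1)n]\<close>
  telescopes to \<open>[ij]\<close>.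
\<close>

definition fk_summable :: "nat \<Rightarrow> (nat \<Rightarrow> 'k::comm_ring_1 series) \<Rightarrow> bool" where
  "fk_summable n X \<longleftrightarrow>
     (\<forall>k. X k \<in> inv_alg n) \<and>
     (\<forall>N. finite {k. \<exists>u \<in> bounded_words N. X k u \<noteq> 0}) \<and>
     (\<forall>v\<in>aff_sym n. \<forall>w\<in>aff_sym n.
        finite {k. \<exists>u. series_act v (X k) u \<noteq> 0 \<and> nil_act n w u \<noteq> None})"

definition fk_closed :: "nat \<Rightarrow> 'k::comm_ring_1 series set \<Rightarrow> bool" where
  "fk_closed n I \<longleftrightarrow>
     (\<forall>X. fk_summable n X \<and> range X \<subseteq> I \<longrightarrow> series_sum X UNIV \<in> I)"

definition fk_ideal :: "nat \<Rightarrow> 'k::comm_ring_1 series set" where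
  "fk_ideal n =
     \<Inter>{I. ideal I (inv_ring n) \<and> fk_closed n I \<and> (\<forall>(f, g) \<in> fk_rels n. f - g \<in> I)}"

definition FK :: "nat \<Rightarrow> 'k::comm_ring_1 series set ring" where
  "FK n = inv_ring n Quot fk_ideal n"

definition fk_class :: "nat \<Rightarrow> 'k::comm_ring_1 series \<Rightarrow> 'k series set" where
  "fk_class n f = fk_ideal n +>\<^bsub>inv_ring n\<^esub> f"

definition fk_act :: "(int \<Rightarrow> int) \<Rightarrow> 'k::comm_ring_1 series set \<Rightarrow> 'k series set" where
  "fk_act w X = series_act w ` X"

definition theta_series :: "nat \<Rightarrow> int \<Rightarrow> 'k::comm_ring_1 series" where
  "theta_series n i = series_sum (br i) {j. \<not> [j = i] (mod int n)}"

definition theta :: "nat \<Rightarrow> int \<Rightarrow> 'k::comm_ring_1 series set" where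
  "theta n i = fk_class n (theta_series n i)"


section \<open>Murnaghan-Nakayama elements\<close>

definition verts :: "(int \<times> int) set \<Rightarrow> int set" where
  "verts D = fst ` D \<union> snd ` D"

definition adj :: "(int \<times> int) set \<Rightarrow> int \<Rightarrow> int \<Rightarrow> bool" where
  "adj D x y \<longleftrightarrow> (x, y) \<in> D \<or> (y, x) \<in> D"

definition has_cycle :: "(int \<times> int) set \<Rightarrow> bool" where
  "has_cycle D \<longleftrightarrow> (\<exists>c. length c \<ge> 3 \<and> distinct c \<and>
     (\<forall>k < length c. adj D (c ! k) (c ! (Suc k mod length c))))"

definition conn_tree :: "nat \<Rightarrow> int \<Rightarrow> (int \<times> int) set \<Rightarrow> bool" where
  "conn_tree n a D \<longleftrightarrow>
     finite D \<and> D \<noteq> {} \<and> (\<forall>(i, j) \<in> D. i \<le> a \<and> a < j) \<and>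
     (\<forall>x \<in> verts D. \<forall>y \<in> verts D. (adj D)\<^sup>*\<^sup>* x y) \<and> \<not> has_cycle D \<and>
     inj_on (\<lambda>x. x mod int n) (verts D)"

text \<open>
  A labeling is written as the list of the boxes in the order of their labels, so it is at the
  same time the word that it defines.
\<close>

definition labelings :: "(int \<times> int) set \<Rightarrow> (int \<times> int) list set" where
  "labelings D = {L. distinct L \<and> set L = D}"

definition swap_step :: "(int \<times> int) list \<Rightarrow> (int \<times> int) list \<Rightarrow> bool" where
  "swap_step L L' \<longleftrightarrow> (\<exists>xs ys i j k l. L = xs @ [(i, j), (k, l)] @ ys \<and>
     L' = xs @ [(k, l), (i, j)] @ ys \<and> {i, j} \<inter> {k, l} = {})"

definition lab_equiv :: "(int \<times> int) list \<Rightarrow> (int \<times> int) list \<Rightarrow> bool" where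
  "lab_equiv = swap_step\<^sup>*\<^sup>*"

text \<open>
  Here \<open>l\<close> is the number of distinct first coordinates (the vertices \<open>\<le> a\<close>), so that, in a tree,
  \<open>l + v = m\<close> and \<open>v + 1\<close> is the number of distinct second coordinates. If \<open>l\<close> counted the second
  coordinates, then a tree with two boxes in the same column would have no such labeling, and the
  action of \<open>s_a\<close> on the element of degree two would not be the asserted one.
\<close>

definition mn_labeling :: "(int \<times> int) set \<Rightarrow> (int \<times> int) list \<Rightarrow> bool" where
  "mn_labeling D L \<longleftrightarrow> L \<in> labelings D \<and>
     (let l = card (fst ` D); L1 = take (l - 1) L; L2 = drop (l - 1) L in
        distinct (map fst L1) \<and> sorted (map snd L1) \<and>
        distinct (map snd L2) \<and> sorted (map fst L2))"

definition mn_reps ::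
  "nat \<Rightarrow> int \<Rightarrow> nat \<Rightarrow> ((int \<times> int) set \<Rightarrow> (int \<times> int) list set) \<Rightarrow> bool" where
  "mn_reps n a m M \<longleftrightarrow> (\<forall>D. conn_tree n a D \<and> card D = m \<longrightarrow>
     M D \<subseteq> labelings D \<and>
     (\<forall>L \<in> M D. \<exists>L'. mn_labeling D L' \<and> lab_equiv L L') \<and>
     (\<forall>L'. mn_labeling D L' \<longrightarrow> (\<exists>!L. L \<in> M D \<and> lab_equiv L L')))"

definition mn_series ::
  "nat \<Rightarrow> ((int \<times> int) set \<Rightarrow> (int \<times> int) list set) \<Rightarrow> nat \<Rightarrow> int \<Rightarrow> 'k::comm_ring_1 series" where
  "mn_series n M m a =
     series_sum (\<lambda>(D, L) u. (- 1) ^ (card {x \<in> verts D. x \<le> a} - 1) * word L u)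
       {(D, L). conn_tree n a D \<and> card D = m \<and> L \<in> M D}"

definition mn_elem ::
  "nat \<Rightarrow> ((int \<times> int) set \<Rightarrow> (int \<times> int) list set) \<Rightarrow> nat \<Rightarrow> int \<Rightarrow> 'k::comm_ring_1 series set" where
  "mn_elem n M m a = fk_class n (mn_series n M m a)"


section \<open>Facts on the affine symmetric group\<close>

lemma aff_symD:
  assumes "w \<in> aff_sym n"
  shows "bij w" "w (i + int n) = w i + int n" "(\<Sum>i=1..int n. w i) = (\<Sum>i=1..int n. i)"
  using assms by (auto simp: aff_sym_def)

lemma periodic_int:
  fixes g :: "int \<Rightarrow> int"
  assumes "\<And>x. g (x + int n) = g x"
  shows "g (x + k * int n) = g x"
proof -
  have nat: "g (y + int m * int n) = g y" for y m
  proof (induction m)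
    case (Suc m)
    have "g (y + int (Suc m) * int n) = g ((y + int m * int n) + int n)" by (simp add: algebra_simps)
    then show ?case using assms Suc by metis
  qed simp
  show ?thesis
  proof (cases "k \<ge> 0")
    case True then show ?thesis using nat[of x "nat k"] by simp
  next
    case False then show ?thesis using nat[of "x + k * int n" "nat (-k)"] by (simp add: algebra_simps)
  qed
qed

lemma periodic_cong:
  fixes g :: "int \<Rightarrow> int"
  assumes "\<And>x. g (x + int n) = g x" and "[x = y] (mod int n)"
  shows "g x = g y"
proof -
  obtain k where "y = x + k * int n"
    using assms(2) by (metis cong_iff_lin mult.commute)
  with periodic_int[of g n x k] assms(1) show ?thesis by simp
qed

lemma aff_sym_shift:
  assumes "w \<in> aff_sym n"
  shows "w (x + k * int n) = w x + k * int n"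
proof -
  have "(\<lambda>x. w x - x) (x + k * int n) = (\<lambda>x. w x - x) x"
    by (rule periodic_int) (simp add: aff_symD(2)[OF assms])
  then show ?thesis by simp
qed

lemma aff_sym_cong:
  assumes "w \<in> aff_sym n"
  shows "[w x = w y] (mod int n) \<longleftrightarrow> [x = y] (mod int n)"
proof
  assume "[x = y] (mod int n)"
  then obtain k where "y = x + k * int n" by (metis cong_iff_lin mult.commute)
  then show "[w x = w y] (mod int n)" using aff_sym_shift[OF assms, of x k]
    by (simp add: cong_def)
next
  assume "[w x = w y] (mod int n)"
  then obtain k where "w y = w x + k * int n" by (metis cong_iff_lin mult.commute)
  then have "w y = w (x + k * int n)" using aff_sym_shift[OF assms, of x k] by simp
  then have "y = x + k * int n" using aff_symD(1)[OF assms] by (metis bij_pointE)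
  then show "[x = y] (mod int n)" by (simp add: cong_def)
qed

lemma sum_period:
  fixes g :: "int \<Rightarrow> int"
  assumes n: "n > 0" and g: "\<And>x. g (x + int n) = g x" and w: "\<And>x y. [w x = w y] (mod int n) \<longleftrightarrow> [x = y] (mod int n)"
  shows "(\<Sum>i=1..int n. g (w i)) = (\<Sum>i=0..<int n. g i)"
proof -
  have inj: "inj_on (\<lambda>i. w i mod int n) {1..int n}"
  proof (rule inj_onI)
    fix x y assume xy: "x \<in> {1..int n}" "y \<in> {1..int n}" and "w x mod int n = w y mod int n"
    then have "[x = y] (mod int n)" using w by (simp add: cong_def)
    then have "int n dvd x - y" by (simp add: cong_iff_dvd_diff)
    moreover have "\<bar>x - y\<bar> < int n" using xy by auto
    ultimately show "x = y" using dvd_imp_le_int[of "x - y" "int n"] by force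
  qed
  have im: "(\<lambda>i. w i mod int n) ` {1..int n} = {0..<int n}"
    by (rule card_subset_eq) (use n inj in \<open>auto simp: card_image\<close>)
  have "(\<Sum>i=0..<int n. g i) = (\<Sum>i=1..int n. g (w i mod int n))"
    using sum.reindex[OF inj, of g] im by simp
  also have "\<dots> = (\<Sum>i=1..int n. g (w i))"
  proof (rule sum.cong)
    fix i show "g (w i mod int n) = g (w i)"
      using periodic_cong[of g n "w i mod int n" "w i"] g by (simp add: cong_def)
  qed simp
  finally show ?thesis by simp
qed

lemma aff_sym_comp:
  assumes n: "n > 0" and v: "v \<in> aff_sym n" and w: "w \<in> aff_sym n"
  shows "v \<circ> w \<in> aff_sym n"
proof -
  have "bij (v \<circ> w)" using v w by (auto intro: bij_comp aff_symD)
  moreover have "\<forall>i. (v \<circ> w) (i + int n) = (v \<circ> w) i + int n"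
    using aff_symD(2)[OF v] aff_symD(2)[OF w] by simp
  moreover have "(\<Sum>i=1..int n. (v \<circ> w) i) = (\<Sum>i=1..int n. i)"
  proof -
    let ?g = "\<lambda>x. v x - x"
    have g: "?g (x + int n) = ?g x" for x using aff_symD(2)[OF v] by simp
    have "(\<Sum>i=1..int n. ?g (w i)) = (\<Sum>i=0..<int n. ?g i)"
      by (rule sum_period[OF n]) (use g aff_sym_cong[OF w] in auto)
    also have "\<dots> = (\<Sum>i=1..int n. ?g (id i))"
      by (rule sum_period[OF n, symmetric]) (use g in auto)
    also have "\<dots> = 0" using aff_symD(3)[OF v] by (simp add: sum_subtractf)
    finally show ?thesis using aff_symD(3)[OF w] by (simp add: sum_subtractf)
  qed
  ultimately show ?thesis by (simp add: aff_sym_def)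
qed

lemma aff_sym_id: "id \<in> aff_sym n"
  by (simp add: aff_sym_def)

lemma aff_sym_inv:
  assumes n: "n > 0" and v: "v \<in> aff_sym n"
  shows "inv_into UNIV v \<in> aff_sym n"
proof -
  let ?p = "inv_into UNIV v"
  have b: "bij v" by (rule aff_symD[OF v])
  have vp: "v (?p x) = x" for x using b by (simp add: bij_is_surj surj_f_inv_f)
  have pv: "?p (v x) = x" for x using b by (simp add: bij_is_inj inv_f_f)
  have per: "?p (i + int n) = ?p i + int n" for i
    using aff_symD(2)[OF v, of "?p i"] vp pv by metis
  have con: "[?p x = ?p y] (mod int n) \<longleftrightarrow> [x = y] (mod int n)" for x y
    using aff_sym_cong[OF v, of "?p x" "?p y"] vp by simp
  let ?g = "\<lambda>x. v x - x"
  have g: "?g (x + int n) = ?g x" for x using aff_symD(2)[OF v] by simp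
  have "(\<Sum>i=1..int n. ?g (?p i)) = (\<Sum>i=0..<int n. ?g i)"
    by (rule sum_period[OF n]) (use g con in auto)
  also have "\<dots> = (\<Sum>i=1..int n. ?g (id i))"
    by (rule sum_period[OF n, symmetric]) (use g in auto)
  also have "\<dots> = 0" using aff_symD(3)[OF v] by (simp add: sum_subtractf)
  finally have "(\<Sum>i=1..int n. ?p i) = (\<Sum>i=1..int n. i)" by (simp add: sum_subtractf vp)
  then show ?thesis using per b by (simp add: aff_sym_def bij_imp_bij_inv)
qed

lemma cong_sub_iff: "[x + (j - i) = j] (mod int n) \<longleftrightarrow> [x = i] (mod int n)"
  by (simp add: cong_iff_dvd_diff)
lemma cong_sub_iff': "[x - (j - i) = i] (mod int n) \<longleftrightarrow> [x = j] (mod int n)"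
  by (simp add: cong_iff_dvd_diff)

lemma aff_refl_invol:
  assumes "\<not> [i = j] (mod int n)"
  shows "aff_refl n i j (aff_refl n i j x) = x"
proof -
  have "\<not> [x + (j - i) = i] (mod int n)" if "[x = i] (mod int n)"
    using assms that cong_sub_iff[of x j i n] unfolding cong_def by metis
  then show ?thesis
    by (auto simp: aff_refl_def cong_sub_iff cong_sub_iff')
qed

lemma card_residue:
  assumes "n > 0"
  shows "card {x \<in> {0..<int n}. [x = i] (mod int n)} = 1"
proof -
  have "{x \<in> {0..<int n}. [x = i] (mod int n)} = {i mod int n}"
    using assms by (auto simp: cong_def)
  then show ?thesis by simp
qed

lemma aff_refl_aff_sym:
  assumes n: "n > 0" and ij: "\<not> [i = j] (mod int n)"
  shows "aff_refl n i j \<in> aff_sym n"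
proof -
  let ?t = "aff_refl n i j"
  have b: "bij ?t" using aff_refl_invol[OF ij] by (metis bijI injI surjI)
  have per: "?t (x + int n) = ?t x + int n" for x
    by (simp add: aff_refl_def cong_def)
  let ?g = "\<lambda>x. ?t x - x"
  have g: "?g (x + int n) = ?g x" for x using per by simp
  have e: "?g x = (if [x = i] (mod int n) then j - i else 0) - (if [x = j] (mod int n) then j - i else 0)" for x
  proof -
    have "\<not> ([x = i] (mod int n) \<and> [x = j] (mod int n))" using ij by (auto simp: cong_def)
    then show ?thesis by (auto simp: aff_refl_def)
  qed
  have "(\<Sum>x=1..int n. ?g (id x)) = (\<Sum>x=0..<int n. ?g x)"
    by (rule sum_period[OF n]) (use g in auto)
  also have "\<dots> = (\<Sum>x\<in>{0..<int n}. if [x = i] (mod int n) then j - i else 0)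
                 - (\<Sum>x\<in>{0..<int n}. if [x = j] (mod int n) then j - i else 0)"
    unfolding e by (simp add: sum_subtractf)
  also have "\<dots> = 0"
    using card_residue[OF n, of i] card_residue[OF n, of j]
    by (simp add: sum.inter_filter[symmetric])
  finally show ?thesis using b per by (simp add: aff_sym_def sum_subtractf)
qed

lemma aff_gen_aff_sym: "n \<ge> 2 \<Longrightarrow> aff_gen n i \<in> aff_sym n"
  unfolding aff_gen_def by (rule aff_refl_aff_sym) (auto simp: cong_iff_dvd_diff zdvd_not_zless)

lemma aff_gen_mod: "aff_gen n (i mod int n) = aff_gen n i"
proof
  fix x
  have "[x = i mod int n] (mod int n) \<longleftrightarrow> [x = i] (mod int n)" by (simp add: cong_def)
  moreover have "[x = i mod int n + 1] (mod int n) \<longleftrightarrow> [x = i + 1] (mod int n)"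
    by (simp add: cong_def mod_simps)
  ultimately show "aff_gen n (i mod int n) x = aff_gen n i x" by (simp add: aff_gen_def aff_refl_def)
qed

lemma aff_prod_snoc: "aff_prod n (is @ [i]) = aff_prod n is \<circ> aff_gen n i"
  by (induction "is") (auto simp: aff_prod_def)

lemma aff_prod_disp: "\<bar>aff_prod n is x - x\<bar> \<le> int (length is)"
proof (induction "is" arbitrary: x)
  case Nil show ?case by (simp add: aff_prod_def)
next
  case (Cons i "is")
  have e: "aff_prod n (i # is) x = aff_gen n i (aff_prod n is x)" by (simp add: aff_prod_def)
  have "\<bar>aff_gen n i y - y\<bar> \<le> 1" for y by (simp add: aff_gen_def aff_refl_def)
  from this[of "aff_prod n is x"] e Cons[of x] show ?case by simp
qed

lemma sum_rotate:
  fixes g :: "int \<Rightarrow> int"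
  assumes n: "n > 0" and g: "\<And>x. g (x + int n) = g x"
  shows "(\<Sum>k=1..int n. g (k + c)) = (\<Sum>k=1..int n. g k)"
proof -
  have "(\<Sum>k=1..int n. g (k + c)) = (\<Sum>k=0..<int n. g k)"
    by (rule sum_period[OF n, of g "\<lambda>k. k + c"]) (use g in \<open>auto simp: cong_iff_dvd_diff\<close>)
  moreover have "(\<Sum>k=1..int n. g (id k)) = (\<Sum>k=0..<int n. g k)"
    by (rule sum_period[OF n]) (use g in auto)
  ultimately show ?thesis by simp
qed

lemma aff_sym_no_descent:
  assumes n: "n \<ge> 2" and w: "w \<in> aff_sym n" and nd: "\<And>i. w i < w (i + 1)"
  shows "w = id"
proof -
  have st: "w x + 1 \<le> w (x + 1)" for x using nd[of x] by simp
  have ge: "w x + int k \<le> w (x + int k)" for x k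
  proof (induction k)
    case (Suc k) then show ?case using st[of "x + int k"] by (simp add: algebra_simps)
  qed simp
  have const: "w (x + 1) = w x + 1" for x
  proof -
    have "w (x + 1) + int (n - 1) \<le> w (x + 1 + int (n - 1))" by (rule ge)
    also have "\<dots> = w x + int n" using n aff_symD(2)[OF w, of x] by (simp add: of_nat_diff)
    finally have "w (x + 1) \<le> w x + 1" using n by (simp add: of_nat_diff)
    then show ?thesis using st[of x] by simp
  qed
  have d: "w x = x + w 0" for x
  proof -
    have "(\<lambda>x. w x - x) (0 + x * int 1) = (\<lambda>x. w x - x) 0"
      by (rule periodic_int) (simp add: const)
    then show ?thesis by simp
  qed
  have "(\<Sum>i=1..int n. w i) = (\<Sum>i=1..int n. i) + int n * w 0"
    by (subst d) (simp add: sum.distrib)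
  then have w0: "w 0 = 0" using aff_symD(3)[OF w] n by simp
  show ?thesis
  proof
    fix x show "w x = id x" using d[of x] w0 by simp
  qed
qed

lemma aff_sym_generated:
  assumes n: "n \<ge> 2" and w: "w \<in> aff_sym n"
  shows "\<exists>is. set is \<subseteq> {0..<int n} \<and> w = aff_prod n is"
  using w
proof (induction "nat (\<Sum>k=1..int n. (w k - k)^2)" arbitrary: w rule: less_induct)
  case less
  show ?case
  proof (cases "\<forall>i. w i < w (i + 1)")
    case True
    then have "w = aff_prod n []" using aff_sym_no_descent[OF n less.prems] by (simp add: aff_prod_def)
    then show ?thesis by (intro exI[of _ "[]"]) simp
  next
    case False
    then obtain i where i: "w i > w (i + 1)"
      using aff_symD(1)[OF less.prems] by (metis add_cancel_left_right bij_is_inj injD linorder_neqE_linordered_idom zero_neq_one)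
    define v where "v = w \<circ> aff_gen n i"
    have v: "v \<in> aff_sym n" unfolding v_def using n by (intro aff_sym_comp less.prems aff_gen_aff_sym) auto
    have pw: "(\<lambda>k. (w k - k)^2) (x + int n) = (\<lambda>k. (w k - k)^2) x" if "w \<in> aff_sym n" for w x
      using aff_symD(2)[OF that] by simp
    let ?S = "\<lambda>w. (\<Sum>k=1..int n. (w (k + (i - 1)) - (k + (i - 1)))^2) :: int"
    have rot: "(\<Sum>k=1..int n. (w k - k)^2) = ?S w" if "w \<in> aff_sym n" for w
      using sum_rotate[of n "\<lambda>k. (w k - k)^2" "i - 1"] pw[OF that] n by simp
    have nc: "\<not> [i + 1 = i] (mod int n)" using n by (auto simp: cong_iff_dvd_diff zdvd_not_zless)
    have vi: "v i = w (i + 1)" by (simp add: v_def aff_gen_def aff_refl_def)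
    have vi1: "v (i + 1) = w i" using nc by (simp add: v_def aff_gen_def aff_refl_def)
    have vo: "v (k + (i - 1)) = w (k + (i - 1))" if "k \<in> {3..int n}" for k
    proof -
      have "\<not> int n dvd k - 1" "\<not> int n dvd k - 2" using that by (auto simp: zdvd_not_zless)
      then have "\<not> [k + (i - 1) = i] (mod int n)" "\<not> [k + (i - 1) = i + 1] (mod int n)"
        by (auto simp: cong_iff_dvd_diff algebra_simps)
      then show ?thesis by (simp add: v_def aff_gen_def aff_refl_def)
    qed
    have split: "{1..int n} = insert 1 (insert 2 {3..int n})" using n by auto
    have S: "?S u = (u i - i)^2 + ((u (i + 1) - (i + 1))^2 + (\<Sum>k\<in>{3..int n}. (u (k + (i - 1)) - (k + (i - 1)))^2))" for u
      unfolding split by (simp add: algebra_simps)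
    have "?S v < ?S w"
    proof -
      have "(\<Sum>k\<in>{3..int n}. (v (k + (i - 1)) - (k + (i - 1)))^2) = (\<Sum>k\<in>{3..int n}. (w (k + (i - 1)) - (k + (i - 1)))^2)"
        by (rule sum.cong) (auto simp: vo)
      moreover have "(w (i + 1) - i)^2 + (w i - (i + 1))^2 < (w i - i)^2 + (w (i + 1) - (i + 1))^2"
        using i by (simp add: power2_eq_square algebra_simps)
      ultimately show ?thesis unfolding S vi vi1 by linarith
    qed
    moreover have "0 \<le> ?S v" by (intro sum_nonneg) simp
    ultimately have "nat (\<Sum>k=1..int n. (v k - k)^2) < nat (\<Sum>k=1..int n. (w k - k)^2)"
      unfolding rot[OF v] rot[OF less.prems] by linarith
    from less.hyps[OF this v] obtain "is" where "is": "set is \<subseteq> {0..<int n}" "v = aff_prod n is" by blast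
    have "w = v \<circ> aff_gen n i" unfolding v_def
      using aff_refl_invol[of i "i+1" n] nc by (simp add: aff_gen_def fun_eq_iff cong_sym_eq)
    also have "\<dots> = aff_prod n (is @ [i mod int n])"
      using "is" by (simp add: aff_prod_snoc aff_gen_mod)
    finally show ?thesis using "is"(1) n by (intro exI[of _ "is @ [i mod int n]"]) auto
  qed
qed

lemma aff_sym_disp:
  assumes n: "n \<ge> 2" and w: "w \<in> aff_sym n"
  shows "\<bar>w x - x\<bar> \<le> int (aff_len n w)"
proof -
  have "\<exists>k is. length is = k \<and> set is \<subseteq> {0..<int n} \<and> w = aff_prod n is"
    using aff_sym_generated[OF n w] by blast
  then have "\<exists>is. length is = aff_len n w \<and> set is \<subseteq> {0..<int n} \<and> w = aff_prod n is"
    unfolding aff_len_def by (rule LeastI_ex)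
  then show ?thesis using aff_prod_disp by metis
qed

lemma nil_act_width:
  assumes n: "n \<ge> 2" and "w \<in> aff_sym n" and "nil_act n w u \<noteq> None" and "set u \<subseteq> letters n"
    and "(i, j) \<in> set u"
  shows "j - i \<le> 2 * int (aff_len n w)"
  using assms(2-)
proof (induction u arbitrary: w)
  case (Cons b u)
  obtain k l where b: "b = (k, l)" by force
  let ?w = "w \<circ> aff_refl n k l"
  have len: "aff_len n ?w + 1 = aff_len n w" and act: "nil_act n ?w u \<noteq> None"
    using Cons.prems b by (auto split: if_splits)
  have kl: "\<not> [k = l] (mod int n)" using Cons.prems b by (auto simp: letters_def)
  have w': "?w \<in> aff_sym n" using n by (intro aff_sym_comp Cons.prems aff_refl_aff_sym kl) auto
  show ?case
  proof (cases "(i, j) = (k, l)")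
    case True
    have "?w k = w l" by (simp add: aff_refl_def)
    then show ?thesis using aff_sym_disp[OF n w', of k] aff_sym_disp[OF n Cons.prems(1), of l] True len
      by auto
  next
    case False
    then have "j - i \<le> 2 * int (aff_len n ?w)" using Cons b act w' by auto
    then show ?thesis using len by simp
  qed
qed simp


section \<open>Well-definedness\<close>

text \<open>
  The main facts are \<open>inv_ring_ring\<close>, \<open>fk_ideal_props\<close>, \<open>FK_ring\<close>, \<open>fk_act_class\<close>, \<open>fk_act_iso\<close>,
  \<open>theta_carrier\<close> and \<open>mn_elem_carrier\<close>: the affine Fomin-Kirillov algebra is a ring on which
  the affine symmetric group acts by automorphisms, and it contains the elements in question.
\<close>

abbreviation "ordered_word u \<equiv> \<forall>(i, j) \<in> set u. i < (j::int)"

lemma pull_word_simps [simp]: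
  "pull_word p [] = []"
  "pull_word p (b # u) = (min (p (fst b)) (p (snd b)), max (p (fst b)) (p (snd b))) # pull_word p u"
  "pull_word p (u @ v) = pull_word p u @ pull_word p v"
  "length (pull_word p u) = length u"
  by (auto simp: pull_word_def split_beta)

lemma pull_word_take: "pull_word p (take k u) = take k (pull_word p u)"
  and pull_word_drop: "pull_word p (drop k u) = drop k (pull_word p u)"
  by (simp_all add: pull_word_def take_map drop_map)

lemma pull_sign_simps [simp]:
  "pull_sign p [] = 1"
  "pull_sign p (b # u) = (if p (fst b) < p (snd b) then 1 else - 1) * pull_sign p u"
  "pull_sign p (u @ v) = pull_sign p u * pull_sign p v"
  by (auto simp: pull_sign_def split_beta)

lemma pull_sign_sq: "pull_sign p u * (pull_sign p u * x) = x"
proof -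
  have "pull_sign p u * pull_sign p u = 1"
    by (induction u) (auto simp: algebra_simps)
  then show ?thesis by (metis mult.assoc mult_1)
qed

lemma pull_sign_mult_eq_0_iff: "pull_sign p u * x = 0 \<longleftrightarrow> x = 0"
  by (metis pull_sign_sq mult_zero_right)

lemma pull_word_pull: "ordered_word u \<Longrightarrow> (\<And>x. q (p x) = x) \<Longrightarrow> pull_word q (pull_word p u) = u"
  by (induction u) (auto simp: min_def max_def split_beta)

lemma pull_word_comp: "pull_word q (pull_word p u) = pull_word (q \<circ> p) u"
  by (induction u) (auto simp: min_def max_def)

lemma pull_sign_comp:
  assumes "inj p" "inj q" "ordered_word u"
  shows "pull_sign p u * pull_sign q (pull_word p u) = pull_sign (q \<circ> p) u"
  using assms(3)
proof (induction u)
  case (Cons b u)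
  have "p (fst b) \<noteq> p (snd b)" "q (p (fst b)) \<noteq> q (p (snd b))"
    using Cons.prems assms(1,2) by (auto simp: inj_eq)
  then show ?case using Cons by (auto simp: min_def max_def algebra_simps)
qed simp

lemma ordered_pull: "inj p \<Longrightarrow> ordered_word u \<Longrightarrow> ordered_word (pull_word p u)"
proof (induction u)
  case (Cons b u)
  have "p (fst b) \<noteq> p (snd b)" using Cons.prems by (auto simp: inj_eq)
  then have "min (p (fst b)) (p (snd b)) < max (p (fst b)) (p (snd b))" by linarith
  then show ?case using Cons by simp
qed simp

lemma in_set_pull:
  "(i, j) \<in> set u \<Longrightarrow> (min (p i) (p j), max (p i) (p j)) \<in> set (pull_word p u)"
  by (force simp: pull_word_def)

lemma ordered_letters: "set u \<subseteq> letters n \<Longrightarrow> ordered_word u"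
  by (auto simp: letters_def)

lemma series_act_nz:
  "series_act v f u \<noteq> 0 \<longleftrightarrow> ordered_word u \<and> f (pull_word (inv_into UNIV v) u) \<noteq> 0"
  by (simp add: series_act_def pull_sign_mult_eq_0_iff)

lemma series_act_add: "series_act v (f + g) = series_act v f + series_act v g"
  by (auto simp: series_act_def fun_eq_iff algebra_simps)

lemma series_act_0: "series_act v 0 = 0"
  by (auto simp: series_act_def fun_eq_iff)

lemma series_act_uminus: "series_act v (- f) = - series_act v f"
  by (auto simp: series_act_def fun_eq_iff)

lemma series_act_diff: "series_act v (f - g) = series_act v f - series_act v g"
  by (auto simp: series_act_def fun_eq_iff algebra_simps)

lemma series_act_one: "series_act v (word []) = word []"
  by (auto simp: series_act_def fun_eq_iff word_def pull_word_def)

lemma series_act_mult: "series_act v (f \<odot> g) = series_act v f \<odot> series_act v g"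
proof
  fix u :: "(int \<times> int) list"
  let ?p = "inv_into UNIV v"
  show "series_act v (f \<odot> g) u = (series_act v f \<odot> series_act v g) u"
  proof (cases "ordered_word u")
    case True
    have "(series_act v f \<odot> series_act v g) u =
      (\<Sum>k\<le>length u. (pull_sign ?p (take k u) * f (pull_word ?p (take k u))) *
         (pull_sign ?p (drop k u) * g (pull_word ?p (drop k u))))"
      unfolding series_mult_def series_act_def
      using True by (intro sum.cong refl) (auto dest: in_set_takeD in_set_dropD)
    also have "\<dots> = (\<Sum>k\<le>length u. pull_sign ?p u * (f (take k (pull_word ?p u)) * g (drop k (pull_word ?p u))))"
    proof (intro sum.cong refl)
      fix k
      have "pull_sign ?p u = pull_sign ?p (take k u) * (pull_sign ?p (drop k u) :: 'a)"
        by (subst pull_sign_simps(3)[symmetric]) simp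
      then show "(pull_sign ?p (take k u) * f (pull_word ?p (take k u))) *
         (pull_sign ?p (drop k u) * g (pull_word ?p (drop k u))) =
         pull_sign ?p u * (f (take k (pull_word ?p u)) * g (drop k (pull_word ?p u)))"
        by (simp add: pull_word_take pull_word_drop algebra_simps)
    qed
    also have "\<dots> = series_act v (f \<odot> g) u"
      using True by (simp add: series_act_def series_mult_def sum_distrib_left)
    finally show ?thesis by simp
  next
    case False
    have "series_act v f (take k u) * series_act v g (drop k u) = 0" for k
    proof (rule ccontr)
      assume "series_act v f (take k u) * series_act v g (drop k u) \<noteq> 0"
      then have "ordered_word (take k u)" "ordered_word (drop k u)"
        by (metis mult_zero_left series_act_nz, metis mult_zero_right series_act_nz)
      then have "ordered_word (take k u @ drop k u)" unfolding set_append by blast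
      with False show False by (simp del: set_append)
    qed
    then have "(series_act v f \<odot> series_act v g) u = 0" by (simp add: series_mult_def)
    moreover have "series_act v (f \<odot> g) u = 0" using False unfolding series_act_def by presburger
    ultimately show ?thesis by simp
  qed
qed

lemma series_act_comp:
  assumes "bij v" "bij w"
  shows "series_act v (series_act w f) = series_act (v \<circ> w) f"
proof
  fix u
  let ?p = "inv_into UNIV v" and ?q = "inv_into UNIV w"
  have pq: "inv_into UNIV (v \<circ> w) = ?q \<circ> ?p" using assms by (simp add: o_inv_distrib)
  have inj: "inj ?p" "inj ?q" using assms by (simp_all add: bij_imp_bij_inv bij_is_inj)
  show "series_act v (series_act w f) u = series_act (v \<circ> w) f u"
  proof (cases "ordered_word u")
    case True
    then show ?thesis using ordered_pull[OF inj(1) True] pull_sign_comp[OF inj True, where 'a = 'a]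
      by (simp add: series_act_def pq pull_word_comp mult.assoc[symmetric])
  next
    case False
    then show ?thesis unfolding series_act_def by presburger
  qed
qed

lemma series_act_id: "(\<And>u. f u \<noteq> 0 \<Longrightarrow> ordered_word u) \<Longrightarrow> series_act id f = f"
proof
  fix u assume f: "\<And>u. f u \<noteq> 0 \<Longrightarrow> ordered_word u"
  have "ordered_word u \<Longrightarrow> pull_word id u = u \<and> pull_sign id u = (1 :: 'a)"
    by (induction u) auto
  then show "series_act id f u = f u" using f[of u] by (auto simp: series_act_def)
qed

definition width_fin :: "nat \<Rightarrow> 'k::comm_ring_1 series \<Rightarrow> bool" where
  "width_fin n f \<longleftrightarrow> (\<forall>u. f u \<noteq> 0 \<longrightarrow> set u \<subseteq> letters n) \<and>
     (\<forall>C. finite {u. f u \<noteq> 0 \<and> (\<forall>(i, j) \<in> set u. j - i \<le> C)})"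

lemma width_fin_fin_act:
  assumes n: "n \<ge> 2" and f: "width_fin n f"
  shows "f \<in> fin_act_alg n"
proof -
  have "finite {u \<in> bounded_words N. f u \<noteq> 0}" for N
    by (rule finite_subset[of _ "{u. f u \<noteq> 0 \<and> (\<forall>(i, j) \<in> set u. j - i \<le> 2 * N)}"])
       (use f in \<open>fastforce simp: width_fin_def bounded_words_def\<close>)+
  moreover have "finite {u. f u \<noteq> 0 \<and> nil_act n w u \<noteq> None}" if "w \<in> aff_sym n" for w
    by (rule finite_subset[of _ "{u. f u \<noteq> 0 \<and> (\<forall>(i, j) \<in> set u. j - i \<le> 2 * int (aff_len n w))}"])
       (use f nil_act_width[OF n that] in \<open>fastforce simp: width_fin_def\<close>)+
  ultimately show ?thesis using f by (auto simp: fin_act_alg_def compl_alg_def width_fin_def)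
qed

lemma series_act_letters:
  assumes n: "n > 0" and v: "v \<in> aff_sym n"
    and f: "\<And>u. f u \<noteq> 0 \<Longrightarrow> set u \<subseteq> letters n" and u: "series_act v f u \<noteq> 0"
  shows "set u \<subseteq> letters n"
proof (rule subsetI, clarify)
  fix i j assume ij: "(i, j) \<in> set u"
  let ?p = "inv_into UNIV v"
  have "(min (?p i) (?p j), max (?p i) (?p j)) \<in> letters n"
    using u f in_set_pull[OF ij] by (force simp: series_act_nz)
  then have "\<not> [?p i = ?p j] (mod int n)" by (auto simp: letters_def min_def max_def cong_sym_eq split: if_splits)
  then have "\<not> [i = j] (mod int n)" using aff_sym_cong[OF aff_sym_inv[OF n v]] by simp
  then show "(i, j) \<in> letters n" using u ij by (auto simp: series_act_nz letters_def)
qed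

lemma inv_apply:
  assumes "v \<in> aff_sym n"
  shows "v (inv_into UNIV v x) = x" "inv_into UNIV v (v x) = x"
  using aff_symD(1)[OF assms] by (simp_all add: bij_is_surj surj_f_inv_f bij_is_inj inv_f_f)

lemma width_fin_act:
  assumes n: "n \<ge> 2" and v: "v \<in> aff_sym n" and f: "width_fin n f"
  shows "width_fin n (series_act v f)"
proof -
  have n0: "n > 0" using n by simp
  let ?p = "inv_into UNIV v"
  have p: "?p \<in> aff_sym n" by (rule aff_sym_inv[OF n0 v])
  let ?L = "int (aff_len n ?p)"
  have "finite {u. series_act v f u \<noteq> 0 \<and> (\<forall>(i, j) \<in> set u. j - i \<le> C)}" for C
  proof (rule finite_subset)
    show "{u. series_act v f u \<noteq> 0 \<and> (\<forall>(i, j) \<in> set u. j - i \<le> C)} \<subseteq>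
        pull_word v ` {u. f u \<noteq> 0 \<and> (\<forall>(i, j) \<in> set u. j - i \<le> \<bar>C\<bar> + 2 * ?L)}" (is "?A \<subseteq> _ ` ?B")
    proof
      fix u assume "u \<in> ?A"
      then have u: "ordered_word u" "f (pull_word ?p u) \<noteq> 0" "\<forall>(i, j) \<in> set u. j - i \<le> C"
        unfolding series_act_nz by auto
      have "b - a \<le> \<bar>C\<bar> + 2 * ?L" if ab: "(a, b) \<in> set (pull_word ?p u)" for a b
      proof -
        obtain i j where ij: "(i, j) \<in> set u" "a = min (?p i) (?p j)" "b = max (?p i) (?p j)"
          using ab by (auto simp: pull_word_def)
        have "j - i \<le> C" "i < j" using u ij by auto
        then show ?thesis using ij(2,3) aff_sym_disp[OF n p, of i] aff_sym_disp[OF n p, of j] by linarith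
      qed
      then have "pull_word ?p u \<in> ?B" using u by auto
      moreover have "u = pull_word v (pull_word ?p u)"
        using u(1) inv_apply[OF v] by (simp add: pull_word_pull)
      ultimately show "u \<in> pull_word v ` ?B" by blast
    qed
    show "finite (pull_word v ` ?B)" using f by (simp add: width_fin_def)
  qed
  moreover have "\<forall>u. series_act v f u \<noteq> 0 \<longrightarrow> set u \<subseteq> letters n"
    using series_act_letters[OF n0 v, of f] f by (auto simp: width_fin_def)
  ultimately show ?thesis by (simp add: width_fin_def)
qed

lemma width_fin_inv_alg: "n \<ge> 2 \<Longrightarrow> width_fin n f \<Longrightarrow> f \<in> inv_alg n"
  by (simp add: inv_alg_def width_fin_fin_act width_fin_act)

lemma series_mult_nz:
  assumes "(f \<odot> g) u \<noteq> 0"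
  obtains a b where "u = a @ b" "f a \<noteq> 0" "g b \<noteq> 0"
proof -
  obtain k where "f (take k u) * g (drop k u) \<noteq> 0"
    using assms unfolding series_mult_def by (meson sum.not_neutral_contains_not_neutral)
  then show ?thesis using that[of "take k u" "drop k u"] by fastforce
qed

lemma compl_alg_mult:
  assumes "f \<in> compl_alg n" "g \<in> compl_alg n"
  shows "f \<odot> g \<in> compl_alg n"
proof -
  have "finite {u \<in> bounded_words N. (f \<odot> g) u \<noteq> 0}" for N
  proof (rule finite_subset)
    show "{u \<in> bounded_words N. (f \<odot> g) u \<noteq> 0} \<subseteq> (\<lambda>(a, b). a @ b) `
        ({u \<in> bounded_words N. f u \<noteq> 0} \<times> {u \<in> bounded_words N. g u \<noteq> 0})"
      by (auto elim!: series_mult_nz simp: bounded_words_def image_iff) blast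
    show "finite ((\<lambda>(a, b). a @ b) `
        ({u \<in> bounded_words N. f u \<noteq> 0} \<times> {u \<in> bounded_words N. g u \<noteq> 0}))"
      using assms by (simp add: compl_alg_def)
  qed
  moreover have "\<forall>u. (f \<odot> g) u \<noteq> 0 \<longrightarrow> set u \<subseteq> letters n"
    using assms unfolding compl_alg_def by (fastforce elim!: series_mult_nz)
  ultimately show ?thesis by (simp add: compl_alg_def)
qed

lemma nil_act_append:
  "nil_act n w (u @ v) = (case nil_act n w u of None \<Rightarrow> None | Some w' \<Rightarrow> nil_act n w' v)"
  by (induction n w u rule: nil_act.induct) (simp_all del: comp_apply)

lemma nil_act_aff_sym:
  assumes n: "n > 0"
  shows "w \<in> aff_sym n \<Longrightarrow> nil_act n w u = Some w' \<Longrightarrow> set u \<subseteq> letters n \<Longrightarrow> w' \<in> aff_sym n"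
proof (induction u arbitrary: w)
  case (Cons b u)
  obtain i j where b: "b = (i, j)" by force
  then have "w \<circ> aff_refl n i j \<in> aff_sym n"
    using Cons.prems by (intro aff_sym_comp[OF n] aff_refl_aff_sym[OF n]) (auto simp: letters_def)
  moreover have "nil_act n (w \<circ> aff_refl n i j) u = Some w'" using Cons.prems b by (simp split: if_splits)
  moreover have "set u \<subseteq> letters n" using Cons.prems by simp
  ultimately show ?case using Cons.IH by blast
qed simp

lemma fin_act_alg_mult:
  assumes n: "n > 0" and f: "f \<in> fin_act_alg n" and g: "g \<in> fin_act_alg n"
  shows "f \<odot> g \<in> fin_act_alg n"
proof -
  have "finite {u. (f \<odot> g) u \<noteq> 0 \<and> nil_act n w u \<noteq> None}" if w: "w \<in> aff_sym n" for w
  proof (rule finite_subset)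
    let ?A = "{u. f u \<noteq> 0 \<and> nil_act n w u \<noteq> None}"
    let ?B = "\<lambda>a. {u. g u \<noteq> 0 \<and> nil_act n (the (nil_act n w a)) u \<noteq> None}"
    show "{u. (f \<odot> g) u \<noteq> 0 \<and> nil_act n w u \<noteq> None} \<subseteq> (\<Union>a\<in>?A. (\<lambda>b. a @ b) ` ?B a)"
      by (auto elim!: series_mult_nz simp: nil_act_append split: option.splits)
    have "finite (?B a)" if "a \<in> ?A" for a
    proof -
      have "the (nil_act n w a) \<in> aff_sym n"
        using that f nil_act_aff_sym[OF n w, of a] by (auto simp: fin_act_alg_def compl_alg_def)
      then show ?thesis using g by (simp add: fin_act_alg_def)
    qed
    then show "finite (\<Union>a\<in>?A. (\<lambda>b. a @ b) ` ?B a)" using f w by (auto simp: fin_act_alg_def)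
  qed
  then show ?thesis using f g by (simp add: fin_act_alg_def compl_alg_mult)
qed

lemma fin_act_alg_add:
  assumes f: "f \<in> fin_act_alg n" and g: "g \<in> fin_act_alg n"
  shows "f + g \<in> fin_act_alg n"
proof -
  have nz: "f u \<noteq> 0 \<or> g u \<noteq> 0" if "(f + g) u \<noteq> 0" for u using that by auto
  have "finite {u. (f + g) u \<noteq> 0 \<and> P u}" if "finite {u. f u \<noteq> 0 \<and> P u}" "finite {u. g u \<noteq> 0 \<and> P u}" for P
    by (rule finite_subset[OF _ finite_UnI[OF that]]) (use nz in blast)
  from this[of "\<lambda>u. u \<in> bounded_words N" for N] this[of "\<lambda>u. nil_act n w u \<noteq> None" for w] show ?thesis
    using f g nz by (simp add: fin_act_alg_def compl_alg_def conj_commute) blast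
qed

lemma fin_act_alg_uminus: "f \<in> fin_act_alg n \<Longrightarrow> - f \<in> fin_act_alg n"
  by (simp add: fin_act_alg_def compl_alg_def)

lemma inv_alg_mult: "n > 0 \<Longrightarrow> f \<in> inv_alg n \<Longrightarrow> g \<in> inv_alg n \<Longrightarrow> f \<odot> g \<in> inv_alg n"
  by (simp add: inv_alg_def fin_act_alg_mult series_act_mult)

lemma inv_alg_add: "f \<in> inv_alg n \<Longrightarrow> g \<in> inv_alg n \<Longrightarrow> f + g \<in> inv_alg n"
  by (simp add: inv_alg_def fin_act_alg_add series_act_add)

lemma inv_alg_uminus: "f \<in> inv_alg n \<Longrightarrow> - f \<in> inv_alg n"
  by (simp add: inv_alg_def fin_act_alg_uminus series_act_uminus)

lemma inv_alg_diff: "f \<in> inv_alg n \<Longrightarrow> g \<in> inv_alg n \<Longrightarrow> f - g \<in> inv_alg n"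
  using inv_alg_add[OF _ inv_alg_uminus, of f n g] by simp

lemma inv_alg_0: "n \<ge> 2 \<Longrightarrow> 0 \<in> inv_alg n"
  by (rule width_fin_inv_alg) (auto simp: width_fin_def)

lemma width_fin_word: "set u \<subseteq> letters n \<Longrightarrow> width_fin n (word u)"
  unfolding width_fin_def
  by (auto simp: word_def split: if_splits intro: finite_subset[of _ "{u}"])

lemma inv_alg_word: "n \<ge> 2 \<Longrightarrow> set u \<subseteq> letters n \<Longrightarrow> word u \<in> inv_alg n"
  by (intro width_fin_inv_alg width_fin_word)

lemma inv_alg_br: "n \<ge> 2 \<Longrightarrow> \<not> [i = j] (mod int n) \<Longrightarrow> br i j \<in> inv_alg n"
  by (cases i j rule: linorder_cases)
     (auto simp: br_def letters_def cong_sym_eq intro!: inv_alg_word inv_alg_uminus)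

lemma inv_alg_act:
  assumes n: "n > 0" and f: "f \<in> inv_alg n" and v: "v \<in> aff_sym n"
  shows "series_act v f \<in> inv_alg n"
  using f aff_sym_comp[OF n _ v] aff_symD(1)[OF v] v
  by (auto simp: inv_alg_def series_act_comp aff_symD(1))

lemma series_mult_assoc: "(f \<odot> g) \<odot> h = f \<odot> (g \<odot> h)"
proof
  fix u :: "(int \<times> int) list"
  let ?N = "length u"
  let ?t = "\<lambda>l k. f (take l u) * g (take (k - l) (drop l u)) * h (drop k u)"
  have "((f \<odot> g) \<odot> h) u = (\<Sum>k\<le>?N. \<Sum>l\<le>k. ?t l k)"
    unfolding series_mult_def
    by (intro sum.cong refl) (auto simp: sum_distrib_right take_take drop_take min_def intro!: sum.cong)
  also have "\<dots> = (\<Sum>(k, l)\<in>(SIGMA k:{..?N}. {..k}). ?t l k)"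
    by (simp add: sum.Sigma)
  also have "\<dots> = (\<Sum>(l, k)\<in>(SIGMA l:{..?N}. {..?N - l}). ?t l (l + k))"
    by (rule sum.reindex_bij_witness[of _ "\<lambda>(l, k). (l + k, l)" "\<lambda>(k, l). (l, k - l)"]) auto
  also have "\<dots> = (\<Sum>l\<le>?N. \<Sum>k\<le>?N - l. ?t l (l + k))"
    by (simp add: sum.Sigma)
  also have "\<dots> = (f \<odot> (g \<odot> h)) u"
    unfolding series_mult_def
    by (intro sum.cong refl) (auto simp: sum_distrib_left mult.assoc add.commute intro!: sum.cong)
  finally show "((f \<odot> g) \<odot> h) u = (f \<odot> (g \<odot> h)) u" .
qed

lemma series_mult_distrib:
  "(f + g) \<odot> h = f \<odot> h + g \<odot> h" "h \<odot> (f + g) = h \<odot> f + h \<odot> g"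
  by (simp_all add: series_mult_def fun_eq_iff sum.distrib algebra_simps)

lemma series_mult_one: "word [] \<odot> f = f" "f \<odot> word [] = f"
proof -
  have "(\<Sum>k\<le>length u. word [] (take k u) * f (drop k u)) = (\<Sum>k\<in>{0}. f (drop k u))" for u
    by (rule sum.mono_neutral_cong_right) (auto simp: word_def)
  then show "word [] \<odot> f = f" by (simp add: series_mult_def fun_eq_iff)
  have "(\<Sum>k\<le>length u. f (take k u) * word [] (drop k u)) = (\<Sum>k\<in>{length u}. f (take k u))" for u
    by (rule sum.mono_neutral_cong_right) (auto simp: word_def)
  then show "f \<odot> word [] = f" by (simp add: series_mult_def fun_eq_iff)
qed

lemma inv_ring_simps [simp]:
  "carrier (inv_ring n) = inv_alg n" "monoid.mult (inv_ring n) = (\<odot>)" "one (inv_ring n) = word []"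
  "zero (inv_ring n) = 0" "add (inv_ring n) = (+)"
  by (simp_all add: inv_ring_def)

lemma inv_ring_ring:
  assumes n: "n \<ge> 2"
  shows "ring (inv_ring n)"
proof (intro ringI abelian_groupI monoidI)
  fix f :: "'a series" assume "f \<in> carrier (inv_ring n)"
  then show "\<exists>g\<in>carrier (inv_ring n). g \<oplus>\<^bsub>inv_ring n\<^esub> f = \<zero>\<^bsub>inv_ring n\<^esub>"
    by (intro bexI[of _ "- f"]) (auto simp: inv_alg_uminus)
qed (use n in \<open>auto simp: inv_alg_add inv_alg_mult inv_alg_0 inv_alg_word series_mult_assoc
       series_mult_distrib series_mult_one add.assoc add.commute\<close>)

lemma series_sum_nz: "series_sum F I u \<noteq> 0 \<Longrightarrow> \<exists>x\<in>I. F x u \<noteq> 0"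
  unfolding series_sum_def by (metis (mono_tags, lifting) mem_Collect_eq sum.not_neutral_contains_not_neutral)

lemma series_act_sum: "series_act v (series_sum F I) = series_sum (\<lambda>x. series_act v (F x)) I"
proof
  fix u
  show "series_act v (series_sum F I) u = series_sum (\<lambda>x. series_act v (F x)) I u"
  proof (cases "ordered_word u")
    case True
    then have "{x \<in> I. series_act v (F x) u \<noteq> 0} = {x \<in> I. F x (pull_word (inv_into UNIV v) u) \<noteq> 0}"
      by (simp add: series_act_nz)
    then show ?thesis using True by (simp add: series_sum_def series_act_def sum_distrib_left)
  next
    case False
    then show ?thesis by (auto simp: series_act_def series_sum_def)
  qed
qed

lemma fin_act_alg_sum:
  assumes X: "\<And>k. X k \<in> fin_act_alg n" 
    and 1: "\<And>N. finite {k. \<exists>u \<in> bounded_words N. X k u \<noteq> 0}"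
    and 2: "\<And>w. w \<in> aff_sym n \<Longrightarrow> finite {k. \<exists>u. X k u \<noteq> 0 \<and> nil_act n w u \<noteq> None}"
  shows "series_sum X UNIV \<in> fin_act_alg n"
proof -
  have *: "finite {u. series_sum X UNIV u \<noteq> 0 \<and> P u}"
    if "finite {k. \<exists>u. X k u \<noteq> 0 \<and> P u}" "\<And>k. finite {u. X k u \<noteq> 0 \<and> P u}" for P
  proof (rule finite_subset)
    show "{u. series_sum X UNIV u \<noteq> 0 \<and> P u} \<subseteq> (\<Union>k\<in>{k. \<exists>u. X k u \<noteq> 0 \<and> P u}. {u. X k u \<noteq> 0 \<and> P u})"
      using series_sum_nz by fastforce
  qed (use that in auto)
  have "finite {u \<in> bounded_words N. series_sum X UNIV u \<noteq> 0}" for N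
    using *[of "\<lambda>u. u \<in> bounded_words N"] 1[of N] X
    by (auto simp: fin_act_alg_def compl_alg_def conj_commute Bex_def)
  moreover have "finite {u. series_sum X UNIV u \<noteq> 0 \<and> nil_act n w u \<noteq> None}" if "w \<in> aff_sym n" for w
    using *[of "\<lambda>u. nil_act n w u \<noteq> None"] 2[OF that] X that
    by (auto simp: fin_act_alg_def)
  moreover have "set u \<subseteq> letters n" if nz: "series_sum X UNIV u \<noteq> 0" for u
  proof -
    obtain k where "X k u \<noteq> 0" using series_sum_nz[OF nz] by blast
    then show ?thesis using X[of k] unfolding fin_act_alg_def compl_alg_def by blast
  qed
  ultimately show ?thesis by (simp add: fin_act_alg_def compl_alg_def)
qed

lemma bounded_pull:
  obtains N' where "\<And>u. u \<in> bounded_words N \<Longrightarrow> pull_word p u \<in> bounded_words N'"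
proof
  fix u assume u: "u \<in> bounded_words N"
  let ?M = "Max ((\<lambda>x. \<bar>p x\<bar>) ` {-N..N})"
  have "\<bar>p x\<bar> \<le> ?M" if "\<bar>x\<bar> < N" for x using that by (intro Max_ge imageI finite_imageI) auto
  then show "pull_word p u \<in> bounded_words (?M + 1)"
    using u by (fastforce simp: bounded_words_def pull_word_def min_def max_def)
qed

lemma fk_summable_act:
  assumes n: "n > 0" and X: "fk_summable n X" and v: "v \<in> aff_sym n"
  shows "fk_summable n (\<lambda>k. series_act v (X k))"
proof -
  have "finite {k. \<exists>u \<in> bounded_words N. series_act v (X k) u \<noteq> 0}" for N
  proof -
    obtain N' where N': "\<And>u. u \<in> bounded_words N \<Longrightarrow> pull_word (inv_into UNIV v) u \<in> bounded_words N'"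
      using bounded_pull by blast
    show ?thesis
      by (rule finite_subset[of _ "{k. \<exists>u \<in> bounded_words N'. X k u \<noteq> 0}"])
         (use X N' in \<open>auto simp: fk_summable_def series_act_nz\<close>)
  qed
  then show ?thesis
    using X v inv_alg_act[OF n, of "X k" v for k] aff_sym_comp[OF n _ v]
    by (simp add: fk_summable_def series_act_comp aff_symD(1))
qed

lemma inv_alg_series_act_id: "f \<in> inv_alg n \<Longrightarrow> series_act id f = f"
  by (rule series_act_id, rule ordered_letters[of _ n])
     (auto simp: inv_alg_def fin_act_alg_def compl_alg_def)

lemma inv_alg_sum:
  assumes n: "n > 0" and X: "fk_summable n X"
  shows "series_sum X UNIV \<in> inv_alg n"
proof -
  have *: "series_sum Y UNIV \<in> fin_act_alg n" if Y: "fk_summable n Y" for Y :: "nat \<Rightarrow> 'a series"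
  proof (rule fin_act_alg_sum)
    show "finite {k. \<exists>u. Y k u \<noteq> 0 \<and> nil_act n w u \<noteq> None}" if "w \<in> aff_sym n" for w
    proof -
      have "finite {k. \<exists>u. series_act id (Y k) u \<noteq> 0 \<and> nil_act n w u \<noteq> None}"
        using Y that aff_sym_id[of n] unfolding fk_summable_def by blast
      moreover have "series_act id (Y k) = Y k" for k
        using Y inv_alg_series_act_id unfolding fk_summable_def by blast
      ultimately show ?thesis by simp
    qed
  qed (use Y in \<open>auto simp: fk_summable_def inv_alg_def\<close>)
  show ?thesis using *[OF X] *[OF fk_summable_act[OF n X]] by (simp add: inv_alg_def series_act_sum)
qed

lemma fk_closed_inv_alg: "n > 0 \<Longrightarrow> fk_closed n (inv_alg n)"
  by (simp add: fk_closed_def inv_alg_sum)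

lemma br_nz: "br i j u \<noteq> 0 \<Longrightarrow> u = [(min i j, max i j)]"
  by (auto simp: br_def word_def split: if_splits)

lemma width_fin_sum_d:
  assumes ij: "\<not> [i = j] (mod int n)"
  shows "width_fin n (series_sum (\<lambda>(i', j'). br i j' \<odot> br j i')
         {(i', j'). [i' = i] (mod int n) \<and> [j' = j] (mod int n)})" (is "width_fin n (series_sum ?F ?I)")
proof -
  have *: "\<exists>i' j'. [i' = i] (mod int n) \<and> [j' = j] (mod int n) \<and> u = [(min i j', max i j'), (min j i', max j i')]"
    if "series_sum ?F ?I u \<noteq> 0" for u
    using series_sum_nz[OF that] by (fastforce elim!: series_mult_nz dest!: br_nz)
  have ne: "\<not> [i = j'] (mod int n)" "\<not> [j = i'] (mod int n)" if "[i' = i] (mod int n)" "[j' = j] (mod int n)" for i' j'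
    using ij that by (auto simp: cong_def)
  have "set u \<subseteq> letters n" if nz: "series_sum ?F ?I u \<noteq> 0" for u
  proof -
    obtain i' j' where "[i' = i] (mod int n)" "[j' = j] (mod int n)" and u: "u = [(min i j', max i j'), (min j i', max j i')]"
      using *[OF nz] by blast
    with ne[of i' j'] have "\<not> [i = j'] (mod int n)" "\<not> [j = i'] (mod int n)" by blast+
    moreover from this have "i \<noteq> j'" "j \<noteq> i'" by (auto simp: cong_def)
    ultimately show ?thesis unfolding u by (auto simp: letters_def min_def max_def cong_sym_eq)
  qed
  moreover have "finite {u. series_sum ?F ?I u \<noteq> 0 \<and> (\<forall>(i, j) \<in> set u. j - i \<le> C)}" for C
  proof (rule finite_subset)
    show "{u. series_sum ?F ?I u \<noteq> 0 \<and> (\<forall>(i, j) \<in> set u. j - i \<le> C)} \<subseteq>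
      (\<lambda>(i', j'). [(min i j', max i j'), (min j i', max j i')]) ` ({j - \<bar>C\<bar>..j + \<bar>C\<bar>} \<times> {i - \<bar>C\<bar>..i + \<bar>C\<bar>})"
    proof
      fix u assume "u \<in> {u. series_sum ?F ?I u \<noteq> 0 \<and> (\<forall>(i, j) \<in> set u. j - i \<le> C)}"
      then obtain i' j' where u: "u = [(min i j', max i j'), (min j i', max j i')]"
        and "max i j' - min i j' \<le> C" "max j i' - min j i' \<le> C" using * by force
      then have "(i', j') \<in> {j - \<bar>C\<bar>..j + \<bar>C\<bar>} \<times> {i - \<bar>C\<bar>..i + \<bar>C\<bar>}" by auto
      then show "u \<in> (\<lambda>(i', j'). [(min i j', max i j'), (min j i', max j i')]) ` ({j - \<bar>C\<bar>..j + \<bar>C\<bar>} \<times> {i - \<bar>C\<bar>..i + \<bar>C\<bar>})"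
        unfolding u by (intro image_eqI[of _ _ "(i', j')"]) simp_all
    qed
  qed auto
  ultimately show ?thesis by (simp add: width_fin_def)
qed

lemma fk_rels_inv_alg:
  assumes n: "n \<ge> 2" and "(f, g) \<in> fk_rels n"
  shows "f \<in> inv_alg n" "g \<in> inv_alg n"
proof -
  have "f \<in> inv_alg n \<and> g \<in> inv_alg n"
    using assms(2)
  proof (induction rule: fk_rels.induct)
    case (d i j)
    then show ?case using width_fin_inv_alg[OF n width_fin_sum_d] inv_alg_0[OF n] by blast
  qed (use n in \<open>(intro conjI inv_alg_mult inv_alg_add inv_alg_br inv_alg_0; simp add: cong_def eq_commute)+\<close>)
  then show "f \<in> inv_alg n" "g \<in> inv_alg n" by auto
qed

lemma fk_ideal_props:
  fixes n :: nat
  assumes n: "n \<ge> 2"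
  defines "J \<equiv> fk_ideal n :: 'k::comm_ring_1 series set"
  shows "ideal J (inv_ring n)" "fk_closed n J" "\<And>f g. (f, g) \<in> fk_rels n \<Longrightarrow> f - g \<in> J" "J \<subseteq> inv_alg n"
proof -
  let ?S = "{I. ideal I (inv_ring n) \<and> fk_closed n I \<and> (\<forall>(f, g) \<in> fk_rels n. f - g \<in> I)} :: 'k series set set"
  have r: "ring (inv_ring n :: 'k series ring)" by (rule inv_ring_ring[OF n])
  have S: "inv_alg n \<in> ?S"
    using ring.oneideal[OF r] fk_closed_inv_alg[of n] n
    by (auto intro: inv_alg_diff dest: fk_rels_inv_alg[OF n])
  show "ideal J (inv_ring n)"
    unfolding J_def fk_ideal_def by (rule ring.i_Intersect[OF r]) (use S in auto)
  show "fk_closed n J" unfolding J_def fk_ideal_def fk_closed_def by blast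
  show "\<And>f g. (f, g) \<in> fk_rels n \<Longrightarrow> f - g \<in> J" unfolding J_def fk_ideal_def by blast
  show "J \<subseteq> inv_alg n" using S unfolding J_def fk_ideal_def by blast
qed

lemma series_act_br:
  assumes w: "w \<in> aff_sym n" and ij: "i \<noteq> j"
  shows "series_act w (br i j) = (br (w i) (w j) :: 'k::comm_ring_1 series)"
proof
  fix u
  let ?p = "inv_into UNIV w"
  have ne: "w i \<noteq> w j" using ij inv_apply[OF w] by metis
  let ?b = "br i j :: 'k series" and ?c = "br (w i) (w j) :: 'k series"
  show "series_act w ?b u = ?c u"
  proof (cases "\<exists>k l. u = [(k, l)] \<and> k < l")
    case False
    then have "?c u = 0" using ne br_nz[of "w i" "w j" u, where 'a = 'k] by (force simp: min_def max_def)
    moreover have "series_act w ?b u = 0"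
    proof (rule ccontr)
      assume "series_act w ?b u \<noteq> 0"
      then have u: "ordered_word u" "pull_word ?p u = [(min i j, max i j)]"
        by (auto simp: series_act_nz dest: br_nz)
      then have "length u = 1" by (metis One_nat_def length_Cons list.size(3) pull_word_simps(4))
      then obtain b where "u = [b]" by (metis One_nat_def length_0_conv length_Suc_conv)
      then show False using u(1) False by (cases b) auto
    qed
    ultimately show ?thesis by simp
  next
    case True
    then obtain k l where u: "u = [(k, l)]" "k < l" by blast
    define a b where "a = ?p k" and "b = ?p l"
    have kl: "k = w a" "l = w b" by (simp_all add: a_def b_def inv_apply[OF w])
    have eq: "w x = w y \<longleftrightarrow> x = y" for x y using aff_symD(1)[OF w] by (simp add: bij_is_inj inj_eq)
    have p: "?p (w x) = x" for x by (rule inv_apply[OF w])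
    have ab: "a \<noteq> b" using u(2) kl by auto
    have less: "i < j \<or> j < i" "w i < w j \<or> w j < w i" using ij ne by auto
    have "series_act w ?b u = (if a < b then ?b [(a, b)] else - ?b [(b, a)])"
      using u ab by (auto simp: series_act_def min_def max_def kl p)
    also have "\<dots> = (if a = i \<and> b = j then 1 else if a = j \<and> b = i then - 1 else 0)"
      using less(1) ab by (auto simp: br_def word_def)
    also have "\<dots> = (if k = w i \<and> l = w j then 1 else if k = w j \<and> l = w i then - 1 else 0)"
      unfolding kl eq ..
    also have "\<dots> = ?c u" using u less(2) by (auto simp: br_def word_def)
    finally show ?thesis .
  qed
qed

lemma series_sum_reindex:
  assumes "bij_betw h I' I"
  shows "series_sum F I = series_sum (\<lambda>x. F (h x)) I'"
proof
  fix u
  have "bij_betw h {x \<in> I'. F (h x) u \<noteq> 0} {x \<in> I. F x u \<noteq> 0}"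
    using assms by (auto simp: bij_betw_def inj_on_def image_iff) 
  then show "series_sum F I u = series_sum (\<lambda>x. F (h x)) I' u"
    unfolding series_sum_def by (rule sum.reindex_bij_betw[symmetric])
qed

lemma series_sum_cong: "(\<And>x. x \<in> I \<Longrightarrow> F x = G x) \<Longrightarrow> series_sum F I = series_sum G I"
  unfolding series_sum_def by (rule ext, rule sum.cong) auto

lemma aff_sym_distinct:
  assumes w: "w \<in> aff_sym n"
  shows "w x mod int n = w y mod int n \<longleftrightarrow> x mod int n = y mod int n"
  using aff_sym_cong[OF w, of x y] by (simp add: cong_def)

lemma fk_rels_act:
  assumes w: "w \<in> aff_sym n" and "(f, g) \<in> fk_rels n"
  shows "(series_act w f, series_act w g) \<in> fk_rels n"
  using assms(2)
proof (induction rule: fk_rels.induct)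
  case (a i j)
  then have "i \<noteq> j" by auto
  with a show ?case
    by (simp only: series_act_mult series_act_br[OF w] series_act_0 fk_rels.a aff_sym_cong[OF w] not_False_eq_True)
next
  case (b i j k l)
  then have "i \<noteq> j" "k \<noteq> l" by auto
  with b show ?case
    by (simp only: simp_thms series_act_mult series_act_br[OF w])
       (rule fk_rels.b, simp add: aff_sym_distinct[OF w])
next
  case (c1 i j k)
  then have "i \<noteq> j" "j \<noteq> k" "i \<noteq> k" by auto
  with c1 show ?case
    by (simp only: simp_thms series_act_mult series_act_add series_act_br[OF w])
       (rule fk_rels.c1, simp add: aff_sym_distinct[OF w])
next
  case (c2 i j k)
  then have "i \<noteq> j" "j \<noteq> k" "i \<noteq> k" by auto
  with c2 show ?case
    by (simp only: simp_thms series_act_mult series_act_add series_act_br[OF w])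
       (rule fk_rels.c2, simp add: aff_sym_distinct[OF w])
next
  case (d i j)
  let ?I = "\<lambda>i j. {(i', j'). [i' = i] (mod int n) \<and> [j' = j] (mod int n)}"
  have "series_act w (series_sum (\<lambda>(i', j'). br i j' \<odot> br j i') (?I i j)) =
    series_sum (\<lambda>x. case x of (i', j') \<Rightarrow> br (w i) (w j') \<odot> br (w j) (w i')) (?I i j)"
    unfolding series_act_sum
  proof (rule series_sum_cong, clarify)
    fix i' j' assume "[i' = i] (mod int n)" "[j' = j] (mod int n)"
    with d have "i \<noteq> j'" "j \<noteq> i'" by (auto simp: cong_def)
    then show "series_act w (br i j' \<odot> br j i') = br (w i) (w j') \<odot> br (w j) (w i')"
      by (simp only: simp_thms series_act_mult series_act_br[OF w])
  qed
  also have "\<dots> = series_sum (\<lambda>x. (\<lambda>(i', j'). br (w i) j' \<odot> br (w j) i') (map_prod w w x)) (?I i j)"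
    by (intro arg_cong2[of _ _ _ _ series_sum] refl) (auto simp: fun_eq_iff)
  also have "\<dots> = series_sum (\<lambda>(i', j'). br (w i) j' \<odot> br (w j) i') (?I (w i) (w j))"
  proof (rule series_sum_reindex[symmetric], rule bij_betw_imageI)
    show "inj_on (map_prod w w) (?I i j)" 
      using aff_symD(1)[OF w] by (auto simp: inj_on_def bij_def)
    show "map_prod w w ` ?I i j = ?I (w i) (w j)"
    proof (intro equalityI subsetI)
      fix x assume "x \<in> ?I (w i) (w j)"
      then obtain i' j' where x: "x = (i', j')" "[i' = w i] (mod int n)" "[j' = w j] (mod int n)" by auto
      let ?p = "inv_into UNIV w"
      have "(?p i', ?p j') \<in> ?I i j"
        using x aff_sym_cong[OF w, of "?p i'" i] aff_sym_cong[OF w, of "?p j'" j] by (simp add: inv_apply[OF w])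
      moreover have "x = map_prod w w (?p i', ?p j')" using x by (simp add: inv_apply[OF w])
      ultimately show "x \<in> map_prod w w ` ?I i j" by blast
    qed (auto simp: aff_sym_cong[OF w])
  qed
  finally have e: "series_act w (series_sum (\<lambda>(i', j'). br i j' \<odot> br j i') (?I i j)) =
    series_sum (\<lambda>(i', j'). br (w i) j' \<odot> br (w j) i') (?I (w i) (w j))" .
  show ?case unfolding e series_act_0 by (rule fk_rels.d) (use d in \<open>simp add: aff_sym_cong[OF w]\<close>)
next
  case (e i j)
  then have "i \<noteq> j" by auto
  moreover have "w (i + int n) = w i + int n" "w (j + int n) = w j + int n" using aff_symD(2)[OF w] by auto
  ultimately show ?case using e
    by (simp add: series_act_br[OF w] aff_sym_cong[OF w] fk_rels.e)
qed

lemma fk_ideal_act: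
  fixes f :: "'k::comm_ring_1 series"
  assumes n: "n \<ge> 2" and w: "w \<in> aff_sym n" and f: "f \<in> fk_ideal n"
  shows "series_act w f \<in> fk_ideal n"
proof -
  let ?J = "fk_ideal n :: 'k series set"
  let ?K = "{f \<in> inv_alg n. series_act w f \<in> ?J}"
  note J = fk_ideal_props[OF n, where 'k = 'k]
  interpret J: ideal ?J "inv_ring n" by (rule J)
  have n0: "n > 0" using n by simp
  have act: "series_act w x \<in> inv_alg n" if "x \<in> inv_alg n" for x :: "'k series"
    by (rule inv_alg_act[OF n0 that w])
  have Jadd: "x + y \<in> ?J" if "x \<in> ?J" "y \<in> ?J" for x y using additive_subgroup.a_closed[OF J.additive_subgroup_axioms that] by simp
  have J0: "0 \<in> ?J" using additive_subgroup.zero_closed[OF J.additive_subgroup_axioms] by simp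
  have Jl: "x \<odot> y \<in> ?J" if "y \<in> ?J" "x \<in> inv_alg n" for x y using J.I_l_closed[of y x] that by simp
  have Jr: "y \<odot> x \<in> ?J" if "y \<in> ?J" "x \<in> inv_alg n" for x y using J.I_r_closed[of y x] that by simp
  have Jm: "- x \<in> ?J" if "x \<in> ?J" for x
  proof -
    have "- word [] \<in> inv_alg n" using inv_alg_uminus inv_alg_word[OF n, of "[]"] by simp
    from Jl[OF that this] have "- word [] \<odot> x \<in> ?J" .
    moreover have "- word [] \<odot> x = - (word [] \<odot> x)" by (simp add: series_mult_def fun_eq_iff sum_negf)
    ultimately show ?thesis by (simp only: series_mult_one)
  qed
  have "ideal ?K (inv_ring n)"
  proof (rule idealI)
    show "subgroup ?K (add_monoid (inv_ring n))"
    proof (rule group.subgroupI)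
      show "group (add_monoid (inv_ring n :: 'k series ring))"
        by (rule abelian_group.a_group[OF ring.is_abelian_group[OF ideal.axioms(2)[OF J(1)]]])
      show "?K \<noteq> {}" using inv_alg_0[OF n] J0 by (metis (mono_tags, lifting) empty_iff mem_Collect_eq series_act_0)
      fix x assume x: "x \<in> ?K"
      have "inv\<^bsub>add_monoid (inv_ring n)\<^esub> x = \<ominus>\<^bsub>inv_ring n\<^esub> x" by (simp add: a_inv_def)
      also have "\<dots> = - x" using x J.minus_equality[of "- x" x] by (simp add: inv_alg_uminus)
      finally show "inv\<^bsub>add_monoid (inv_ring n)\<^esub> x \<in> ?K"
        using x Jm by (auto simp: inv_alg_uminus series_act_uminus)
    qed (auto simp: inv_alg_add series_act_add Jadd simp del: plus_fun_def)
  qed (use ideal.axioms(2)[OF J(1)] n0 in \<open>auto simp: inv_alg_mult series_act_mult act Jl Jr\<close>)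
  moreover have "fk_closed n ?K"
    unfolding fk_closed_def
  proof (intro allI impI, elim conjE)
    fix X assume X: "fk_summable n X" "range X \<subseteq> ?K"
    have "range (\<lambda>k. series_act w (X k)) \<subseteq> ?J" using X(2) by auto
    then have "series_sum (\<lambda>k. series_act w (X k)) UNIV \<in> ?J"
      using J(2) fk_summable_act[OF n0 X(1) w] unfolding fk_closed_def by blast
    then show "series_sum X UNIV \<in> ?K" by (simp add: series_act_sum inv_alg_sum[OF n0 X(1)])
  qed
  moreover have "\<forall>(f, g) \<in> fk_rels n. f - g \<in> ?K"
    using inv_alg_diff[OF fk_rels_inv_alg[OF n]] J(3)[OF fk_rels_act[OF w]]
    by (auto simp: series_act_diff)
  ultimately have "?J \<subseteq> ?K" unfolding fk_ideal_def by blast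
  with f show ?thesis by blast
qed

lemma fk_class_altdef: "fk_class n f = {g + f | g. g \<in> fk_ideal n}"
  by (auto simp: fk_class_def a_r_coset_def' )

lemma fk_act_class:
  assumes n: "n \<ge> 2" and w: "w \<in> aff_sym n"
  shows "fk_act w (fk_class n f) = fk_class n (series_act w f)"
proof -
  let ?p = "inv_into UNIV w"
  have p: "?p \<in> aff_sym n" using aff_sym_inv[OF _ w] n by simp
  show ?thesis
  proof (intro equalityI subsetI)
    fix x assume "x \<in> fk_act w (fk_class n f)"
    then show "x \<in> fk_class n (series_act w f)"
      using fk_ideal_act[OF n w] by (auto simp: fk_act_def fk_class_altdef series_act_add simp del: plus_fun_def)
  next
    fix x assume "x \<in> fk_class n (series_act w f)"
    then obtain g where g: "g \<in> fk_ideal n" "x = g + series_act w f" by (auto simp: fk_class_altdef)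
    have "w \<circ> ?p = id" using inv_apply[OF w] by auto
    then have "series_act w (series_act ?p g) = g"
      using g(1) fk_ideal_props(4)[OF n, where 'k = 'a] series_act_comp[OF aff_symD(1)[OF w] aff_symD(1)[OF p], of g]
        inv_alg_series_act_id[of g n] by auto
    then have "x = series_act w (series_act ?p g + f)" using g(2) by (simp add: series_act_add del: plus_fun_def)
    moreover have "series_act ?p g \<in> fk_ideal n" by (rule fk_ideal_act[OF n p g(1)])
    ultimately show "x \<in> fk_act w (fk_class n f)" unfolding fk_act_def fk_class_altdef by blast
  qed
qed

lemma width_fin_theta: "width_fin n (theta_series n i :: 'k::comm_ring_1 series)"
proof -
  let ?t = "theta_series n i :: 'k series"
  let ?I = "{j. \<not> [j = i] (mod int n)}"
  have *: "\<exists>j. \<not> [j = i] (mod int n) \<and> u = [(min i j, max i j)]" if "?t u \<noteq> 0" for u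
    using series_sum_nz[of "br i :: int \<Rightarrow> 'k series" ?I u] that br_nz[of i _ u, where 'a = 'k] by (auto simp: theta_series_def)
  have "set u \<subseteq> letters n" if nz: "?t u \<noteq> 0" for u
  proof -
    obtain j where j: "\<not> [j = i] (mod int n)" "u = [(min i j, max i j)]" using *[OF nz] by blast
    moreover from j have "i \<noteq> j" by auto
    ultimately show ?thesis by (auto simp: letters_def min_def max_def cong_sym_eq)
  qed
  moreover have "finite {u. ?t u \<noteq> 0 \<and> (\<forall>(i, j) \<in> set u. j - i \<le> C)}" for C
    by (rule finite_subset[of _ "(\<lambda>j. [(min i j, max i j)]) ` {i - \<bar>C\<bar>..i + \<bar>C\<bar>}"]) (use * in force)+
  ultimately show ?thesis by (simp add: width_fin_def)
qed

lemma width_fin_mn: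
  assumes M: "mn_reps n a m M"
  shows "width_fin n (mn_series n M m a :: 'k::comm_ring_1 series)"
proof -
  let ?t = "mn_series n M m a :: 'k series"
  have *: "conn_tree n a (set u) \<and> length u = m" if nz: "?t u \<noteq> 0" for u
  proof -
    obtain D L where D: "conn_tree n a D" "card D = m" "L \<in> M D" and "L = u"
      using series_sum_nz[OF nz[unfolded mn_series_def]] by (auto simp: word_def split: if_splits)
    moreover from this have "L \<in> labelings D" using M unfolding mn_reps_def by blast
    ultimately show ?thesis by (auto simp: labelings_def distinct_card)
  qed
  have "set u \<subseteq> letters n" if nz: "?t u \<noteq> 0" for u
  proof (rule subsetI, clarify)
    fix i j assume ij: "(i, j) \<in> set u"
    have t: "conn_tree n a (set u)" using *[OF nz] by blast
    then have "i < j" using ij by (force simp: conn_tree_def)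
    moreover have "i \<in> verts (set u)" "j \<in> verts (set u)" using ij by (force simp: verts_def)+
    moreover have "inj_on (\<lambda>x. x mod int n) (verts (set u))" using t by (simp add: conn_tree_def)
    ultimately show "(i, j) \<in> letters n" by (auto simp: letters_def cong_def inj_on_def)
  qed
  moreover have "finite {u. ?t u \<noteq> 0 \<and> (\<forall>(i, j) \<in> set u. j - i \<le> C)}" for C
  proof (rule finite_subset)
    show "{u. ?t u \<noteq> 0 \<and> (\<forall>(i, j) \<in> set u. j - i \<le> C)} \<subseteq>
      {u. set u \<subseteq> {a - \<bar>C\<bar>..a} \<times> {a..a + \<bar>C\<bar>} \<and> length u = m}"
      using * unfolding conn_tree_def by fastforce
  qed (auto intro: finite_lists_length_eq)
  ultimately show ?thesis by (simp add: width_fin_def)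
qed

lemma FK_ring: "n \<ge> 2 \<Longrightarrow> ring (FK n)"
  unfolding FK_def by (intro ideal.quotient_is_ring fk_ideal_props)

lemma mn_elem_carrier: "n \<ge> 2 \<Longrightarrow> mn_reps n a m M \<Longrightarrow> mn_elem n M m a \<in> carrier (FK n)"
  unfolding FK_def FactRing_def A_RCOSETS_def' mn_elem_def fk_class_def
  using width_fin_inv_alg[OF _ width_fin_mn] by simp blast

lemma theta_carrier: "n \<ge> 2 \<Longrightarrow> theta n i \<in> carrier (FK n)"
  unfolding FK_def FactRing_def A_RCOSETS_def' theta_def fk_class_def
  using width_fin_inv_alg[OF _ width_fin_theta] by simp blast

lemma FK_carrier: "carrier (FK n) = fk_class n ` inv_alg n"
  by (auto simp: FK_def FactRing_def A_RCOSETS_def' fk_class_def)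

lemma fk_class_hom:
  fixes f g :: "'k::comm_ring_1 series"
  assumes n: "n \<ge> 2" and "f \<in> inv_alg n" "g \<in> inv_alg n"
  shows "fk_class n f \<otimes>\<^bsub>FK n\<^esub> fk_class n g = fk_class n (f \<odot> g)"
    and "fk_class n f \<oplus>\<^bsub>FK n\<^esub> fk_class n g = fk_class n (f + g)"
    and "\<one>\<^bsub>FK n\<^esub> = fk_class n (word [] :: 'k series)"
proof -
  interpret J: ideal "fk_ideal n :: 'k series set" "inv_ring n" by (rule fk_ideal_props[OF n])
  show "fk_class n f \<otimes>\<^bsub>FK n\<^esub> fk_class n g = fk_class n (f \<odot> g)"
    using J.rcoset_mult_add[of f g] assms by (simp add: FK_def FactRing_def fk_class_def)
  show "fk_class n f \<oplus>\<^bsub>FK n\<^esub> fk_class n g = fk_class n (f + g)"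
    using J.a_rcos_sum[of f g] assms by (simp add: FK_def FactRing_def fk_class_def del: plus_fun_def)
  show "\<one>\<^bsub>FK n\<^esub> = fk_class n (word [] :: 'k series)"
    by (simp add: FK_def FactRing_def fk_class_def)
qed

lemma fk_act_iso:
  assumes n: "n \<ge> 2" and w: "w \<in> aff_sym n"
  shows "fk_act w \<in> ring_iso (FK n) (FK n :: 'k::comm_ring_1 series set ring)"
proof -
  have n0: "n > 0" using n by simp
  let ?R = "FK n :: 'k series set ring" and ?p = "inv_into UNIV w"
  have p: "?p \<in> aff_sym n" by (rule aff_sym_inv[OF n0 w])
  have act: "series_act v f \<in> inv_alg n" if "v \<in> aff_sym n" "f \<in> inv_alg n" for v and f :: "'k series"
    using inv_alg_act[OF n0] that by blast
  have inv: "series_act w (series_act ?p f) = f" "series_act ?p (series_act w f) = f"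
    if "f \<in> inv_alg n" for f :: "'k series"
  proof -
    have "w \<circ> ?p = id" "?p \<circ> w = id" using inv_apply[OF w] by auto
    then show "series_act w (series_act ?p f) = f" "series_act ?p (series_act w f) = f"
      using inv_alg_series_act_id[OF that] by (simp_all add: series_act_comp aff_symD(1)[OF w] aff_symD(1)[OF p])
  qed
  have "fk_act w \<in> ring_hom ?R ?R"
    by (rule ring_hom_memI)
       (auto simp: FK_carrier fk_class_hom[OF n] fk_act_class[OF n w] act[OF w] inv_alg_mult[OF n0] inv_alg_add
         inv_alg_word[OF n] series_act_mult series_act_add series_act_one
         fk_class_hom(3)[OF n inv_alg_0[OF n] inv_alg_0[OF n]] simp del: plus_fun_def)
  moreover have "bij_betw (fk_act w) (carrier ?R) (carrier ?R)"
    by (rule bij_betw_byWitness[of _ "fk_act ?p"])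
       (auto simp: FK_carrier fk_act_class[OF n w] fk_act_class[OF n p] inv act[OF w] act[OF p])
  ultimately show ?thesis by (simp add: ring_iso_def)
qed

end

theory Submission
  imports Defs "HOL-Combinatorics.Multiset_Permutations" "HOL-Library.Countable_Set"
begin

text \<open>
  Read the boxes of a connected tree as the edges of a bipartite plane tree, whose rows are the
  vertices \<open>\<le> a\<close> and whose columns are the vertices \<open>> a\<close>. Up to commutation, the
  Murnaghan-Nakayama labelings are the words that traverse such plane trees in depth-first order,
  each class once, so modulo the relations \<open>p_m(a)\<close> is the signed series \<open>T_a\<close> of all these words.
  A generator \<open>s_i\<close> with \<open>i \<noteq> a\<close> (mod \<open>n\<close>) preserves \<open>{x. x \<le> a}\<close> and hence fixes \<open>T_a\<close>.

  The case \<open>i = a\<close> follows from \<open>T_a = T_(a-1) + \<theta>_a^m\<close>, as \<open>s_a\<close> fixes \<open>T_(a-1)\<close> and maps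
  \<open>\<theta>_a\<close> to \<open>\<theta>_(a+1)\<close>. For a fixed vertex set the signed words of plane trees add up to the sum
  of the stars \<open>[r j_1] ... [r j_m]\<close> over all rows \<open>r\<close>; to see this, one solves the recursion for
  the generating functions of plane trees in the ring of square-free series, where the sum over
  all orders of a path \<open>[x_1 x_2][x_2 x_3] ...\<close> vanishes. So \<open>T_a - T_(a-1)\<close> consists of the stars
  with center \<open>a\<close>. These are the terms of \<open>\<theta>_a^m\<close> without repeated residues. The other terms cancel:
  if \<open>t_r\<close> is the part of \<open>\<theta>_a\<close> with residue \<open>r\<close>, then \<open>t_r^2 = 0\<close> by relation \<open>d\<close>, and
  \<open>t_p t_q = b t_p - t_q b\<close> where \<open>b\<close> commutes with all other \<open>t_r\<close>.
\<close>

section \<open>Square-free series\<close>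

text \<open>Cutting a tree at an edge divides its vertices into two disjoint sets, so the tree
  identity involves all subsets of the vertex set at once. Central variables of square zero do this
  bookkeeping. The recursion for trees with root row \<open>a\<close> has the form
  \<open>X a = tv a + (\<Sum>j. Q j * [a j] * X a)\<close>. Multiplication by the Dunkl element of
  \<open>a\<close> and comparison of fixed points give
  \<open>X a = star a - (\<Sum>i. [a i] * X i) * star a\<close>, from which the columns have
  disappeared; iteration leads to paths through the rows, whose sums vanish because they are
  commutators with a central element. The other obstacle is infinity. The ideal is closed under
  admissible families only, so an identity of infinite series has to be cut into finite identities
  (by word, by vertex set, by pair of summation indices) that form such a family. Bounds on the
  widths \<open>j - i\<close> of the letters guarantee this. Finally, the finite identities belong
  to locales over the class \<open>ring_1\<close>, while the algebra is a record that depends on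
  \<open>n\<close>; the ring type \<open>fk_alg\<close> mediates between the two.\<close>

typedef (overloaded) ('v, 'r::ring_1) sqf = "{f :: 'v set \<Rightarrow> 'r. \<forall>S. infinite S \<longrightarrow> f S = 0}"
  morphisms coef Sqf
  by (rule exI[of _ "\<lambda>_. 0"]) simp

setup_lifting type_definition_sqf

lemma coef_infinite: "infinite S \<Longrightarrow> coef f S = 0"
  using coef[of f] by simp

lemma sqf_eqI: "(\<And>S. finite S \<Longrightarrow> coef f S = coef g S) \<Longrightarrow> f = g"
  by (rule coef_inject[THEN iffD1], rule ext) (metis coef_infinite)

instantiation sqf :: (type, ring_1) ring_1
begin

lift_definition zero_sqf :: "('a, 'b) sqf" is "\<lambda>_. 0" by simp
lift_definition one_sqf :: "('a, 'b) sqf" is "\<lambda>S. if S = {} then 1 else 0" by auto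
lift_definition plus_sqf :: "('a, 'b) sqf \<Rightarrow> ('a, 'b) sqf \<Rightarrow> ('a, 'b) sqf" is "\<lambda>f g S. f S + g S" by simp
lift_definition minus_sqf :: "('a, 'b) sqf \<Rightarrow> ('a, 'b) sqf \<Rightarrow> ('a, 'b) sqf" is "\<lambda>f g S. f S - g S" by simp
lift_definition uminus_sqf :: "('a, 'b) sqf \<Rightarrow> ('a, 'b) sqf" is "\<lambda>f S. - f S" by simp
text \<open>For infinite \<open>S\<close> the sum ranges over an infinite power set and is 0 by
  convention, so the product stays in the type.\<close>

lift_definition times_sqf :: "('a, 'b) sqf \<Rightarrow> ('a, 'b) sqf \<Rightarrow> ('a, 'b) sqf"
  is "\<lambda>f g S. \<Sum>T\<in>Pow S. f T * g (S - T)" by simp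

instance
proof
  fix f g h :: "('a, 'b) sqf"
  show "f * g * h = f * (g * h)"
  proof (rule sqf_eqI)
    fix S :: "'a set" assume S: "finite S"
    have "coef (f * g * h) S = (\<Sum>T\<in>Pow S. \<Sum>U\<in>Pow T. coef f U * coef g (T - U) * coef h (S - T))"
      by (simp add: times_sqf.rep_eq sum_distrib_right)
    also have "\<dots> = (\<Sum>(T, U)\<in>(SIGMA T:Pow S. Pow T). coef f U * coef g (T - U) * coef h (S - T))"
      using S by (intro sum.Sigma) (auto intro: finite_subset)
    also have "\<dots> = (\<Sum>(U, W)\<in>(SIGMA U:Pow S. Pow (S - U)). coef f U * coef g W * coef h (S - U - W))"
      by (rule sum.reindex_bij_witness[of _ "\<lambda>(U, W). (U \<union> W, U)" "\<lambda>(T, U). (U, T - U)"])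
        (auto simp: Diff_Diff_Int Int_absorb1 intro!: arg_cong2[of _ _ _ _ times] arg_cong[of _ _ "coef _"])
    also have "\<dots> = (\<Sum>U\<in>Pow S. \<Sum>W\<in>Pow (S - U). coef f U * coef g W * coef h (S - U - W))"
      using S by (intro sum.Sigma[symmetric]) auto
    also have "\<dots> = coef (f * (g * h)) S"
      by (simp add: times_sqf.rep_eq sum_distrib_left mult.assoc)
    finally show "coef (f * g * h) S = coef (f * (g * h)) S" .
  qed
  show "(f + g) * h = f * h + g * h" "f * (g + h) = f * g + f * h"
    by (transfer; simp add: sum.distrib algebra_simps fun_eq_iff)+
  show "1 * f = f"
  proof (rule sqf_eqI)
    fix S :: "'a set" assume S: "finite S"
    have "coef (1 * f) S = (\<Sum>T\<in>{{}}. coef f (S - T))"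
      unfolding times_sqf.rep_eq by (rule sum.mono_neutral_cong_right) (use S in \<open>auto simp: one_sqf.rep_eq\<close>)
    then show "coef (1 * f) S = coef f S" by simp
  qed
  show "f * 1 = f"
  proof (rule sqf_eqI)
    fix S :: "'a set" assume S: "finite S"
    have "coef (f * 1) S = (\<Sum>T\<in>{S}. coef f T)"
      unfolding times_sqf.rep_eq by (rule sum.mono_neutral_cong_right) (use S in \<open>auto simp: one_sqf.rep_eq\<close>)
    then show "coef (f * 1) S = coef f S" by simp
  qed
  show "(0::('a, 'b) sqf) \<noteq> 1"
    by (transfer) (auto simp: fun_eq_iff)
qed (transfer; simp add: fun_eq_iff algebra_simps)+

end

lift_definition con :: "'r::ring_1 \<Rightarrow> ('v, 'r) sqf" is "\<lambda>b S. if S = {} then b else 0" by auto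
lift_definition tv :: "'v \<Rightarrow> ('v, 'r::ring_1) sqf" is "\<lambda>v S. if S = {v} then 1 else 0" by auto

lemma coef_simps [simp]: "coef 0 S = 0" "coef (f + g) S = coef f S + coef g S"
  "coef (f - g) S = coef f S - coef g S" "coef (- f) S = - coef f S"
  by (simp_all add: zero_sqf.rep_eq plus_sqf.rep_eq minus_sqf.rep_eq uminus_sqf.rep_eq)

lemma coef_sum: "coef (sum F I) S = (\<Sum>x\<in>I. coef (F x) S)"
  by (induction I rule: infinite_finite_induct) auto

lemma coef_times_finite:
  "finite S \<Longrightarrow> coef (f * g) S = (\<Sum>T\<in>Pow S. coef f T * coef g (S - T))"
  by (simp add: times_sqf.rep_eq)

lemma coef_con_left [simp]: "coef (con b * f) S = b * coef f S"
proof (cases "finite S")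
  case True
  have "coef (con b * f) S = (\<Sum>T\<in>{{}}. b * coef f (S - T))"
    unfolding times_sqf.rep_eq by (rule sum.mono_neutral_cong_right) (use True in \<open>auto simp: con.rep_eq\<close>)
  then show ?thesis by simp
qed (simp add: coef_infinite)

lemma coef_con_right [simp]: "coef (f * con b) S = coef f S * b"
proof (cases "finite S")
  case True
  have "coef (f * con b) S = (\<Sum>T\<in>{S}. coef f T * b)"
    unfolding times_sqf.rep_eq by (rule sum.mono_neutral_cong_right) (use True in \<open>auto simp: con.rep_eq\<close>)
  then show ?thesis by simp
qed (simp add: coef_infinite)

lemma coef_tv_left: "coef (tv v * f) S = (if v \<in> S then coef f (S - {v}) else 0)"
proof (cases "finite S")
  case True
  have "coef (tv v * f) S = (\<Sum>T\<in>(if v \<in> S then {{v}} else {}). coef f (S - T))"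
    unfolding times_sqf.rep_eq by (rule sum.mono_neutral_cong_right) (use True in \<open>auto simp: tv.rep_eq split: if_splits\<close>)
  then show ?thesis by simp
qed (simp add: coef_infinite)

lemma coef_tv_right: "coef (f * tv v) S = (if v \<in> S then coef f (S - {v}) else 0)"
proof (cases "finite S")
  case True
  have eq: "S - T = {v} \<longleftrightarrow> T = S - {v} \<and> v \<in> S" if "T \<subseteq> S" for T using that by auto
  have "coef (f * tv v) S = (\<Sum>T\<in>(if v \<in> S then {S - {v}} else {}). coef f T)"
    unfolding times_sqf.rep_eq
    by (rule sum.mono_neutral_cong_right) (use True in \<open>auto simp: tv.rep_eq eq split: if_splits\<close>)
  then show ?thesis by simp
qed (simp add: coef_infinite)

lemma tv_central: "f * tv v = tv v * f"
  by (rule sqf_eqI) (simp add: coef_tv_left coef_tv_right)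

lemma tv_central': "f * (tv v * g) = tv v * (f * g)"
  by (metis mult.assoc tv_central)

lemma con_arith: "con (x + y) = con x + con y" "con (x - y) = con x - con y" "con (- x) = - con x"
  "con (x * y) = con x * con y" "con 0 = 0" "con 1 = 1"
  by (rule sqf_eqI; simp add: con.rep_eq one_sqf.rep_eq)+

lemma con_sum: "con (sum F I) = (\<Sum>x\<in>I. con (F x))"
  by (induction I rule: infinite_finite_induct) (auto simp: con_arith)

section \<open>Divisibility by a variable, and uniqueness of solutions of recursions\<close>

definition has :: "'v \<Rightarrow> ('v, 'r::ring_1) sqf \<Rightarrow> bool" where
  "has x f \<longleftrightarrow> (\<forall>S. coef f S \<noteq> 0 \<longrightarrow> x \<in> S)"

lemma has_mult: "has x f \<Longrightarrow> has x (f * g)" "has x g \<Longrightarrow> has x (f * g)"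
proof -
  have *: "\<exists>T\<in>Pow S. coef f T \<noteq> 0 \<and> coef g (S - T) \<noteq> 0" if "coef (f * g) S \<noteq> 0" for S
  proof (rule ccontr)
    assume "\<not> ?thesis"
    then have "coef f T * coef g (S - T) = 0" if "T \<in> Pow S" for T using that by (metis mult_zero_left mult_zero_right)
    then show False using that by (simp add: times_sqf.rep_eq)
  qed
  show "has x f \<Longrightarrow> has x (f * g)" "has x g \<Longrightarrow> has x (f * g)"
    using * unfolding has_def by blast+
qed

lemma has_tv: "has x (tv x)"
  by (simp add: has_def tv.rep_eq)

text \<open>When \<open>S\<close> is divided into two parts, only one of them can contain
  \<open>x\<close>. This is the rule that variables have square zero.\<close>

lemma has_has_zero: "has x f \<Longrightarrow> has x g \<Longrightarrow> f * g = 0"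
proof (rule sqf_eqI)
  fix S assume "has x f" "has x g"
  then show "coef (f * g) S = coef 0 S"
    unfolding times_sqf.rep_eq coef_simps has_def by (intro sum.neutral ballI) (metis Diff_iff mult_zero_left mult_zero_right)
qed

lemma has_empty: "has x f \<Longrightarrow> coef f {} = 0"
  by (auto simp: has_def)

text \<open>Since \<open>f\<close> has no constant term, the coefficient of \<open>f * d\<close> at
  \<open>S\<close> involves \<open>d\<close> on proper subsets of \<open>S\<close> only. This is how
  two solutions of one recursion are identified.\<close>

lemma left_fixpoint_zero:
  fixes d f :: "('v, 'r::ring_1) sqf"
  assumes "coef f {} = 0" "d = f * d"
  shows "d = 0"
proof (rule sqf_eqI)
  fix S :: "'v set" assume "finite S"
  then show "coef d S = coef 0 S"
  proof (induction S rule: finite_psubset_induct)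
    case (psubset S)
    have "coef d S = (\<Sum>T\<in>Pow S. coef f T * coef d (S - T))"
      by (subst assms(2)) (simp add: times_sqf.rep_eq)
    also have "\<dots> = 0"
    proof (intro sum.neutral ballI)
      fix T assume T: "T \<in> Pow S"
      show "coef f T * coef d (S - T) = 0"
      proof (cases "T = {}")
        case False
        with T have "S - T \<subset> S" by auto
        then show ?thesis using psubset.IH by simp
      qed (simp add: assms(1))
    qed
    finally show ?case by simp
  qed
qed

text \<open>The analogue for a coupled system: \<open>d a\<close> at \<open>S\<close> depends on all
  the \<open>d i\<close> at proper subsets of \<open>S\<close>, so the induction on \<open>S\<close>
  treats all members at once.\<close>

lemma family_fixpoint_zero:
  fixes d f :: "'a \<Rightarrow> ('v, 'r::ring_1) sqf"
  assumes f: "\<And>a. a \<in> R \<Longrightarrow> coef (f a) {} = 0"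
    and d: "\<And>a. a \<in> R \<Longrightarrow> d a = (\<Sum>i\<in>R. con (g a i) * d i) * f a" and a: "a \<in> R"
  shows "d a = 0"
proof (rule sqf_eqI)
  fix S :: "'v set" assume "finite S"
  then show "coef (d a) S = coef 0 S" using a
  proof (induction S arbitrary: a rule: finite_psubset_induct)
    case (psubset S)
    have "coef (d a) S = (\<Sum>T\<in>Pow S. coef (\<Sum>i\<in>R. con (g a i) * d i) T * coef (f a) (S - T))"
      by (subst d[OF psubset.prems]) (simp add: times_sqf.rep_eq)
    also have "\<dots> = 0"
    proof (intro sum.neutral ballI)
      fix T assume T: "T \<in> Pow S"
      show "coef (\<Sum>i\<in>R. con (g a i) * d i) T * coef (f a) (S - T) = 0"
      proof (cases "T = S")
        case False
        with T have "T \<subset> S" by auto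
        then show ?thesis using psubset.IH by (simp add: coef_sum)
      qed (simp add: f psubset.prems)
    qed
    finally show ?case by simp
  qed
qed

lemma right_fixpoint_zero:
  fixes d f :: "('v, 'r::ring_1) sqf"
  assumes "coef f {} = 0" "d = d * f"
  shows "d = 0"
proof (rule family_fixpoint_zero[of "{()}" "\<lambda>_. f" "\<lambda>_. d" "\<lambda>_ _. 1" "()"])
  show "d = (\<Sum>i\<in>{()}. con 1 * d) * f" using assms(2) by (simp only: con_arith sum.insert sum.empty finite.emptyI empty_iff simp_thms mult_1 add_0_right)
qed (simp_all add: assms(1))

section \<open>Sums over paths\<close>

lemma sum_permutations_Cons:
  assumes "finite A" "A \<noteq> {}"
  shows "(\<Sum>l\<in>permutations_of_set A. F l) = (\<Sum>x\<in>A. \<Sum>l\<in>permutations_of_set (A - {x}). F (x # l))"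
proof -
  have "(\<Sum>l\<in>permutations_of_set A. F l) = (\<Sum>x\<in>A. \<Sum>l\<in>(#) x ` permutations_of_set (A - {x}). F l)"
    unfolding permutations_of_set_nonempty[OF assms(2)]
    by (rule sum.UNION_disjoint) (use assms in auto)
  then show ?thesis by (simp add: sum.reindex)
qed

text \<open>Deleting \<open>x\<close> from an ordering leaves an ordering of \<open>A\<close>, and
  the number of entries in front of \<open>x\<close> records where it stood.\<close>

lemma sum_permutations_insert:
  assumes A: "finite A" "x \<notin> A"
  shows "(\<Sum>l\<in>permutations_of_set (insert x A). F l) =
    (\<Sum>l\<in>permutations_of_set A. \<Sum>k\<le>card A. F (take k l @ x # drop k l))"
proof -
  have idx: "take (length (takeWhile (\<lambda>y. y \<noteq> x) l)) (remove1 x l) @ x # drop (length (takeWhile (\<lambda>y. y \<noteq> x) l)) (remove1 x l) = l"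
    if "x \<in> set l" for l using that by (induction l) auto
  have idx2: "length (takeWhile (\<lambda>y. y \<noteq> x) l) < length l"
    if "x \<in> set l" for l using that by (induction l) auto
  have "(\<Sum>l\<in>permutations_of_set (insert x A). F l) =
     (\<Sum>(l, k)\<in>permutations_of_set A \<times> {..card A}. F (take k l @ x # drop k l))"
  proof (rule sum.reindex_bij_witness[of _ "\<lambda>(l, k). take k l @ x # drop k l"
        "\<lambda>l. (remove1 x l, length (takeWhile (\<lambda>y. y \<noteq> x) l))"], goal_cases)
    case (1 l)
    then show ?case using idx by (auto dest: permutations_of_setD)
  next
    case (2 l)
    then have l: "x \<in> set l" "distinct l" "set l = insert x A" by (auto dest: permutations_of_setD)
    then have "length l = card (insert x A)" by (metis distinct_card)
    then show ?case using idx2[OF l(1)] l(2,3) A by (simp add: permutations_of_set_def)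
  next
    case (3 p)
    then obtain l k where p: "p = (l, k)" "set l = A" "distinct l" "k \<le> card A"
      by (auto dest: permutations_of_setD)
    then have len: "k \<le> length l" using distinct_card by metis
    have x: "x \<notin> set (take k l)" "x \<notin> set (drop k l)" "x \<notin> set l"
      using p assms by (auto dest: in_set_takeD in_set_dropD)
    have "takeWhile (\<lambda>y. y \<noteq> x) (take k l @ x # drop k l) = take k l"
      using x by (subst takeWhile_append2) auto
    then show ?case using p x len by (auto simp: remove1_append min_def)
  next
    case (4 p)
    then obtain l k where p: "p = (l, k)" "set l = A" "distinct l"
      by (auto dest: permutations_of_setD)
    have "set (take k l) \<union> set (drop k l) = A" using p(2) by (metis append_take_drop_id set_append)
    then have s: "set (take k l @ x # drop k l) = insert x A" by auto
    have x: "x \<notin> set (take k l)" "x \<notin> set (drop k l)"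
      using p assms by (auto dest: in_set_takeD in_set_dropD)
    have "distinct (take k l @ x # drop k l)"
      using p x by (auto simp: set_take_disj_set_drop_if_distinct)
    then show ?case using s p by (simp add: permutations_of_set_def)
  next
    case (5 l)
    then show ?case using idx by (auto dest: permutations_of_setD)
  qed
  also have "\<dots> = (\<Sum>l\<in>permutations_of_set A. \<Sum>k\<le>card A. F (take k l @ x # drop k l))"
    by (simp add: sum.cartesian_product)
  finally show ?thesis .
qed

fun path_prod :: "('v \<Rightarrow> 'v \<Rightarrow> 'r::ring_1) \<Rightarrow> 'v list \<Rightarrow> 'r" where
  "path_prod B (x # y # l) = B x y * path_prod B (y # l)"
| "path_prod B l = 1"

text \<open>The relations among finitely many vertices with distinct residues. \<open>tri\<close> is
  the relation \<open>c1\<close> made cyclic by \<open>[ik] = -[ki]\<close>. All axioms speak of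
  distinct vertices, because \<open>B x x\<close> has no meaning.\<close>

locale fk_system =
  fixes V :: "'v set" and B :: "'v \<Rightarrow> 'v \<Rightarrow> 'r::ring_1"
  assumes anti: "x \<in> V \<Longrightarrow> y \<in> V \<Longrightarrow> x \<noteq> y \<Longrightarrow> B y x = - B x y"
    and comm: "{x, y, z, w} \<subseteq> V \<Longrightarrow> distinct [x, y, z, w] \<Longrightarrow> B x y * B z w = B z w * B x y"
    and tri: "{x, y, z} \<subseteq> V \<Longrightarrow> distinct [x, y, z] \<Longrightarrow> B x y * B y z + B y z * B z x + B z x * B x y = 0"
    and fin: "finite V"
begin

text \<open>The cyclic relation for \<open>y, x, z\<close>, solved for the product of two edges at
  \<open>x\<close>. Summed over residue classes it becomes the axiom \<open>rel\<close> of
  \<open>dunkl_system\<close>.\<close>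

lemma tri':
  assumes "{x, y, z} \<subseteq> V" "distinct [x, y, z]"
  shows "B x y * B x z = B y z * B x y - B x z * B y z"
proof -
  have "B y x * B x z + B x z * B z y + B z y * B y x = 0" using tri[of y x z] assms by auto
  then have "B y x * B x z = - (B x z * B z y) - B z y * B y x"
    by (simp add: eq_diff_eq eq_neg_iff_add_eq_0 add_ac)
  moreover have "B y x = - B x y" "B z y = - B y z" using anti[of x y] anti[of y z] assms by auto
  ultimately have "- (B x y * B x z) = B x z * B y z - B y z * B x y" by simp
  then show ?thesis by (metis minus_diff_eq minus_minus)
qed

lemma path_prod_comm:
  "set l \<subseteq> V \<Longrightarrow> distinct (x # y # l) \<Longrightarrow> {x, y} \<subseteq> V \<Longrightarrow> B x y * path_prod B l = path_prod B l * B x y"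
proof (induction l rule: induct_list012)
  case (3 u v l)
  have "B x y * path_prod B (u # v # l) = B u v * (B x y * path_prod B (v # l))"
    using comm[of x y u v] 3(3-) by (simp add: mult.assoc[symmetric])
  moreover have "B x y * path_prod B (v # l) = path_prod B (v # l) * B x y" using 3 by auto
  ultimately show ?case by (simp add: mult.assoc)
qed auto

text \<open>Inserting \<open>x\<close> between neighbours \<open>b\<close> and \<open>c\<close>
  gives \<open>B b x * B x c\<close>, and \<open>tri\<close> turns this into a difference of two
  products that contain the old edge \<open>B b c\<close>. Summed over all positions, a commutator
  remains.\<close>

lemma path_prod_insert:
  assumes "l \<noteq> []" "set l \<subseteq> V" "distinct l" "x \<in> V" "x \<notin> set l"
  shows "(\<Sum>k\<le>length l. path_prod B (take k l @ x # drop k l)) =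
    (\<Sum>b\<in>set l. B x b) * path_prod B l - path_prod B l * (\<Sum>b\<in>set l. B x b)"
  using assms
proof (induction l rule: induct_list012)
  case (2 b)
  then show ?case using anti[of x b] by auto
next
  case (3 b c l)
  let ?p = "path_prod B (c # l)" and ?D = "\<Sum>d\<in>set l. B x d"
  let ?f = "\<lambda>k. path_prod B (take k (c # l) @ x # drop k (c # l))"
  have IH: "(\<Sum>k\<le>Suc (length l). ?f k) = (B x c + ?D) * ?p - ?p * (B x c + ?D)"
    using 3 by simp
  \<comment> \<open>The term with \<open>x\<close> in front of \<open>c\<close> is split off: behind
    \<open>b\<close> it does not acquire the factor \<open>B b c\<close> like the others, but
    \<open>B b x\<close>, and needs \<open>tri\<close>.\<close>
  have S: "(\<Sum>k\<le>Suc (length l). ?f k) = B x c * ?p + (\<Sum>k\<le>length l. ?f (Suc k))"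
    by (subst sum.atMost_Suc_shift) simp
  have "(\<Sum>k\<le>length (b # c # l). path_prod B (take k (b # c # l) @ x # drop k (b # c # l))) =
      B x b * (B b c * ?p) + (B b x * (B x c * ?p) + (\<Sum>k\<le>length l. B b c * ?f (Suc k)))"
    by (simp add: sum.atMost_Suc_shift del: sum.atMost_Suc)
  also have "(\<Sum>k\<le>length l. B b c * ?f (Suc k)) = B b c * ((B x c + ?D) * ?p - ?p * (B x c + ?D) - B x c * ?p)"
  proof -
    have "B x c * ?p + (\<Sum>k\<le>length l. ?f (Suc k)) = (B x c + ?D) * ?p - ?p * (B x c + ?D)"
      using IH S by (simp only:)
    then have "(\<Sum>k\<le>length l. ?f (Suc k)) = (B x c + ?D) * ?p - ?p * (B x c + ?D) - B x c * ?p"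
      by (simp only: eq_diff_eq add.commute)
    then show ?thesis by (simp only: sum_distrib_left[symmetric])
  qed
  finally have 1: "(\<Sum>k\<le>length (b # c # l). path_prod B (take k (b # c # l) @ x # drop k (b # c # l))) =
      B x b * (B b c * ?p) + (B b x * (B x c * ?p) + B b c * (?D * ?p - ?p * (B x c + ?D)))"
    by (simp add: algebra_simps)
  have t: "B b x * B x c = B x c * B b c - B b c * B x b"
  proof -
    have "B b x * B x c + B x c * B c b + B c b * B b x = 0" using tri[of b x c] 3(3-) by auto
    then have "B b x * B x c = - (B x c * B c b) - B c b * B b x"
      by (simp add: eq_diff_eq eq_neg_iff_add_eq_0 add_ac)
    moreover have "B c b = - B b c" "B b x = - B x b" using anti[of b c] anti[of x b] 3(3-) by auto
    ultimately show ?thesis by simp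
  qed
  have p: "B x b * ?p = ?p * B x b" using 3(3-) by (intro path_prod_comm) auto
  have d: "?D * B b c = B b c * ?D"
    unfolding sum_distrib_left sum_distrib_right by (intro sum.cong refl comm) (use 3(3-) in auto)
  have "B b x * (B x c * ?p) = B x c * (B b c * ?p) - B b c * (?p * B x b)"
    unfolding mult.assoc[symmetric] t left_diff_distrib by (simp only: mult.assoc p)
  moreover have "?D * (B b c * ?p) = B b c * (?D * ?p)" by (simp only: mult.assoc[symmetric] d)
  moreover have "(\<Sum>d\<in>set (b # c # l). B x d) = B x b + (B x c + ?D)" using 3(3-) by simp
  ultimately show ?case unfolding 1 by (simp add: algebra_simps)
qed auto

definition path_sum :: "'v set \<Rightarrow> 'r" where
  "path_sum A = (\<Sum>l\<in>permutations_of_set A. path_prod B l)"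

definition path_from :: "'v \<Rightarrow> 'v set \<Rightarrow> 'r" where
  "path_from a A = (\<Sum>l\<in>permutations_of_set A. path_prod B (a # l))"

lemma path_sum_from: "finite A \<Longrightarrow> A \<noteq> {} \<Longrightarrow> path_sum A = (\<Sum>a\<in>A. path_from a (A - {a}))"
  unfolding path_sum_def path_from_def by (rule sum_permutations_Cons)

lemma path_from_rec:
  "finite A \<Longrightarrow> A \<noteq> {} \<Longrightarrow> path_from a A = (\<Sum>i\<in>A. B a i * path_from i (A - {i}))"
  unfolding path_from_def by (simp add: sum_permutations_Cons sum_distrib_left)

lemma path_sum_insert:
  assumes "insert x A \<subseteq> V" "A \<noteq> {}" "x \<notin> A"
  shows "path_sum (insert x A) = (\<Sum>b\<in>A. B x b) * path_sum A - path_sum A * (\<Sum>b\<in>A. B x b)"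
proof -
  have fA: "finite A" by (metis assms(1) fin finite_subset insert_subset)
  have "path_sum (insert x A) = (\<Sum>l\<in>permutations_of_set A. \<Sum>k\<le>card A. path_prod B (take k l @ x # drop k l))"
    unfolding path_sum_def by (rule sum_permutations_insert[OF fA assms(3)])
  also have "\<dots> = (\<Sum>l\<in>permutations_of_set A. (\<Sum>b\<in>A. B x b) * path_prod B l - path_prod B l * (\<Sum>b\<in>A. B x b))"
  proof (rule sum.cong, simp)
    fix l assume l: "l \<in> permutations_of_set A"
    then have l': "set l = A" "distinct l" "length l = card A"
      by (auto simp: permutations_of_set_def distinct_card)
    then show "(\<Sum>k\<le>card A. path_prod B (take k l @ x # drop k l)) =
      (\<Sum>b\<in>A. B x b) * path_prod B l - path_prod B l * (\<Sum>b\<in>A. B x b)"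
      using path_prod_insert[of l x] assms by auto
  qed
  finally show ?thesis 
    by (simp only: path_sum_def sum_subtractf sum_distrib_left[symmetric] sum_distrib_right[symmetric])
qed

text \<open>By \<open>path_sum_insert\<close> one more vertex gives a commutator with the sum for
  \<open>A\<close>, which is 1 or 0 by induction and hence central.\<close>

lemma path_sum_eq:
  assumes "A \<subseteq> V" "A \<noteq> {}"
  shows "path_sum A = (if card A = 1 then 1 else 0)"
proof -
  have "finite A" using fin assms finite_subset by blast
  then show ?thesis using assms(2,1)
  proof (induction rule: finite_ne_induct)
    case (singleton x)
    then show ?case by (simp add: path_sum_def)
  next
    case (insert x A)
    then show ?case using path_sum_insert[of x A] by auto
  qed
qed

end

section \<open>Star series and their Dunkl recursion\<close>

context fk_system
begin

definition cen :: "('v, 'r) sqf \<Rightarrow> bool" where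
  "cen f \<longleftrightarrow> (\<forall>S x y. x \<in> V - S \<longrightarrow> y \<in> V - S \<longrightarrow> x \<noteq> y \<longrightarrow> coef f S * B x y = B x y * coef f S)"

text \<open>As \<open>f\<close> contains \<open>x\<close> and \<open>y\<close>, only coefficients of
  \<open>g\<close> on sets avoiding both contribute, and these commute with
  \<open>B x y\<close>.\<close>

lemma cen_right:
  assumes "cen g" "has x f" "has y f" "x \<in> V" "y \<in> V" "x \<noteq> y"
  shows "f * (con (B x y) * g) = f * (g * con (B x y))"
proof (rule sqf_eqI)
  fix S :: "'v set" assume S: "finite S"
  have "coef f T * (B x y * coef g (S - T)) = coef f T * (coef g (S - T) * B x y)" for T
  proof (cases "coef f T = 0")
    case False
    then have "x \<in> T" "y \<in> T" using assms by (auto simp: has_def)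
    then show ?thesis using assms unfolding cen_def by (metis DiffD2 DiffI)
  qed simp
  then show "coef (f * (con (B x y) * g)) S = coef (f * (g * con (B x y))) S"
    using S by (simp add: coef_times_finite[of S f])
qed

lemma cen_left:
  assumes "cen g" "has x h" "has y h" "x \<in> V" "y \<in> V" "x \<noteq> y"
  shows "g * (con (B x y) * h) = con (B x y) * (g * h)"
proof (rule sqf_eqI)
  fix S :: "'v set" assume S: "finite S"
  have "coef g T * (B x y * coef h (S - T)) = B x y * (coef g T * coef h (S - T))" if "T \<subseteq> S" for T
  proof (cases "coef h (S - T) = 0")
    case False
    then have "x \<notin> T" "y \<notin> T" using assms by (auto simp: has_def)
    then have "coef g T * B x y = B x y * coef g T" using assms unfolding cen_def by blast
    then show ?thesis by (metis mult.assoc)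
  qed simp
  then show "coef (g * (con (B x y) * h)) S = coef (con (B x y) * (g * h)) S"
    using S by (simp add: coef_times_finite[of S g] sum_distrib_left)
qed

text \<open>The Dunkl element of \<open>a\<close> with the second endpoints marked by variables. The
  meaningless summand \<open>k = a\<close> does no harm: the series multiplied by
  \<open>dunkl a\<close> are divisible by \<open>tv a\<close>, which kills it.\<close>

definition dunkl :: "'v \<Rightarrow> ('v, 'r) sqf" where
  "dunkl a = (\<Sum>k\<in>V. con (B a k) * tv k)"

lemma dunkl_empty: "coef (dunkl a) {} = 0"
  by (simp add: dunkl_def coef_sum tv.rep_eq)

definition star_coef :: "'v \<Rightarrow> 'v set \<Rightarrow> 'r" where
  "star_coef a S = (\<Sum>l\<in>permutations_of_set S. prod_list (map (B a) l))"

lift_definition star :: "'v \<Rightarrow> ('v, 'r) sqf" is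
  "\<lambda>a S. if a \<in> S \<and> S \<subseteq> V then star_coef a (S - {a}) else 0"
  by (auto dest: finite_subset[OF _ fin])

lemma star_coef_rec:
  assumes "finite S" "S \<noteq> {}"
  shows "star_coef a S = (\<Sum>k\<in>S. star_coef a (S - {k}) * B a k)"
proof -
  \<comment> \<open>Reversing the lists makes the head the last factor, so that
    \<open>sum_permutations_Cons\<close> splits off a factor on the right.\<close>
  have "star_coef a S = (\<Sum>l\<in>permutations_of_set S. prod_list (map (B a) (rev l)))"
    unfolding star_coef_def
    by (rule sum.reindex_bij_witness[of _ rev rev]) (auto simp: permutations_of_set_def)
  also have "\<dots> = (\<Sum>k\<in>S. \<Sum>l\<in>permutations_of_set (S - {k}). prod_list (map (B a) (rev (k # l))))"
    by (rule sum_permutations_Cons[OF assms])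
  also have "\<dots> = (\<Sum>k\<in>S. \<Sum>l\<in>permutations_of_set (S - {k}). prod_list (map (B a) l) * B a k)"
    by (rule sum.cong[OF refl], rule sum.reindex_bij_witness[of _ rev rev])
       (auto simp: permutations_of_set_def)
  finally show ?thesis by (simp add: star_coef_def sum_distrib_right)
qed

text \<open>In square-free variables the powers of \<open>dunkl a\<close> expand into the orderings
  of the leaf sets. Thus \<open>star a\<close> is \<open>tv a\<close> times the inverse of
  \<open>1 - dunkl a\<close>, expressed here as a recursion.\<close>

lemma star_eq:
  assumes a: "a \<in> V"
  shows "star a = tv a + star a * dunkl a"
proof (rule sqf_eqI)
  fix S :: "'v set" assume S: "finite S"
  have 1: "coef (star a * dunkl a) S = (\<Sum>k\<in>V. if k \<in> S then coef (star a) (S - {k}) * B a k else 0)"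
    unfolding dunkl_def sum_distrib_left coef_sum
    by (intro sum.cong refl) (simp add: mult.assoc[symmetric] coef_tv_right)
  show "coef (star a) S = coef (tv a + star a * dunkl a) S"
  proof (cases "a \<in> S \<and> S \<subseteq> V \<and> S \<noteq> {a}")
    case True
    have "coef (star a * dunkl a) S = (\<Sum>k\<in>S - {a}. star_coef a (S - {a} - {k}) * B a k)"
      unfolding 1 by (rule sum.mono_neutral_cong_right)
        (use True fin S in \<open>auto simp: star.rep_eq Diff_insert2[symmetric] insert_commute intro!: arg_cong[of _ _ "star_coef a"]\<close>)
    also have "\<dots> = star_coef a (S - {a})"
      using S True by (intro star_coef_rec[symmetric]) auto
    finally show ?thesis using True by (auto simp: star.rep_eq tv.rep_eq)
  next
    case False
    have "coef (star a * dunkl a) S = 0"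
      unfolding 1 using False by (intro sum.neutral) (auto simp: star.rep_eq)
    moreover have "coef (star a) S = coef (tv a) S"
      by (cases "S = {a}") (use False a in \<open>auto simp: star.rep_eq tv.rep_eq star_coef_def\<close>)
    ultimately show ?thesis by simp
  qed
qed

lemma has_star: "has a (star a)"
  by (simp add: has_def star.rep_eq)

lemma star_coef_comm:
  assumes "insert a S \<subseteq> V" "insert b T \<subseteq> V" "insert a S \<inter> insert b T = {}" "a \<notin> S" "b \<notin> T"
  shows "star_coef a S * star_coef b T = star_coef b T * star_coef a S"
proof -
  have 1: "B a x * prod_list (map (B b) l) = prod_list (map (B b) l) * B a x"
    if "set l \<subseteq> T" "x \<in> S" for l x
    using that
  proof (induction l)
    case (Cons y l)
    have "B a x * B b y = B b y * B a x" by (rule comm) (use Cons.prems assms in auto)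
    then have "B a x * prod_list (map (B b) (y # l)) = B b y * (B a x * prod_list (map (B b) l))"
      by (simp add: mult.assoc[symmetric])
    then show ?case using Cons by (simp add: mult.assoc)
  qed simp
  have 2: "prod_list (map (B a) k) * prod_list (map (B b) l) = prod_list (map (B b) l) * prod_list (map (B a) k)"
    if "set l \<subseteq> T" "set k \<subseteq> S" for k l
    using that(2)
  proof (induction k)
    case (Cons x k)
    have e: "B a x * prod_list (map (B b) l) = prod_list (map (B b) l) * B a x" using 1 that Cons by simp
    have "prod_list (map (B a) (x # k)) * prod_list (map (B b) l) = (B a x * prod_list (map (B b) l)) * prod_list (map (B a) k)"
      using Cons by (simp add: mult.assoc)
    also have "\<dots> = prod_list (map (B b) l) * prod_list (map (B a) (x # k))" unfolding e by (simp add: mult.assoc)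
    finally show ?case .
  qed simp
  show ?thesis
    unfolding star_coef_def sum_product
    by (subst (2) sum.swap) (intro sum.cong refl 2; auto dest: permutations_of_setD)
qed

text \<open>In a product of square-free series the two stars occupy disjoint vertex sets, where all
  their letters commute. Passing from \<open>T\<close> to its complement in \<open>S\<close>
  exchanges the factors.\<close>

lemma star_comm:
  assumes "a \<in> V" "b \<in> V" "a \<noteq> b"
  shows "star a * star b = star b * star a"
proof (rule sqf_eqI)
  fix S :: "'v set" assume S: "finite S"
  have "coef (star a * star b) S = (\<Sum>T\<in>Pow S. coef (star a) (S - T) * coef (star b) (S - (S - T)))"
    unfolding times_sqf.rep_eq by (rule sum.reindex_bij_witness[of _ "\<lambda>T. S - T" "\<lambda>T. S - T"]) (auto simp: double_diff)
  also have "\<dots> = (\<Sum>T\<in>Pow S. coef (star b) T * coef (star a) (S - T))"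
  proof (rule sum.cong[OF refl])
    fix T assume T: "T \<in> Pow S"
    then have e: "S - (S - T) = T" by auto
    show "coef (star a) (S - T) * coef (star b) (S - (S - T)) = coef (star b) T * coef (star a) (S - T)"
      unfolding e star.rep_eq using assms T star_coef_comm[of a "S - T - {a}" b "T - {b}"] by (auto simp: insert_absorb)
  qed
  finally show "coef (star a * star b) S = coef (star b * star a) S" by (simp add: times_sqf.rep_eq)
qed

definition stars :: "'v set \<Rightarrow> ('v, 'r) sqf" where
  "stars A = Finite_Set.fold (\<lambda>x f. star x * f) 1 A"

lemma stars_insert: "insert x A \<subseteq> V \<Longrightarrow> x \<notin> A \<Longrightarrow> stars (insert x A) = star x * stars A"
proof -
  have "comp_fun_commute_on V (\<lambda>x f. star x * f)"
  proof
    fix x y assume "x \<in> V" "y \<in> V"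
    then have "star y * star x = star x * star y" using star_comm by metis
    then show "(\<lambda>f. star y * f) \<circ> (\<lambda>f. star x * f) = (\<lambda>f. star x * f) \<circ> (\<lambda>f. star y * f)"
      by (auto simp: fun_eq_iff mult.assoc[symmetric])
  qed
  then show "insert x A \<subseteq> V \<Longrightarrow> x \<notin> A \<Longrightarrow> ?thesis"
    unfolding stars_def
    by (intro comp_fun_commute_on.fold_insert) (auto intro: finite_subset[OF _ fin])
qed

lemma stars_empty: "stars {} = 1"
  by (simp add: stars_def)

lemma stars_singleton: "a \<in> V \<Longrightarrow> stars {a} = star a"
  using stars_insert[of a "{}"] by (simp add: stars_empty)

lemma stars_mult_star:
  assumes "A \<subseteq> V" "x \<in> V"
  shows "stars A * star x = (if x \<in> A then 0 else stars (insert x A))"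
proof -
  have fA: "finite A" using assms fin finite_subset by metis
  have c: "stars A * star x = star x * stars A"
    using fA assms(1)
  proof (induction A rule: finite_induct)
    case (insert y A)
    then have 1: "stars A * star x = star x * stars A" by simp
    have 2: "star y * star x = star x * star y" using star_comm insert.prems assms(2) by (cases "x = y") auto
    have "stars (insert y A) * star x = star y * star x * stars A"
      using insert 1 by (simp add: stars_insert mult.assoc)
    then show ?case using insert unfolding 2 by (simp add: stars_insert mult.assoc)
  qed (simp add: stars_empty)
  show ?thesis
  proof (cases "x \<in> A")
    case True
    then obtain A' where "A = insert x A'" "x \<notin> A'" by (metis Set.set_insert)
    then have "star x * stars A = star x * star x * stars A'" using assms by (simp add: stars_insert mult.assoc)
    then show ?thesis using True c has_has_zero[OF has_star has_star, of x] by simp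
  qed (use c assms in \<open>simp add: stars_insert\<close>)
qed

end

text \<open>\<open>X a\<close> and \<open>Q j\<close> model the signed generating functions of plane
  trees with a row root and a column root. Such a tree is a single vertex or is cut at one letter at
  its root into a column tree followed by a row tree. A column tree counts all its rows in the sign,
  a row tree all but one, so cutting a column tree costs a sign; writing \<open>B j i\<close> in
  place of \<open>B i j\<close> absorbs it.\<close>

locale tree_sums = fk_system V B for V :: "'v set" and B :: "'v \<Rightarrow> 'v \<Rightarrow> 'r::ring_1" +
  fixes R C :: "'v set" and X Q :: "'v \<Rightarrow> ('v, 'r) sqf"
  assumes V: "R \<union> C = V" "R \<inter> C = {}"
    and X: "a \<in> R \<Longrightarrow> X a = tv a + (\<Sum>j\<in>C. Q j * (con (B a j) * X a))"
    and Q: "j \<in> C \<Longrightarrow> Q j = tv j + (\<Sum>i\<in>R. Q j * (con (B j i) * X i))"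
    and hasX: "a \<in> R \<Longrightarrow> has a (X a)" and hasQ: "j \<in> C \<Longrightarrow> has j (Q j)"
    and cenX: "a \<in> R \<Longrightarrow> cen (X a)" and cenQ: "j \<in> C \<Longrightarrow> cen (Q j)"
begin

text \<open>For \<open>i \<noteq> a\<close> this is \<open>tri'\<close> for \<open>a, j, i\<close>.
  In one term \<open>a\<close> and \<open>j\<close> already occur to the left of \<open>X i\<close>,
  in the other \<open>a\<close> and \<open>i\<close> already occur to the right of
  \<open>Q j\<close>, so the letters joining them can be moved across by \<open>cen_right\<close>
  and \<open>cen_left\<close>. For \<open>i = a\<close> everything vanishes because \<open>a\<close>
  occurs twice.\<close>

lemma triple:
  assumes a: "a \<in> R" and i: "i \<in> R" and j: "j \<in> C"
  shows "tv a * (Q j * (con (B a j) * (con (B a i) * X i))) =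
    tv a * (Q j * (con (B j i) * X i)) * con (B a j) + tv a * (con (B a i) * (Q j * (con (B i j) * X i)))"
proof (cases "i = a")
  case True
  have "tv a * (f * X a) = 0" "tv a * (f * X a) * g = 0" for f g
    using has_has_zero[OF has_tv has_mult(2)[OF hasX[OF a]], of f] by simp_all
  from this[of "Q j * (con (B a j) * con (B a a))"] this[of "Q j * con (B j a)"]
    this[of "con (B a a) * (Q j * con (B a j))"]
  show ?thesis by (simp add: True mult.assoc)
next
  case False
  have mem: "a \<in> V" "i \<in> V" "j \<in> V" "a \<noteq> j" "i \<noteq> j" using assms V by auto
  have "B a j * B a i = B j i * B a j + B a i * B i j"
    using tri'[of a j i] anti[of i j] mem False by auto
  then have t: "con (B a j) * (con (B a i) * X i) = con (B j i) * (con (B a j) * X i) + con (B a i) * (con (B i j) * X i)"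
    by (metis con_arith(1,4) distrib_right mult.assoc)
  have "has a (tv a * Q j * con (B j i))" "has j (tv a * Q j * con (B j i))"
    using hasQ[OF j] by (auto intro: has_mult has_tv)
  then have 1: "tv a * Q j * con (B j i) * (con (B a j) * X i) = tv a * Q j * con (B j i) * (X i * con (B a j))"
    using mem by (intro cen_right cenX[OF i]) auto
  have "has a (con (B i j) * (tv a * X i))" "has i (con (B i j) * (tv a * X i))"
    using hasX[OF i] by (auto intro: has_mult has_tv)
  then have 2: "Q j * (con (B a i) * (con (B i j) * (tv a * X i))) = con (B a i) * (Q j * (con (B i j) * (tv a * X i)))"
    using mem False by (intro cen_left cenQ[OF j]) auto
  show ?thesis
    unfolding t distrib_left using 1 2 by (simp add: mult.assoc tv_central')
qed

text \<open>Let \<open>U\<close> be the sum of the \<open>Q j * con (B a j)\<close>, so that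
  \<open>X a = tv a + U * X a\<close>. Both sides solve \<open>Y = tv a * dunkl a + U * Y\<close>,
  which has only one solution. For the right-hand side, \<open>triple\<close> brings the double sum
  into a form to which the recursions for \<open>Q\<close> and \<open>X\<close> apply.\<close>

lemma X_dunkl:
  assumes a: "a \<in> R"
  shows "X a * dunkl a = X a - tv a + tv a * (\<Sum>i\<in>R. con (B a i) * X i)"
proof -
  let ?G = "\<Sum>i\<in>R. con (B a i) * X i"
  let ?F = "X a - tv a + tv a * ?G"
  let ?U = "\<Sum>j\<in>C. Q j * con (B a j)"
  have X': "X a = tv a + ?U * X a" using X[OF a] by (simp add: sum_distrib_right mult.assoc)
  have fV: "finite R" "finite C" using fin V by (metis finite_Un)+
  have D: "tv a * dunkl a = tv a * (\<Sum>i\<in>R. con (B a i) * tv i) + tv a * (\<Sum>j\<in>C. con (B a j) * tv j)"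
    unfolding dunkl_def using sum.union_disjoint[of R C] fV V by (metis (no_types, lifting) distrib_left)
  have "?U * (tv a * ?G) = (\<Sum>j\<in>C. \<Sum>i\<in>R. tv a * (Q j * (con (B a j) * (con (B a i) * X i))))"
    by (simp add: sum_distrib_right sum_distrib_left mult.assoc tv_central') (rule sum.swap)
  also have "\<dots> = (\<Sum>j\<in>C. \<Sum>i\<in>R. tv a * (Q j * (con (B j i) * X i)) * con (B a j)) +
     (\<Sum>j\<in>C. \<Sum>i\<in>R. tv a * (con (B a i) * (Q j * (con (B i j) * X i))))"
    using triple[OF a] by (simp add: sum.distrib cong: sum.cong)
  also have "(\<Sum>j\<in>C. \<Sum>i\<in>R. tv a * (Q j * (con (B j i) * X i)) * con (B a j)) =
     (\<Sum>j\<in>C. tv a * (Q j - tv j) * con (B a j))"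
  proof (rule sum.cong[OF refl])
    fix j assume j: "j \<in> C"
    have "Q j - tv j = (\<Sum>i\<in>R. Q j * (con (B j i) * X i))" using Q[OF j] by (metis add_diff_cancel_left')
    then show "(\<Sum>i\<in>R. tv a * (Q j * (con (B j i) * X i)) * con (B a j)) = tv a * (Q j - tv j) * con (B a j)"
      by (simp add: sum_distrib_left sum_distrib_right)
  qed
  also have "(\<Sum>j\<in>C. \<Sum>i\<in>R. tv a * (con (B a i) * (Q j * (con (B i j) * X i)))) =
     (\<Sum>i\<in>R. tv a * (con (B a i) * (X i - tv i)))"
  proof (subst sum.swap, rule sum.cong[OF refl])
    fix i assume i: "i \<in> R"
    have "X i - tv i = (\<Sum>j\<in>C. Q j * (con (B i j) * X i))" using X[OF i] by (metis add_diff_cancel_left')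
    then show "(\<Sum>j\<in>C. tv a * (con (B a i) * (Q j * (con (B i j) * X i)))) = tv a * (con (B a i) * (X i - tv i))"
      by (simp add: sum_distrib_left)
  qed
  also have "(\<Sum>j\<in>C. tv a * (Q j - tv j) * con (B a j)) = ?U * tv a - tv a * (\<Sum>j\<in>C. con (B a j) * tv j)"
  proof -
    have "tv a * (Q j - tv j) * con b = Q j * con b * tv a - tv a * (con b * tv j)" for j b
    proof -
      have "tv a * Q j * con b = Q j * con b * tv a" "tv j * con b = con b * tv j"
        by (metis tv_central mult.assoc)+
      then show ?thesis by (simp only: right_diff_distrib left_diff_distrib mult.assoc)
    qed
    then show ?thesis by (simp only: sum_subtractf sum_distrib_left sum_distrib_right)
  qed
  also have "(\<Sum>i\<in>R. tv a * (con (B a i) * (X i - tv i))) = tv a * ?G - tv a * (\<Sum>i\<in>R. con (B a i) * tv i)"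
    by (simp add: algebra_simps sum_subtractf sum_distrib_left)
  finally have "?U * (tv a * ?G) = ?U * tv a + tv a * ?G - tv a * dunkl a"
    unfolding D by (simp add: algebra_simps)
  moreover have UX: "?U * X a = X a - tv a" using X' by (metis add_diff_cancel_left')
  ultimately have F: "?U * ?F = ?F - tv a * dunkl a"
    by (simp only: distrib_left right_diff_distrib) simp
  have "?U * (X a * dunkl a) = X a * dunkl a - tv a * dunkl a"
    unfolding mult.assoc[symmetric] UX by (simp only: left_diff_distrib)
  then have "X a * dunkl a - ?F = ?U * (X a * dunkl a - ?F)"
    unfolding right_diff_distrib[of ?U "X a * dunkl a" ?F] F by simp
  moreover have "coef ?U {} = 0" using hasQ[THEN has_empty] by (simp add: coef_sum)
  ultimately show ?thesis using left_fixpoint_zero[of ?U "X a * dunkl a - ?F"] by simp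
qed

text \<open>\<open>X_dunkl\<close> reads \<open>X a * (1 - dunkl a) = (1 - G) * tv a\<close>, where
  \<open>G\<close> is the sum on the right, and \<open>star_eq\<close> reads
  \<open>star a * (1 - dunkl a) = tv a\<close>; the factor \<open>1 - dunkl a\<close>
  cancels.\<close>

lemma X_star:
  assumes a: "a \<in> R"
  shows "X a = star a - (\<Sum>i\<in>R. con (B a i) * X i) * star a"
proof -
  let ?G = "\<Sum>i\<in>R. con (B a i) * X i"
  let ?e = "star a - ?G * star a"
  have aV: "a \<in> V" using a V by auto
  have "?e * dunkl a = ?e - (tv a - ?G * tv a)"
  proof -
    have "star a * dunkl a = star a - tv a" using star_eq[OF aV] by (metis add_diff_cancel_left')
    then show ?thesis by (simp add: left_diff_distrib right_diff_distrib mult.assoc)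
  qed
  moreover have "X a * dunkl a = X a - (tv a - ?G * tv a)" using X_dunkl[OF a] by (simp add: tv_central)
  ultimately have "X a - ?e = (X a - ?e) * dunkl a" by (simp only: left_diff_distrib) simp
  then have "X a - ?e = 0" using right_fixpoint_zero[OF dunkl_empty] by blast
  then show ?thesis by simp
qed

text \<open>Iterating \<open>X_star\<close> gives paths from \<open>a\<close> through other rows,
  with a sign for every step and a star factor for every visited row. The stars commute, so their
  product depends on the set of visited rows only, and a repeated row gives zero.\<close>

lemma X_paths:
  assumes a: "a \<in> R"
  shows "X a = (\<Sum>A\<in>Pow (R - {a}). (- 1) ^ card A * con (path_from a A) * stars (insert a A))"
proof -
  let ?W = "\<lambda>a. \<Sum>A\<in>Pow (R - {a}). (- 1) ^ card A * con (path_from a A) * stars (insert a A)"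
  have fR: "finite R" using fin V by (metis finite_Un)
  have W: "?W a = star a - (\<Sum>i\<in>R. con (B a i) * ?W i) * star a" if a: "a \<in> R" for a
  proof -
    let ?t = "\<lambda>i A. con (B a i) * ((- 1) ^ card A * con (path_from i A) * stars (insert a (insert i A)))"
    have tm: "con (B a i) * ((- 1) ^ card A * con (path_from i A) * stars (insert i A)) * star a =
       (if a \<in> insert i A then 0 else ?t i A)" if "i \<in> R" "A \<subseteq> R - {i}" for i A
    proof -
      have "stars (insert i A) * star a = (if a \<in> insert i A then 0 else stars (insert a (insert i A)))"
        using that a V by (intro stars_mult_star) auto
      then show ?thesis by (simp add: mult.assoc split: if_splits)
    qed
    have "(\<Sum>i\<in>R. con (B a i) * ?W i) * star a = (\<Sum>i\<in>R. \<Sum>A\<in>Pow (R - {i}). if a \<in> insert i A then 0 else ?t i A)"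
      unfolding sum_distrib_left sum_distrib_right by (intro sum.cong refl tm) auto
    also have "\<dots> = (\<Sum>(i, A)\<in>(SIGMA i:R. Pow (R - {i})). if a \<in> insert i A then 0 else ?t i A)"
      using fR by (intro sum.Sigma) auto
    also have "\<dots> = (\<Sum>(i, A)\<in>(SIGMA i:R - {a}. Pow (R - {i} - {a})). ?t i A)"
    proof (rule sum.mono_neutral_cong_right)
      show "finite (SIGMA i:R. Pow (R - {i}))" using fR by (intro finite_SigmaI) auto
      fix p assume p: "p \<in> (SIGMA i:R - {a}. Pow (R - {i} - {a}))"
      then show "(case p of (i, A) \<Rightarrow> if a \<in> insert i A then 0 else ?t i A) = (case p of (i, A) \<Rightarrow> ?t i A)"
        by (cases p) auto
    qed auto
    also have "\<dots> = (\<Sum>(A, i)\<in>(SIGMA A:Pow (R - {a}) - {{}}. A).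
        - ((- 1) ^ card A * con (B a i * path_from i (A - {i})) * stars (insert a A)))"
    \<comment> \<open>A path from \<open>a\<close> is now recorded by the set of all later rows and
      the first of them; the set gains the element \<open>i\<close>, which changes the sign.\<close>
    proof (rule sum.reindex_bij_witness[of _ "\<lambda>(A, i). (i, A - {i})" "\<lambda>(i, A). (insert i A, i)"], goal_cases)
      case (5 p)
      then obtain i A where p: "p = (i, A)" "i \<in> R" "A \<subseteq> R - {i} - {a}" by auto
      then have "finite A" "i \<notin> A" using finite_subset[of A R] fR by auto
      then have "(con (B a i) :: ('v, 'r) sqf) * ((- 1) ^ card A * con (path_from i A)) =
        - ((- 1) ^ card (insert i A) * con (B a i * path_from i A))"
        by (cases "even (card A)") (simp_all add: con_arith)
      then have "?t i A = - ((- 1) ^ card (insert i A) * con (B a i * path_from i A) * stars (insert a (insert i A)))"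
        by (simp only: mult.assoc[symmetric] mult_minus_left)
      moreover have "insert i A - {i} = A" using \<open>i \<notin> A\<close> by simp
      ultimately show ?case using p by simp
    qed auto
    also have "\<dots> = (\<Sum>A\<in>Pow (R - {a}) - {{}}. \<Sum>i\<in>A. - ((- 1) ^ card A * con (B a i * path_from i (A - {i})) * stars (insert a A)))"
      using fR by (intro sum.Sigma[symmetric]) (auto intro: finite_subset)
    also have "\<dots> = (\<Sum>A\<in>Pow (R - {a}) - {{}}. - ((- 1) ^ card A * con (path_from a A) * stars (insert a A)))"
    proof (rule sum.cong[OF refl])
      fix A assume A: "A \<in> Pow (R - {a}) - {{}}"
      then have "finite A" "A \<noteq> {}" using fR by (auto intro: finite_subset)
      then show "(\<Sum>i\<in>A. - ((- 1) ^ card A * con (B a i * path_from i (A - {i})) * stars (insert a A))) =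
         - ((- 1) ^ card A * con (path_from a A) * stars (insert a A))"
        by (simp add: path_from_rec[of A a] con_sum sum_negf sum_distrib_left sum_distrib_right)
    qed
    also have "\<dots> = - (?W a - star a)"
    proof -
      have "?W a = star a + (\<Sum>A\<in>Pow (R - {a}) - {{}}. (- 1) ^ card A * con (path_from a A) * stars (insert a A))"
        using sum.remove[of "Pow (R - {a})" "{}" "\<lambda>A. (- 1) ^ card A * con (path_from a A) * stars (insert a A)"] fR a V
          stars_singleton[of a] by (auto simp: path_from_def con_arith)
      then show ?thesis by (simp add: sum_negf)
    qed
    finally show ?thesis by simp
  qed
  have "(\<lambda>a. X a - ?W a) a = 0"
  proof (rule family_fixpoint_zero[of R star])
    fix a assume a: "a \<in> R"
    show "X a - ?W a = (\<Sum>i\<in>R. con (- B a i) * (X i - ?W i)) * star a"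
    proof -
      have "X a - ?W a = (\<Sum>i\<in>R. con (B a i) * ?W i) * star a - (\<Sum>i\<in>R. con (B a i) * X i) * star a"
        by (subst X_star[OF a], subst W[OF a]) simp
      also have "\<dots> = (\<Sum>i\<in>R. con (- B a i) * (X i - ?W i)) * star a"
        unfolding left_diff_distrib[symmetric] sum_subtractf[symmetric]
        by (intro arg_cong2[of _ _ _ _ times] sum.cong refl) (simp add: con_arith(3) right_diff_distrib)
      finally show ?thesis .
    qed
  qed (use a has_star[THEN has_empty] in auto)
  then show ?thesis by simp
qed

text \<open>Collecting the paths by their set \<open>A\<close> of rows produces
  \<open>path_sum A\<close> as coefficient of \<open>stars A\<close>, and it survives only if
  \<open>A\<close> is a singleton.\<close>

theorem tree_sum_eq_star_sum: "(\<Sum>a\<in>R. X a) = (\<Sum>a\<in>R. star a)"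
proof -
  have fR: "finite R" using fin V by (metis finite_Un)
  let ?g = "\<lambda>A a. con (path_from a (A - {a})) * ((- 1) ^ (card A - 1) * stars A)"
  have "(\<Sum>a\<in>R. X a) = (\<Sum>a\<in>R. \<Sum>A\<in>Pow (R - {a}). (- 1) ^ card A * con (path_from a A) * stars (insert a A))"
    by (intro sum.cong refl X_paths)
  also have "\<dots> = (\<Sum>(a, A)\<in>(SIGMA a:R. Pow (R - {a})). (- 1) ^ card A * con (path_from a A) * stars (insert a A))"
    using fR by (intro sum.Sigma) auto
  also have "\<dots> = (\<Sum>(A, a)\<in>(SIGMA A:Pow R - {{}}. A). ?g A a)"
  proof (rule sum.reindex_bij_witness[of _ "\<lambda>(A, a). (a, A - {a})" "\<lambda>(a, A). (insert a A, a)"], goal_cases)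
    case (5 p)
    then obtain a A where p: "p = (a, A)" "a \<in> R" "A \<subseteq> R - {a}" by auto
    then have "finite A" "a \<notin> A" using finite_subset[of A R] fR by auto
    moreover have "(- 1) ^ card A * con (path_from a A) * f = con (path_from a A) * ((- 1) ^ card A * f)"
      for f :: "('v, 'r) sqf"
      by (cases "even (card A)") simp_all
    ultimately show ?case using p by simp
  qed auto
  also have "\<dots> = (\<Sum>A\<in>Pow R - {{}}. \<Sum>a\<in>A. ?g A a)"
    using fR by (intro sum.Sigma[symmetric]) (auto intro: finite_subset)
  also have "\<dots> = (\<Sum>A\<in>Pow R - {{}}. if card A = 1 then stars A else 0)"
  proof (rule sum.cong[OF refl])
    fix A assume A: "A \<in> Pow R - {{}}"
    then have "finite A" "A \<noteq> {}" "A \<subseteq> V" using fR V by (auto intro: finite_subset)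
    then have "(\<Sum>a\<in>A. path_from a (A - {a})) = (if card A = 1 then 1 else 0)"
      using path_sum_from path_sum_eq by metis
    then show "(\<Sum>a\<in>A. ?g A a) = (if card A = 1 then stars A else 0)"
      unfolding sum_distrib_right[symmetric] con_sum[symmetric] by (simp add: con_arith)
  qed
  also have "\<dots> = (\<Sum>A\<in>(\<lambda>a. {a}) ` R. stars A)"
    by (rule sum.mono_neutral_cong_right) (use fR in \<open>auto simp: card_Suc_eq\<close>)
  also have "\<dots> = (\<Sum>a\<in>R. star a)"
  proof -
    have "R \<subseteq> V" using V by blast
    then show ?thesis by (subst sum.reindex) (auto intro!: sum.cong stars_singleton)
  qed
  finally show ?thesis .
qed

end

section \<open>Labelings up to commutation\<close>

primrec bef :: "'a list \<Rightarrow> 'a \<Rightarrow> 'a \<Rightarrow> bool" where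
  "bef [] x y \<longleftrightarrow> False"
| "bef (z # l) x y \<longleftrightarrow> z = x \<and> y \<in> set l \<or> bef l x y"

lemma bef_append: "bef (u @ v) x y \<longleftrightarrow> bef u x y \<or> bef v x y \<or> x \<in> set u \<and> y \<in> set v"
  by (induction u) auto

lemma bef_in_set: "bef l x y \<Longrightarrow> x \<in> set l \<and> y \<in> set l"
  by (induction l) auto

lemma bef_asym: "distinct l \<Longrightarrow> bef l x y \<Longrightarrow> \<not> bef l y x"
  by (induction l) (auto dest: bef_in_set)

lemma bef_total: "x \<in> set l \<Longrightarrow> y \<in> set l \<Longrightarrow> x \<noteq> y \<Longrightarrow> bef l x y \<or> bef l y x"
  by (induction l) auto

lemma bef_filter: "bef (filter P l) x y \<longleftrightarrow> P x \<and> P y \<and> bef l x y"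
  by (induction l) (auto dest: bef_in_set)

lemma bef_map: "inj f \<Longrightarrow> bef (map f l) (f x) (f y) \<longleftrightarrow> bef l x y"
  by (induction l) (auto simp: inj_eq inj_image_mem_iff)

lemma bef_rev: "bef (rev l) x y \<longleftrightarrow> bef l y x"
  by (induction l) (auto simp: bef_append)

definition meets :: "'v \<times> 'v \<Rightarrow> 'v \<times> 'v \<Rightarrow> bool" where
  "meets e e' \<longleftrightarrow> {fst e, snd e} \<inter> {fst e', snd e'} \<noteq> {}"

text \<open>Equivalence of words under partial commutation, for words without repeated letters: only
  the order of letters that share a vertex matters. Unlike the chains of swaps in
  \<open>lab_equiv\<close>, it can be checked pair by pair.\<close>

definition teq :: "('v \<times> 'v) list \<Rightarrow> ('v \<times> 'v) list \<Rightarrow> bool" where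
  "teq L L' \<longleftrightarrow> distinct L \<and> distinct L' \<and> set L = set L' \<and>
     (\<forall>e e'. meets e e' \<longrightarrow> bef L e e' = bef L' e e')"

lemma meets_sym: "meets e e' \<longleftrightarrow> meets e' e"
  by (auto simp: meets_def)

text \<open>Letters of a word without repetitions are totally ordered, so preserving the order of
  meeting letters in one direction forces the converse.\<close>

lemma teqI:
  fixes L L' :: "('v \<times> 'v) list"
  assumes "distinct L" "distinct L'" "set L = set L'"
    and "\<And>e e'. meets e e' \<Longrightarrow> bef L e e' \<Longrightarrow> bef L' e e'"
  shows "teq L L'"
  unfolding teq_def
proof (intro conjI allI impI assms(1-3))
  fix e e' :: "'v \<times> 'v" assume m: "meets e e'"
  show "bef L e e' = bef L' e e'"
  proof
    assume b: "bef L' e e'"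
    then have "e \<noteq> e'" "e \<in> set L" "e' \<in> set L" using bef_asym[OF assms(2) b] b bef_in_set[OF b] assms(3) by auto
    then show "bef L e e'"
      using bef_total[of e L e'] assms(4)[of e' e] m meets_sym bef_asym[OF assms(2) b] by blast
  qed (use assms(4) m in blast)
qed

lemma teq_refl: "distinct L \<Longrightarrow> teq L L"
  by (simp add: teq_def)

lemma teq_sym: "teq L L' \<Longrightarrow> teq L' L"
  by (auto simp: teq_def)

lemma teq_trans: "teq L L' \<Longrightarrow> teq L' L'' \<Longrightarrow> teq L L''"
  by (auto simp: teq_def)

lemma teq_filter: "teq L L' \<Longrightarrow> teq (filter P L) (filter P L')"
  by (auto simp: teq_def bef_filter)

lemma swap_step_iff:
  "swap_step L L' \<longleftrightarrow> (\<exists>xs ys e e'. L = xs @ [e, e'] @ ys \<and> L' = xs @ [e', e] @ ys \<and> \<not> meets e e')"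
  unfolding swap_step_def meets_def by (simp only: split_paired_Ex fst_conv snd_conv not_not)

lemma lab_equiv_trans: "lab_equiv L L' \<Longrightarrow> lab_equiv L' L'' \<Longrightarrow> lab_equiv L L''"
  by (simp add: lab_equiv_def)

lemma lab_equiv_Cons: "lab_equiv l l' \<Longrightarrow> lab_equiv (x # l) (x # l')"
  unfolding lab_equiv_def
proof (induction rule: rtranclp_induct)
  case (step y z)
  then obtain xs ys e e' where "y = xs @ [e, e'] @ ys" "z = xs @ [e', e] @ ys" "\<not> meets e e'"
    unfolding swap_step_iff by blast
  then have "swap_step (x # y) (x # z)"
    unfolding swap_step_iff by (intro exI[of _ "x # xs"] exI[of _ ys] exI[of _ e] exI[of _ e']) simp
  then show ?case using step by simp
qed simp

lemma lab_equiv_teq: "distinct L \<Longrightarrow> lab_equiv L L' \<Longrightarrow> teq L L'"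
  unfolding lab_equiv_def
proof (rotate_tac, induction rule: rtranclp_induct)
  case (step L' L'')
  then have t: "teq L L'" by simp
  obtain xs ys e e' where s: "L' = xs @ [e, e'] @ ys" "L'' = xs @ [e', e] @ ys" "\<not> meets e e'"
    using step(2) unfolding swap_step_iff by blast
  have "teq L' L''"
    by (rule teqI) (use t s in \<open>auto simp: teq_def bef_append meets_sym\<close>)
  then show ?case using t teq_trans by blast
qed (rule teq_refl)

lemma lab_equiv_bubble: "(\<And>y. y \<in> set p \<Longrightarrow> \<not> meets x y) \<Longrightarrow> lab_equiv (x # p @ q) (p @ x # q)"
proof (induction p)
  case (Cons y p)
  then have "swap_step (x # y # p @ q) (y # x # p @ q)"
    unfolding swap_step_iff
    by (intro exI[of _ "[]"] exI[of _ "p @ q"] exI[of _ x] exI[of _ y]) simp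
  then have "lab_equiv (x # y # p @ q) (y # x # p @ q)" by (simp add: lab_equiv_def)
  moreover have "lab_equiv (y # x # p @ q) (y # p @ x # q)" using Cons by (intro lab_equiv_Cons) auto
  ultimately show ?case using lab_equiv_trans by auto
qed (simp add: lab_equiv_def)

text \<open>The first letter of \<open>L\<close> meets none of the letters in front of it in
  \<open>L'\<close>, so swaps bring it to the front there, and the tails are compared by
  induction.\<close>

lemma teq_lab_equiv: "teq L L' \<Longrightarrow> lab_equiv L L'"
proof (induction L arbitrary: L')
  case Nil
  then show ?case by (simp add: teq_def lab_equiv_def)
next
  case (Cons x l)
  then have d: "distinct (x # l)" "distinct L'" "set L' = insert x (set l)"
    by (auto simp: teq_def)
  have b: "\<And>e e'. meets e e' \<Longrightarrow> bef (x # l) e e' = bef L' e e'"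
    using Cons.prems unfolding teq_def by blast
  obtain p q where L': "L' = p @ x # q" using d(3) by (metis insertI1 split_list)
  have "\<not> meets x y" if y: "y \<in> set p" for y
  proof
    assume "meets x y"
    then have "bef (x # l) y x = bef L' y x" using b meets_sym by blast
    moreover have "bef L' y x" using y by (simp add: L' bef_append)
    ultimately show False using d L' y by (auto dest: bef_in_set)
  qed
  then have 1: "lab_equiv (x # p @ q) L'" unfolding L' by (rule lab_equiv_bubble)
  have "teq l (p @ q)"
    unfolding teq_def
  proof (intro conjI allI impI)
    fix e e' :: "int \<times> int" assume "meets e e'"
    from b[OF this] show "bef l e e' = bef (p @ q) e e'"
      using d L' by (auto simp: bef_append dest: bef_in_set)
  qed (use d L' in auto)
  then have "lab_equiv (x # l) (x # p @ q)" using Cons.IH lab_equiv_Cons by blast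
  then show ?case using 1 lab_equiv_trans by blast
qed

section \<open>Words of rooted plane trees\<close>

text \<open>Depth-first words: the branch of a child column stands before the letter that attaches
  it, the branch of a child row after it. At a row root the cut is made at the first letter of the
  root, at a column root at the last one. Consequently the letter to the parent is the first one at
  a row and the last one at a column.\<close>

inductive rtree :: "('v \<Rightarrow> bool) \<Rightarrow> 'v \<Rightarrow> 'v set \<Rightarrow> ('v \<times> 'v) list \<Rightarrow> bool" for row where
  leaf: "rtree row x {x} []"
| row: "row i \<Longrightarrow> \<not> row j \<Longrightarrow> rtree row j S v \<Longrightarrow> rtree row i T w \<Longrightarrow> S \<inter> T = {} \<Longrightarrow>
    rtree row i (S \<union> T) (v @ (i, j) # w)"
| col: "row i \<Longrightarrow> \<not> row j \<Longrightarrow> rtree row j S v \<Longrightarrow> rtree row i T w \<Longrightarrow> S \<inter> T = {} \<Longrightarrow>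
    rtree row j (S \<union> T) (v @ (i, j) # w)"

lemma rtree_finite: "rtree row x S u \<Longrightarrow> finite S"
  by (induction rule: rtree.induct) auto

lemma rtree_root: "rtree row x S u \<Longrightarrow> x \<in> S"
  by (induction rule: rtree.induct) auto

lemma rtree_letters: "rtree row x S u \<Longrightarrow> e \<in> set u \<Longrightarrow> fst e \<in> S \<and> snd e \<in> S \<and> row (fst e) \<and> \<not> row (snd e)"
  by (induction arbitrary: e rule: rtree.induct) (auto dest: rtree_root)

lemma rtree_distinct: "rtree row x S u \<Longrightarrow> distinct u"
proof (induction rule: rtree.induct)
  case (row i j S v T w)
  have "e \<notin> set w" if "e \<in> set v" for e using that row rtree_letters by (metis disjoint_iff)
  moreover have "(i, j) \<notin> set v" "(i, j) \<notin> set w"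
    using row rtree_letters rtree_root by (metis disjoint_iff fst_conv, metis disjoint_iff snd_conv)
  ultimately show ?case using row by auto
next
  case (col i j S v T w)
  have "e \<notin> set w" if "e \<in> set v" for e using that col rtree_letters by (metis disjoint_iff)
  moreover have "(i, j) \<notin> set v" "(i, j) \<notin> set w"
    using col rtree_letters rtree_root by (metis disjoint_iff fst_conv, metis disjoint_iff snd_conv)
  ultimately show ?case using col by auto
qed simp

lemma rtree_card: "rtree row x S u \<Longrightarrow> card S = Suc (length u)"
  by (induction rule: rtree.induct) (simp_all add: card_Un_disjoint rtree_finite)

lemma rtree_set: "rtree row x S u \<Longrightarrow> S = insert x (fst ` set u \<union> snd ` set u)"
  by (induction rule: rtree.induct) auto

text \<open>All vertices are linked to the root by letters, so the vertex set is the smallest set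
  that contains the root and never separates the ends of a letter. This characterizes a branch
  without reference to the order of its letters.\<close>

lemma rtree_closed:
  "rtree row x S u \<Longrightarrow> x \<in> X \<Longrightarrow> (\<And>e. e \<in> set u \<Longrightarrow> fst e \<in> X \<longleftrightarrow> snd e \<in> X) \<Longrightarrow> S \<subseteq> X"
proof (induction rule: rtree.induct)
  case (row i j S v T w)
  then have "j \<in> X" by (metis fst_conv in_set_conv_decomp snd_conv)
  then show ?case using row by auto
next
  case (col i j S v T w)
  then have "i \<in> X" by (metis fst_conv in_set_conv_decomp snd_conv)
  then show ?case using col by auto
qed simp

text \<open>Reversing a word and exchanging rows with columns turns the case of a column root into that of a row root.\<close>

definition dual :: "('v \<times> 'v) list \<Rightarrow> ('v \<times> 'v) list" where
  "dual u = rev (map prod.swap u)"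

lemma dual_simps [simp]:
  "dual (dual u) = u" "set (dual u) = prod.swap ` set u" "dual [] = []" "length (dual u) = length u"
  "dual (v @ (i, j) # w) = dual w @ (j, i) # dual v" "distinct (dual u) = distinct u"
  by (auto simp: dual_def rev_map comp_def distinct_map)

lemma bef_dual: "bef (dual u) e e' \<longleftrightarrow> bef u (prod.swap e') (prod.swap e)"
  using bef_map[of prod.swap "rev u" "prod.swap e" "prod.swap e'"]
  by (simp add: dual_def rev_map[symmetric] bef_rev)

lemma teq_dual: "teq u u' \<Longrightarrow> teq (dual u) (dual u')"
  by (auto simp: teq_def bef_dual meets_def)

lemma rtree_dual: "rtree row x S u \<Longrightarrow> rtree (\<lambda>s. \<not> row s) x S (dual u)"
proof (induction rule: rtree.induct)
  case (row i j S v T w)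
  then show ?case using rtree.col[of "\<lambda>s. \<not> row s" j i T "dual w" S "dual v"] by (simp add: Un_commute Int_commute)
next
  case (col i j S v T w)
  then show ?case using rtree.row[of "\<lambda>s. \<not> row s" j i T "dual w" S "dual v"] by (simp add: Un_commute Int_commute)
qed (simp add: rtree.leaf)

text \<open>The first letter at a row root is the same in equivalent words. It determines the branch
  that it attaches as a set of vertices, and filtering by this set recovers equivalent words for the
  two parts, to which induction applies.\<close>

lemma rtree_inj:
  "rtree row x S u \<Longrightarrow> rtree row x S' u' \<Longrightarrow> teq u u' \<Longrightarrow> u = u'"
proof (induction "length u" arbitrary: row x S u S' u' rule: less_induct)
  case less
  have main: "u1 = u2" if x: "row x" and u1: "rtree row x S u1" and u2: "rtree row x S' u2" and t: "teq u1 u2"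
    and len: "length u1 = length u" for row u1 u2
  proof (cases "u1 = []")
    case True
    then show ?thesis using t by (simp add: teq_def)
  next
    case False
    then have "u2 \<noteq> []" using t by (auto simp: teq_def)
    from u1 False x obtain j S1 v T1 w where 1: "u1 = v @ (x, j) # w"
        "\<not> row j" "rtree row j S1 v" "rtree row x T1 w" "S1 \<inter> T1 = {}"
      by (cases rule: rtree.cases) auto
    from u2 \<open>u2 \<noteq> []\<close> x obtain j' S2 v' T2 w' where 2: "u2 = v' @ (x, j') # w'"
        "\<not> row j'" "rtree row j' S2 v'" "rtree row x T2 w'" "S2 \<inter> T2 = {}"
      by (cases rule: rtree.cases) auto
    have b: "\<And>e e'. meets e e' \<Longrightarrow> bef u1 e e' = bef u2 e e'" and d: "distinct u1" "distinct u2" and s: "set u1 = set u2"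
      using t unfolding teq_def by blast+
    have r: "j \<in> S1" "x \<in> T1" "j' \<in> S2" "x \<in> T2" using rtree_root 1 2 by metis+
    have v: "fst e \<in> S1" "snd e \<in> S1" "fst e \<notin> T1" "snd e \<notin> T1" if "e \<in> set v" for e
      using rtree_letters[OF 1(3) that] 1(5) by auto
    have w: "fst e \<in> T1" "snd e \<in> T1" "fst e \<notin> S1" "snd e \<notin> S1" if "e \<in> set w" for e
      using rtree_letters[OF 1(4) that] 1(5) by auto
    have v': "fst e \<in> S2" "snd e \<in> S2" "fst e \<notin> T2" "snd e \<notin> T2" if "e \<in> set v'" for e
      using rtree_letters[OF 2(3) that] 2(5) by auto
    have w': "fst e \<in> T2" "snd e \<in> T2" "fst e \<notin> S2" "snd e \<notin> S2" if "e \<in> set w'" for e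
      using rtree_letters[OF 2(4) that] 2(5) by auto
    have xv: "(x, y) \<notin> set v" "(x, y) \<notin> set v'" for y using v(3)[of "(x, y)"] v'(3)[of "(x, y)"] r by auto
    have j: "j' = j"
    proof (rule ccontr)
      assume ne: "j' \<noteq> j"
      have "(x, j') \<in> set u1" "(x, j) \<in> set u2" using s unfolding 1(1) 2(1) by auto
      then have "(x, j') \<in> set w" "(x, j) \<in> set w'" using ne xv unfolding 1(1) 2(1) by auto
      then have "bef u1 (x, j) (x, j')" "bef u2 (x, j') (x, j)" unfolding 1(1) 2(1) by (auto simp: bef_append)
      moreover have "meets (x, j) (x, j')" by (simp add: meets_def)
      ultimately show False using b bef_asym[OF d(2)] by blast
    qed
    have "S1 \<subseteq> S2"
    proof (rule rtree_closed[OF 1(3)])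
      fix e assume e: "e \<in> set v"
      then have "e \<in> set u2" using s unfolding 1(1) by auto
      moreover have "e \<noteq> (x, j)" using e xv by auto
      ultimately have "e \<in> set v' \<or> e \<in> set w'" using j unfolding 2(1) by auto
      then show "fst e \<in> S2 \<longleftrightarrow> snd e \<in> S2" using v' w' by blast
    qed (use r j in simp)
    moreover have "S2 \<subseteq> S1"
    proof (rule rtree_closed[OF 2(3)])
      fix e assume e: "e \<in> set v'"
      then have "e \<in> set u1" using s unfolding 2(1) by auto
      moreover have "e \<noteq> (x, j)" using e xv by auto
      ultimately have "e \<in> set v \<or> e \<in> set w" unfolding 1(1) by auto
      then show "fst e \<in> S1 \<longleftrightarrow> snd e \<in> S1" using v w by blast
    qed (use r j in simp)
    ultimately have S: "S2 = S1" by blast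
    have "x \<notin> S1" using r 1(5) by auto
    then have "filter (\<lambda>e. fst e \<in> S1) u1 = v" "filter (\<lambda>e. snd e \<notin> S1) u1 = w"
      "filter (\<lambda>e. fst e \<in> S1) u2 = v'" "filter (\<lambda>e. snd e \<notin> S1) u2 = w'"
      using v w v' w' r j unfolding 1(1) 2(1) S by (simp_all add: filter_id_conv filter_empty_conv)
    then have "teq v v'" "teq w w'" using teq_filter[OF t] by metis+
    moreover have "length v < length u" "length w < length u" using len unfolding 1(1) by auto
    ultimately have "v = v'" "w = w'" using less.hyps 1(3,4) 2(3,4) j by blast+
    then show ?thesis unfolding 1(1) 2(1) j by simp
  qed
  show ?case
  proof (cases "row x")
    case True
    then show ?thesis using main less.prems by blast
  next
    case False
    then have "dual u = dual u'"
      using main[OF _ rtree_dual[OF less.prems(1)] rtree_dual[OF less.prems(2)] teq_dual[OF less.prems(3)]] by simp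
    then show ?thesis using dual_simps(1) by metis
  qed
qed

text \<open>
  Every vertex other than the root has a letter leading to its parent. These letters are \<open>PA\<close> for
  the rows and \<open>PB\<close> for the columns.
\<close>

definition parents :: "('v \<Rightarrow> bool) \<Rightarrow> 'v \<Rightarrow> 'v set \<Rightarrow> ('v \<times> 'v) list \<Rightarrow> ('v \<times> 'v) set \<Rightarrow> ('v \<times> 'v) set \<Rightarrow> bool" where
  "parents row x S u PA PB \<longleftrightarrow> set u = PA \<union> PB \<and> PA \<inter> PB = {} \<and>
     inj_on fst PA \<and> fst ` PA = {s \<in> S - {x}. row s} \<and>
     inj_on snd PB \<and> snd ` PB = {s \<in> S - {x}. \<not> row s} \<and>
     (\<forall>e\<in>PA. \<forall>e'\<in>set u. e' \<noteq> e \<longrightarrow> fst e' = fst e \<longrightarrow> bef u e e') \<and>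
     (\<forall>e\<in>PB. \<forall>e'\<in>set u. e' \<noteq> e \<longrightarrow> snd e' = snd e \<longrightarrow> bef u e' e)"

lemma parentsD:
  assumes "parents row x S u PA PB"
  shows "set u = PA \<union> PB" "PA \<inter> PB = {}" "inj_on fst PA" "fst ` PA = {s \<in> S - {x}. row s}"
    "inj_on snd PB" "snd ` PB = {s \<in> S - {x}. \<not> row s}"
    "\<And>e e'. e \<in> PA \<Longrightarrow> e' \<in> set u \<Longrightarrow> e' \<noteq> e \<Longrightarrow> fst e' = fst e \<Longrightarrow> bef u e e'"
    "\<And>e e'. e \<in> PB \<Longrightarrow> e' \<in> set u \<Longrightarrow> e' \<noteq> e \<Longrightarrow> snd e' = snd e \<Longrightarrow> bef u e' e"
  using assms unfolding parents_def by (elim conjE; simp only: simp_thms Ball_def; blast)+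

lemma parents_dual: "parents row x S u PA PB \<Longrightarrow> parents (\<lambda>s. \<not> row s) x S (dual u) (prod.swap ` PB) (prod.swap ` PA)"
proof -
  assume p: "parents row x S u PA PB"
  have "inj_on snd PB" "inj_on fst PA" using p unfolding parents_def by blast+
  then have *: "inj_on fst (prod.swap ` PB)" "inj_on snd (prod.swap ` PA)"
    unfolding inj_on_def by fastforce+
  have "(fst \<circ> prod.swap) = snd" "(snd \<circ> prod.swap) = fst" by auto
  then have **: "fst ` prod.swap ` PB = snd ` PB" "snd ` prod.swap ` PA = fst ` PA" by (metis image_comp)+
  show ?thesis
    using p * unfolding parents_def ** dual_simps
    by (auto simp: bef_dual)
qed

lemma parents_merge:
  assumes ij: "row i" "\<not> row j" and r: "j \<in> S" "i \<in> T" and ST: "S \<inter> T = {}"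
    and v: "\<And>e. e \<in> set v \<Longrightarrow> fst e \<in> S \<and> snd e \<in> S" and w: "\<And>e. e \<in> set w \<Longrightarrow> fst e \<in> T \<and> snd e \<in> T"
    and p: "parents row j S v PA PB" and p': "parents row i T w PA' PB'"
  shows "parents row i (S \<union> T) (v @ (i, j) # w) (PA \<union> PA') (insert (i, j) (PB \<union> PB'))"
proof -
  note P = parentsD[OF p] and P' = parentsD[OF p']
  have a: "e \<in> set v" "fst e \<in> S" "snd e \<in> S" "fst e \<notin> T" "snd e \<notin> T" if "e \<in> PA \<or> e \<in> PB" for e
    using P(1) v[of e] that ST by auto
  have a': "e \<in> set w" "fst e \<in> T" "snd e \<in> T" "fst e \<notin> S" "snd e \<notin> S" if "e \<in> PA' \<or> e \<in> PB'" for e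
    using P'(1) w[of e] that ST by auto
  have j: "snd e \<noteq> j" if "e \<in> PB \<or> e \<in> PB'" for e
  proof (cases "e \<in> PB")
    case True
    then have "snd e \<in> {s \<in> S - {j}. \<not> row s}" using P(6) by blast
    then show ?thesis by simp
  qed (use a'[of e] that r(1) in auto)
  have i: "fst e \<noteq> i" if "e \<in> PA \<or> e \<in> PA'" for e
  proof (cases "e \<in> PA'")
    case True
    then have "fst e \<in> {s \<in> T - {i}. row s}" using P'(4) by blast
    then show ?thesis by simp
  qed (use a[of e] that r(2) in auto)
  have i0: "i \<notin> S" "j \<notin> T" using r ST by auto
  show ?thesis
    unfolding parents_def
  proof (intro conjI)
    show "inj_on fst (PA \<union> PA')" 
    proof -
      have "fst ` PA \<inter> fst ` PA' = {}" unfolding P(4) P'(4) using ST by blast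
      then show ?thesis unfolding inj_on_Un using P(3) P'(3) by blast
    qed
    show "inj_on snd (insert (i, j) (PB \<union> PB'))"
    proof -
      have "snd ` PB \<inter> snd ` PB' = {}" unfolding P(6) P'(6) using ST by blast
      then have "inj_on snd (PB \<union> PB')" unfolding inj_on_Un using P(5) P'(5) by blast
      moreover have "j \<notin> snd ` (PB \<union> PB')" using j by auto
      ultimately show ?thesis by auto
    qed
    show "fst ` (PA \<union> PA') = {s \<in> S \<union> T - {i}. row s}"
      unfolding image_Un P(4) P'(4) using ij r i0 by auto
    show "snd ` insert (i, j) (PB \<union> PB') = {s \<in> S \<union> T - {i}. \<not> row s}"
      unfolding image_insert image_Un P(6) P'(6) using ij r i0 by auto
    show "(PA \<union> PA') \<inter> insert (i, j) (PB \<union> PB') = {}"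
    proof -
      have "(i, j) \<notin> PA \<union> PA'" using i[of "(i, j)"] by auto
      moreover have "PA \<inter> PB' = {}" "PA' \<inter> PB = {}" using a(2) a'(4) by blast+
      ultimately show ?thesis using P(2) P'(2) by blast
    qed
    show "set (v @ (i, j) # w) = PA \<union> PA' \<union> insert (i, j) (PB \<union> PB')" using P(1) P'(1) by auto
    show "\<forall>e\<in>PA \<union> PA'. \<forall>e'\<in>set (v @ (i, j) # w). e' \<noteq> e \<longrightarrow> fst e' = fst e \<longrightarrow> bef (v @ (i, j) # w) e e'"
    proof (intro ballI impI)
      fix e e' assume e: "e \<in> PA \<union> PA'" "e' \<in> set (v @ (i, j) # w)" "e' \<noteq> e" "fst e' = fst e"
      have "e' \<noteq> (i, j)" using e i[of e] by auto
      then have "e \<in> PA \<and> e' \<in> set v \<or> e \<in> PA' \<and> e' \<in> set w"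
        using e(1,2,4) a(4)[of e] a'(4)[of e] v[of e'] w[of e'] by auto
      then show "bef (v @ (i, j) # w) e e'" using P(7)[of e e'] P'(7)[of e e'] e(3,4) by (auto simp: bef_append)
    qed
    show "\<forall>e\<in>insert (i, j) (PB \<union> PB'). \<forall>e'\<in>set (v @ (i, j) # w). e' \<noteq> e \<longrightarrow> snd e' = snd e \<longrightarrow> bef (v @ (i, j) # w) e' e"
    proof (intro ballI impI)
      fix e e' assume e: "e \<in> insert (i, j) (PB \<union> PB')" "e' \<in> set (v @ (i, j) # w)" "e' \<noteq> e" "snd e' = snd e"
      have "e' \<noteq> (i, j)" using e j[of e] by auto
      then have "e \<in> PB \<and> e' \<in> set v \<or> e \<in> PB' \<and> e' \<in> set w \<or> e = (i, j) \<and> e' \<in> set v"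
        using e(1,2,4) a(5)[of e] a'(5)[of e] v[of e'] w[of e'] i0 by auto
      then show "bef (v @ (i, j) # w) e' e" using P(8)[of e e'] P'(8)[of e e'] e(3,4) by (auto simp: bef_append)
    qed
  qed
qed

lemma rtree_parents: "rtree row x S u \<Longrightarrow> \<exists>PA PB. parents row x S u PA PB"
proof (induction rule: rtree.induct)
  case (leaf x)
  show ?case by (rule exI[of _ "{}"], rule exI[of _ "{}"]) (auto simp: parents_def)
next
  case (row i j S v T w)
  then obtain PA PB PA' PB' where p: "parents row j S v PA PB" "parents row i T w PA' PB'" by blast
  from parents_merge[OF row.hyps(1,2) _ _ row.hyps(5) _ _ p] show ?case
    using rtree_root rtree_letters row.hyps(3,4) by metis
next
  case (col i j S v T w)
  then obtain PA PB PA' PB' where p: "parents row j S v PA PB" "parents row i T w PA' PB'" by blast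
  let ?row = "\<lambda>s. \<not> row s"
  have "parents ?row j (T \<union> S) (dual w @ (j, i) # dual v) (prod.swap ` PB' \<union> prod.swap ` PB)
      (insert (j, i) (prod.swap ` PA' \<union> prod.swap ` PA))"
  proof (rule parents_merge[OF _ _ _ _ _ _ _ parents_dual[OF p(2)] parents_dual[OF p(1)]])
    show "i \<in> T" "j \<in> S" using rtree_root col.hyps by metis+
    show "fst e \<in> T \<and> snd e \<in> T" if "e \<in> set (dual w)" for e
      using rtree_letters[OF col.hyps(4)] that by auto
    show "fst e \<in> S \<and> snd e \<in> S" if "e \<in> set (dual v)" for e
      using rtree_letters[OF col.hyps(3)] that by auto
  qed (use col.hyps in auto)
  from parents_dual[OF this] show ?case by (auto simp: Un_commute)
qed

text \<open>If \<open>r'\<close> were not the root of \<open>u\<close>, its parent letter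
  \<open>e\<close> in \<open>u\<close> would lead to a column that has a different parent letter
  \<open>e2\<close>, last at that column, so \<open>e\<close> precedes \<open>e2\<close>. In
  \<open>u'\<close> the row \<open>r'\<close> is the root, so \<open>e\<close> must be the parent
  letter of the column and come last there: a contradiction.\<close>

lemma rtree_root_unique:
  assumes u: "rtree row r S u" "row r" and u': "rtree row r' S u'" "row r'" and t: "teq u u'"
  shows "r = r'"
proof (rule ccontr)
  assume ne: "r \<noteq> r'"
  obtain PA PB where p: "parents row r S u PA PB" using rtree_parents[OF u(1)] by blast
  obtain PA' PB' where p': "parents row r' S u' PA' PB'" using rtree_parents[OF u'(1)] by blast
  note P = parentsD[OF p] and P' = parentsD[OF p'] and T = t[unfolded teq_def]
  have "r' \<in> {s \<in> S - {r}. row s}" using rtree_root[OF u'(1)] ne u' by auto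
  then obtain e where e: "e \<in> PA" "fst e = r'" unfolding P(4)[symmetric] by auto
  then have eu: "e \<in> set u" using P(1) by blast
  then have "snd e \<in> {s \<in> S - {r}. \<not> row s}" using rtree_letters[OF u(1) eu] u(2) by auto
  then obtain e2 where e2: "e2 \<in> PB" "snd e2 = snd e" unfolding P(6)[symmetric] by auto
  then have ne2: "e2 \<noteq> e" using e P(2) by blast
  then have b: "bef u e e2" using P(8) e2 eu by metis
  moreover have "meets e e2" using e2(2) by (simp add: meets_def)
  ultimately have b': "bef u' e e2" using T by blast
  have "e \<in> PA' \<union> PB'" using eu T P'(1) by blast
  moreover have "e \<notin> PA'" using P'(4) e(2) by blast
  ultimately have "e \<in> PB'" by blast
  then have "bef u' e2 e" using P'(8) e2(2) bef_in_set[OF b'] ne2 by metis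
  moreover have "distinct u'" using T by blast
  ultimately show False using b' bef_asym by metis
qed

section \<open>Recognizing plane trees by their parent letters\<close>

definition par :: "('v \<times> 'v) set \<Rightarrow> ('v \<times> 'v) set \<Rightarrow> 'v \<Rightarrow> 'v \<Rightarrow> bool" where
  "par PA PB s t \<longleftrightarrow> (s, t) \<in> PA \<or> (t, s) \<in> PB"

text \<open>The features of a depth-first word that survive partial commutation: first and last
  letters at the vertices, and the ancestor relation. Murnaghan-Nakayama labelings can be checked
  against this directly.\<close>

definition ptree :: "('v \<Rightarrow> bool) \<Rightarrow> 'v \<Rightarrow> 'v set \<Rightarrow> ('v \<times> 'v) list \<Rightarrow> ('v \<times> 'v) set \<Rightarrow> ('v \<times> 'v) set \<Rightarrow> bool" where
  "ptree row x S u PA PB \<longleftrightarrow> finite S \<and> x \<in> S \<and> distinct u \<and>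
     (\<forall>e\<in>set u. fst e \<in> S \<and> snd e \<in> S \<and> row (fst e) \<and> \<not> row (snd e)) \<and>
     parents row x S u PA PB \<and> (\<forall>s\<in>S. (par PA PB)\<^sup>*\<^sup>* s x)"

lemma ptreeD:
  assumes "ptree row x S u PA PB"
  shows "finite S" "x \<in> S" "distinct u"
    "\<And>e. e \<in> set u \<Longrightarrow> fst e \<in> S \<and> snd e \<in> S \<and> row (fst e) \<and> \<not> row (snd e)"
    "parents row x S u PA PB" "\<And>s. s \<in> S \<Longrightarrow> (par PA PB)\<^sup>*\<^sup>* s x"
  using assms by (simp_all add: ptree_def)

lemma ptree_dual: "ptree row x S u PA PB \<Longrightarrow> ptree (\<lambda>s. \<not> row s) x S (dual u) (prod.swap ` PB) (prod.swap ` PA)"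
proof -
  assume p: "ptree row x S u PA PB"
  have "par (prod.swap ` PB) (prod.swap ` PA) = par PA PB"
    by (force simp: par_def fun_eq_iff image_iff)
  then show ?thesis using p parents_dual[OF ptreeD(5)[OF p]] by (auto simp: ptree_def)
qed

text \<open>Letters run from rows to columns, so a row can find its parent only through
  \<open>PA\<close> and a column only through \<open>PB\<close>, and both are injective
  there.\<close>

lemma par_unique:
  assumes "inj_on fst PA" "inj_on snd PB" "\<And>e. e \<in> PA \<union> PB \<Longrightarrow> row (fst e) \<and> \<not> row (snd e)"
    and "par PA PB s t" "par PA PB s t'"
  shows "t = t'"
  using assms(3)[of "(s, t)"] assms(3)[of "(t, s)"] assms(3)[of "(s, t')"] assms(3)[of "(t', s)"] assms(4,5)
    inj_onD[OF assms(1), of "(s, t)" "(s, t')"] inj_onD[OF assms(2), of "(t, s)" "(t', s)"]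
  by (auto simp: par_def)

text \<open>The word is cut at the first letter \<open>(x, j)\<close> of the root. The branch
  \<open>S1\<close> consists of the descendants of \<open>j\<close>, and the words of the two parts
  are obtained by filtering, which keeps the order within each part.\<close>

lemma ptree_split:
  assumes p: "ptree row x S u PA PB" and x: "row x" and ne: "S \<noteq> {x}"
  obtains j S1 v w PA1 PB1 PA2 PB2 where "\<not> row j" "(x, j) \<in> set u" "S1 \<subseteq> S" "j \<in> S1" "x \<notin> S1"
    "ptree row j S1 v PA1 PB1" "ptree row x (S - S1) w PA2 PB2" "set u = insert (x, j) (set v \<union> set w)"
    "\<And>e e'. e \<in> set v \<Longrightarrow> e' \<in> set v \<Longrightarrow> bef u e e' \<Longrightarrow> bef v e e'"
    "\<And>e e'. e \<in> set w \<Longrightarrow> e' \<in> set w \<Longrightarrow> bef u e e' \<Longrightarrow> bef w e e'"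
    "\<And>e. e \<in> set v \<Longrightarrow> snd e = j \<Longrightarrow> bef u e (x, j)"
    "\<And>e. e \<in> set w \<Longrightarrow> fst e = x \<Longrightarrow> bef u (x, j) e"
proof -
  note D = ptreeD[OF p]
  note P = parentsD[OF D(5)]
  have row: "row (fst e) \<and> \<not> row (snd e)" if "e \<in> PA \<union> PB" for e using D(4)[of e] that P(1) by blast
  have uniq: "t = t'" if "par PA PB s t" "par PA PB s t'" for s t t'
    by (rule par_unique[OF P(3,5) _ that, of row]) (rule row)
  have root: "\<not> par PA PB x t" for t
  proof
    assume "par PA PB x t"
    then have "x \<in> fst ` PA \<or> x \<in> snd ` PB" unfolding par_def by force
    then show False unfolding P(4,6) by simp
  qed
  obtain s where s: "s \<in> S" "s \<noteq> x" using ne D(2) by blast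
  from D(6)[OF s(1)] s(2) obtain t where "par PA PB t x" by (metis rtranclp.cases)
  then have "(x, t) \<in> PB" using row[of "(t, x)"] x by (auto simp: par_def)
  then have "(x, t) \<in> set (filter (\<lambda>e. fst e = x) u)" using P(1) by auto
  \<comment> \<open>The root has a child, hence a letter; the first one is chosen to match the rule
    for row roots in \<open>rtree\<close>.\<close>
  then obtain e0 es where es: "filter (\<lambda>e. fst e = x) u = e0 # es" by (cases "filter (\<lambda>e. fst e = x) u") auto
  then have "e0 \<in> set (filter (\<lambda>e. fst e = x) u)" by simp
  then have e0: "e0 \<in> set u" "fst e0 = x" by auto
  define j where "j = snd e0"
  have ej: "e0 = (x, j)" using e0 by (simp add: j_def prod_eq_iff)
  have first: "bef u (x, j) e" if "e \<in> set u" "fst e = x" "e \<noteq> (x, j)" for e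
  proof -
    have "e \<in> set (filter (\<lambda>e. fst e = x) u)" using that by simp
    then have "e \<in> set es" using that es ej by auto
    then have "bef (filter (\<lambda>e. fst e = x) u) (x, j) e" unfolding es ej by simp
    then show ?thesis by (simp add: bef_filter)
  qed
  have "(x, j) \<notin> PA"
  proof
    assume "(x, j) \<in> PA"
    then have "x \<in> fst ` PA" by (metis fst_conv image_eqI)
    then show False unfolding P(4) by simp
  qed
  moreover have "(x, j) \<in> set u" using e0 ej by simp
  ultimately have jB: "(x, j) \<in> PB" unfolding P(1) by simp
  have jr: "\<not> row j" "j \<in> S" using D(4)[OF e0(1)] ej by auto
  define S1 where "S1 = {s \<in> S. (par PA PB)\<^sup>*\<^sup>* s j}"
  have jS: "j \<in> S1" using jr by (simp add: S1_def)
  have step: "t \<in> S1" if "s \<in> S1" "s \<noteq> j" "par PA PB s t" for s t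
  proof -
    from that obtain t' where "par PA PB s t'" "(par PA PB)\<^sup>*\<^sup>* t' j"
      unfolding S1_def by (metis (mono_tags, lifting) converse_rtranclpE mem_Collect_eq)
    moreover have "t \<in> S" using that(3) D(4)[of "(s, t)"] D(4)[of "(t, s)"] P(1) by (auto simp: par_def)
    ultimately show ?thesis using uniq[OF that(3)] by (simp add: S1_def)
  qed
  have step': "s \<in> S1" if "t \<in> S1" "par PA PB s t" for s t
  proof -
    have "s \<in> S" using that(2) D(4)[of "(s, t)"] D(4)[of "(t, s)"] P(1) by (auto simp: par_def)
    then show ?thesis using that by (auto simp: S1_def intro: converse_rtranclp_into_rtranclp)
  qed
  have xS: "x \<notin> S1"
  proof
    assume "x \<in> S1"
    then have "(par PA PB)\<^sup>*\<^sup>* x j" "x \<noteq> j" using x jr by (auto simp: S1_def)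
    then show False using root by (metis converse_rtranclpE)
  qed
  \<comment> \<open>Every letter joins a vertex to its parent, and \<open>(x, j)\<close> is the only
    one that leads from a descendant of \<open>j\<close> to a vertex that is none.\<close>
  have clos: "fst e \<in> S1 \<longleftrightarrow> snd e \<in> S1" if e: "e \<in> set u" "e \<noteq> (x, j)" for e
  proof (cases "e \<in> PA")
    case True
    then have "par PA PB (fst e) (snd e)" by (simp add: par_def)
    moreover have "fst e \<noteq> j" using D(4)[OF e(1)] jr by auto
    ultimately show ?thesis using step step' by metis
  next
    case False
    then have eB: "e \<in> PB" using e P(1) by blast
    then have "par PA PB (snd e) (fst e)" by (simp add: par_def)
    moreover have "snd e \<noteq> j" using inj_onD[OF P(5), of e "(x, j)"] eB jB e(2) by auto
    ultimately show ?thesis using step step' by metis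
  qed
  define v where "v = filter (\<lambda>e. fst e \<in> S1) u"
  define w where "w = filter (\<lambda>e. snd e \<notin> S1) u"
  define PA1 where "PA1 = {e \<in> PA. fst e \<in> S1}"
  define PB1 where "PB1 = {e \<in> PB. fst e \<in> S1}"
  define PA2 where "PA2 = {e \<in> PA. snd e \<notin> S1}"
  define PB2 where "PB2 = {e \<in> PB. snd e \<notin> S1}"
  have v: "e \<in> set u" "fst e \<in> S1" "snd e \<in> S1" "e \<noteq> (x, j)" if "e \<in> set v" for e
  proof -
    show 1: "e \<in> set u" "fst e \<in> S1" using that by (auto simp: v_def)
    then show 2: "e \<noteq> (x, j)" using xS by auto
    show "snd e \<in> S1" using clos[OF 1(1) 2] 1(2) by simp
  qed
  have w: "e \<in> set u" "fst e \<notin> S1" "snd e \<notin> S1" "e \<noteq> (x, j)" if "e \<in> set w" for e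
  proof -
    show 1: "e \<in> set u" "snd e \<notin> S1" using that by (auto simp: w_def)
    then show 2: "e \<noteq> (x, j)" using jS by auto
    show "fst e \<notin> S1" using clos[OF 1(1) 2] 1(2) by simp
  qed
  have uvw: "set u = insert (x, j) (set v \<union> set w)"
  proof
    show "set u \<subseteq> insert (x, j) (set v \<union> set w)" using clos by (auto simp: v_def w_def)
    show "insert (x, j) (set v \<union> set w) \<subseteq> set u" using e0 ej by (auto simp: v_def w_def)
  qed
  have p1: "parents row j S1 v PA1 PB1"
    unfolding parents_def
  proof (intro conjI ballI impI)
    show "set v = PA1 \<union> PB1" using P(1) by (auto simp: v_def PA1_def PB1_def)
    show "PA1 \<inter> PB1 = {}" using P(2) by (auto simp: PA1_def PB1_def)
    show "inj_on fst PA1" "inj_on snd PB1" using P(3,5) by (auto simp: PA1_def PB1_def inj_on_def)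
    have "fst ` PA1 = fst ` PA \<inter> S1" by (auto simp: PA1_def)
    also have "\<dots> = {s \<in> S1 - {j}. row s}" unfolding P(4) using xS jr by (auto simp: S1_def)
    finally show "fst ` PA1 = {s \<in> S1 - {j}. row s}" .
    have "PB1 = {e \<in> PB. snd e \<in> S1 - {j}}"
    proof (intro equalityI subsetI)
      fix e assume "e \<in> PB1"
      then have e: "e \<in> PB" "fst e \<in> S1" "e \<noteq> (x, j)" using xS by (auto simp: PB1_def)
      then have "snd e \<noteq> j" using inj_onD[OF P(5), of e "(x, j)"] jB by auto
      then show "e \<in> {e \<in> PB. snd e \<in> S1 - {j}}" using e clos[of e] P(1) by simp
    next
      fix e assume e: "e \<in> {e \<in> PB. snd e \<in> S1 - {j}}"
      then have "e \<noteq> (x, j)" by auto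
      then show "e \<in> PB1" using e clos[of e] P(1) by (simp add: PB1_def)
    qed
    then have "snd ` PB1 = snd ` PB \<inter> (S1 - {j})" by auto
    also have "\<dots> = {s \<in> S1 - {j}. \<not> row s}" unfolding P(6) using xS by (auto simp: S1_def)
    finally show "snd ` PB1 = {s \<in> S1 - {j}. \<not> row s}" .
  next
    fix e e' assume "e \<in> PA1" "e' \<in> set v" "e' \<noteq> e" "fst e' = fst e"
    then show "bef v e e'" using P(7)[of e e'] by (auto simp: v_def PA1_def bef_filter)
  next
    fix e e' assume "e \<in> PB1" "e' \<in> set v" "e' \<noteq> e" "snd e' = snd e"
    then show "bef v e' e" using P(8)[of e e'] by (auto simp: v_def PB1_def bef_filter)
  qed
  have p2: "parents row x (S - S1) w PA2 PB2"
    unfolding parents_def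
  proof (intro conjI ballI impI)
    show "set w = PA2 \<union> PB2" using P(1) by (auto simp: w_def PA2_def PB2_def)
    show "PA2 \<inter> PB2 = {}" using P(2) by (auto simp: PA2_def PB2_def)
    show "inj_on fst PA2" "inj_on snd PB2" using P(3,5) by (auto simp: PA2_def PB2_def inj_on_def)
    have "PA2 = {e \<in> PA. fst e \<notin> S1}" 
    proof -
      have "fst e \<in> S1 \<longleftrightarrow> snd e \<in> S1" if "e \<in> PA" for e using clos[of e] that P(1) \<open>(x, j) \<notin> PA\<close> by blast
      then show ?thesis by (auto simp: PA2_def)
    qed
    then have "fst ` PA2 = fst ` PA - S1" by auto
    also have "\<dots> = {s \<in> S - S1 - {x}. row s}" unfolding P(4) by auto
    finally show "fst ` PA2 = {s \<in> S - S1 - {x}. row s}" .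
    have "snd ` PB2 = snd ` PB - S1" by (auto simp: PB2_def)
    also have "\<dots> = {s \<in> S - S1 - {x}. \<not> row s}" unfolding P(6) by auto
    finally show "snd ` PB2 = {s \<in> S - S1 - {x}. \<not> row s}" .
  next
    fix e e' assume "e \<in> PA2" "e' \<in> set w" "e' \<noteq> e" "fst e' = fst e"
    then show "bef w e e'" using P(7)[of e e'] by (auto simp: w_def PA2_def bef_filter)
  next
    fix e e' assume "e \<in> PB2" "e' \<in> set w" "e' \<noteq> e" "snd e' = snd e"
    then show "bef w e' e" using P(8)[of e e'] by (auto simp: w_def PB2_def bef_filter)
  qed
  have c1: "(par PA1 PB1)\<^sup>*\<^sup>* s j" if "s \<in> S1" for s
  proof -
    have "(par PA PB)\<^sup>*\<^sup>* s j" using that by (simp add: S1_def)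
    then show ?thesis using that
    proof (induction rule: converse_rtranclp_induct)
      case (step y z)
      show ?case
      proof (cases "y = j")
        case False
        then have "z \<in> S1" using \<open>\<And>s t. s \<in> S1 \<Longrightarrow> s \<noteq> j \<Longrightarrow> par PA PB s t \<Longrightarrow> t \<in> S1\<close> step by blast
        moreover have "par PA1 PB1 y z" using step.hyps(1) step.prems \<open>z \<in> S1\<close> by (auto simp: par_def PA1_def PB1_def)
        ultimately show ?thesis using step.IH by (metis converse_rtranclp_into_rtranclp)
      qed simp
    qed simp
  qed
  have c2: "(par PA2 PB2)\<^sup>*\<^sup>* s x" if "s \<in> S - S1" for s
  proof -
    have "(par PA PB)\<^sup>*\<^sup>* s x" using that D(6) by blast
    then show ?thesis using that
    proof (induction rule: converse_rtranclp_induct)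
      case (step y z)
      have "z \<in> S" using step.hyps(1) D(4)[of "(y, z)"] D(4)[of "(z, y)"] P(1) by (auto simp: par_def)
      moreover have "z \<notin> S1" using step' step.hyps(1) step.prems by blast
      moreover have "par PA2 PB2 y z" using step.hyps(1) step.prems \<open>z \<notin> S1\<close> by (auto simp: par_def PA2_def PB2_def)
      ultimately show ?case using step.IH by (metis DiffI converse_rtranclp_into_rtranclp)
    qed simp
  qed
  have "finite S1" using D(1) by (simp add: S1_def)
  show ?thesis
  proof (rule that[of j S1 v PA1 PB1 w PA2 PB2])
    show "ptree row j S1 v PA1 PB1"
      unfolding ptree_def
    proof (intro conjI ballI)
      show "distinct v" using D(3) by (simp add: v_def)
      show "row (fst e)" "\<not> row (snd e)" if "e \<in> set v" for e using D(4)[OF v(1)[OF that]] by auto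
    qed (use \<open>finite S1\<close> jS v p1 c1 in blast)+
    show "ptree row x (S - S1) w PA2 PB2"
      unfolding ptree_def
    proof (intro conjI ballI)
      show "distinct w" using D(3) by (simp add: w_def)
      show "fst e \<in> S - S1" "snd e \<in> S - S1" "row (fst e)" "\<not> row (snd e)" if "e \<in> set w" for e
        using D(4)[OF w(1)[OF that]] w[OF that] by auto
    qed (use D(1,2) xS p2 c2 in blast)+
    show "S1 \<subseteq> S" by (auto simp: S1_def)
    show "bef u e (x, j)" if "e \<in> set v" "snd e = j" for e using P(8)[OF jB, of e] v[OF that(1)] that(2) by simp
    show "bef u (x, j) e" if "e \<in> set w" "fst e = x" for e using first[of e] w[OF that(1)] that(2) by simp
    show "bef v e e'" if "e \<in> set v" "e' \<in> set v" "bef u e e'" for e e'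
      using that v(2) unfolding v_def bef_filter by blast
    show "bef w e e'" if "e \<in> set w" "e' \<in> set w" "bef u e e'" for e e'
      using that w(3) unfolding w_def bef_filter by blast
    show "(x, j) \<in> set u" using e0 ej by simp
  qed (rule jr(1) jS xS uvw)+
qed

text \<open>After \<open>ptree_split\<close> the two parts are put into depth-first form by
  induction and joined around the cut letter. Letters of different parts share no vertex, so only
  their order relative to the cut letter has to be compared.\<close>

lemma ptree_rtree: "ptree row x S u PA PB \<Longrightarrow> \<exists>u'. rtree row x S u' \<and> teq u u'"
proof (induction "card S" arbitrary: row x S u PA PB rule: less_induct)
  case less
  have main: "\<exists>u'. rtree row x S u' \<and> teq u u'" if x: "row x" and p: "ptree row x S u PA PB" for row u PA PB
  proof (cases "S = {x}")
    case True
    have "fst ` PA = {}" "snd ` PB = {}"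
      unfolding parentsD(4,6)[OF ptreeD(5)[OF p]] True by auto
    then have "PA = {}" "PB = {}" by simp_all
    then have "u = []" using parentsD(1)[OF ptreeD(5)[OF p]] by simp
    then show ?thesis using True teq_refl[of "[]"] by (intro exI[of _ "[]"]) (simp add: rtree.leaf)
  next
    case False
    obtain j S1 v w PA1 PB1 PA2 PB2 where
      j: "\<not> row j" and "(x, j) \<in> set u" and S1: "S1 \<subseteq> S" "j \<in> S1" "x \<notin> S1" and
      pt: "ptree row j S1 v PA1 PB1" "ptree row x (S - S1) w PA2 PB2" and s: "set u = insert (x, j) (set v \<union> set w)"
      and bv: "\<And>e e'. e \<in> set v \<Longrightarrow> e' \<in> set v \<Longrightarrow> bef u e e' \<Longrightarrow> bef v e e'"
      and bw: "\<And>e e'. e \<in> set w \<Longrightarrow> e' \<in> set w \<Longrightarrow> bef u e e' \<Longrightarrow> bef w e e'"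
      and be: "\<And>e. e \<in> set v \<Longrightarrow> snd e = j \<Longrightarrow> bef u e (x, j)" "\<And>e. e \<in> set w \<Longrightarrow> fst e = x \<Longrightarrow> bef u (x, j) e"
      by (rule ptree_split[OF p x False]) (rule that)
    have fS: "finite S" "x \<in> S" and du: "distinct u" using ptreeD[OF p] by auto
    have "card S1 < card S" "card (S - S1) < card S"
      using fS S1 by (auto intro!: psubset_card_mono)
    then obtain v' w' where v': "rtree row j S1 v'" "teq v v'" and w': "rtree row x (S - S1) w'" "teq w w'"
      using less.hyps pt by metis
    let ?u = "v' @ (x, j) # w'"
    have "rtree row x (S1 \<union> (S - S1)) ?u" by (rule rtree.row[OF x j v'(1) w'(1)]) auto
    then have r: "rtree row x S ?u" using S1(1) by (simp add: Un_absorb1)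
    have sv: "set v' = set v" "set w' = set w" using v' w' unfolding teq_def by blast+
    have lv: "fst e \<in> S1" "snd e \<in> S1" if "e \<in> set v" for e using ptreeD(4)[OF pt(1) that] by auto
    have lw: "fst e \<notin> S1" "snd e \<notin> S1" if "e \<in> set w" for e using ptreeD(4)[OF pt(2) that] by auto
    have lr: "row (fst e)" "\<not> row (snd e)" if "e \<in> set u" for e using ptreeD(4)[OF p that] by auto
    have "teq u ?u"
    proof (rule teqI[OF du rtree_distinct[OF r]])
      show "set u = set ?u" using s sv by auto
      fix e e' assume m: "meets e e'" and b: "bef u e e'"
      have ee: "e \<in> set u" "e' \<in> set u" using bef_in_set[OF b] by auto
      have ne: "e \<noteq> e'" using b bef_asym[OF du b] by auto
      have m': "fst e = fst e' \<or> snd e = snd e'" using m lr[OF ee(1)] lr[OF ee(2)] by (auto simp: meets_def)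
      consider "e \<in> set v" "e' \<in> set v" | "e \<in> set w" "e' \<in> set w" | "e \<in> set v" "e' \<in> set w" | "e \<in> set w" "e' \<in> set v"
        | "e = (x, j)" "e' \<in> set v" | "e = (x, j)" "e' \<in> set w" | "e \<in> set v" "e' = (x, j)" | "e \<in> set w" "e' = (x, j)"
        using ee ne s by auto
      then show "bef ?u e e'"
      proof cases
        case 1
        then show ?thesis using bv[OF 1 b] v'(2) m unfolding teq_def bef_append by blast
      next
        case 2
        then show ?thesis using bw[OF 2 b] w'(2) m unfolding teq_def bef_append bef.simps by blast
      next
        case 3
        then show ?thesis using lv[OF 3(1)] lw[OF 3(2)] m' by auto
      next
        case 4
        then show ?thesis using lv[OF 4(2)] lw[OF 4(1)] m' by auto
      next
        case 5
        then have "snd e' = j" using lv[OF 5(2)] S1 m' by auto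
        then show ?thesis using be(1)[OF 5(2)] b 5 bef_asym[OF du] by blast
      next
        case 6
        then show ?thesis using sv by (simp add: bef_append)
      next
        case 7
        then show ?thesis using sv by (simp add: bef_append)
      next
        case 8
        then have "fst e = x" using lw[OF 8(1)] S1 m' by auto
        then show ?thesis using be(2)[OF 8(1)] b 8 bef_asym[OF du] by blast
      qed
    qed
    then show ?thesis using r by blast
  qed
  show ?case
  proof (cases "row x")
    case True
    then show ?thesis using main less.prems by blast
  next
    case False
    then obtain u' where "rtree (\<lambda>s. \<not> row s) x S u'" "teq (dual u) u'"
      using main[OF _ ptree_dual[OF less.prems]] by auto
    then have "rtree row x S (dual u')" "teq u (dual u')"
      using rtree_dual[of "\<lambda>s. \<not> row s" x S u'] teq_dual[of "dual u" u'] by auto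
    then show ?thesis by blast
  qed
qed

section \<open>Murnaghan-Nakayama labelings as words of plane trees\<close>

lemma verts_subset_iff: "verts D \<subseteq> S \<longleftrightarrow> (\<forall>e\<in>D. fst e \<in> S \<and> snd e \<in> S)"
  by (auto simp: verts_def)

lemma adj_sym: "(adj D)\<^sup>*\<^sup>* x y \<Longrightarrow> (adj D)\<^sup>*\<^sup>* y x"
proof -
  have "symp (adj D)" by (rule sympI) (auto simp: adj_def)
  then show "(adj D)\<^sup>*\<^sup>* x y \<Longrightarrow> (adj D)\<^sup>*\<^sup>* y x" by (metis sympD symp_rtranclp)
qed

lemma adj_mono: "D \<subseteq> D' \<Longrightarrow> (adj D)\<^sup>*\<^sup>* x y \<Longrightarrow> (adj D')\<^sup>*\<^sup>* x y"
  by (erule mono_rtranclp[rule_format, rotated]) (auto simp: adj_def)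

lemma rtree_connected: "rtree row x S u \<Longrightarrow> s \<in> S \<Longrightarrow> (adj (set u))\<^sup>*\<^sup>* x s"
proof (induction arbitrary: s rule: rtree.induct)
  case (row i j S v T w)
  let ?D = "set (v @ (i, j) # w)"
  have ij: "adj ?D i j" by (simp add: adj_def)
  show ?case
  proof (cases "s \<in> S")
    case True
    then have "(adj ?D)\<^sup>*\<^sup>* j s" using row.IH(1) adj_mono[of "set v" ?D] by auto
    then show ?thesis using ij by (metis converse_rtranclp_into_rtranclp)
  next
    case False
    then have "(adj (set w))\<^sup>*\<^sup>* i s" using row.IH(2) row.prems by blast
    then show ?thesis by (rule adj_mono[rotated]) auto
  qed
next
  case (col i j S v T w)
  let ?D = "set (v @ (i, j) # w)"
  have ij: "adj ?D j i" by (simp add: adj_def)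
  show ?case
  proof (cases "s \<in> T")
    case True
    then have "(adj ?D)\<^sup>*\<^sup>* i s" using col.IH(2) adj_mono[of "set w" ?D] by auto
    then show ?thesis using ij by (metis converse_rtranclp_into_rtranclp)
  next
    case False
    then have "(adj (set v))\<^sup>*\<^sup>* j s" using col.IH(1) col.prems by blast
    then show ?thesis by (rule adj_mono[rotated]) auto
  qed
qed simp

lemma cyclic_crossing:
  assumes k: "k < length c" "P (c ! k)" and l: "l < length c" "\<not> P (c ! l)"
  shows "\<exists>m<length c. P (c ! m) \<and> \<not> P (c ! (Suc m mod length c))"
proof (rule ccontr)
  let ?N = "length c"
  assume "\<not> ?thesis"
  then have step: "P (c ! (Suc m mod ?N))" if "m < ?N" "P (c ! m)" for m using that by blast
  have N: "?N > 0" using k by linarith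
  have "P (c ! ((k + t) mod ?N))" for t
  proof (induction t)
    case (Suc t)
    from step[OF mod_less_divisor[OF N] this] show ?case by (simp add: mod_Suc_eq)
  qed (use k in simp)
  from this[of "?N - k + l"] have "P (c ! ((?N + l) mod ?N))" using k by simp
  then show False using l by simp
qed

text \<open>A cycle that meets both sides has to use the bridge once in each direction. The two
  crossings then follow one another cyclically both ways, so the cycle has length two.\<close>

lemma has_cycle_bridge:
  assumes S: "verts D1 \<subseteq> S" and T: "verts D2 \<subseteq> T" and ST: "S \<inter> T = {}" and ij: "j \<in> S" "i \<in> T"
    and c: "has_cycle (D1 \<union> insert (i, j) D2)"
  shows "has_cycle D1 \<or> has_cycle D2"
proof -
  let ?D = "D1 \<union> insert (i, j) D2"
  obtain c where c: "length c \<ge> 3" "distinct c" "\<And>k. k < length c \<Longrightarrow> adj ?D (c ! k) (c ! (Suc k mod length c))"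
    using c unfolding has_cycle_def by blast
  let ?N = "length c"
  have N: "?N > 0" using c(1) by linarith
  have in1: "x \<in> S \<and> y \<in> S" if "adj D1 x y" for x y
    using that S unfolding verts_subset_iff adj_def by auto
  have in2: "x \<in> T \<and> y \<in> T" if "adj D2 x y" for x y
    using that T unfolding verts_subset_iff adj_def by auto
  have D: "adj ?D x y \<longleftrightarrow> adj D1 x y \<or> adj D2 x y \<or> x = i \<and> y = j \<or> x = j \<and> y = i" for x y
    by (auto simp: adj_def)
  have nS: "x \<notin> S" if "x \<in> T" for x using that ST by auto
  have N': "Suc k mod ?N < ?N" for k using N by simp
  consider "\<forall>k<?N. c ! k \<in> S" | "\<forall>k<?N. c ! k \<notin> S" | k l where "k < ?N" "c ! k \<in> S" "l < ?N" "c ! l \<notin> S" by blast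
  then show ?thesis
  proof cases
    case 1
    then have "adj D1 (c ! k) (c ! (Suc k mod ?N))" if "k < ?N" for k
      using c(3)[OF that] in2 nS ij N' that unfolding D by metis
    then show ?thesis using c(1,2) unfolding has_cycle_def by blast
  next
    case 2
    then have "adj D2 (c ! k) (c ! (Suc k mod ?N))" if "k < ?N" for k
      using c(3)[OF that] in1 ij N' that unfolding D by metis
    then show ?thesis using c(1,2) unfolding has_cycle_def by blast
  next
    case 3
    obtain m where m: "m < ?N" "c ! m \<in> S" "c ! (Suc m mod ?N) \<notin> S"
      using cyclic_crossing[of k c "\<lambda>x. x \<in> S" l] 3 by blast
    obtain m' where m': "m' < ?N" "c ! m' \<notin> S" "c ! (Suc m' mod ?N) \<in> S"
      using cyclic_crossing[of l c "\<lambda>x. x \<notin> S" k] 3 by blast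
    have "c ! m = j" "c ! (Suc m mod ?N) = i" using c(3)[OF m(1)] m in1 in2 nS ij unfolding D by metis+
    moreover have "c ! m' = i" "c ! (Suc m' mod ?N) = j" using c(3)[OF m'(1)] m' in1 in2 nS ij unfolding D by metis+
    ultimately have "Suc m mod ?N = m'" "Suc m' mod ?N = m"
      using c(2) N' m(1) m'(1) nth_eq_iff_index_eq by metis+
    then show ?thesis using c(1) m(1) by (auto simp: mod_Suc split: if_splits)
  qed
qed

lemma rtree_acyclic: "rtree row x S u \<Longrightarrow> \<not> has_cycle (set u)"
proof (induction rule: rtree.induct)
  case (leaf x)
  show ?case
  proof
    assume "has_cycle (set ([] :: (int \<times> int) list))"
    then obtain c :: "int list" where "length c \<ge> 3" "\<forall>k<length c. adj (set []) (c ! k) (c ! (Suc k mod length c))"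
      unfolding has_cycle_def by blast
    moreover from this have "0 < length c" by linarith
    ultimately show False by (auto simp: adj_def)
  qed
next
  case (row i j S v T w)
  have "verts (set v) \<subseteq> S" "verts (set w) \<subseteq> T"
    unfolding verts_subset_iff using rtree_letters[OF row.hyps(3)] rtree_letters[OF row.hyps(4)] by blast+
  from has_cycle_bridge[OF this row.hyps(5) rtree_root[OF row.hyps(3)] rtree_root[OF row.hyps(4)]]
  show ?case using row.IH by auto
next
  case (col i j S v T w)
  have "verts (set v) \<subseteq> S" "verts (set w) \<subseteq> T"
    unfolding verts_subset_iff using rtree_letters[OF col.hyps(3)] rtree_letters[OF col.hyps(4)] by blast+
  from has_cycle_bridge[OF this col.hyps(5) rtree_root[OF col.hyps(3)] rtree_root[OF col.hyps(4)]]
  show ?case using col.IH by auto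
qed

lemma bef_sort_key: "f x = f y \<Longrightarrow> bef l x y \<Longrightarrow> bef (sort_key f l) x y"
proof -
  assume f: "f x = f y" and b: "bef l x y"
  then have "bef (filter (\<lambda>z. f z = f y) l) x y" by (simp add: bef_filter)
  then have "bef (filter (\<lambda>z. f z = f y) (sort_key f l)) x y" by (simp only: sort_key_stable)
  then show ?thesis by (simp add: bef_filter)
qed

text \<open>The labeling is a normal form of the word: the parent letters of the rows, sorted by
  column, followed by the parent letters of the columns, sorted by row. The sorting is stable, and
  two letters of the same kind can share only the coordinate used as the key.\<close>

lemma rtree_mn:
  fixes u :: "(int \<times> int) list"
  assumes u: "rtree (\<lambda>s. s \<le> a) r S u" and r: "r \<le> a" and ne: "u \<noteq> []"
    and inj: "inj_on (\<lambda>x. x mod int n) S"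
  shows "verts (set u) = S" "conn_tree n a (set u)" "\<exists>L. mn_labeling (set u) L \<and> teq u L"
proof -
  let ?row = "\<lambda>s. s \<le> a"
  note l = rtree_letters[OF u]
  have "r \<in> verts (set u)"
    using u ne r by (cases rule: rtree.cases) (auto simp: verts_def)
  then show V: "verts (set u) = S" using rtree_set[OF u] by (auto simp: verts_def)
  have conn: "(adj (set u))\<^sup>*\<^sup>* x y" if "x \<in> S" "y \<in> S" for x y
    using rtree_connected[OF u that(1)] rtree_connected[OF u that(2)] adj_sym by (metis rtranclp_trans)
  have box: "\<forall>(i, j)\<in>set u. i \<le> a \<and> a < j" using l by fastforce
  show "conn_tree n a (set u)"
    unfolding conn_tree_def V using conn rtree_acyclic[OF u] inj box ne by auto
  obtain PA PB where p: "parents ?row r S u PA PB" using rtree_parents[OF u] by blast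
  note P = parentsD[OF p]
  have du: "distinct u" by (rule rtree_distinct[OF u])
  let ?A = "sort_key snd (filter (\<lambda>e. e \<in> PA) u)" and ?B = "sort_key fst (filter (\<lambda>e. e \<in> PB) u)"
  let ?L = "?A @ ?B"
  have sA: "set ?A = PA" and sB: "set ?B = PB" using P(1) by auto
  have dA: "distinct ?A" "distinct ?B" using du by auto
  have rows: "fst ` set u = {s \<in> S. s \<le> a}"
  proof
    show "fst ` set u \<subseteq> {s \<in> S. s \<le> a}" using l by auto
    have "s \<in> fst ` set u" if "s \<in> S" "s \<le> a" for s
      using that unfolding V[symmetric] verts_def using l by fastforce
    then show "{s \<in> S. s \<le> a} \<subseteq> fst ` set u" by blast
  qed
  have fin: "finite S" by (rule rtree_finite[OF u])
  have "length ?A = card PA" using distinct_card[OF dA(1)] sA by simp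
  also have "\<dots> = card (fst ` PA)" by (rule card_image[OF P(3), symmetric])
  also have "fst ` PA = fst ` set u - {r}" unfolding P(4) rows by auto
  also have "card \<dots> = card (fst ` set u) - 1" using rtree_root[OF u] r rows by (intro card_Diff_singleton) auto
  \<comment> \<open>Every row except the root has one letter in \<open>PA\<close>, so the block
    \<open>?A\<close> has the length required of the first block of a labeling.\<close>
  finally have len: "card (fst ` set u) - 1 = length ?A" ..
  have "mn_labeling (set u) ?L"
    unfolding mn_labeling_def labelings_def Let_def len
  proof (intro conjI CollectI)
    show "distinct ?L" using dA sA sB P(2) by simp
    show "set ?L = set u" using sA sB P(1) by simp
    show "distinct (map fst (take (length ?A) ?L))" using dA sA P(3) by (simp add: distinct_map)
    show "distinct (map snd (drop (length ?A) ?L))" using dA sB P(5) by (simp add: distinct_map)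
  qed simp_all
  moreover have "teq u ?L"
  proof (rule teqI[OF du])
    show "distinct ?L" using dA sA sB P(2) by simp
    show "set u = set ?L" using sA sB P(1) by simp
    fix e e' assume m: "meets e e'" and b: "bef u e e'"
    have ee: "e \<in> set u" "e' \<in> set u" "e \<noteq> e'" "\<not> bef u e' e" using bef_in_set[OF b] bef_asym[OF du b] b by auto
    have m': "fst e = fst e' \<or> snd e = snd e'" using m l[OF ee(1)] l[OF ee(2)] by (auto simp: meets_def)
    consider "e \<in> PA" "e' \<in> PA" | "e \<in> PB" "e' \<in> PB" | "e \<in> PA" "e' \<in> PB" | "e \<in> PB" "e' \<in> PA"
      using ee P(1) by blast
    then show "bef ?L e e'"
    proof cases
      case 1
      then have "snd e = snd e'" using m' inj_onD[OF P(3) _ 1] ee(3) by blast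
      moreover have "bef (filter (\<lambda>e. e \<in> PA) u) e e'" using 1 b by (simp add: bef_filter)
      ultimately have "bef ?A e e'" by (rule bef_sort_key)
      then show ?thesis unfolding bef_append by blast
    next
      case 2
      then have "fst e = fst e'" using m' inj_onD[OF P(5) _ 2] ee(3) by blast
      moreover have "bef (filter (\<lambda>e. e \<in> PB) u) e e'" using 2 b by (simp add: bef_filter)
      ultimately have "bef ?B e e'" by (rule bef_sort_key)
      then show ?thesis unfolding bef_append by blast
    next
      case 3
      then show ?thesis unfolding bef_append sA sB by blast
    next
      \<comment> \<open>Impossible: at a common row the letter in \<open>PA\<close> comes first, at
        a common column the letter in \<open>PB\<close> comes last.\<close>
      case 4
      then show ?thesis using P(7)[OF 4(2) ee(1)] P(8)[OF 4(1) ee(2)] m' ee(3,4) by metis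
    qed
  qed
  ultimately show "\<exists>L. mn_labeling (set u) L \<and> teq u L" by blast
qed

text \<open>The two blocks of the labeling serve as the parent letters of rows and columns. The
  first block has one letter fewer than there are rows and no row twice, so it misses a single row,
  which becomes the root.\<close>

lemma mn_ptree:
  assumes D: "conn_tree n a D" and L: "mn_labeling D L"
  shows "\<exists>r PA PB. r \<le> a \<and> ptree (\<lambda>s. s \<le> a) r (verts D) L PA PB"
proof -
  let ?row = "\<lambda>s. s \<le> a"
  define l where "l = card (fst ` D) - 1"
  define PA where "PA = set (take l L)"
  define PB where "PB = set (drop l L)"
  have Ls: "distinct L" "set L = D" and dA: "distinct (map fst (take l L))" and dB: "distinct (map snd (drop l L))"
    using L by (auto simp: mn_labeling_def labelings_def Let_def l_def)
  have finD: "finite D" "D \<noteq> {}" and inj: "inj_on (\<lambda>x. x mod int n) (verts D)"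
    and conn: "\<And>x y. x \<in> verts D \<Longrightarrow> y \<in> verts D \<Longrightarrow> (adj D)\<^sup>*\<^sup>* x y"
    using D by (auto simp: conn_tree_def)
  have box: "fst e \<le> a" "a < snd e" if "e \<in> D" for e
    using D that by (fastforce simp: conn_tree_def)+
  have DP: "D = PA \<union> PB" using Ls(2) unfolding PA_def PB_def by (metis append_take_drop_id set_append)
  have disj: "PA \<inter> PB = {}" using Ls(1) unfolding PA_def PB_def by (simp add: set_take_disj_set_drop_if_distinct)
  have iA: "inj_on fst PA" and iB: "inj_on snd PB" using dA dB by (simp_all add: distinct_map PA_def PB_def)
  have "card (fst ` D) \<le> card D" "card (fst ` D) > 0" using finD by (auto intro: card_image_le simp: card_gt_0_iff)
  moreover have "length L = card D" using Ls distinct_card by metis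
  ultimately have "length (take l L) = l" "l < card (fst ` D)" by (auto simp: l_def)
  then have cA: "card (fst ` PA) = card (fst ` D) - 1"
    using distinct_card[of "map fst (take l L)"] dA unfolding PA_def l_def by simp
  have sub: "fst ` PA \<subseteq> fst ` D" using DP by blast
  then have "card (fst ` D - fst ` PA) = 1"
    using cA finD \<open>card (fst ` D) > 0\<close> by (simp add: card_Diff_subset finite_subset)
  then obtain r where r: "fst ` D - fst ` PA = {r}" by (metis card_1_singletonE)
  have fA: "fst ` PA = fst ` D - {r}" using r sub by blast
  have rD: "r \<in> fst ` D" using r by blast
  have ra: "r \<le> a" using rD box by auto
  have uniq: "t = t'" if "par PA PB s t" "par PA PB s t'" for s t t'
    by (rule par_unique[OF iA iB _ that, of ?row]) (use box DP in fastforce)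
  have root: "\<not> par PA PB r t" for t
  proof
    assume "par PA PB r t"
    then have "r \<in> fst ` PA \<or> (t, r) \<in> D" unfolding par_def DP by force
    then show False using fA box[of "(t, r)"] ra by auto
  qed
  \<comment> \<open>Induction along a path that starts at \<open>r\<close>: each edge leads either
    to a child of \<open>y\<close>, or from \<open>y\<close> to its unique parent, which is the next
    vertex on the way from \<open>y\<close> to \<open>r\<close>.\<close>
  have reach: "(par PA PB)\<^sup>*\<^sup>* s r" if s: "s \<in> verts D" for s
  proof -
    have "(adj D)\<^sup>*\<^sup>* r s" using conn[of r s] s rD by (auto simp: verts_def)
    then show ?thesis
    proof (induction rule: rtranclp_induct)
      case (step y z)
      have "par PA PB y z \<or> par PA PB z y" using step.hyps(2) DP by (auto simp: adj_def par_def)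
      then show ?case
      proof
        assume "par PA PB z y"
        then show ?case using step.IH by (metis converse_rtranclp_into_rtranclp)
      next
        assume yz: "par PA PB y z"
        then have "y \<noteq> r" using root by blast
        then obtain z' where "par PA PB y z'" "(par PA PB)\<^sup>*\<^sup>* z' r" using step.IH by (metis converse_rtranclpE)
        then show ?case using uniq[OF yz] by blast
      qed
    qed simp
  qed
  \<comment> \<open>A column reaches the root but is not the root, so it has a parent, and its
    parent letter lies in \<open>PB\<close>.\<close>
  have sB: "snd ` PB = snd ` D"
  proof
    show "snd ` PB \<subseteq> snd ` D" using DP by blast
    show "snd ` D \<subseteq> snd ` PB"
    proof
      fix j assume j: "j \<in> snd ` D"
      then have ja: "j > a" using box by auto
      then have "(par PA PB)\<^sup>*\<^sup>* j r" "j \<noteq> r" using j reach[of j] ra by (auto simp: verts_def)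
      then obtain t where "par PA PB j t" by (metis converse_rtranclpE)
      moreover have "(j, t) \<notin> PA" using box[of "(j, t)"] ja DP by auto
      ultimately show "j \<in> snd ` PB" by (force simp: par_def)
    qed
  qed
  have "s \<le> a" if "s \<in> fst ` D" for s using that box(1) by blast
  moreover have "\<not> s \<le> a" if "s \<in> snd ` D" for s using that box(2) by force
  ultimately have V: "fst ` D = {s \<in> verts D. s \<le> a}" "snd ` D = {s \<in> verts D. \<not> s \<le> a}"
    unfolding verts_def by blast+
  have "parents ?row r (verts D) L PA PB"
    unfolding parents_def
  proof (intro conjI ballI impI)
    show "fst ` PA = {s \<in> verts D - {r}. s \<le> a}" unfolding fA V by blast
    show "snd ` PB = {s \<in> verts D - {r}. \<not> s \<le> a}" unfolding sB V using ra by blast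
  next
    fix e e' assume e: "e \<in> PA" "e' \<in> set L" "e' \<noteq> e" "fst e' = fst e"
    then have "e' \<notin> PA" using inj_onD[OF iA, of e' e] by blast
    then have "e' \<in> PB" using e Ls DP by blast
    then have "bef (take l L @ drop l L) e e'" using e unfolding bef_append PA_def PB_def by blast
    then show "bef L e e'" by simp
  next
    fix e e' assume e: "e \<in> PB" "e' \<in> set L" "e' \<noteq> e" "snd e' = snd e"
    then have "e' \<notin> PB" using inj_onD[OF iB, of e' e] by blast
    then have "e' \<in> PA" using e Ls DP by blast
    then have "bef (take l L @ drop l L) e' e" using e unfolding bef_append PA_def PB_def by blast
    then show "bef L e' e" by simp
  qed (use Ls DP disj iA iB in auto)
  moreover have "finite (verts D)" "r \<in> verts D" using finD rD by (auto simp: verts_def)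
  moreover have "\<forall>e\<in>set L. fst e \<in> verts D \<and> snd e \<in> verts D \<and> ?row (fst e) \<and> \<not> ?row (snd e)"
    using Ls box by (force simp: verts_def)
  ultimately have "ptree ?row r (verts D) L PA PB" unfolding ptree_def using Ls reach by blast
  then show ?thesis using ra by blast
qed

section \<open>Sums over plane trees are sums over stars\<close>

lemma append_first_eq:
  "(\<And>e. e \<in> set v \<Longrightarrow> fst e \<noteq> a) \<Longrightarrow> (\<And>e. e \<in> set v' \<Longrightarrow> fst e \<noteq> a) \<Longrightarrow>
    v @ (a, j) # w = v' @ (a, j') # w' \<Longrightarrow> v = v' \<and> j = j' \<and> w = w'"
proof (induction v arbitrary: v')
  case Nil
  show ?case
  proof (cases v')
    case (Cons e l)
    then show ?thesis using Nil.prems(2)[of e] Nil.prems(3) by auto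
  qed (use Nil.prems(3) in simp)
next
  case (Cons e v)
  show ?case
  proof (cases v')
    case Nil
    then show ?thesis using Cons.prems(1)[of e] Cons.prems(3) by auto
  next
    case (Cons e' l)
    then show ?thesis using Cons.IH[of l] Cons.prems by simp
  qed
qed

lemma append_last_eq:
  fixes v w :: "('v \<times> 'v) list"
  assumes "\<And>e. e \<in> set w \<Longrightarrow> snd e \<noteq> b" "\<And>e. e \<in> set w' \<Longrightarrow> snd e \<noteq> b"
    "v @ (i, b) # w = v' @ (i', b) # w'"
  shows "v = v' \<and> i = i' \<and> w = w'"
proof -
  have "dual w @ (b, i) # dual v = dual w' @ (b, i') # dual v'"
    using arg_cong[OF assms(3), of dual] by simp
  then have "dual w = dual w' \<and> i = i' \<and> dual v = dual v'"
    by (rule append_first_eq[rotated 2]) (use assms(1,2) in force)+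
  then show ?thesis by (metis dual_simps(1))
qed

lemma finite_rtree: "finite {u. rtree row x S u}"
proof (cases "finite S")
  case True
  have "{u. rtree row x S u} \<subseteq> {u. set u \<subseteq> S \<times> S \<and> length u \<le> card S}"
    using rtree_letters rtree_card by (fastforce simp: mem_Times_iff)
  then show ?thesis using finite_lists_length_le[of "S \<times> S" "card S"] True finite_subset by blast
next
  case False
  then have "{u. rtree row x S u} = {}" by (auto dest: rtree_finite)
  then show ?thesis by simp
qed

section \<open>Generating functions of plane tree words\<close>

context fk_system
begin

definition ev :: "('v \<times> 'v) list \<Rightarrow> 'r" where
  "ev u = prod_list (map (\<lambda>e. B (fst e) (snd e)) u)"

definition tsum :: "('v \<Rightarrow> bool) \<Rightarrow> 'v \<Rightarrow> 'v set \<Rightarrow> 'r" where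
  "tsum row x S = (\<Sum>u | rtree row x S u. ev u)"

lemma ev_simps [simp]: "ev [] = 1" "ev (v @ e # w) = ev v * B (fst e) (snd e) * ev w"
  by (simp_all add: ev_def mult.assoc)

lemma tsum_leaf: "tsum row x {x} = 1"
proof -
  have "{u. rtree row x {x} u} = {[]}"
  proof (intro equalityI subsetI)
    fix u assume "u \<in> {u. rtree row x {x} u}"
    then have "length u = 0" using rtree_card[of row x "{x}" u] by simp
    then show "u \<in> {[]}" by simp
  qed (auto intro: rtree.leaf)
  then show ?thesis by (simp add: tsum_def)
qed

lemma tsum_outside: "x \<notin> S \<Longrightarrow> tsum row x S = 0"
proof -
  assume "x \<notin> S"
  then have "{u. rtree row x S u} = {}" by (auto dest: rtree_root)
  then show ?thesis unfolding tsum_def by (metis sum.empty)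
qed

lemma tsum_product:
  "tsum row y T * b * tsum row z U = (\<Sum>(v, w)\<in>{u. rtree row y T u} \<times> {u. rtree row z U u}. ev v * b * ev w)"
proof -
  have "tsum row y T * b = (\<Sum>v | rtree row y T v. ev v * b)" by (simp add: tsum_def sum_distrib_right)
  then show ?thesis by (simp add: tsum_def[of row z] sum_product sum.cartesian_product)
qed

lemma tsum_row:
  assumes S: "finite S" "S \<noteq> {x}" "S \<subseteq> A" and x: "row x" and A: "finite A"
  shows "tsum row x S = (\<Sum>j | j \<in> A \<and> \<not> row j. \<Sum>T\<in>Pow S. tsum row j T * B x j * tsum row x (S - T))"
proof -
  let ?C = "{j. j \<in> A \<and> \<not> row j}"
  let ?W = "\<lambda>j T. {u. rtree row j T u} \<times> {u. rtree row x (S - T) u}"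
  let ?K = "SIGMA j:?C. SIGMA T:Pow S. ?W j T"
  let ?h = "\<lambda>(j, T, v, w). v @ (x, j) # w"
  have inj: "inj_on ?h ?K"
  proof (rule inj_onI)
    fix p p' assume "p \<in> ?K" "p' \<in> ?K" and eq: "?h p = ?h p'"
    then obtain j T v w j' T' v' w' where p: "p = (j, T, v, w)" "p' = (j', T', v', w')"
      and t: "rtree row j T v" "rtree row x (S - T) w" "rtree row j' T' v'" "rtree row x (S - T') w'" by auto
    have "x \<notin> T" "x \<notin> T'" using rtree_root[OF t(2)] rtree_root[OF t(4)] by auto
    then have "v = v' \<and> j = j' \<and> w = w'"
      using eq rtree_letters[OF t(1)] rtree_letters[OF t(3)] unfolding p by (intro append_first_eq[of v x v' j w j' w']) auto
    moreover have "T = insert j (fst ` set v \<union> snd ` set v)" "T' = insert j' (fst ` set v' \<union> snd ` set v')"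
      using rtree_set t by metis+
    ultimately show "p = p'" using p by simp
  qed
  have img: "?h ` ?K = {u. rtree row x S u}"
  proof (intro equalityI subsetI)
    fix u assume "u \<in> ?h ` ?K"
    then obtain j T v w where u: "u = v @ (x, j) # w" and j: "\<not> row j" "T \<subseteq> S"
      and t: "rtree row j T v" "rtree row x (S - T) w" by auto
    have "rtree row x (T \<union> (S - T)) u" unfolding u by (rule rtree.row[OF x j(1) t]) auto
    moreover have "T \<union> (S - T) = S" using j by auto
    ultimately show "u \<in> {u. rtree row x S u}" by simp
  next
    fix u assume "u \<in> {u. rtree row x S u}"
    then have "rtree row x S u" by simp
    then show "u \<in> ?h ` ?K"
    proof (cases rule: rtree.cases)
      case (row j S1 v T1 w)
      have "S - S1 = T1" using row by auto
      moreover have "j \<in> S" using rtree_root[OF row(5)] row(1) by auto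
      ultimately have "(j, S1, v, w) \<in> ?K" using row S(3) by auto
      moreover have "u = ?h (j, S1, v, w)" using row by simp
      ultimately show ?thesis by (metis (no_types, lifting) image_eqI)
    qed (use S x in auto)
  qed
  have fin: "finite (?W j T)" for j T by (intro finite_cartesian_product finite_rtree)
  have fC: "finite ?C" using A by simp
  have "(\<Sum>j\<in>?C. \<Sum>T\<in>Pow S. tsum row j T * B x j * tsum row x (S - T)) =
     (\<Sum>j\<in>?C. \<Sum>T\<in>Pow S. \<Sum>(v, w)\<in>?W j T. ev (v @ (x, j) # w))"
    by (simp add: tsum_product)
  also have "\<dots> = (\<Sum>j\<in>?C. \<Sum>(T, v, w)\<in>(SIGMA T:Pow S. ?W j T). ev (v @ (x, j) # w))"
    using S fin by (intro sum.cong refl sum.Sigma) auto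
  also have "\<dots> = (\<Sum>(j, T, v, w)\<in>?K. ev (v @ (x, j) # w))"
    using fC S fin by (intro sum.Sigma ballI finite_SigmaI) (auto simp: finite_rtree)
  also have "\<dots> = (\<Sum>p\<in>?K. ev (?h p))" by (intro sum.cong refl) (auto simp: split_beta)
  also have "\<dots> = (\<Sum>u\<in>?h ` ?K. ev u)" by (rule sum.reindex[OF inj, symmetric, unfolded comp_def])
  finally show ?thesis unfolding img by (simp add: tsum_def)
qed

text \<open>The mirror image of \<open>tsum_row\<close>: at a column root the word is cut at the
  last letter of the root.\<close>

lemma tsum_col:
  assumes S: "finite S" "S \<noteq> {x}" "S \<subseteq> A" and x: "\<not> row x" and A: "finite A"
  shows "tsum row x S = (\<Sum>i | i \<in> A \<and> row i. \<Sum>T\<in>Pow S. tsum row x T * B i x * tsum row i (S - T))"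
proof -
  let ?R = "{i. i \<in> A \<and> row i}"
  let ?W = "\<lambda>i T. {u. rtree row x T u} \<times> {u. rtree row i (S - T) u}"
  let ?K = "SIGMA i:?R. SIGMA T:Pow S. ?W i T"
  let ?h = "\<lambda>(i, T, v, w). v @ (i, x) # w"
  have inj: "inj_on ?h ?K"
  proof (rule inj_onI)
    fix p p' assume "p \<in> ?K" "p' \<in> ?K" and eq: "?h p = ?h p'"
    then obtain i T v w i' T' v' w' where p: "p = (i, T, v, w)" "p' = (i', T', v', w')"
      and t: "rtree row x T v" "rtree row i (S - T) w" "rtree row x T' v'" "rtree row i' (S - T') w'" by auto
    have "x \<notin> S - T" "x \<notin> S - T'" using rtree_root[OF t(1)] rtree_root[OF t(3)] by auto
    then have "v = v' \<and> i = i' \<and> w = w'"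
      using eq rtree_letters[OF t(2)] rtree_letters[OF t(4)] unfolding p by (intro append_last_eq[of w x w' v i v' i']) auto
    moreover have "T = insert x (fst ` set v \<union> snd ` set v)" "T' = insert x (fst ` set v' \<union> snd ` set v')"
      using rtree_set t by metis+
    ultimately show "p = p'" using p by simp
  qed
  have img: "?h ` ?K = {u. rtree row x S u}"
  proof (intro equalityI subsetI)
    fix u assume "u \<in> ?h ` ?K"
    then obtain i T v w where u: "u = v @ (i, x) # w" and i: "row i" "T \<subseteq> S"
      and t: "rtree row x T v" "rtree row i (S - T) w" by auto
    have "rtree row x (T \<union> (S - T)) u" unfolding u by (rule rtree.col[OF i(1) x t]) auto
    moreover have "T \<union> (S - T) = S" using i by auto
    ultimately show "u \<in> {u. rtree row x S u}" by simp
  next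
    fix u assume "u \<in> {u. rtree row x S u}"
    then have "rtree row x S u" by simp
    then show "u \<in> ?h ` ?K"
    proof (cases rule: rtree.cases)
      case (col i S1 v T1 w)
      have "S - S1 = T1" using col by auto
      moreover have "i \<in> S" using rtree_root[OF col(6)] col(1) by auto
      ultimately have "(i, S1, v, w) \<in> ?K" using col S(3) by auto
      moreover have "u = ?h (i, S1, v, w)" using col by simp
      ultimately show ?thesis by (metis (no_types, lifting) image_eqI)
    qed (use S x in auto)
  qed
  have fin: "finite (?W i T)" for i T by (intro finite_cartesian_product finite_rtree)
  have fR: "finite ?R" using A by simp
  have "(\<Sum>i\<in>?R. \<Sum>T\<in>Pow S. tsum row x T * B i x * tsum row i (S - T)) =
     (\<Sum>i\<in>?R. \<Sum>T\<in>Pow S. \<Sum>(v, w)\<in>?W i T. ev (v @ (i, x) # w))"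
    by (simp add: tsum_product)
  also have "\<dots> = (\<Sum>i\<in>?R. \<Sum>(T, v, w)\<in>(SIGMA T:Pow S. ?W i T). ev (v @ (i, x) # w))"
    using S fin by (intro sum.cong refl sum.Sigma) auto
  also have "\<dots> = (\<Sum>(i, T, v, w)\<in>?K. ev (v @ (i, x) # w))"
    using fR S fin by (intro sum.Sigma ballI finite_SigmaI) (auto simp: finite_rtree)
  also have "\<dots> = (\<Sum>p\<in>?K. ev (?h p))" by (intro sum.cong refl) (auto simp: split_beta)
  also have "\<dots> = (\<Sum>u\<in>?h ` ?K. ev u)" by (rule sum.reindex[OF inj, symmetric, unfolded comp_def])
  finally show ?thesis unfolding img by (simp add: tsum_def)
qed

lemma ev_comm:
  assumes "\<And>e. e \<in> set u \<Longrightarrow> {fst e, snd e} \<subseteq> V - {x, y} \<and> fst e \<noteq> snd e" "x \<in> V" "y \<in> V" "x \<noteq> y"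
  shows "ev u * B x y = B x y * ev u"
  using assms(1)
proof (induction u)
  case (Cons e u)
  have "B x y * B (fst e) (snd e) = B (fst e) (snd e) * B x y"
    using Cons.prems[of e] assms(2-4) by (intro comm) auto
  then have "B x y * ev (e # u) = B (fst e) (snd e) * (B x y * ev u)" by (simp add: ev_def mult.assoc[symmetric])
  also have "\<dots> = ev (e # u) * B x y" using Cons by (simp add: ev_def mult.assoc)
  finally show ?case ..
qed simp

lemma tsum_comm:
  assumes S: "S \<subseteq> V" and xy: "x \<in> V - S" "y \<in> V - S" "x \<noteq> y"
  shows "tsum row z S * B x y = B x y * tsum row z S"
  unfolding tsum_def sum_distrib_left sum_distrib_right
proof (rule sum.cong[OF refl])
  fix u assume u: "u \<in> {u. rtree row z S u}"
  show "ev u * B x y = B x y * ev u"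
  proof (rule ev_comm)
    fix e assume "e \<in> set u"
    then have "fst e \<in> S \<and> snd e \<in> S \<and> row (fst e) \<and> \<not> row (snd e)" using u rtree_letters[of row z S u e] by blast
    then show "{fst e, snd e} \<subseteq> V - {x, y} \<and> fst e \<noteq> snd e" using S xy by auto
  qed (use xy in auto)
qed

lemma sign_tsum_comm:
  assumes "S \<subseteq> V" "x \<in> V - S" "y \<in> V - S" "x \<noteq> y"
  shows "(- 1) ^ k * tsum row z S * B x y = B x y * ((- 1) ^ k * tsum row z S)"
  by (cases "even k") (simp_all add: tsum_comm[OF assms])

lift_definition row_series :: "('v \<Rightarrow> bool) \<Rightarrow> 'v \<Rightarrow> ('v, 'r) sqf" is
  "\<lambda>row x S. if S \<subseteq> V then (- 1) ^ (card {s \<in> S. row s} - 1) * tsum row x S else 0"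
  by (auto dest: finite_subset[OF _ fin])

text \<open>All rows are counted in the sign, whereas \<open>row_series\<close> leaves out one; with
  this choice the signs of a column tree and a row tree multiply to that of a row tree.\<close>

lift_definition col_series :: "('v \<Rightarrow> bool) \<Rightarrow> 'v \<Rightarrow> ('v, 'r) sqf" is
  "\<lambda>row x S. if S \<subseteq> V then (- 1) ^ card {s \<in> S. row s} * tsum row x S else 0"
  by (auto dest: finite_subset[OF _ fin])

text \<open>The positivity ensures that the truncated subtraction in the sign of
  \<open>row_series\<close> is a true one.\<close>

lemma sign_split:
  assumes S: "finite S" and T: "T \<subseteq> S" and x: "x \<in> S - T" "row x"
  shows "card {s \<in> S. row s} = card {s \<in> T. row s} + card {s \<in> S - T. row s}" "card {s \<in> S - T. row s} > 0"
proof -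
  have "{s \<in> S. row s} = {s \<in> T. row s} \<union> {s \<in> S - T. row s}" using T by auto
  moreover have f: "finite {s \<in> T. row s}" "finite {s \<in> S - T. row s}" using S T by (auto intro: finite_subset[of _ S])
  moreover have "{s \<in> T. row s} \<inter> {s \<in> S - T. row s} = {}" by auto
  ultimately show "card {s \<in> S. row s} = card {s \<in> T. row s} + card {s \<in> S - T. row s}"
    using card_Un_disjoint by metis
  show "card {s \<in> S - T. row s} > 0" using x f by (auto simp: card_gt_0_iff)
qed

lemma minus_one_power_comm: "(- 1) ^ k * z = z * (- 1 :: 'r) ^ k"
  by (cases "even k") simp_all

lemma series_product_coef:
  assumes S: "finite S" "S \<subseteq> V" and i: "row i"
  shows "coef (col_series row j * (con b * row_series row i)) S =
    (- 1) ^ (card {s \<in> S. row s} - 1) * (\<Sum>T\<in>Pow S. tsum row j T * b * tsum row i (S - T))"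
proof -
  have "coef (col_series row j) T * coef (con b * row_series row i) (S - T) =
     (- 1) ^ (card {s \<in> S. row s} - 1) * (tsum row j T * b * tsum row i (S - T))" if T: "T \<in> Pow S" for T
  proof (cases "i \<in> S - T")
    case True
    let ?k = "card {s \<in> T. row s}" and ?l = "card {s \<in> S - T. row s} - 1"
    have "card {s \<in> S. row s} - 1 = ?k + ?l" using sign_split[of S T i row] S T True i by simp
    then have "(- 1) ^ (card {s \<in> S. row s} - 1) * (tsum row j T * b * tsum row i (S - T)) =
      (- 1) ^ ?k * ((- 1) ^ ?l * (tsum row j T * b)) * tsum row i (S - T)" by (simp add: power_add mult.assoc)
    also have "(- 1) ^ ?l * (tsum row j T * b) = tsum row j T * b * (- 1) ^ ?l" by (rule minus_one_power_comm)
    finally show ?thesis using S T by (auto simp: col_series.rep_eq row_series.rep_eq mult.assoc)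
  next
    case False
    then show ?thesis by (simp add: row_series.rep_eq tsum_outside)
  qed
  then show ?thesis unfolding times_sqf.rep_eq by (simp add: sum_distrib_left)
qed

text \<open>The words of plane trees satisfy the recursions of \<open>tree_sums\<close>; the claim
  is the coefficient of \<open>tree_sum_eq_star_sum\<close> at the full vertex set
  \<open>V\<close>.\<close>

theorem plane_tree_sum:
  "(\<Sum>r | r \<in> V \<and> row r. (- 1) ^ (card {s \<in> V. row s} - 1) * tsum row r V) =
   (\<Sum>r | r \<in> V \<and> row r. star_coef r (V - {r}))"
proof -
  let ?R = "{r. r \<in> V \<and> row r}" and ?C = "{c. c \<in> V \<and> \<not> row c}"
  interpret tree_sums V B ?R ?C "row_series row" "col_series row"
  proof
    show "?R \<union> ?C = V" "?R \<inter> ?C = {}" by auto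
    fix a
    show "has a (row_series row a)" "has a (col_series row a)"
      unfolding has_def row_series.rep_eq col_series.rep_eq by (metis mult_zero_right tsum_outside)+
    have "coef (row_series row a) S * B x y = B x y * coef (row_series row a) S"
      "coef (col_series row a) S * B x y = B x y * coef (col_series row a) S"
      if "x \<in> V - S" "y \<in> V - S" "x \<noteq> y" for S x y
      using sign_tsum_comm[OF _ that] by (simp_all add: row_series.rep_eq col_series.rep_eq)
    then show "cen (row_series row a)" "cen (col_series row a)"
      unfolding cen_def by blast+
  next
    fix a assume a: "a \<in> ?R"
    show "row_series row a = tv a + (\<Sum>j\<in>?C. col_series row j * (con (B a j) * row_series row a))"
    proof (rule sqf_eqI)
      fix S :: "'v set" assume S: "finite S"
      show "coef (row_series row a) S =
        coef (tv a + (\<Sum>j\<in>?C. col_series row j * (con (B a j) * row_series row a))) S"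
      proof (cases "S \<subseteq> V")
        case True
        then have e: "coef (\<Sum>j\<in>?C. col_series row j * (con (B a j) * row_series row a)) S =
          (- 1) ^ (card {s \<in> S. row s} - 1) * (\<Sum>j\<in>?C. \<Sum>T\<in>Pow S. tsum row j T * B a j * tsum row a (S - T))"
          using S a by (simp add: coef_sum series_product_coef sum_distrib_left)
        show ?thesis
        proof (cases "S = {a}")
          case True
          have "tsum row j T * B a j * tsum row a (S - T) = 0" if "j \<in> ?C" "T \<in> Pow S" for j T
          proof -
            have "j \<notin> T" using that True a by auto
            then show ?thesis by (simp add: tsum_outside)
          qed
          then have "(\<Sum>j\<in>?C. \<Sum>T\<in>Pow S. tsum row j T * B a j * tsum row a (S - T)) = 0" by simp
          moreover have "{s \<in> {a}. row s} = {a}" using a by auto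
          ultimately show ?thesis using e True a by (simp add: row_series.rep_eq tv.rep_eq tsum_leaf)
        next
          case False
          have "tsum row a S = (\<Sum>j\<in>?C. \<Sum>T\<in>Pow S. tsum row j T * B a j * tsum row a (S - T))"
            using a fin True S False by (intro tsum_row) auto
          then show ?thesis using e True False by (simp add: row_series.rep_eq tv.rep_eq)
        qed
      next
        case False
        have "coef (col_series row j) T * coef (con (B a j) * row_series row a) (S - T) = 0" if "T \<subseteq> S" for j T
          using that False by (auto simp: row_series.rep_eq col_series.rep_eq)
        then show ?thesis using False a by (auto simp: row_series.rep_eq tv.rep_eq coef_sum times_sqf.rep_eq)
      qed
    qed
  next
    fix j assume j: "j \<in> ?C"
    show "col_series row j = tv j + (\<Sum>i\<in>?R. col_series row j * (con (B j i) * row_series row i))"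
    proof (rule sqf_eqI)
      fix S :: "'v set" assume S: "finite S"
      show "coef (col_series row j) S =
        coef (tv j + (\<Sum>i\<in>?R. col_series row j * (con (B j i) * row_series row i))) S"
      proof (cases "S \<subseteq> V")
        case True
        have "coef (\<Sum>i\<in>?R. col_series row j * (con (B j i) * row_series row i)) S =
          (\<Sum>i\<in>?R. (- 1) ^ card {s \<in> S. row s} * (\<Sum>T\<in>Pow S. tsum row j T * B i j * tsum row i (S - T)))"
          unfolding coef_sum
        proof (rule sum.cong[OF refl])
          fix i assume i: "i \<in> ?R"
          \<comment> \<open>This sign accounts for the row that \<open>row_series\<close> does not
            count but \<open>col_series\<close> does.\<close>
          have Bi: "B j i = - B i j" using anti[of i j] i j by auto
          have 0: "(\<Sum>T\<in>Pow S. tsum row j T * B i j * tsum row i (S - T)) = 0" if "i \<notin> S"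
            using that by (auto intro!: sum.neutral simp: tsum_outside)
          have "card {s \<in> S. row s} = Suc (card {s \<in> S. row s} - 1)" if "i \<in> S"
          proof -
            have "i \<in> {s \<in> S. row s}" "finite {s \<in> S. row s}" using that S i by auto
            then have "card {s \<in> S. row s} > 0" by (metis card_gt_0_iff empty_iff)
            then show ?thesis by simp
          qed
          then have s: "(- 1 :: 'r) ^ card {s \<in> S. row s} = - ((- 1) ^ (card {s \<in> S. row s} - 1))" if "i \<in> S"
            using that by (metis mult_minus1 power_Suc)
          have "(\<Sum>T\<in>Pow S. tsum row j T * B j i * tsum row i (S - T)) =
            - (\<Sum>T\<in>Pow S. tsum row j T * B i j * tsum row i (S - T))"
            unfolding Bi by (simp add: sum_negf)
          then show "coef (col_series row j * (con (B j i) * row_series row i)) S =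
            (- 1) ^ card {s \<in> S. row s} * (\<Sum>T\<in>Pow S. tsum row j T * B i j * tsum row i (S - T))"
            using series_product_coef[of S row i j "B j i"] S True i s 0 by (cases "i \<in> S") simp_all
        qed
        then have e: "coef (\<Sum>i\<in>?R. col_series row j * (con (B j i) * row_series row i)) S =
          (- 1) ^ card {s \<in> S. row s} * (\<Sum>i\<in>?R. \<Sum>T\<in>Pow S. tsum row j T * B i j * tsum row i (S - T))"
          by (simp add: sum_distrib_left)
        show ?thesis
        proof (cases "S = {j}")
          case True
          have "tsum row j T * B i j * tsum row i (S - T) = 0" if "i \<in> ?R" "T \<in> Pow S" for i T
          proof -
            have "i \<notin> S - T" using that True j by auto
            then show ?thesis by (simp add: tsum_outside)
          qed
          then have "(\<Sum>i\<in>?R. \<Sum>T\<in>Pow S. tsum row j T * B i j * tsum row i (S - T)) = 0" by simp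
          moreover have "coef (col_series row j) {j} = 1"
          proof -
            have R: "{s \<in> {j}. row s} = {}" using j by auto
            show ?thesis unfolding col_series.rep_eq R using j by (simp add: tsum_leaf)
          qed
          ultimately show ?thesis using e True by (simp add: tv.rep_eq)
        next
          case False
          have "tsum row j S = (\<Sum>i\<in>?R. \<Sum>T\<in>Pow S. tsum row j T * B i j * tsum row i (S - T))"
            using j fin True S False by (intro tsum_col) auto
          then show ?thesis using e True False by (simp add: col_series.rep_eq tv.rep_eq)
        qed
      next
        case False
        have "coef (col_series row j) T * coef (con (B j i) * row_series row i) (S - T) = 0" if "T \<subseteq> S" for i T
          using that False by (auto simp: row_series.rep_eq col_series.rep_eq)
        then show ?thesis using False j by (auto simp: col_series.rep_eq tv.rep_eq coef_sum times_sqf.rep_eq)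
      qed
    qed
  qed
  have "coef (\<Sum>a\<in>?R. row_series row a) V = coef (\<Sum>a\<in>?R. star a) V"
    using tree_sum_eq_star_sum by simp
  then show ?thesis by (simp add: coef_sum row_series.rep_eq star.rep_eq)
qed

end

section \<open>A ring type containing the affine Fomin-Kirillov algebras\<close>

lemma fk_ideal_closed:
  fixes n :: nat
  assumes n: "n \<ge> 2"
  shows "(0 :: 'k::comm_ring_1 series) \<in> fk_ideal n"
    and "\<And>f g :: 'k series. f \<in> fk_ideal n \<Longrightarrow> g \<in> fk_ideal n \<Longrightarrow> f + g \<in> fk_ideal n"
    and "\<And>f :: 'k series. f \<in> fk_ideal n \<Longrightarrow> - f \<in> fk_ideal n"
    and "\<And>f g :: 'k series. f \<in> fk_ideal n \<Longrightarrow> g \<in> inv_alg n \<Longrightarrow> g \<odot> f \<in> fk_ideal n"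
    and "\<And>f g :: 'k series. f \<in> fk_ideal n \<Longrightarrow> g \<in> inv_alg n \<Longrightarrow> f \<odot> g \<in> fk_ideal n"
proof -
  interpret J: ideal "fk_ideal n :: 'k series set" "inv_ring n" by (rule fk_ideal_props[OF n])
  show "(0 :: 'k series) \<in> fk_ideal n"
    using additive_subgroup.zero_closed[OF J.additive_subgroup_axioms] by simp
  show "f + g \<in> fk_ideal n" if "f \<in> fk_ideal n" "g \<in> fk_ideal n" for f g :: "'k series"
    using additive_subgroup.a_closed[OF J.additive_subgroup_axioms that] by simp
  show l: "g \<odot> f \<in> fk_ideal n" if "f \<in> fk_ideal n" "g \<in> inv_alg n" for f g :: "'k series"
    using J.I_l_closed[of f g] that by simp
  show "f \<odot> g \<in> fk_ideal n" if "f \<in> fk_ideal n" "g \<in> inv_alg n" for f g :: "'k series"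
    using J.I_r_closed[of f g] that by simp
  show "- f \<in> fk_ideal n" if "f \<in> fk_ideal n" for f :: "'k series"
  proof -
    have "- word [] \<in> inv_alg n" using inv_alg_uminus inv_alg_word[OF n, of "[]"] by simp
    from l[OF that this] have "- word [] \<odot> f \<in> fk_ideal n" .
    moreover have "- word [] \<odot> f = - (word [] \<odot> f)" by (simp add: series_mult_def fun_eq_iff sum_negf)
    ultimately show ?thesis by (simp only: series_mult_one)
  qed
qed

lemma series_mult_diff:
  "(f - g) \<odot> h = f \<odot> h - g \<odot> h" "h \<odot> (f - g) = h \<odot> f - h \<odot> g"
  by (simp_all add: series_mult_def fun_eq_iff sum_subtractf algebra_simps)

text \<open>
  The type has to be independent of \<open>n\<close>, so it is the product over all \<open>n\<close>. For \<open>n < 2\<close>, where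
  \<open>fk_ideal n\<close> need not be an ideal, no relations are imposed.
\<close>

definition fk_eq :: "(nat \<Rightarrow> 'k::comm_ring_1 series) \<Rightarrow> (nat \<Rightarrow> 'k series) \<Rightarrow> bool" where
  "fk_eq F G \<longleftrightarrow> (\<forall>n. if n \<ge> 2 then F n \<in> inv_alg n \<and> G n \<in> inv_alg n \<and> F n - G n \<in> fk_ideal n else F n = G n)"

lemma fk_eqD:
  assumes "fk_eq F G"
  shows "n \<ge> 2 \<Longrightarrow> F n \<in> inv_alg n" "n \<ge> 2 \<Longrightarrow> G n \<in> inv_alg n" "n \<ge> 2 \<Longrightarrow> F n - G n \<in> fk_ideal n"
    "\<not> n \<ge> 2 \<Longrightarrow> F n = G n"
  using assms unfolding fk_eq_def by meson+

lemma fk_eqI: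
  assumes "\<And>n. n \<ge> 2 \<Longrightarrow> F n \<in> inv_alg n" "\<And>n. n \<ge> 2 \<Longrightarrow> G n \<in> inv_alg n"
    "\<And>n. n \<ge> 2 \<Longrightarrow> F n - G n \<in> fk_ideal n" "\<And>n. \<not> n \<ge> 2 \<Longrightarrow> F n = G n"
  shows "fk_eq F G"
  using assms unfolding fk_eq_def by meson

lemma fk_eq_refl: "(\<And>n. n \<ge> 2 \<Longrightarrow> F n \<in> inv_alg n) \<Longrightarrow> fk_eq F F"
  by (rule fk_eqI) (auto simp: fk_ideal_closed(1) simp del: zero_fun_def)

\<comment> \<open>The quotient is partial because for \<open>n \<ge> 2\<close> only families with
  components in \<open>inv_alg n\<close> represent elements.\<close>
quotient_type (overloaded) 'k fk_alg = "nat \<Rightarrow> 'k::comm_ring_1 series" / partial: fk_eq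
proof (rule part_equivpI)
  show "\<exists>x :: nat \<Rightarrow> 'k series. fk_eq x x" by (rule exI[of _ "\<lambda>_. 0"], rule fk_eq_refl) (rule inv_alg_0)
  show "symp (fk_eq :: (nat \<Rightarrow> 'k series) \<Rightarrow> _)"
  proof (rule sympI, rule fk_eqI)
    fix F G :: "nat \<Rightarrow> 'k series" and n :: nat
    assume e: "fk_eq F G" and n: "n \<ge> 2"
    have "- (F n - G n) \<in> fk_ideal n" by (rule fk_ideal_closed(3)[OF n fk_eqD(3)[OF e n]])
    then show "G n - F n \<in> fk_ideal n" by (simp only: minus_diff_eq)
  qed (auto dest: fk_eqD)
  show "transp (fk_eq :: (nat \<Rightarrow> 'k series) \<Rightarrow> _)"
  proof (rule transpI, rule fk_eqI)
    fix F G H :: "nat \<Rightarrow> 'k series" and n :: nat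
    assume e: "fk_eq F G" "fk_eq G H" and n: "n \<ge> 2"
    have "(F n - G n) + (G n - H n) \<in> fk_ideal n"
      by (rule fk_ideal_closed(2)[OF n fk_eqD(3)[OF e(1) n] fk_eqD(3)[OF e(2) n]])
    then show "F n - H n \<in> fk_ideal n" by (simp only: diff_add_cancel add_diff_eq)
  next
    show "F n = H n" if "fk_eq F G" "fk_eq G H" "\<not> n \<ge> 2" for F G H :: "nat \<Rightarrow> 'k series" and n
      using fk_eqD(4)[OF that(1,3)] fk_eqD(4)[OF that(2,3)] by simp
  qed (auto dest: fk_eqD)
qed

instantiation fk_alg :: (comm_ring_1) ring_1
begin

lift_definition zero_fk_alg :: "'a fk_alg" is "\<lambda>_. 0"
  by (rule fk_eq_refl) (rule inv_alg_0)

lift_definition one_fk_alg :: "'a fk_alg" is "\<lambda>_. word []"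
  by (rule fk_eq_refl) (simp add: inv_alg_word)

lift_definition plus_fk_alg :: "'a fk_alg \<Rightarrow> 'a fk_alg \<Rightarrow> 'a fk_alg" is "\<lambda>F G n. F n + G n"
proof (rule fk_eqI)
  fix F F' G G' :: "nat \<Rightarrow> 'a series" and n :: nat
  assume e: "fk_eq F F'" "fk_eq G G'" and n: "n \<ge> 2"
  have "(F n - F' n) + (G n - G' n) \<in> fk_ideal n"
    by (rule fk_ideal_closed(2)[OF n fk_eqD(3)[OF e(1) n] fk_eqD(3)[OF e(2) n]])
  then show "F n + G n - (F' n + G' n) \<in> fk_ideal n" by (simp only: add_diff_add)
next
  show "F n + G n = F' n + G' n" if "fk_eq F F'" "fk_eq G G'" "\<not> n \<ge> 2" for F F' G G' :: "nat \<Rightarrow> 'a series" and n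
    using fk_eqD(4)[OF that(1,3)] fk_eqD(4)[OF that(2,3)] by simp
qed (auto intro: inv_alg_add dest: fk_eqD simp del: plus_fun_def)

lift_definition uminus_fk_alg :: "'a fk_alg \<Rightarrow> 'a fk_alg" is "\<lambda>F n. - F n"
proof (rule fk_eqI)
  fix F F' :: "nat \<Rightarrow> 'a series" and n :: nat
  assume e: "fk_eq F F'" and n: "n \<ge> 2"
  have "- (F n - F' n) \<in> fk_ideal n" by (rule fk_ideal_closed(3)[OF n fk_eqD(3)[OF e n]])
  then show "- F n - - F' n \<in> fk_ideal n" by (simp only: minus_diff_minus)
next
  show "- F n = - F' n" if "fk_eq F F'" "\<not> n \<ge> 2" for F F' :: "nat \<Rightarrow> 'a series" and n
    using fk_eqD(4)[OF that] by simp
qed (auto intro: inv_alg_uminus dest: fk_eqD simp del: uminus_apply fun_Compl_def)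

lift_definition times_fk_alg :: "'a fk_alg \<Rightarrow> 'a fk_alg \<Rightarrow> 'a fk_alg" is "\<lambda>F G n. F n \<odot> G n"
proof (rule fk_eqI)
  fix F F' G G' :: "nat \<Rightarrow> 'a series" and n :: nat
  assume e: "fk_eq F F'" "fk_eq G G'" and n: "n \<ge> 2"
  have "(F n - F' n) \<odot> G n \<in> fk_ideal n" "F' n \<odot> (G n - G' n) \<in> fk_ideal n"
    using e n by (auto intro: fk_ideal_closed dest: fk_eqD)
  then have "(F n - F' n) \<odot> G n + F' n \<odot> (G n - G' n) \<in> fk_ideal n" by (rule fk_ideal_closed(2)[OF n])
  then show "F n \<odot> G n - F' n \<odot> G' n \<in> fk_ideal n"
    by (simp only: series_mult_diff diff_add_cancel add_diff_eq)
next
  show "F n \<odot> G n = F' n \<odot> G' n" if "fk_eq F F'" "fk_eq G G'" "\<not> n \<ge> 2" for F F' G G' :: "nat \<Rightarrow> 'a series" and n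
    using fk_eqD(4)[OF that(1,3)] fk_eqD(4)[OF that(2,3)] by simp
qed (auto intro!: inv_alg_mult dest: fk_eqD)

definition minus_fk_alg :: "'a fk_alg \<Rightarrow> 'a fk_alg \<Rightarrow> 'a fk_alg" where
  "minus_fk_alg F G = F + - G"

instance
proof
  fix a b c :: "'a fk_alg"
  show "a + b + c = a + (b + c)"
    by transfer (simp only: add.assoc, rule fk_eq_refl, auto intro!: inv_alg_add dest: fk_eqD simp del: plus_fun_def)
  show "a + b = b + a"
    by transfer (simp only: add.commute, rule fk_eq_refl, auto intro!: inv_alg_add dest: fk_eqD simp del: plus_fun_def)
  show "0 + a = a" by transfer (simp only: add_0)
  show "- a + a = 0" by transfer (simp only: left_minus, rule fk_eq_refl, rule inv_alg_0)
  show "a - b = a + - b" by (simp add: minus_fk_alg_def)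
  show "a * b * c = a * (b * c)"
    by transfer (simp only: series_mult_assoc, rule fk_eq_refl, auto intro!: inv_alg_mult dest: fk_eqD)
  show "(a + b) * c = a * c + b * c"
    by transfer (simp only: series_mult_distrib, rule fk_eq_refl,
        auto intro!: inv_alg_mult inv_alg_add dest: fk_eqD simp del: plus_fun_def)
  show "a * (b + c) = a * b + a * c"
    by transfer (simp only: series_mult_distrib, rule fk_eq_refl,
        auto intro!: inv_alg_mult inv_alg_add dest: fk_eqD simp del: plus_fun_def)
  show "1 * a = a" by transfer (simp only: series_mult_one)
  show "a * 1 = a" by transfer (simp only: series_mult_one)
  \<comment> \<open>Component 0 carries no relations, so the two elements differ there whatever the
    ideals for \<open>n \<ge> 2\<close> are.\<close>
  show "(0 :: 'a fk_alg) \<noteq> 1"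
    by transfer (auto simp: fk_eq_def word_def fun_eq_iff intro!: exI[of _ 0])
qed

end

text \<open>The class of \<open>f\<close> in component \<open>n\<close>, with 0 in all others and
  for series outside \<open>inv_alg n\<close>. In particular \<open>cls n (word [])\<close> is not
  the unit of the product ring, whence the restriction to nonempty words and positive exponents in
  what follows.\<close>

lift_definition cls :: "nat \<Rightarrow> 'k::comm_ring_1 series \<Rightarrow> 'k fk_alg" is
  "\<lambda>n f m. if m = n \<and> f \<in> inv_alg n then f else 0"
  by (rule fk_eq_refl) (auto simp: inv_alg_0 simp del: zero_fun_def)

lemma cls_eq_iff:
  assumes n: "n \<ge> 2" and f: "f \<in> inv_alg n" and g: "g \<in> inv_alg n"
  shows "cls n f = cls n g \<longleftrightarrow> f - g \<in> fk_ideal n"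
  using assms
proof transfer
  fix n and f g :: "'a series"
  assume n: "n \<ge> 2" and f: "f \<in> inv_alg n" and g: "g \<in> inv_alg n"
  show "fk_eq (\<lambda>m. if m = n \<and> f \<in> inv_alg n then f else 0) (\<lambda>m. if m = n \<and> g \<in> inv_alg n then g else 0) \<longleftrightarrow>
    f - g \<in> fk_ideal n"
  proof
    assume "f - g \<in> fk_ideal n"
    then show "fk_eq (\<lambda>m. if m = n \<and> f \<in> inv_alg n then f else 0) (\<lambda>m. if m = n \<and> g \<in> inv_alg n then g else 0)"
      using n f g by (auto intro!: fk_eqI simp: inv_alg_0 fk_ideal_closed(1) simp del: zero_fun_def minus_apply fun_diff_def)
  qed (use n f g fk_eqD(3) in fastforce)
qed

lemma cls_mult: "n \<ge> 2 \<Longrightarrow> f \<in> inv_alg n \<Longrightarrow> g \<in> inv_alg n \<Longrightarrow> cls n (f \<odot> g) = cls n f * cls n g"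
proof transfer
  fix n and f g :: "'a series"
  assume n: "n \<ge> 2" and f: "f \<in> inv_alg n" and g: "g \<in> inv_alg n"
  have z: "(0 :: 'a series) \<odot> 0 = 0" by (simp add: series_mult_def fun_eq_iff)
  have fg: "f \<odot> g \<in> inv_alg n" using n f g by (intro inv_alg_mult) auto
  have "(\<lambda>m. if m = n \<and> f \<odot> g \<in> inv_alg n then f \<odot> g else 0) =
    (\<lambda>m. (if m = n \<and> f \<in> inv_alg n then f else 0) \<odot> (if m = n \<and> g \<in> inv_alg n then g else 0))"
    using f g fg z by (intro ext) (simp del: zero_fun_def)
  moreover have "fk_eq (\<lambda>m. if m = n \<and> f \<odot> g \<in> inv_alg n then f \<odot> g else 0)
      (\<lambda>m. if m = n \<and> f \<odot> g \<in> inv_alg n then f \<odot> g else 0)"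
    by (rule fk_eq_refl) (auto simp: inv_alg_0 simp del: zero_fun_def)
  ultimately show "fk_eq (\<lambda>m. if m = n \<and> f \<odot> g \<in> inv_alg n then f \<odot> g else 0)
    (\<lambda>m. (if m = n \<and> f \<in> inv_alg n then f else 0) \<odot> (if m = n \<and> g \<in> inv_alg n then g else 0))"
    by (simp only:)
qed

lemma cls_add: "f \<in> inv_alg n \<Longrightarrow> g \<in> inv_alg n \<Longrightarrow> cls n (f + g) = cls n f + cls n g"
proof transfer
  fix n and f g :: "'a series"
  assume f: "f \<in> inv_alg n" and g: "g \<in> inv_alg n"
  have fg: "f + g \<in> inv_alg n" using f g by (rule inv_alg_add)
  have "(\<lambda>m. if m = n \<and> f + g \<in> inv_alg n then f + g else 0) =
    (\<lambda>m. (if m = n \<and> f \<in> inv_alg n then f else 0) + (if m = n \<and> g \<in> inv_alg n then g else 0))"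
    using f g fg by (intro ext) (simp del: zero_fun_def plus_fun_def)
  moreover have "fk_eq (\<lambda>m. if m = n \<and> f + g \<in> inv_alg n then f + g else 0)
      (\<lambda>m. if m = n \<and> f + g \<in> inv_alg n then f + g else 0)"
    by (rule fk_eq_refl) (auto simp: inv_alg_0 simp del: zero_fun_def plus_fun_def)
  ultimately show "fk_eq (\<lambda>m. if m = n \<and> f + g \<in> inv_alg n then f + g else 0)
    (\<lambda>m. (if m = n \<and> f \<in> inv_alg n then f else 0) + (if m = n \<and> g \<in> inv_alg n then g else 0))"
    by (simp only:)
qed

lemma cls_0: "cls n 0 = 0"
  by transfer (rule fk_eqI, auto simp: inv_alg_0 fk_ideal_closed(1) simp del: zero_fun_def)

lemma cls_uminus: "f \<in> inv_alg n \<Longrightarrow> cls n (- f) = - cls n f"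
  using cls_add[of f n "- f"] inv_alg_uminus[of f n] by (simp add: cls_0 eq_neg_iff_add_eq_0 add.commute)

lemma cls_diff: "f \<in> inv_alg n \<Longrightarrow> g \<in> inv_alg n \<Longrightarrow> cls n (f - g) = cls n f - cls n g"
  using cls_add[of f n "- g"] cls_uminus[of g n] inv_alg_uminus[of g n] by simp

lemma inv_alg_finite_sum: "n \<ge> 2 \<Longrightarrow> (\<And>x. x \<in> I \<Longrightarrow> F x \<in> inv_alg n) \<Longrightarrow> sum F I \<in> inv_alg n"
  by (induction I rule: infinite_finite_induct)
     (auto simp: inv_alg_0 intro!: inv_alg_add simp del: plus_fun_def zero_fun_def)

lemma cls_sum:
  assumes n: "n \<ge> 2" and F: "\<And>x. x \<in> I \<Longrightarrow> F x \<in> inv_alg n"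
  shows "cls n (sum F I) = (\<Sum>x\<in>I. cls n (F x))"
  using F
proof (induction I rule: infinite_finite_induct)
  case (insert x I)
  then have "F x \<in> inv_alg n" "sum F I \<in> inv_alg n" using inv_alg_finite_sum[OF n, of I F] by auto
  then have "cls n (F x + sum F I) = cls n (F x) + cls n (sum F I)" by (rule cls_add)
  then show ?case using insert by (simp only: sum.insert insert_iff simp_thms)
qed (simp_all add: cls_0 del: zero_fun_def)

lemma cls_eq_0_iff: "n \<ge> 2 \<Longrightarrow> f \<in> inv_alg n \<Longrightarrow> cls n f = 0 \<longleftrightarrow> f \<in> fk_ideal n"
  using cls_eq_iff[of n f 0] by (simp add: cls_0 inv_alg_0 del: zero_fun_def minus_apply fun_diff_def)

abbreviation B :: "nat \<Rightarrow> int \<Rightarrow> int \<Rightarrow> 'k::comm_ring_1 fk_alg" where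
  "B n i j \<equiv> cls n (br i j)"

lemma cls_rel:
  assumes n: "n \<ge> 2" and r: "(f, g) \<in> fk_rels n"
  shows "cls n f = cls n g"
  using cls_eq_iff[OF n fk_rels_inv_alg[OF n r]] fk_ideal_props(3)[OF n r] by simp

lemma br_swap: "i \<noteq> j \<Longrightarrow> br j i = - br i j"
  by (auto simp: br_def)

lemma B_swap: "n \<ge> 2 \<Longrightarrow> \<not> [i = j] (mod int n) \<Longrightarrow> B n j i = - B n i j"
  using cls_uminus[OF inv_alg_br, of n i j] br_swap[of i j] by (metis cong_refl)

text \<open>Distinct residues are exactly what the relations \<open>b\<close> and \<open>c1\<close>
  ask for, so the finite theory applies to every such vertex set.\<close>

lemma B_fk_system:
  assumes n: "n \<ge> 2" and V: "finite V" "inj_on (\<lambda>x. x mod int n) V"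
  shows "fk_system V (B n :: int \<Rightarrow> int \<Rightarrow> 'k::comm_ring_1 fk_alg)"
proof
  have ne: "\<not> [x = y] (mod int n)" if "x \<in> V" "y \<in> V" "x \<noteq> y" for x y
    using V(2) that by (auto simp: cong_def inj_on_def)
  have mem: "(br x y :: 'k series) \<in> inv_alg n" if "x \<in> V" "y \<in> V" "x \<noteq> y" for x y
    using inv_alg_br[OF n ne[OF that]] .
  show "B n y x = - (B n x y :: 'k fk_alg)" if "x \<in> V" "y \<in> V" "x \<noteq> y" for x y
    by (rule B_swap[OF n ne[OF that]])
  show "(B n x y :: 'k fk_alg) * B n z w = B n z w * B n x y" if "{x, y, z, w} \<subseteq> V" "distinct [x, y, z, w]" for x y z w
  proof -
    have "distinct [x mod int n, y mod int n, z mod int n, w mod int n]"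
      using that ne unfolding cong_def by auto
    then have "cls n (br x y \<odot> br z w :: 'k series) = cls n (br z w \<odot> br x y)"
      by (intro cls_rel[OF n] fk_rels.b)
    then show ?thesis using that mem n by (simp add: cls_mult)
  qed
  show "(B n x y :: 'k fk_alg) * B n y z + B n y z * B n z x + B n z x * B n x y = 0"
    if "{x, y, z} \<subseteq> V" "distinct [x, y, z]" for x y z
  proof -
    have "distinct [x mod int n, y mod int n, z mod int n]"
      using that ne unfolding cong_def by auto
    then have "cls n (br x y \<odot> br y z :: 'k series) = cls n (br y z \<odot> br x z + br x z \<odot> br x y)"
      by (intro cls_rel[OF n] fk_rels.c1)
    then have "(B n x y :: 'k fk_alg) * B n y z = B n y z * B n x z + B n x z * B n x y"
      using that mem n by (simp add: cls_mult cls_add inv_alg_mult del: plus_fun_def)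
    moreover have "(B n z x :: 'k fk_alg) = - B n x z" using B_swap[OF n ne, of x z] that by auto
    ultimately show ?thesis by simp
  qed
qed (use V in auto)

section \<open>Locally finite sums\<close>

definition wide :: "int \<Rightarrow> (int \<times> int) list \<Rightarrow> bool" where
  "wide C u \<longleftrightarrow> (\<forall>(i, j)\<in>set u. j - i \<le> C)"

text \<open>Finiteness is measured by the widths \<open>j - i\<close> of letters, which are
  invariant under translation by \<open>n\<close> and change by a bounded amount under a group
  element; one condition thus covers all group elements in \<open>fk_summable\<close>.\<close>

definition locfin :: "('b \<Rightarrow> 'k::comm_ring_1 series) \<Rightarrow> 'b set \<Rightarrow> bool" where
  "locfin F I \<longleftrightarrow> (\<forall>C. finite {x \<in> I. \<exists>u. wide C u \<and> F x u \<noteq> 0})"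

lemma locfinD: "locfin F I \<Longrightarrow> finite {x \<in> I. F x u \<noteq> 0}"
proof -
  assume l: "locfin F I"
  let ?C = "Max (insert 0 ((\<lambda>(i, j). j - i) ` set u))"
  have "wide ?C u" unfolding wide_def
  proof clarify
    fix i j assume "(i, j) \<in> set u"
    then have "j - i \<in> (\<lambda>(i, j). j - i) ` set u" by force
    then show "j - i \<le> ?C" by (intro Max_ge) auto
  qed
  then have "{x \<in> I. F x u \<noteq> 0} \<subseteq> {x \<in> I. \<exists>u. wide ?C u \<and> F x u \<noteq> 0}" by blast
  then show ?thesis using l finite_subset unfolding locfin_def by blast
qed

lemma series_sum_finite:
  "finite A \<Longrightarrow> A \<subseteq> I \<Longrightarrow> {x \<in> I. F x u \<noteq> 0} \<subseteq> A \<Longrightarrow> series_sum F I u = (\<Sum>x\<in>A. F x u)"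
  unfolding series_sum_def by (rule sum.mono_neutral_left) auto

lemma wide_pull:
  assumes n: "n \<ge> 2" and p: "p \<in> aff_sym n" and u: "ordered_word u" "wide C u"
  shows "wide (\<bar>C\<bar> + 2 * int (aff_len n p)) (pull_word p u)"
  unfolding wide_def
proof clarify
  fix a b assume "(a, b) \<in> set (pull_word p u)"
  then obtain i j where ij: "(i, j) \<in> set u" "a = min (p i) (p j)" "b = max (p i) (p j)"
    by (auto simp: pull_word_def)
  have "j - i \<le> C" "i < j" using u ij by (auto simp: wide_def)
  then show "b - a \<le> \<bar>C\<bar> + 2 * int (aff_len n p)"
    using ij(2,3) aff_sym_disp[OF n p, of i] aff_sym_disp[OF n p, of j] by linarith
qed

text \<open>By \<open>nil_act_width\<close> a word that does not annihilate \<open>A_w\<close> has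
  letters of width at most twice the length of \<open>w\<close>, and pulling it back along
  \<open>v\<close> adds at most twice the length of the inverse of \<open>v\<close>.\<close>

lemma fk_summable_locfin:
  assumes n: "n \<ge> 2" and X: "\<And>k. X k \<in> inv_alg n" and lf: "locfin X UNIV"
  shows "fk_summable n X"
  unfolding fk_summable_def
proof (intro conjI allI ballI X)
  fix N
  have "wide (2 * N) u" if "u \<in> bounded_words N" for u
    using that by (fastforce simp: wide_def bounded_words_def)
  then have "{k. \<exists>u\<in>bounded_words N. X k u \<noteq> 0} \<subseteq> {k \<in> UNIV. \<exists>u. wide (2 * N) u \<and> X k u \<noteq> 0}" by blast
  then show "finite {k. \<exists>u\<in>bounded_words N. X k u \<noteq> 0}" using lf finite_subset unfolding locfin_def by blast
next
  fix v w assume v: "v \<in> aff_sym n" and w: "w \<in> aff_sym n"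
  let ?p = "inv_into UNIV v"
  have p: "?p \<in> aff_sym n" using aff_sym_inv[OF _ v] n by simp
  let ?C = "2 * int (aff_len n w)"
  let ?D = "\<bar>?C\<bar> + 2 * int (aff_len n ?p)"
  have "\<exists>u'. wide ?D u' \<and> X k u' \<noteq> 0" if u: "series_act v (X k) u \<noteq> 0" "nil_act n w u \<noteq> None" for k u
  proof -
    have XL: "set u \<subseteq> letters n" if "X k u \<noteq> 0" for u
      using X[of k] that unfolding inv_alg_def fin_act_alg_def compl_alg_def by blast
    have l: "set u \<subseteq> letters n" by (rule series_act_letters[OF _ v XL u(1)]) (use n in auto)
    then have "wide ?C u" using nil_act_width[OF n w u(2)] by (auto simp: wide_def)
    moreover have "ordered_word u" "X k (pull_word ?p u) \<noteq> 0" using u(1) unfolding series_act_nz by auto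
    ultimately show ?thesis using wide_pull[OF n p] by blast
  qed
  then have "{k. \<exists>u. series_act v (X k) u \<noteq> 0 \<and> nil_act n w u \<noteq> None} \<subseteq> {k \<in> UNIV. \<exists>u. wide ?D u \<and> X k u \<noteq> 0}"
    by blast
  then show "finite {k. \<exists>u. series_act v (X k) u \<noteq> 0 \<and> nil_act n w u \<noteq> None}"
    using lf finite_subset unfolding locfin_def by blast
qed

text \<open>The passage from finite to infinite identities: each member is placed in the ideal by a
  finite computation, and the closure of the ideal gives their sum.\<close>

lemma series_sum_ideal:
  assumes n: "n \<ge> 2" and I: "countable I" and F: "\<And>x. x \<in> I \<Longrightarrow> F x \<in> fk_ideal n" and lf: "locfin F I"
  shows "series_sum F I \<in> fk_ideal n"
proof -
  let ?K = "to_nat_on I ` I"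
  define X where "X k = (if k \<in> ?K then F (from_nat_into I k) else 0)" for k
  have Xt: "X (to_nat_on I x) = F x" if "x \<in> I" for x using that I by (simp add: X_def)
  have XJ: "X k \<in> fk_ideal n" for k
    using F fk_ideal_closed(1)[OF n] I by (auto simp: X_def simp del: zero_fun_def)
  then have Xi: "X k \<in> inv_alg n" for k using fk_ideal_props(4)[OF n] by blast
  have "locfin X UNIV"
    unfolding locfin_def
  proof
    fix C
    have "{k \<in> UNIV. \<exists>u. wide C u \<and> X k u \<noteq> 0} \<subseteq> to_nat_on I ` {x \<in> I. \<exists>u. wide C u \<and> F x u \<noteq> 0}"
    proof
      fix k assume "k \<in> {k \<in> UNIV. \<exists>u. wide C u \<and> X k u \<noteq> 0}"
      then obtain u where u: "wide C u" "X k u \<noteq> 0" by auto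
      then have "k \<in> ?K" by (auto simp: X_def split: if_splits)
      then obtain x where "x \<in> I" "k = to_nat_on I x" by auto
      then show "k \<in> to_nat_on I ` {x \<in> I. \<exists>u. wide C u \<and> F x u \<noteq> 0}" using u Xt by auto
    qed
    then show "finite {k \<in> UNIV. \<exists>u. wide C u \<and> X k u \<noteq> 0}"
      using lf finite_subset unfolding locfin_def by blast
  qed
  then have "fk_summable n X" by (rule fk_summable_locfin[OF n Xi])
  then have "series_sum X UNIV \<in> fk_ideal n"
    using fk_ideal_props(2)[OF n] XJ unfolding fk_closed_def by blast
  moreover have "series_sum X UNIV = series_sum F I"
  proof -
    have "series_sum X UNIV = series_sum X ?K"
    proof
      fix u
      have "{k. k \<in> UNIV \<and> X k u \<noteq> 0} = {k. k \<in> ?K \<and> X k u \<noteq> 0}" by (auto simp: X_def)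
      then show "series_sum X UNIV u = series_sum X ?K u" by (simp add: series_sum_def)
    qed
    also have "\<dots> = series_sum (\<lambda>x. X (to_nat_on I x)) I"
      by (rule series_sum_reindex) (use I in \<open>simp add: bij_betw_def inj_on_to_nat_on\<close>)
    also have "\<dots> = series_sum F I" by (rule series_sum_cong) (rule Xt)
    finally show ?thesis .
  qed
  ultimately show ?thesis by simp
qed

lemma series_sum_add:
  assumes "\<And>u. finite {x \<in> I. F x u \<noteq> 0}" "\<And>u. finite {x \<in> I. G x u \<noteq> 0}"
  shows "series_sum (\<lambda>x. F x + G x) I = series_sum F I + series_sum G I"
proof
  fix u
  let ?A = "{x \<in> I. F x u \<noteq> 0} \<union> {x \<in> I. G x u \<noteq> 0}"
  have A: "finite ?A" "?A \<subseteq> I" using assms by auto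
  have "series_sum (\<lambda>x. F x + G x) I u = (\<Sum>x\<in>?A. (F x + G x) u)"
    by (rule series_sum_finite[OF A]) auto
  also have "\<dots> = series_sum F I u + series_sum G I u"
    using series_sum_finite[OF A, of F u] series_sum_finite[OF A, of G u] by (auto simp: sum.distrib)
  finally show "series_sum (\<lambda>x. F x + G x) I u = (series_sum F I + series_sum G I) u" by simp
qed

lemma series_sum_uminus: "series_sum (\<lambda>x. - F x) I = - series_sum F I"
  by (auto simp: series_sum_def sum_negf)

lemma series_sum_diff:
  assumes "\<And>u. finite {x \<in> I. F x u \<noteq> 0}" "\<And>u. finite {x \<in> I. G x u \<noteq> 0}"
  shows "series_sum (\<lambda>x. F x - G x) I = series_sum F I - series_sum G I"
  using series_sum_add[of I F "\<lambda>x. - G x"] assms by (simp add: series_sum_uminus del: plus_fun_def)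

lemma series_sum_mult:
  assumes F: "\<And>u. finite {x \<in> I. F x u \<noteq> 0}" and G: "\<And>u. finite {y \<in> J. G y u \<noteq> 0}"
  shows "series_sum F I \<odot> series_sum G J = series_sum (\<lambda>(x, y). F x \<odot> G y) (I \<times> J)"
    and "finite {p \<in> I \<times> J. (case p of (x, y) \<Rightarrow> F x \<odot> G y) u \<noteq> 0}"
proof -
  let ?A = "\<lambda>u. \<Union>k\<in>{..length u}. {x \<in> I. F x (take k u) \<noteq> 0}"
  let ?B = "\<lambda>u. \<Union>k\<in>{..length u}. {y \<in> J. G y (drop k u) \<noteq> 0}"
  have fin: "finite (?A u)" "finite (?B u)" for u using F G by auto
  have sub: "{p \<in> I \<times> J. (case p of (x, y) \<Rightarrow> F x \<odot> G y) u \<noteq> 0} \<subseteq> ?A u \<times> ?B u" for u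
  proof
    fix p assume "p \<in> {p \<in> I \<times> J. (case p of (x, y) \<Rightarrow> F x \<odot> G y) u \<noteq> 0}"
    then obtain x y where p: "p = (x, y)" "x \<in> I" "y \<in> J" "(F x \<odot> G y) u \<noteq> 0" by auto
    then obtain a b where ab: "u = a @ b" "F x a \<noteq> 0" "G y b \<noteq> 0" by (auto elim: series_mult_nz)
    then have "take (length a) u = a" "drop (length a) u = b" "length a \<in> {..length u}" by auto
    then show "p \<in> ?A u \<times> ?B u" using p ab(2,3) by (auto intro!: bexI[of _ "length a"])
  qed
  show "finite {p \<in> I \<times> J. (case p of (x, y) \<Rightarrow> F x \<odot> G y) u \<noteq> 0}"
    by (rule finite_subset[OF sub finite_cartesian_product[OF fin]])
  show "series_sum F I \<odot> series_sum G J = series_sum (\<lambda>(x, y). F x \<odot> G y) (I \<times> J)"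
  proof
    fix u
    have "(series_sum F I \<odot> series_sum G J) u = (\<Sum>k\<le>length u. (\<Sum>x\<in>?A u. F x (take k u)) * (\<Sum>y\<in>?B u. G y (drop k u)))"
      unfolding series_mult_def
    proof (intro sum.cong refl)
      fix k assume k: "k \<in> {..length u}"
      have "series_sum F I (take k u) = (\<Sum>x\<in>?A u. F x (take k u))"
        by (rule series_sum_finite[OF fin(1)]) (use k in blast)+
      moreover have "series_sum G J (drop k u) = (\<Sum>y\<in>?B u. G y (drop k u))"
        by (rule series_sum_finite[OF fin(2)]) (use k in blast)+
      ultimately show "series_sum F I (take k u) * series_sum G J (drop k u) =
        (\<Sum>x\<in>?A u. F x (take k u)) * (\<Sum>y\<in>?B u. G y (drop k u))" by simp
    qed
    also have "\<dots> = (\<Sum>k\<le>length u. \<Sum>(x, y)\<in>?A u \<times> ?B u. F x (take k u) * G y (drop k u))"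
      by (simp add: sum_product sum.cartesian_product)
    also have "\<dots> = (\<Sum>p\<in>?A u \<times> ?B u. (case p of (x, y) \<Rightarrow> F x \<odot> G y) u)"
      by (subst sum.swap) (auto simp: series_mult_def split_beta intro!: sum.cong)
    also have "\<dots> = series_sum (\<lambda>(x, y). F x \<odot> G y) (I \<times> J) u"
      by (rule series_sum_finite[symmetric]) (use fin sub in auto)
    finally show "(series_sum F I \<odot> series_sum G J) u = series_sum (\<lambda>(x, y). F x \<odot> G y) (I \<times> J) u" .
  qed
qed

lemma width_fin_iff:
  "width_fin n f \<longleftrightarrow> (\<forall>u. f u \<noteq> 0 \<longrightarrow> set u \<subseteq> letters n) \<and> (\<forall>C. finite {u. f u \<noteq> 0 \<and> wide C u})"
  by (simp add: width_fin_def wide_def)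

lemma width_fin_series_sum:
  assumes F: "\<And>x. x \<in> I \<Longrightarrow> width_fin n (F x)" and lf: "locfin F I"
  shows "width_fin n (series_sum F I)"
  unfolding width_fin_iff
proof (intro conjI allI impI)
  fix u assume "series_sum F I u \<noteq> 0"
  then obtain x where "x \<in> I" "F x u \<noteq> 0" using series_sum_nz by blast
  then show "set u \<subseteq> letters n" using F unfolding width_fin_iff by blast
next
  fix C
  let ?A = "{x \<in> I. \<exists>u. wide C u \<and> F x u \<noteq> 0}"
  have "{u. series_sum F I u \<noteq> 0 \<and> wide C u} \<subseteq> (\<Union>x\<in>?A. {u. F x u \<noteq> 0 \<and> wide C u})"
  proof
    fix u assume u: "u \<in> {u. series_sum F I u \<noteq> 0 \<and> wide C u}"
    then obtain x where "x \<in> I" "F x u \<noteq> 0" using series_sum_nz by blast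
    then show "u \<in> (\<Union>x\<in>?A. {u. F x u \<noteq> 0 \<and> wide C u})" using u by blast
  qed
  moreover have "finite (\<Union>x\<in>?A. {u. F x u \<noteq> 0 \<and> wide C u})"
    using lf F unfolding locfin_def width_fin_iff by (intro finite_UN_I) auto
  ultimately show "finite {u. series_sum F I u \<noteq> 0 \<and> wide C u}" by (rule finite_subset)
qed

lemma word_append: "word (u @ v) = (word u \<odot> word v :: 'k::comm_ring_1 series)"
proof
  fix w
  have "word u (take k w) * word v (drop k w) = (if w = u @ v \<and> k = length u then 1 else 0 :: 'k)" if "k \<le> length w" for k
  proof -
    have "take k w = u \<and> drop k w = v \<longleftrightarrow> w = u @ v \<and> k = length u"
      using that by (auto simp: append_eq_conv_conj)
    then show ?thesis by (auto simp: word_def)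
  qed
  then have "(word u \<odot> word v) w = (\<Sum>k\<le>length w. if w = u @ v \<and> k = length u then 1 else 0 :: 'k)"
    unfolding series_mult_def by (intro sum.cong) auto
  then show "word (u @ v) w = (word u \<odot> word v :: 'k series) w" by (cases "w = u @ v") (simp_all add: word_def)
qed

lemma cls_word:
  assumes n: "n \<ge> 2" and u: "u \<noteq> []" "set u \<subseteq> letters n"
  shows "cls n (word u) = (prod_list (map (\<lambda>e. B n (fst e) (snd e)) u) :: 'k::comm_ring_1 fk_alg)"
  using u
proof (induction u rule: list_nonempty_induct)
  case (single e)
  then show ?case by (auto simp: letters_def br_def)
next
  case (cons e u)
  have e: "cls n (word [e]) = (B n (fst e) (snd e) :: 'k fk_alg)" using cons.prems by (auto simp: letters_def br_def)
  have "word (e # u) = (word [e] \<odot> word u :: 'k series)" using word_append[of "[e]" u] by simp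
  moreover have "(word [e] :: 'k series) \<in> inv_alg n" "(word u :: 'k series) \<in> inv_alg n"
    using cons.prems n by (auto intro!: inv_alg_word)
  ultimately show ?case using cons e n by (simp add: cls_mult)
qed

text \<open>The vertices have distinct residues, so every swap of letters with disjoint supports is
  an instance of the commutation relation.\<close>

lemma cls_word_lab_equiv:
  assumes n: "n \<ge> 2" and L: "set L \<subseteq> letters n" "inj_on (\<lambda>x. x mod int n) (verts (set L))" "L \<noteq> []"
    and eq: "lab_equiv L L'"
  shows "cls n (word L) = (cls n (word L') :: 'k::comm_ring_1 fk_alg)"
proof -
  let ?V = "verts (set L)" and ?ev = "\<lambda>L. prod_list (map (\<lambda>e. B n (fst e) (snd e) :: 'k fk_alg) L)"
  have fV: "finite ?V" by (simp add: verts_def)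
  interpret fk_system ?V "B n :: int \<Rightarrow> int \<Rightarrow> 'k fk_alg" by (rule B_fk_system[OF n fV L(2)])
  from eq have "set L' = set L \<and> ?ev L = ?ev L'"
    unfolding lab_equiv_def
  proof (induction rule: rtranclp_induct)
    case (step y z)
    obtain xs ys e e' where s: "y = xs @ [e, e'] @ ys" "z = xs @ [e', e] @ ys" "\<not> meets e e'"
      using step(2) unfolding swap_step_iff by blast
    have m: "e \<in> set L" "e' \<in> set L" using step s by auto
    have V: "fst e \<in> ?V" "snd e \<in> ?V" "fst e' \<in> ?V" "snd e' \<in> ?V" using m by (auto simp: verts_def)
    have "fst e \<noteq> snd e" "fst e' \<noteq> snd e'" using m L(1) by (auto simp: letters_def)
    then have "B n (fst e) (snd e) * B n (fst e') (snd e') = B n (fst e') (snd e') * (B n (fst e) (snd e) :: 'k fk_alg)"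
      using V s(3) by (intro comm) (auto simp: meets_def)
    then have "?ev y = ?ev z" using s by (simp add: mult.assoc[symmetric])
    then show ?case using step s by auto
  qed simp
  then have e: "set L' = set L" "?ev L = ?ev L'" by blast+
  then have L': "L' \<noteq> []" "set L' \<subseteq> letters n" using L(1,3) by auto
  show ?thesis unfolding cls_word[OF n L(3,1)] cls_word[OF n L'] by (rule e(2))
qed

lemma sign_series_ideal:
  assumes "n \<ge> 2" "f \<in> fk_ideal n"
  shows "(\<lambda>w. (- 1) ^ k * f w) \<in> fk_ideal n"
proof (cases "even k")
  case False
  then have "(\<lambda>w. (- 1) ^ k * f w) = - f" by (simp add: fun_eq_iff)
  then show ?thesis using fk_ideal_closed(3)[OF assms] by (simp only:)
qed (use assms in simp)

lemma series_sum_words: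
  "series_sum (\<lambda>u w. c u * word u w) U = (\<lambda>w. if w \<in> U then c w else (0 :: 'k::comm_ring_1))"
proof
  fix w
  have "series_sum (\<lambda>u w. c u * word u w) U w = (\<Sum>u\<in>(if w \<in> U then {w} else {}). c u * word u w)"
    by (rule series_sum_finite) (auto simp: word_def)
  then show "series_sum (\<lambda>u w. c u * word u w) U w = (if w \<in> U then c w else 0)" by (simp add: word_def)
qed

section \<open>The series of plane trees\<close>

text \<open>The vertex set is read off from the letters. The empty word then has no vertex that
  could be its root, so the set is empty for \<open>m = 0\<close>.\<close>

definition tree_words :: "nat \<Rightarrow> nat \<Rightarrow> int \<Rightarrow> (int \<times> int) list set" where
  "tree_words n m a = {u. length u = m \<and> inj_on (\<lambda>x. x mod int n) (verts (set u)) \<and>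
     (\<exists>r\<le>a. rtree (\<lambda>s. s \<le> a) r (verts (set u)) u)}"

definition tree_sign :: "int \<Rightarrow> (int \<times> int) list \<Rightarrow> 'k::comm_ring_1" where
  "tree_sign a u = (- 1) ^ (card {x \<in> verts (set u). x \<le> a} - 1)"

definition tree_series :: "nat \<Rightarrow> nat \<Rightarrow> int \<Rightarrow> 'k::comm_ring_1 series" where
  "tree_series n m a = (\<lambda>u. if u \<in> tree_words n m a then tree_sign a u else 0)"

lemma tree_words_letters: "u \<in> tree_words n m a \<Longrightarrow> e \<in> set u \<Longrightarrow> fst e \<le> a \<and> a < snd e"
  unfolding tree_words_def using rtree_letters by fastforce

lemma inj_mod_letters:
  assumes "inj_on (\<lambda>x. x mod int n) (verts (set u))" "ordered_word u"
  shows "set u \<subseteq> letters n"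
proof
  fix e assume e: "e \<in> set u"
  then have "fst e \<in> verts (set u)" "snd e \<in> verts (set u)" "fst e < snd e" using assms(2) by (auto simp: verts_def)
  then have "\<not> [fst e = snd e] (mod int n)" using assms(1) by (auto simp: cong_def inj_on_def)
  then show "e \<in> letters n" using \<open>fst e < snd e\<close> by (cases e) (simp add: letters_def)
qed

lemma tree_words_subset_letters: "u \<in> tree_words n m a \<Longrightarrow> set u \<subseteq> letters n"
proof (rule inj_mod_letters)
  assume u: "u \<in> tree_words n m a"
  then show "inj_on (\<lambda>x. x mod int n) (verts (set u))" by (simp add: tree_words_def)
  show "ordered_word u" using tree_words_letters[OF u] by fastforce
qed

lemma tree_words_verts: "u \<in> tree_words n m a \<Longrightarrow> finite (verts (set u)) \<and> card (verts (set u)) = Suc m"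
proof -
  assume "u \<in> tree_words n m a"
  then obtain r where "rtree (\<lambda>s. s \<le> a) r (verts (set u)) u" "length u = m" by (auto simp: tree_words_def)
  then show ?thesis using rtree_card rtree_finite by metis
qed

lemma finite_tree_words: "finite {u \<in> tree_words n m a. wide C u}"
proof (rule finite_subset)
  show "{u \<in> tree_words n m a. wide C u} \<subseteq> {u. set u \<subseteq> {a - \<bar>C\<bar>..a} \<times> {a..a + \<bar>C\<bar>} \<and> length u = m}"
  proof clarify
    fix u assume u: "u \<in> tree_words n m a" "wide C u"
    have "e \<in> {a - \<bar>C\<bar>..a} \<times> {a..a + \<bar>C\<bar>}" if "e \<in> set u" for e
      using tree_words_letters[OF u(1) that] u(2) that unfolding wide_def by fastforce
    moreover have "length u = m" using u(1) by (simp add: tree_words_def)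
    ultimately show "set u \<subseteq> {a - \<bar>C\<bar>..a} \<times> {a..a + \<bar>C\<bar>} \<and> length u = m" by blast
  qed
qed (simp add: finite_lists_length_eq)

lemma width_fin_tree_series: "width_fin n (tree_series n m a)"
  unfolding width_fin_iff
proof (intro conjI allI impI)
  fix C
  have "{u. tree_series n m a u \<noteq> (0 :: 'a) \<and> wide C u} \<subseteq> {u \<in> tree_words n m a. wide C u}"
    by (auto simp: tree_series_def)
  then show "finite {u. tree_series n m a u \<noteq> (0 :: 'a) \<and> wide C u}" using finite_tree_words finite_subset by blast
qed (auto simp: tree_series_def dest: tree_words_subset_letters split: if_splits)

section \<open>Comparison with the Murnaghan-Nakayama series\<close>

definition rep_words :: "nat \<Rightarrow> nat \<Rightarrow> int \<Rightarrow> ((int \<times> int) set \<Rightarrow> (int \<times> int) list set) \<Rightarrow> (int \<times> int) list set" where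
  "rep_words n m a M = {u. conn_tree n a (set u) \<and> card (set u) = m \<and> u \<in> M (set u)}"

text \<open>A labeling determines its tree as the set of its letters, so each word comes from at
  most one pair of tree and labeling.\<close>

lemma mn_series_eq:
  assumes M: "mn_reps n a m M"
  shows "mn_series n M m a = (\<lambda>u. if u \<in> rep_words n m a M then tree_sign a u else (0 :: 'k::comm_ring_1))"
proof
  fix u
  let ?I = "{(D, L). conn_tree n a D \<and> card D = m \<and> L \<in> M D}"
  let ?F = "\<lambda>(D, L) u. (- 1) ^ (card {x \<in> verts D. x \<le> a} - 1) * word L u :: 'k"
  let ?A = "if u \<in> rep_words n m a M then {(set u, u)} else {}"
  have "(mn_series n M m a u :: 'k) = (\<Sum>p\<in>?A. ?F p u)"
    unfolding mn_series_def
  proof (rule series_sum_finite)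
    show "?A \<subseteq> ?I" by (auto simp: rep_words_def)
    show "{p \<in> ?I. ?F p u \<noteq> 0} \<subseteq> ?A"
    proof
      fix p assume "p \<in> {p \<in> ?I. ?F p u \<noteq> 0}"
      then obtain D L where p: "p = (D, L)" and D: "conn_tree n a D" "card D = m" "L \<in> M D"
        and nz: "(- 1) ^ (card {x \<in> verts D. x \<le> a} - 1) * word L u \<noteq> (0 :: 'k)" by auto
      have "L = u" using nz by (auto simp: word_def split: if_splits)
      moreover have "L \<in> labelings D" using M D unfolding mn_reps_def by blast
      then have "set L = D" by (simp add: labelings_def)
      ultimately show "p \<in> ?A" using D p by (auto simp: rep_words_def)
    qed
  qed simp
  then show "mn_series n M m a u = (if u \<in> rep_words n m a M then tree_sign a u else (0 :: 'k))"
    by (cases "u \<in> rep_words n m a M") (simp_all add: tree_sign_def word_def)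
qed

text \<open>Each class of labelings contains exactly one plane tree word: existence is
  \<open>mn_ptree\<close> with \<open>ptree_rtree\<close>, uniqueness is
  \<open>rtree_root_unique\<close> with \<open>rtree_inj\<close>. Conversely,
  \<open>rtree_mn\<close> finds a labeling for every such word.\<close>

lemma tree_words_rep_words:
  assumes M: "mn_reps n a m M" and m: "m > 0"
  shows "\<exists>\<phi>. bij_betw \<phi> (tree_words n m a) (rep_words n m a M) \<and> (\<forall>u\<in>tree_words n m a. teq u (\<phi> u))"
proof -
  have dist: "distinct L" "set L = D" if "conn_tree n a D" "card D = m" "L \<in> M D" for D L
    using M that unfolding mn_reps_def labelings_def by blast+
  have ex: "\<exists>L0. L0 \<in> rep_words n m a M \<and> teq u L0" if u: "u \<in> tree_words n m a" for u
  proof -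
    obtain r where r: "rtree (\<lambda>s. s \<le> a) r (verts (set u)) u" "r \<le> a" and inj: "inj_on (\<lambda>x. x mod int n) (verts (set u))"
      and len: "length u = m" using u by (auto simp: tree_words_def)
    have ne: "u \<noteq> []" using len m by auto
    obtain L where c: "conn_tree n a (set u)" and L: "mn_labeling (set u) L" "teq u L"
      using rtree_mn(2,3)[OF r ne inj] by blast
    have card: "card (set u) = m" using rtree_distinct[OF r(1)] len by (simp add: distinct_card)
    obtain L0 where L0: "L0 \<in> M (set u)" "lab_equiv L0 L" using M c card L(1) unfolding mn_reps_def by blast
    have "teq L0 L" by (rule lab_equiv_teq[OF dist(1)[OF c card L0(1)] L0(2)])
    then have "teq u L0" using L(2) teq_sym teq_trans by blast
    moreover have "set L0 = set u" by (rule dist(2)[OF c card L0(1)])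
    ultimately show ?thesis using c card L0(1) unfolding rep_words_def by (intro exI[of _ L0]) auto
  qed
  then obtain \<phi> where \<phi>: "\<And>u. u \<in> tree_words n m a \<Longrightarrow> \<phi> u \<in> rep_words n m a M \<and> teq u (\<phi> u)" by metis
  have "inj_on \<phi> (tree_words n m a)"
  proof (rule inj_onI)
    fix u u' assume u: "u \<in> tree_words n m a" and u': "u' \<in> tree_words n m a" and e: "\<phi> u = \<phi> u'"
    then have t: "teq u u'" using \<phi> teq_sym teq_trans by metis
    then have s: "set u = set u'" by (simp add: teq_def)
    obtain r where r: "rtree (\<lambda>s. s \<le> a) r (verts (set u)) u" "r \<le> a" using u by (auto simp: tree_words_def)
    obtain r' where r': "rtree (\<lambda>s. s \<le> a) r' (verts (set u)) u'" "r' \<le> a" using u' s by (auto simp: tree_words_def)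
    have "r = r'" by (rule rtree_root_unique[OF r r' t])
    then show "u = u'" using rtree_inj[OF r(1) _ t] r'(1) by simp
  qed
  moreover have "\<phi> ` tree_words n m a = rep_words n m a M"
  proof (intro equalityI subsetI)
    fix L assume "L \<in> rep_words n m a M"
    then have c: "conn_tree n a (set L)" "card (set L) = m" "L \<in> M (set L)" by (auto simp: rep_words_def)
    obtain L' where L': "mn_labeling (set L) L'" "lab_equiv L L'" using M c unfolding mn_reps_def by blast
    obtain r PA PB where r: "r \<le> a" "ptree (\<lambda>s. s \<le> a) r (verts (set L)) L' PA PB"
      using mn_ptree[OF c(1) L'(1)] by blast
    obtain u where u: "rtree (\<lambda>s. s \<le> a) r (verts (set L)) u" "teq L' u" using ptree_rtree[OF r(2)] by blast
    have tL: "teq L L'" by (rule lab_equiv_teq[OF dist(1)[OF c] L'(2)])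
    then have s: "set u = set L" "distinct u" using u(2) by (auto simp: teq_def)
    then have "length u = m" using c(2) distinct_card by metis
    then have uU: "u \<in> tree_words n m a"
      using u(1) r(1) c(1) s unfolding tree_words_def conn_tree_def by auto
    have t: "teq (\<phi> u) L'" "set (\<phi> u) = set L"
      using \<phi>[OF uU] u(2) teq_sym teq_trans s(1) by (blast, simp add: teq_def)
    have "\<phi> u \<in> M (set L)" using \<phi>[OF uU] t(2) by (simp add: rep_words_def)
    then have "\<phi> u = L" using M c L' teq_lab_equiv[OF t(1)] unfolding mn_reps_def by blast
    then show "L \<in> \<phi> ` tree_words n m a" using uU by blast
  qed (use \<phi> in blast)
  ultimately show ?thesis using \<phi> unfolding bij_betw_def by blast
qed

text \<open>Matching words have the same letters, hence the same sign and the same widths. The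
  difference of the series is therefore a locally finite sum of differences of
  commutation-equivalent words.\<close>

lemma mn_series_tree_series:
  assumes n: "n \<ge> 2" and m: "m > 0" and M: "mn_reps n a m M"
  shows "mn_series n M m a - tree_series n m a \<in> (fk_ideal n :: 'k::comm_ring_1 series set)"
proof -
  let ?U = "tree_words n m a"
  obtain \<phi> where bij: "bij_betw \<phi> ?U (rep_words n m a M)" and t: "\<And>u. u \<in> ?U \<Longrightarrow> teq u (\<phi> u)"
    using tree_words_rep_words[OF M m] by blast
  have s: "set (\<phi> u) = set u" if "u \<in> ?U" for u using t[OF that] by (simp add: teq_def)
  let ?G = "\<lambda>u w. tree_sign a u * word u w :: 'k" and ?H = "\<lambda>u w. tree_sign a u * word (\<phi> u) w :: 'k"
  have G: "tree_series n m a = series_sum ?G ?U" by (simp add: series_sum_words tree_series_def)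
  have "mn_series n M m a = series_sum ?G (rep_words n m a M)"
    unfolding mn_series_eq[OF M] by (rule series_sum_words[symmetric])
  also have "\<dots> = series_sum (\<lambda>u. ?G (\<phi> u)) ?U" by (rule series_sum_reindex[OF bij])
  also have "\<dots> = series_sum ?H ?U" by (rule series_sum_cong) (simp add: tree_sign_def s)
  finally have H: "mn_series n M m a = series_sum ?H ?U" .
  have wU: "{u \<in> ?U. \<exists>w. wide C w \<and> (?H u - ?G u) w \<noteq> 0} \<subseteq> {u \<in> ?U. wide C u}" for C
  proof clarify
    fix u w assume u: "u \<in> ?U" and w: "wide C w" "(?H u - ?G u) w \<noteq> 0"
    then have "w = \<phi> u \<or> w = u" by (auto simp: word_def split: if_splits)
    then show "wide C u" using w(1) s[OF u] by (auto simp: wide_def)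
  qed
  have fG: "finite {u \<in> ?U. ?G u w \<noteq> 0}" for w
    by (rule finite_subset[of _ "{w}"]) (auto simp: word_def)
  have fH: "finite {u \<in> ?U. ?H u w \<noteq> 0}" for w
  proof (rule finite_subset)
    show "{u \<in> ?U. ?H u w \<noteq> 0} \<subseteq> {u \<in> ?U. wide (Max (insert 0 ((\<lambda>(i, j). j - i) ` set w))) u}"
    proof clarify
      fix u assume u: "u \<in> ?U" "?H u w \<noteq> 0"
      then have "w = \<phi> u" by (auto simp: word_def split: if_splits)
      then have "set w = set u" using s u by simp
      then show "wide (Max (insert 0 ((\<lambda>(i, j). j - i) ` set w))) u"
        unfolding wide_def by (force intro!: Max_ge)
    qed
  qed (rule finite_tree_words)
  have "series_sum (\<lambda>u. ?H u - ?G u) ?U \<in> fk_ideal n"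
  proof (rule series_sum_ideal[OF n])
    show "countable ?U" by (rule countableI_type)
    show "locfin (\<lambda>u. ?H u - ?G u) ?U"
      unfolding locfin_def using finite_subset[OF wU finite_tree_words] by blast
    fix u assume u: "u \<in> ?U"
    have l: "set u \<subseteq> letters n" "inj_on (\<lambda>x. x mod int n) (verts (set u))" "u \<noteq> []"
      using tree_words_subset_letters[OF u] u m by (auto simp: tree_words_def)
    have mem: "word u \<in> inv_alg n" "word (\<phi> u) \<in> inv_alg n" using l(1) s[OF u] n by (auto intro: inv_alg_word)
    have "cls n (word (\<phi> u)) = (cls n (word u) :: 'k fk_alg)"
      by (rule cls_word_lab_equiv[OF n l teq_lab_equiv[OF t[OF u]], symmetric])
    then have "word (\<phi> u) - word u \<in> (fk_ideal n :: 'k series set)" using cls_eq_iff[OF n mem(2,1)] by blast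
    then have "(\<lambda>w. tree_sign a u * (word (\<phi> u) - word u) w) \<in> (fk_ideal n :: 'k series set)"
      unfolding tree_sign_def by (rule sign_series_ideal[OF n])
    moreover have "(\<lambda>w. tree_sign a u * (word (\<phi> u) - word u) w) = ?H u - ?G u"
      by (simp add: fun_eq_iff algebra_simps)
    ultimately show "?H u - ?G u \<in> fk_ideal n" by (simp only:)
  qed
  moreover have "series_sum (\<lambda>u. ?H u - ?G u) ?U = mn_series n M m a - tree_series n m a"
    unfolding G H by (rule series_sum_diff[OF fH fG])
  ultimately show ?thesis by (simp only:)
qed

section \<open>Invariance under group elements that preserve the rows\<close>

lemma rtree_map:
  "rtree row x S u \<Longrightarrow> inj g \<Longrightarrow> (\<And>s. row (g s) \<longleftrightarrow> row s) \<Longrightarrow> rtree row (g x) (g ` S) (map (map_prod g g) u)"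
proof (induction rule: rtree.induct)
  case (row i j S v T w)
  then show ?case
    using rtree.row[of row "g i" "g j" "g ` S" "map (map_prod g g) v" "g ` T" "map (map_prod g g) w"]
    by (simp add: image_Un image_Int[symmetric])
next
  case (col i j S v T w)
  then show ?case
    using rtree.col[of row "g i" "g j" "g ` S" "map (map_prod g g) v" "g ` T" "map (map_prod g g) w"]
    by (simp add: image_Un image_Int[symmetric])
qed (simp add: rtree.leaf)

lemma verts_map: "verts (map_prod g g ` D) = g ` verts D"
  by (auto simp: verts_def image_Un image_comp comp_def)

lemma tree_words_map:
  assumes g: "g \<in> aff_sym n" "\<And>x. g x \<le> a \<longleftrightarrow> x \<le> a" and u: "u \<in> tree_words n m a"
  shows "map (map_prod g g) u \<in> tree_words n m a" "tree_sign a (map (map_prod g g) u) = tree_sign a u"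
proof -
  have inj: "inj g" using aff_symD(1)[OF g(1)] by (rule bij_is_inj)
  obtain r where r: "rtree (\<lambda>s. s \<le> a) r (verts (set u)) u" "r \<le> a" using u by (auto simp: tree_words_def)
  have "rtree (\<lambda>s. s \<le> a) (g r) (g ` verts (set u)) (map (map_prod g g) u)"
    by (rule rtree_map[OF r(1) inj]) (rule g(2))
  moreover have "inj_on (\<lambda>x. x mod int n) (g ` verts (set u))"
    using u aff_sym_distinct[OF g(1)] by (auto simp: tree_words_def inj_on_def)
  ultimately show "map (map_prod g g) u \<in> tree_words n m a"
    using u r(2) g(2) by (auto simp: tree_words_def verts_map)
  have "{x \<in> g ` verts (set u). x \<le> a} = g ` {x \<in> verts (set u). x \<le> a}" using g(2) by auto
  then show "tree_sign a (map (map_prod g g) u) = tree_sign a u"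
    using card_image[OF inj_on_subset[OF inj subset_UNIV], of "{x \<in> verts (set u). x \<le> a}"]
    by (simp add: tree_sign_def verts_map)
qed

text \<open>Such a group element keeps both sides of the cut at \<open>a\<close>, so no letter is
  reversed, all signs in \<open>series_act\<close> are 1, and the tree words are permuted.\<close>

lemma tree_series_act:
  assumes n: "n \<ge> 2" and g: "g \<in> aff_sym n" "\<And>x. g x \<le> a \<longleftrightarrow> x \<le> a"
  shows "series_act g (tree_series n m a) = (tree_series n m a :: 'k::comm_ring_1 series)"
proof
  fix u
  let ?p = "inv_into UNIV g"
  have p: "?p \<in> aff_sym n" using aff_sym_inv[OF _ g(1)] n by simp
  have pa: "?p x \<le> a \<longleftrightarrow> x \<le> a" for x using g(2)[of "?p x"] inv_apply(1)[OF g(1)] by simp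
  show "series_act g (tree_series n m a) u = (tree_series n m a u :: 'k)"
  proof (cases "\<forall>e\<in>set u. fst e \<le> a \<and> a < snd e")
    case True
    then have less: "?p (fst e) < ?p (snd e) \<and> fst e < snd e" if "e \<in> set u" for e
      using that pa by (metis le_less_trans not_le)
    have w: "pull_word ?p u = map (map_prod ?p ?p) u"
      using less by (force simp: pull_word_def min_def max_def)
    have s: "pull_sign ?p u = (1 :: 'k)" using less by (induction u) auto
    have o: "ordered_word u" using less by auto
    have "map (map_prod ?p ?p) u \<in> tree_words n m a \<longleftrightarrow> u \<in> tree_words n m a"
    proof
      assume "map (map_prod ?p ?p) u \<in> tree_words n m a"
      then have "map (map_prod g g) (map (map_prod ?p ?p) u) \<in> tree_words n m a" by (rule tree_words_map[OF g])
      moreover have "map (map_prod g g) (map (map_prod ?p ?p) u) = u"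
        using inv_apply(1)[OF g(1)] by (simp add: map_idI prod.map_comp comp_def map_prod_def split_beta)
      ultimately show "u \<in> tree_words n m a" by simp
    qed (rule tree_words_map(1)[OF p pa])
    then show ?thesis
      using o s w tree_words_map(2)[OF p pa, of u m, where 'a = 'k] by (simp add: series_act_def tree_series_def)
  next
    case False
    then have "u \<notin> tree_words n m a" using tree_words_letters by blast
    moreover have "pull_word ?p u \<notin> tree_words n m a" if o: "ordered_word u"
    proof
      assume t: "pull_word ?p u \<in> tree_words n m a"
      obtain k l where kl: "(k, l) \<in> set u" "\<not> (k \<le> a \<and> a < l)" using False by auto
      have "min (?p k) (?p l) \<le> a" "a < max (?p k) (?p l)"
        using tree_words_letters[OF t in_set_pull[OF kl(1)]] by auto
      moreover have "k < l" using o kl(1) by auto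
      ultimately show False using kl(2) pa[of k] pa[of l] by (auto simp: min_def max_def split: if_splits)
    qed
    ultimately show ?thesis by (simp add: series_act_def tree_series_def)
  qed
qed

section \<open>Series of stars\<close>

definition br_prod :: "int \<Rightarrow> int list \<Rightarrow> 'k::comm_ring_1 series" where
  "br_prod a js = foldr (\<lambda>j f. br a j \<odot> f) js (word [])"

definition star_lists :: "nat \<Rightarrow> nat \<Rightarrow> int \<Rightarrow> int list set" where
  "star_lists n m a = {js. length js = m \<and> distinct (map (\<lambda>x. x mod int n) (a # js))}"

definition star_series :: "nat \<Rightarrow> nat \<Rightarrow> int \<Rightarrow> 'k::comm_ring_1 series" where
  "star_series n m a = series_sum (br_prod a) (star_lists n m a)"

lemma br_prod_Cons: "br_prod a (j # js) = br a j \<odot> br_prod a js"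
  by (simp add: br_prod_def)

lemma br_prod_nz: "br_prod a js u \<noteq> 0 \<Longrightarrow> u = map (\<lambda>j. (min a j, max a j)) js"
proof (induction js arbitrary: u)
  case Nil
  then show ?case by (simp add: br_prod_def word_def split: if_splits)
next
  case (Cons j js)
  from Cons.prems obtain x y where "u = x @ y" "br a j x \<noteq> (0 :: 'a)" "br_prod a js y \<noteq> (0 :: 'a)"
    unfolding br_prod_Cons by (rule series_mult_nz)
  then show ?case using Cons.IH[of y] br_nz[of a j x] by simp
qed

lemma br_prod_inv_alg:
  assumes n: "n \<ge> 2"
  shows "(\<And>j. j \<in> set js \<Longrightarrow> \<not> [a = j] (mod int n)) \<Longrightarrow> br_prod a js \<in> inv_alg n"
proof (induction js)
  case Nil
  then show ?case using inv_alg_word[OF n, of "[]"] by (simp add: br_prod_def)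
next
  case (Cons j js)
  then show ?case unfolding br_prod_Cons using n by (intro inv_alg_mult inv_alg_br) auto
qed

lemma cls_br_prod:
  assumes n: "n \<ge> 2" and js: "js \<noteq> []" "\<And>j. j \<in> set js \<Longrightarrow> \<not> [a = j] (mod int n)"
  shows "cls n (br_prod a js) = (prod_list (map (B n a) js) :: 'k::comm_ring_1 fk_alg)"
  using js
proof (induction js rule: list_nonempty_induct)
  case (single j)
  then show ?case by (simp add: br_prod_def series_mult_one)
next
  case (cons j js)
  have "(br a j :: 'k series) \<in> inv_alg n" "(br_prod a js :: 'k series) \<in> inv_alg n"
    using cons.prems n by (auto intro!: inv_alg_br br_prod_inv_alg)
  then show ?case using cons n by (simp add: br_prod_Cons cls_mult)
qed

lemma star_lists_cong: "js \<in> star_lists n m a \<Longrightarrow> j \<in> set js \<Longrightarrow> \<not> [a = j] (mod int n)"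
  by (force simp: star_lists_def cong_def)

lemma br_wide: "br a j u \<noteq> 0 \<Longrightarrow> wide C u \<Longrightarrow> j \<in> {a - \<bar>C\<bar>..a + \<bar>C\<bar>}"
  by (drule br_nz) (auto simp: wide_def)

lemma locfin_br_prod: "locfin (br_prod a) {js. length js = m}"
  unfolding locfin_def
proof
  fix C
  have "{js \<in> {js. length js = m}. \<exists>u. wide C u \<and> br_prod a js u \<noteq> (0 :: 'a)} \<subseteq>
    {js. set js \<subseteq> {a - \<bar>C\<bar>..a + \<bar>C\<bar>} \<and> length js = m}"
  proof
    fix js assume "js \<in> {js \<in> {js. length js = m}. \<exists>u. wide C u \<and> br_prod a js u \<noteq> (0 :: 'a)}"
    then obtain u where len: "length js = m" and u: "wide C u" "br_prod a js u \<noteq> (0 :: 'a)" by blast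
    have "j \<in> {a - \<bar>C\<bar>..a + \<bar>C\<bar>}" if j: "j \<in> set js" for j
    proof -
      have "(min a j, max a j) \<in> set u" using br_prod_nz[OF u(2)] j by auto
      then have "max a j - min a j \<le> C" using u(1) by (auto simp: wide_def)
      then show ?thesis by auto
    qed
    then show "js \<in> {js. set js \<subseteq> {a - \<bar>C\<bar>..a + \<bar>C\<bar>} \<and> length js = m}" using len by blast
  qed
  then show "finite {js \<in> {js. length js = m}. \<exists>u. wide C u \<and> br_prod a js u \<noteq> (0 :: 'a)}"
    by (rule finite_subset) (simp add: finite_lists_length_eq)
qed

lemma locfin_subset: "locfin F J \<Longrightarrow> I \<subseteq> J \<Longrightarrow> locfin F I"
proof -
  assume F: "locfin F J" and IJ: "I \<subseteq> J"
  show "locfin F I"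
    unfolding locfin_def
  proof
    fix C
    have "{x \<in> I. \<exists>u. wide C u \<and> F x u \<noteq> 0} \<subseteq> {x \<in> J. \<exists>u. wide C u \<and> F x u \<noteq> 0}" using IJ by auto
    then show "finite {x \<in> I. \<exists>u. wide C u \<and> F x u \<noteq> 0}" using F finite_subset unfolding locfin_def by blast
  qed
qed

lemma locfin_star: "locfin (br_prod a) (star_lists n m a)"
  by (rule locfin_subset[OF locfin_br_prod[of a m]]) (auto simp: star_lists_def)

lemma width_fin_br_prod:
  assumes "\<And>j. j \<in> set js \<Longrightarrow> \<not> [a = j] (mod int n)"
  shows "width_fin n (br_prod a js)"
  unfolding width_fin_iff
proof (intro conjI allI impI)
  fix u assume "br_prod a js u \<noteq> (0 :: 'a)"
  then have u: "u = map (\<lambda>j. (min a j, max a j)) js" by (rule br_prod_nz)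
  have "(min a j, max a j) \<in> letters n" if "j \<in> set js" for j
    using assms[OF that] by (cases a j rule: linorder_cases) (auto simp: letters_def cong_sym_eq)
  then show "set u \<subseteq> letters n" unfolding u by auto
next
  fix C
  have "{u. br_prod a js u \<noteq> (0 :: 'a) \<and> wide C u} \<subseteq> {map (\<lambda>j. (min a j, max a j)) js}"
    using br_prod_nz by blast
  then show "finite {u. br_prod a js u \<noteq> (0 :: 'a) \<and> wide C u}" using finite_subset by blast
qed

lemma width_fin_star_series: "width_fin n (star_series n m a)"
  unfolding star_series_def
  by (rule width_fin_series_sum[OF width_fin_br_prod locfin_star]) (rule star_lists_cong)

lemma rtree_cong:
  "rtree row x S u \<Longrightarrow> (\<And>s. s \<in> S \<Longrightarrow> row' s \<longleftrightarrow> row s) \<Longrightarrow> rtree row' x S u"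
proof (induction rule: rtree.induct)
  case (row i j S v T w)
  then show ?case using rtree_root[OF row.hyps(3)] rtree_root[OF row.hyps(4)] by (intro rtree.row) auto
next
  case (col i j S v T w)
  then show ?case using rtree_root[OF col.hyps(3)] rtree_root[OF col.hyps(4)] by (intro rtree.col) auto
qed (simp add: rtree.leaf)

text \<open>Only the vertex \<open>a\<close> changes from column to row when the cut moves. Thus the
  difference of the two series lives on words through \<open>a\<close>, as does the star
  series.\<close>

lemma tree_series_pred:
  assumes "a \<notin> verts (set u)"
  shows "tree_series n m a u = tree_series n m (a - 1) u"
proof -
  have eq: "s \<le> a \<longleftrightarrow> s \<le> a - 1" if "s \<in> verts (set u)" for s using that assms by (cases "s = a") auto
  have r1: "r \<le> a - 1 \<and> rtree (\<lambda>s. s \<le> a - 1) r (verts (set u)) u"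
    if "r \<le> a" "rtree (\<lambda>s. s \<le> a) r (verts (set u)) u" for r
    using eq[OF rtree_root[OF that(2)]] that rtree_cong[OF that(2), of "\<lambda>s. s \<le> a - 1"] eq by simp
  have r2: "r \<le> a \<and> rtree (\<lambda>s. s \<le> a) r (verts (set u)) u"
    if "r \<le> a - 1" "rtree (\<lambda>s. s \<le> a - 1) r (verts (set u)) u" for r
    using that rtree_cong[OF that(2), of "\<lambda>s. s \<le> a"] eq by simp
  have "(\<exists>r\<le>a. rtree (\<lambda>s. s \<le> a) r (verts (set u)) u) \<longleftrightarrow> (\<exists>r\<le>a - 1. rtree (\<lambda>s. s \<le> a - 1) r (verts (set u)) u)"
    using r1 r2 by (intro iffI; elim exE conjE) blast+
  moreover have "{x \<in> verts (set u). x \<le> a} = {x \<in> verts (set u). x \<le> a - 1}" using eq by auto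
  ultimately show ?thesis unfolding tree_series_def tree_words_def tree_sign_def mem_Collect_eq by presburger
qed

lemma verts_star: "js \<noteq> [] \<Longrightarrow> verts (set (map (\<lambda>j. (min a j, max a j)) js)) = insert a (set js)"
proof -
  assume js: "js \<noteq> []"
  have "verts (set (map (\<lambda>j. (min a j, max a j)) js)) = (\<Union>j\<in>set js. {min a j, max a j})"
    by (induction js) (auto simp: verts_def)
  also have "\<dots> = (\<Union>j\<in>set js. {a, j})" by (rule SUP_cong) (auto simp: min_def max_def)
  also have "\<dots> = insert a (set js)" using js by auto
  finally show ?thesis .
qed

section \<open>Tree series and star series on a single vertex set\<close>

definition vertex_sets :: "nat \<Rightarrow> nat \<Rightarrow> int \<Rightarrow> int set set" where
  "vertex_sets n m a = {V. finite V \<and> a \<in> V \<and> card V = Suc m \<and> inj_on (\<lambda>x. x mod int n) V}"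

definition restrict_verts :: "int set \<Rightarrow> 'k::comm_ring_1 series \<Rightarrow> 'k series" where
  "restrict_verts V f = (\<lambda>u. if verts (set u) = V then f u else 0)"

lemma sum_series_apply: "sum F I u = (\<Sum>x\<in>I. F x u)" for F :: "'b \<Rightarrow> 'k::comm_ring_1 series"
  by (induction I rule: infinite_finite_induct) auto

text \<open>A word belongs to one row root only, so summing over the roots counts no word
  twice.\<close>

lemma restrict_tree_series:
  assumes V: "finite V" "card V = Suc m" "inj_on (\<lambda>x. x mod int n) V" and m: "m > 0"
  shows "restrict_verts V (tree_series n m a) =
    (\<Sum>r | r \<in> V \<and> r \<le> a. \<Sum>u | rtree (\<lambda>s. s \<le> a) r V u. (\<lambda>w. (- 1) ^ (card {x \<in> V. x \<le> a} - 1) * word u w) :: 'k::comm_ring_1 series)"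
    (is "_ = ?S")
proof
  fix w
  let ?R = "{r. r \<in> V \<and> r \<le> a}" and ?row = "\<lambda>s. s \<le> a"
  let ?c = "(- 1) ^ (card {x \<in> V. x \<le> a} - 1) :: 'k"
  have "(\<Sum>u | rtree ?row r V u. ?c * word u w) = (if rtree ?row r V w then ?c else 0)" for r
  proof -
    have "(\<Sum>u | rtree ?row r V u. ?c * word u w) = (\<Sum>u\<in>(if rtree ?row r V w then {w} else {}). ?c * word u w)"
      by (rule sum.mono_neutral_right) (auto simp: finite_rtree word_def)
    then show ?thesis by (simp add: word_def)
  qed
  then have "?S w = (\<Sum>r\<in>?R. if rtree ?row r V w then ?c else 0)" by (simp add: sum_series_apply)
  also have "\<dots> = (if \<exists>r\<in>?R. rtree ?row r V w then ?c else 0)"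
  proof (cases "\<exists>r\<in>?R. rtree ?row r V w")
    case True
    then obtain r where r: "r \<in> ?R" "rtree ?row r V w" by blast
    have u: "r' = r" if "r' \<in> ?R" "rtree ?row r' V w" for r'
      using rtree_root_unique[OF that(2) _ r(2)] that(1) r(1) teq_refl[OF rtree_distinct[OF r(2)]] by blast
    have "(\<Sum>r\<in>?R. if rtree ?row r V w then ?c else 0) = (\<Sum>r\<in>{r}. ?c)"
    proof (rule sum.mono_neutral_cong_right)
      show "finite ?R" using V(1) by simp
      show "{r} \<subseteq> ?R" using r by blast
      show "\<forall>r'\<in>?R - {r}. (if rtree ?row r' V w then ?c else 0) = 0" using u by auto
      show "(if rtree ?row r' V w then ?c else 0) = ?c" if "r' \<in> {r}" for r' using that r(2) by simp
    qed
    then show ?thesis using True by simp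
  qed (simp add: sum.neutral)
  also have "\<dots> = restrict_verts V (tree_series n m a) w"
  proof -
    have "verts (set w) = V \<and> length w = m" if r: "r \<in> ?R" "rtree ?row r V w" for r
    proof -
      have len: "length w = m" using rtree_card[OF r(2)] V(2) by simp
      then have "w \<noteq> []" using m by auto
      then show ?thesis using rtree_mn(1)[OF r(2) _ _ V(3)] r(1) len by simp
    qed
    then have 1: "verts (set w) = V \<and> w \<in> tree_words n m a" if r: "r \<in> ?R" "rtree ?row r V w" for r
      unfolding tree_words_def using r V(3) by blast
    have 2: "\<exists>r\<in>?R. rtree ?row r V w" if w: "verts (set w) = V" "w \<in> tree_words n m a"
    proof -
      have "\<exists>r\<le>a. rtree ?row r (verts (set w)) w" using w(2) unfolding tree_words_def by blast
      then obtain r where r: "r \<le> a" "rtree ?row r V w" unfolding w(1) by (elim exE conjE)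
      then have "r \<in> ?R" using rtree_root[OF r(2)] by simp
      then show ?thesis using r(2) by (rule bexI[rotated])
    qed
    have "(\<exists>r\<in>?R. rtree ?row r V w) \<longleftrightarrow> verts (set w) = V \<and> w \<in> tree_words n m a"
      using 1 2 by blast
    then show ?thesis by (auto simp: restrict_verts_def tree_series_def tree_sign_def)
  qed
  finally show "restrict_verts V (tree_series n m a) w = ?S w" ..
qed

lemma restrict_star_series:
  assumes V: "V \<in> vertex_sets n m a" and m: "m > 0"
  shows "restrict_verts V (star_series n m a) = (\<Sum>js\<in>permutations_of_set (V - {a}). br_prod a js :: 'k::comm_ring_1 series)"
proof
  fix w
  let ?A = "permutations_of_set (V - {a})"
  have V': "finite V" "a \<in> V" "card V = Suc m" "inj_on (\<lambda>x. x mod int n) V" using V by (auto simp: vertex_sets_def)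
  have A: "js \<in> star_lists n m a \<and> verts (set (map (\<lambda>j. (min a j, max a j)) js)) = V" if js: "js \<in> ?A" for js
  proof -
    have d: "set js = V - {a}" "distinct js" using js by (auto dest: permutations_of_setD)
    then have len: "length js = m" using V' distinct_card[of js] by simp
    then have "js \<noteq> []" using m by auto
    moreover have "set (a # js) = V" "distinct (a # js)" using d V'(2) by auto
    then have "distinct (map (\<lambda>x. x mod int n) (a # js))" using V'(4) distinct_map by metis
    ultimately show ?thesis using d len V'(2) unfolding star_lists_def by (subst verts_star) auto
  qed
  show "restrict_verts V (star_series n m a) w = (\<Sum>js\<in>?A. br_prod a js :: 'k series) w"
  proof (cases "verts (set w) = V")
    case True
    have "star_series n m a w = (\<Sum>js\<in>?A. br_prod a js w :: 'k)"
      unfolding star_series_def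
    proof (rule series_sum_finite)
      show "finite ?A" by simp
      show "?A \<subseteq> star_lists n m a" using A by blast
      show "{js \<in> star_lists n m a. br_prod a js w \<noteq> (0 :: 'k)} \<subseteq> ?A"
      proof clarify
        fix js assume js: "js \<in> star_lists n m a" "br_prod a js w \<noteq> (0 :: 'k)"
        then have "js \<noteq> []" "distinct (a # js)" using m by (auto simp: star_lists_def distinct_map)
        then have "insert a (set js) = V" "a \<notin> set js" "distinct js"
          using True br_prod_nz[OF js(2)] verts_star[of js a] by auto
        then show "js \<in> ?A" by (auto simp: permutations_of_set_def)
      qed
    qed
    then show ?thesis using True by (simp add: restrict_verts_def sum_series_apply)
  next
    case False
    then have "br_prod a js w = (0 :: 'k)" if "js \<in> ?A" for js using A[OF that] br_prod_nz by metis
    then show ?thesis using False by (simp add: restrict_verts_def sum_series_apply)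
  qed
qed

text \<open>On a fixed vertex set the series is a finite sum of words, to which
  \<open>plane_tree_sum\<close> applies in the ring type.\<close>

lemma cls_restrict_tree_series:
  assumes n: "n \<ge> 2" and V: "finite V" "card V = Suc m" "inj_on (\<lambda>x. x mod int n) V" and m: "m > 0"
  shows "restrict_verts V (tree_series n m a) \<in> (inv_alg n :: 'k::comm_ring_1 series set)"
    and "cls n (restrict_verts V (tree_series n m a)) =
      (\<Sum>r | r \<in> V \<and> r \<le> a. fk_system.star_coef (B n) r (V - {r}) :: 'k fk_alg)"
proof -
  let ?R = "{r. r \<in> V \<and> r \<le> a}" and ?row = "\<lambda>s. s \<le> a"
  let ?k = "card {x \<in> V. x \<le> a} - 1"
  let ?f = "\<lambda>u w. (- 1) ^ ?k * word u w :: 'k"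
  interpret fk_system V "B n :: int \<Rightarrow> int \<Rightarrow> 'k fk_alg" by (rule B_fk_system[OF n V(1,3)])
  have u: "u \<noteq> []" "set u \<subseteq> letters n" if r: "r \<in> ?R" "rtree ?row r V u" for r u
  proof -
    show ne: "u \<noteq> []" using rtree_card[OF r(2)] V(2) m by auto
    have "verts (set u) = V" using rtree_mn(1)[OF r(2) _ ne V(3)] r(1) by blast
    moreover have "ordered_word u" using rtree_letters[OF r(2)] by fastforce
    ultimately show "set u \<subseteq> letters n" using inj_mod_letters V(3) by metis
  qed
  have f: "?f u \<in> inv_alg n \<and> cls n (?f u) = (- 1) ^ ?k * ev u" if r: "r \<in> ?R" "rtree ?row r V u" for r u
  proof -
    have w: "(word u :: 'k series) \<in> inv_alg n" using u[OF r] n by (intro inv_alg_word)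
    have c: "cls n (word u) = (ev u :: 'k fk_alg)" unfolding ev_def by (rule cls_word[OF n u[OF r]])
    have "?f u = word u \<or> ?f u = - word u \<and> odd ?k"
      by (cases "even ?k") (auto simp: fun_eq_iff)
    then show ?thesis
    proof (cases "even ?k")
      case True
      then have "?f u = word u" by (simp add: fun_eq_iff)
      then show ?thesis using w c True by (simp only: power_minus_even power_one mult_1)
    next
      case False
      then have "?f u = - word u" by (simp add: fun_eq_iff)
      then show ?thesis using inv_alg_uminus[OF w] cls_uminus[OF w] c False
        by (simp only: power_minus_odd power_one mult_minus1 simp_thms)
    qed
  qed
  have in1: "(\<Sum>u | rtree ?row r V u. ?f u) \<in> inv_alg n" if "r \<in> ?R" for r
    using f[OF that] by (intro inv_alg_finite_sum[OF n]) blast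
  show "restrict_verts V (tree_series n m a) \<in> (inv_alg n :: 'k series set)"
    unfolding restrict_tree_series[OF V m] by (rule inv_alg_finite_sum[OF n in1])
  have "cls n (restrict_verts V (tree_series n m a)) = (\<Sum>r\<in>?R. cls n (\<Sum>u | rtree ?row r V u. ?f u))"
    unfolding restrict_tree_series[OF V m] by (rule cls_sum[OF n in1])
  also have "\<dots> = (\<Sum>r\<in>?R. \<Sum>u | rtree ?row r V u. cls n (?f u))"
    using f by (intro sum.cong refl cls_sum[OF n]) blast
  also have "\<dots> = (\<Sum>r\<in>?R. (- 1) ^ ?k * tsum ?row r V)"
    unfolding tsum_def sum_distrib_left using f by (intro sum.cong refl) blast
  also have "\<dots> = (\<Sum>r\<in>?R. star_coef r (V - {r}))" by (rule plane_tree_sum)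
  finally show "cls n (restrict_verts V (tree_series n m a)) = (\<Sum>r\<in>?R. star_coef r (V - {r}))" .
qed

lemma restrict_verts_diff: "restrict_verts V (f - g) = restrict_verts V f - restrict_verts V g"
  by (simp add: restrict_verts_def fun_eq_iff)

text \<open>Comparing the two series one vertex set at a time reduces the claim to finite identities.\<close>

lemma tree_series_step:
  assumes n: "n \<ge> 2" and m: "m > 0"
  shows "tree_series n m a - tree_series n m (a - 1) - star_series n m a \<in> (fk_ideal n :: 'k::comm_ring_1 series set)"
proof -
  let ?D = "tree_series n m a - tree_series n m (a - 1) - star_series n m a :: 'k series"
  let ?V = "vertex_sets n m a" and ?X = "\<lambda>V. restrict_verts V ?D"
  have nz: "tree_series n m a u \<noteq> (0 :: 'k) \<or> tree_series n m (a - 1) u \<noteq> (0 :: 'k) \<or> star_series n m a u \<noteq> (0 :: 'k)"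
    if "?D u \<noteq> 0" for u using that by auto
  have star: "\<exists>js\<in>star_lists n m a. u = map (\<lambda>j. (min a j, max a j)) js" if nz: "star_series n m a u \<noteq> (0 :: 'k)" for u
    using series_sum_nz[OF nz[unfolded star_series_def]] br_prod_nz by blast
  have mem: "verts (set u) \<in> ?V" if u: "?D u \<noteq> 0" for u
  proof (cases "star_series n m a u = (0 :: 'k)")
    case True
    then have "a \<in> verts (set u)" using tree_series_pred[of a u n m, where 'a = 'k] u by auto
    moreover have "u \<in> tree_words n m a \<or> u \<in> tree_words n m (a - 1)"
      using nz[OF u] True by (auto simp: tree_series_def split: if_splits)
    then have "finite (verts (set u)) \<and> card (verts (set u)) = Suc m \<and> inj_on (\<lambda>x. x mod int n) (verts (set u))"
      using tree_words_verts unfolding tree_words_def by blast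
    ultimately show ?thesis by (simp add: vertex_sets_def)
  next
    case False
    then obtain js where js: "js \<in> star_lists n m a" "u = map (\<lambda>j. (min a j, max a j)) js" using star by blast
    have "length js = m" and d: "distinct (map (\<lambda>x. x mod int n) (a # js))" using js(1) by (auto simp: star_lists_def)
    moreover have "distinct (a # js)" using d unfolding distinct_map by blast
    then have "card (set (a # js)) = Suc (length js)" using distinct_card by fastforce
    moreover have "inj_on (\<lambda>x. x mod int n) (set (a # js))" using d by (simp only: distinct_map)
    moreover have "verts (set u) = set (a # js)" using verts_star[of js a] js(2) m \<open>length js = m\<close> by auto
    ultimately show ?thesis by (simp add: vertex_sets_def)
  qed
  have "series_sum ?X ?V = ?D"
  proof
    fix u
    have "series_sum ?X ?V u = (\<Sum>V\<in>(if verts (set u) \<in> ?V then {verts (set u)} else {}). ?X V u)"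
      by (rule series_sum_finite) (auto simp: restrict_verts_def split: if_splits)
    then show "series_sum ?X ?V u = ?D u" using mem[of u] by (auto simp: restrict_verts_def)
  qed
  moreover have "series_sum ?X ?V \<in> fk_ideal n"
  proof (rule series_sum_ideal[OF n])
    have "countable (Collect (finite :: int set \<Rightarrow> bool))" by (rule countable_Collect_finite)
    then show "countable ?V" by (rule countable_subset[rotated]) (auto simp: vertex_sets_def)
    show "locfin ?X ?V"
      unfolding locfin_def
    proof
      fix C
      \<comment> \<open>Every letter of a contributing word has \<open>a\<close> between its ends or
        as an end, so a bound on the widths bounds all vertices.\<close>
      have "{V \<in> ?V. \<exists>u. wide C u \<and> ?X V u \<noteq> 0} \<subseteq> Pow {a - \<bar>C\<bar> - 1..a + \<bar>C\<bar> + 1}"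
      proof clarify
        fix V u x assume w: "wide C u" and X: "?X V u \<noteq> 0" and x: "x \<in> V"
        then have V: "V = verts (set u)" and D: "?D u \<noteq> 0" by (auto simp: restrict_verts_def split: if_splits)
        obtain e where e: "e \<in> set u" "x = fst e \<or> x = snd e" using x unfolding V verts_def by auto
        have "snd e - fst e \<le> C" using w e(1) by (auto simp: wide_def)
        moreover have "fst e \<le> a \<and> a \<le> snd e"
        proof (cases "star_series n m a u = (0 :: 'k)")
          case True
          then have "u \<in> tree_words n m a \<or> u \<in> tree_words n m (a - 1)"
            using nz[OF D] by (auto simp: tree_series_def split: if_splits)
          then show ?thesis using tree_words_letters[OF _ e(1)] by fastforce
        next
          case False
          then obtain js where "u = map (\<lambda>j. (min a j, max a j)) js" using star by blast
          then show ?thesis using e(1) by auto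
        qed
        ultimately show "x \<in> {a - \<bar>C\<bar> - 1..a + \<bar>C\<bar> + 1}" using e(2) by auto
      qed
      then show "finite {V \<in> ?V. \<exists>u. wide C u \<and> ?X V u \<noteq> 0}" by (rule finite_subset) simp
    qed
    fix V assume V: "V \<in> ?V"
    then have V': "finite V" "card V = Suc m" "inj_on (\<lambda>x. x mod int n) V" "a \<in> V" by (auto simp: vertex_sets_def)
    interpret fk_system V "B n :: int \<Rightarrow> int \<Rightarrow> 'k fk_alg" by (rule B_fk_system[OF n V'(1,3)])
    have ne: "js \<noteq> []" "\<And>j. j \<in> set js \<Longrightarrow> \<not> [a = j] (mod int n)" if js: "js \<in> permutations_of_set (V - {a})" for js
    proof -
      have s: "set js = V - {a}" using js by (rule permutations_of_setD)
      have "card (set js) = m" unfolding s using V' by simp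
      then show "js \<noteq> []" using m by (metis card.empty list.set(1) less_irrefl)
      show "\<not> [a = j] (mod int n)" if "j \<in> set js" for j using that s V'(3,4) unfolding cong_def inj_on_def by blast
    qed
    have si: "(br_prod a js :: 'k series) \<in> inv_alg n" if "js \<in> permutations_of_set (V - {a})" for js
      by (rule br_prod_inv_alg[OF n ne(2)[OF that]])
    have s1: "restrict_verts V (star_series n m a) \<in> (inv_alg n :: 'k series set)"
      unfolding restrict_star_series[OF V m] by (rule inv_alg_finite_sum[OF n si])
    have "cls n (restrict_verts V (star_series n m a)) = (\<Sum>js\<in>permutations_of_set (V - {a}). cls n (br_prod a js) :: 'k fk_alg)"
      unfolding restrict_star_series[OF V m] by (rule cls_sum[OF n si])
    also have "\<dots> = star_coef a (V - {a})"
      unfolding star_coef_def by (intro sum.cong refl cls_br_prod[OF n ne])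
    finally have s2: "cls n (restrict_verts V (star_series n m a)) = (star_coef a (V - {a}) :: 'k fk_alg)" .
    note t = cls_restrict_tree_series[OF n V'(1-3) m, where 'k = 'k]
    \<comment> \<open>Both tree series have become sums of stars over their rows, and the rows
      differ by \<open>a\<close> alone.\<close>
    have "{r. r \<in> V \<and> r \<le> a} = insert a {r. r \<in> V \<and> r \<le> a - 1}" using V'(4) by auto
    then have "(\<Sum>r | r \<in> V \<and> r \<le> a. star_coef r (V - {r})) =
      star_coef a (V - {a}) + (\<Sum>r | r \<in> V \<and> r \<le> a - 1. star_coef r (V - {r}))"
      using V'(1) by simp
    then have "cls n (?X V) = 0"
      unfolding restrict_verts_diff
      by (simp only: cls_diff inv_alg_diff s1 t s2) simp
    moreover have "?X V \<in> inv_alg n" unfolding restrict_verts_diff by (intro inv_alg_diff s1 t)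
    ultimately show "?X V \<in> fk_ideal n" using cls_eq_0_iff[OF n] by blast
  qed
  ultimately show ?thesis by (simp only:)
qed

section \<open>Powers of a sum of Dunkl type elements\<close>

definition dlists :: "nat \<Rightarrow> 'a set \<Rightarrow> 'a list set" where
  "dlists m X = {l. length l = m \<and> distinct l \<and> set l \<subseteq> X}"

lemma finite_dlists: "finite X \<Longrightarrow> finite (dlists m X)"
proof -
  assume "finite X"
  then have "finite {l. set l \<subseteq> X \<and> length l = m}" by (rule finite_lists_length_eq)
  moreover have "dlists m X \<subseteq> {l. set l \<subseteq> X \<and> length l = m}" by (auto simp: dlists_def)
  ultimately show ?thesis by (rule finite_subset[rotated])
qed

lemma dlists_0: "dlists 0 X = {[]}"
  by (auto simp: dlists_def)

lemma sum_dlists_Cons: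
  assumes "finite X"
  shows "(\<Sum>l\<in>dlists (Suc m) X. F l) = (\<Sum>x\<in>X. \<Sum>l\<in>dlists m (X - {x}). F (x # l))"
proof -
  have "dlists (Suc m) X = (\<Union>x\<in>X. (#) x ` dlists m (X - {x}))"
    by (auto simp: dlists_def length_Suc_conv image_iff)
  also have "sum F \<dots> = (\<Sum>x\<in>X. \<Sum>l\<in>(#) x ` dlists m (X - {x}). F l)"
    by (rule sum.UNION_disjoint) (use assms finite_dlists[of "X - {_}" m] in auto)
  finally show ?thesis by (simp add: sum.reindex)
qed

lemma sum_dlists_snoc:
  assumes "finite X"
  shows "(\<Sum>l\<in>dlists (Suc m) X. F l) = (\<Sum>l\<in>dlists m X. \<Sum>x\<in>X - set l. F (l @ [x]))"
proof -
  have "(\<Sum>l\<in>dlists m X. \<Sum>x\<in>X - set l. F (l @ [x])) =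
    (\<Sum>(l, x)\<in>(SIGMA l:dlists m X. X - set l). F (l @ [x]))"
    using assms by (intro sum.Sigma) (auto simp: finite_dlists)
  also have "\<dots> = (\<Sum>l\<in>dlists (Suc m) X. F l)"
  proof (rule sum.reindex_bij_witness[of _ "\<lambda>l. (butlast l, last l)" "\<lambda>(l, x). l @ [x]"])
    fix l assume "l \<in> dlists (Suc m) X"
    then obtain xs x where "l = xs @ [x]" "length xs = m" "distinct (xs @ [x])" "set (xs @ [x]) \<subseteq> X"
      by (cases l rule: rev_cases) (auto simp: dlists_def)
    then show "(case (butlast l, last l) of (l, x) \<Rightarrow> l @ [x]) = l"
      "(butlast l, last l) \<in> (SIGMA l:dlists m X. X - set l)"
      by (auto simp: dlists_def)
  qed (auto simp: dlists_def)
  finally show ?thesis ..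
qed

lemma sum_dlists_permutations:
  assumes "finite X"
  shows "(\<Sum>l\<in>dlists m X. F l) = (\<Sum>Y | Y \<subseteq> X \<and> card Y = m. \<Sum>l\<in>permutations_of_set Y. F l)"
proof -
  have "(\<Sum>Y | Y \<subseteq> X \<and> card Y = m. \<Sum>l\<in>{l \<in> dlists m X. set l = Y}. F l) = (\<Sum>l\<in>dlists m X. F l)"
  proof (rule sum.group)
    show "finite (dlists m X)" by (rule finite_dlists[OF assms])
    show "finite {Y. Y \<subseteq> X \<and> card Y = m}" using assms by simp
  qed (auto simp: dlists_def distinct_card)
  moreover have "{l \<in> dlists m X. set l = Y} = permutations_of_set Y" if "Y \<subseteq> X" "card Y = m" for Y
    using that by (auto simp: dlists_def permutations_of_set_def distinct_card)
  ultimately show ?thesis by (metis (mono_tags, lifting) mem_Collect_eq sum.cong)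
qed

lemma sum_permutations_rotate:
  "(\<Sum>l\<in>permutations_of_set A. F (rotate k l)) = (\<Sum>l\<in>permutations_of_set A. F l)"
proof -
  have "inj_on (rotate k) (permutations_of_set A)"
    unfolding rotate_def by (rule inj_on_subset[OF inj_fn[OF inj_rotate1]]) simp
  moreover have "rotate k ` permutations_of_set A \<subseteq> permutations_of_set A"
    by (auto simp: permutations_of_set_def)
  ultimately have "bij_betw (rotate k) (permutations_of_set A) (permutations_of_set A)"
    by (simp add: bij_betw_def endo_inj_surj)
  then show ?thesis by (rule sum.reindex_bij_betw)
qed

text \<open>In the application \<open>t p\<close> is the part of theta with residue
  \<open>p\<close>, and \<open>b p q\<close> is the sum of the symbols from a representative of
  residue \<open>p\<close> to all integers of residue \<open>q\<close>.\<close>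

locale dunkl_system =
  fixes P :: "'p set" and t :: "'p \<Rightarrow> 'r::ring_1" and b :: "'p \<Rightarrow> 'p \<Rightarrow> 'r"
  assumes fin: "finite P"
    and sq: "p \<in> P \<Longrightarrow> t p * t p = 0"
    and rel: "p \<in> P \<Longrightarrow> q \<in> P \<Longrightarrow> p \<noteq> q \<Longrightarrow> t p * t q = b p q * t p - t q * b p q"
    and comm: "{p, q, r} \<subseteq> P \<Longrightarrow> distinct [p, q, r] \<Longrightarrow> b p q * t r = t r * b p q"
begin

abbreviation pt :: "'p list \<Rightarrow> 'r" where
  "pt l \<equiv> prod_list (map t l)"

lemma pt_comm: "set l \<subseteq> P \<Longrightarrow> {p, q} \<subseteq> P \<Longrightarrow> p \<noteq> q \<Longrightarrow> {p, q} \<inter> set l = {} \<Longrightarrow> b p q * pt l = pt l * b p q"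
proof (induction l)
  case (Cons r l)
  have "b p q * (t r * pt l) = t r * (b p q * pt l)"
  proof -
    have "b p q * t r = t r * b p q" by (rule comm) (use Cons.prems in auto)
    then show ?thesis by (simp only: mult.assoc[symmetric])
  qed
  then show ?case using Cons by (simp add: mult.assoc)
qed simp

text \<open>The sum over the rotations of \<open>l\<close>, each closed up by repeating its first
  factor at the end.\<close>

definition cyc :: "'p list \<Rightarrow> 'r" where
  "cyc l = (\<Sum>k<length l. pt (drop k l) * pt (take k l) * t (l ! k))"

text \<open>In every closed rotation \<open>t p * t q\<close> occurs as a block, where
  \<open>rel\<close> applies. The factor \<open>b p q\<close> commutes with the other factors and
  can be moved to the outside; only the rotations that start at \<open>p\<close> and at
  \<open>q\<close> need separate treatment.\<close>

lemma cyc_snoc2: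
  assumes "distinct (xs @ [p, q])" "set (xs @ [p, q]) \<subseteq> P"
  shows "cyc (xs @ [p, q]) = b p q * cyc (xs @ [p]) - cyc (xs @ [q]) * b p q"
proof -
  let ?b = "b p q"
  have r: "t p * t q = ?b * t p - t q * ?b" using assms by (intro rel) auto
  have c: "?b * pt l = pt l * ?b" if "set l \<subseteq> set xs" for l
    by (rule pt_comm) (use assms that in auto)
  have t: "?b * t (xs ! k) = t (xs ! k) * ?b" if "k < length xs" for k
    by (rule comm) (use assms that in \<open>auto simp: nth_mem\<close>)
  \<comment> \<open>Each of these two rotations leaves a term in which \<open>b p q\<close> is
    caught between \<open>t q\<close> and \<open>t p\<close>; the two terms cancel.\<close>
  have last: "t p * t q * pt xs * t p + t q * pt xs * t p * t q = ?b * (t p * pt xs * t p) - t q * pt xs * t q * ?b"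
  proof -
    have "t p * t q * pt xs * t p = ?b * (t p * pt xs * t p) - t q * pt xs * (?b * t p)"
    proof -
      have "t p * t q * pt xs * t p = ?b * (t p * pt xs * t p) - t q * (?b * pt xs) * t p"
        by (simp only: r left_diff_distrib mult.assoc)
      also have "?b * pt xs = pt xs * ?b" by (rule c) simp
      finally show ?thesis by (simp only: mult.assoc)
    qed
    moreover have "t q * pt xs * t p * t q = t q * pt xs * (?b * t p) - t q * pt xs * t q * ?b"
      by (simp only: mult.assoc r right_diff_distrib)
    ultimately show ?thesis by simp
  qed
  have "pt (drop k xs) * (t p * t q) * pt (take k xs) * t (xs ! k) =
    ?b * (pt (drop k xs) * t p * pt (take k xs) * t (xs ! k)) - pt (drop k xs) * t q * pt (take k xs) * t (xs ! k) * ?b"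
    if k: "k < length xs" for k
  proof -
    let ?d = "pt (drop k xs)" and ?t = "pt (take k xs)" and ?x = "t (xs ! k)"
    have "?d * (t p * t q) * ?t * ?x = ?d * ?b * (t p * ?t * ?x) - ?d * t q * (?b * ?t) * ?x"
      by (simp add: r algebra_simps)
    also have "?d * ?b = ?b * ?d" by (rule c[symmetric, OF set_drop_subset])
    also have "?b * ?t = ?t * ?b" by (rule c[OF set_take_subset])
    also have "?d * t q * (?t * ?b) * ?x = ?d * t q * ?t * (?b * ?x)" by (simp only: mult.assoc)
    also have "?b * ?x = ?x * ?b" by (rule t[OF k])
    finally show ?thesis by (simp only: mult.assoc)
  qed
  then have "(\<Sum>k<length xs. pt (drop k xs) * (t p * t q) * pt (take k xs) * t (xs ! k)) =
    ?b * (\<Sum>k<length xs. pt (drop k xs) * t p * pt (take k xs) * t (xs ! k)) -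
    (\<Sum>k<length xs. pt (drop k xs) * t q * pt (take k xs) * t (xs ! k)) * ?b"
    by (simp add: sum_subtractf sum_distrib_left sum_distrib_right)
  moreover have "cyc (xs @ [p, q]) = (\<Sum>k<length xs. pt (drop k xs) * (t p * t q) * pt (take k xs) * t (xs ! k)) +
      (t p * t q * pt xs * t p + t q * pt xs * t p * t q)"
    by (simp add: cyc_def nth_append mult.assoc)
  moreover have "cyc (xs @ [y]) = (\<Sum>k<length xs. pt (drop k xs) * t y * pt (take k xs) * t (xs ! k)) + t y * pt xs * t y" for y
    by (simp add: cyc_def nth_append)
  ultimately show ?thesis unfolding last by (simp only: distrib_left distrib_right add_diff_add)
qed

text \<open>\<open>cyc_snoc2\<close> reduces the length by one until a single square
  \<open>t p * t p\<close> remains.\<close>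

lemma cyc_zero:
  "l \<noteq> [] \<Longrightarrow> distinct l \<Longrightarrow> set l \<subseteq> P \<Longrightarrow> cyc l = 0"
proof (induction l rule: length_induct)
  case (1 l)
  then obtain l' q where l: "l = l' @ [q]" by (metis rev_exhaust)
  show ?case
  proof (cases l' rule: rev_cases)
    case Nil
    then show ?thesis using 1 l sq by (simp add: cyc_def)
  next
    case (snoc xs p)
    then have "cyc (xs @ [p]) = 0" "cyc (xs @ [q]) = 0" using 1 l by auto
    then show ?thesis using cyc_snoc2[of xs p q] 1 l snoc by simp
  qed
qed

text \<open>The orderings of \<open>Y\<close> fall into rotation classes. Each class has one member
  that begins with the chosen \<open>x\<close>, and its sum is the \<open>cyc\<close> of that
  member, hence zero.\<close>

lemma sum_permutations_hd:
  assumes "Y \<subseteq> P" "Y \<noteq> {}"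
  shows "(\<Sum>l\<in>permutations_of_set Y. pt l * t (hd l)) = 0"
proof -
  obtain x where x: "x \<in> Y" using assms(2) by blast
  let ?A = "Y - {x}" and ?G = "\<lambda>l. pt l * t (hd l)"
  have fA: "finite ?A" using fin assms(1) finite_subset by blast
  have "(\<Sum>l\<in>permutations_of_set Y. ?G l) = (\<Sum>l\<in>permutations_of_set ?A. \<Sum>k\<le>card ?A. ?G (take k l @ x # drop k l))"
    using sum_permutations_insert[OF fA, of x ?G] x by (simp add: insert_absorb)
  also have "\<dots> = (\<Sum>k\<le>card ?A. \<Sum>l\<in>permutations_of_set ?A. ?G (take k l @ x # drop k l))" by (rule sum.swap)
  \<comment> \<open>Rotating \<open>l\<close>, which permutes the orderings of \<open>?A\<close>,
    turns an insertion of \<open>x\<close> into a rotation of \<open>x # l\<close>.\<close>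
  also have "\<dots> = (\<Sum>k\<le>card ?A. \<Sum>l\<in>permutations_of_set ?A. ?G (drop (card ?A - k) l @ x # take (card ?A - k) l))"
  proof (rule sum.cong[OF refl])
    fix k assume k: "k \<in> {..card ?A}"
    have "take k (rotate (card ?A - k) l) = drop (card ?A - k) l \<and> drop k (rotate (card ?A - k) l) = take (card ?A - k) l"
      if "l \<in> permutations_of_set ?A" for l
    proof -
      have len: "length l = card ?A" using that by (rule length_finite_permutations_of_set)
      have "rotate (card ?A - k) l = drop (card ?A - k) l @ take (card ?A - k) l"
        using len k by (cases "k = 0") (auto simp: rotate_drop_take)
      then show ?thesis using len k by simp
    qed
    then show "(\<Sum>l\<in>permutations_of_set ?A. ?G (take k l @ x # drop k l)) =
        (\<Sum>l\<in>permutations_of_set ?A. ?G (drop (card ?A - k) l @ x # take (card ?A - k) l))"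
      by (subst sum_permutations_rotate[where k = "card ?A - k", symmetric]) (rule sum.cong, auto)
  qed
  also have "\<dots> = (\<Sum>k\<le>card ?A. \<Sum>l\<in>permutations_of_set ?A. ?G (drop k l @ x # take k l))"
    using sum.nat_diff_reindex[of "\<lambda>k. \<Sum>l\<in>permutations_of_set ?A. ?G (drop k l @ x # take k l)" "Suc (card ?A)"]
    by (simp only: lessThan_Suc_atMost diff_Suc_Suc)
  also have "\<dots> = (\<Sum>l\<in>permutations_of_set ?A. \<Sum>k\<le>card ?A. ?G (drop k l @ x # take k l))" by (rule sum.swap)
  also have "\<dots> = (\<Sum>l\<in>permutations_of_set ?A. cyc (x # l))"
  proof (rule sum.cong[OF refl])
    fix l assume "l \<in> permutations_of_set ?A"
    then have len: "length l = card ?A" by (rule length_finite_permutations_of_set)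
    have "?G (drop k l @ x # take k l) = pt (drop k l) * pt (take (Suc k) (x # l)) * t (l ! k)" if "k < length l" for k
      using that by (simp add: hd_append hd_drop_conv_nth mult.assoc)
    then have 1: "(\<Sum>k<length l. ?G (drop k l @ x # take k l)) = (\<Sum>k<length l. pt (drop k l) * pt (take (Suc k) (x # l)) * t (l ! k))"
      by (intro sum.cong) auto
    have "(\<Sum>k\<le>card ?A. ?G (drop k l @ x # take k l)) = (\<Sum>k<length l. ?G (drop k l @ x # take k l)) + ?G (x # l)"
      unfolding len[symmetric] lessThan_Suc_atMost[symmetric] by simp
    moreover have "cyc (x # l) = ?G (x # l) + (\<Sum>k<length l. pt (drop k l) * pt (take (Suc k) (x # l)) * t (l ! k))"
      unfolding cyc_def by (simp add: sum.lessThan_Suc_shift del: sum.lessThan_Suc)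
    ultimately show "(\<Sum>k\<le>card ?A. ?G (drop k l @ x # take k l)) = cyc (x # l)"
      unfolding 1 by (simp only: add.commute)
  qed
  also have "\<dots> = 0"
    using x assms(1) by (intro sum.neutral ballI cyc_zero) (auto dest: permutations_of_setD)
  finally show ?thesis .
qed

text \<open>Repetition of the first factor is covered by \<open>sum_permutations_hd\<close>, one set
  of entries at a time. If a later factor is repeated, the first one can be pulled out on the left,
  and the rest is the claim for the remaining entries.\<close>

lemma sum_dlists_repeat: "X \<subseteq> P \<Longrightarrow> (\<Sum>l\<in>dlists m X. \<Sum>k<m. pt l * t (l ! k)) = 0"
proof (induction m arbitrary: X)
  case (Suc m)
  have fX: "finite X" using Suc.prems fin finite_subset by blast
  have "(\<Sum>l\<in>dlists (Suc m) X. \<Sum>k<Suc m. pt l * t (l ! k)) =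
    (\<Sum>l\<in>dlists (Suc m) X. pt l * t (l ! 0)) + (\<Sum>l\<in>dlists (Suc m) X. \<Sum>k<m. pt l * t (l ! Suc k))"
    by (simp add: sum.lessThan_Suc_shift sum.distrib del: sum.lessThan_Suc)
  also have "(\<Sum>l\<in>dlists (Suc m) X. \<Sum>k<m. pt l * t (l ! Suc k)) =
    (\<Sum>x\<in>X. t x * (\<Sum>l\<in>dlists m (X - {x}). \<Sum>k<m. pt l * t (l ! k)))"
    by (simp add: sum_dlists_Cons[OF fX] sum_distrib_left mult.assoc)
  also have "\<dots> = 0"
  proof (intro sum.neutral ballI)
    fix x
    have "X - {x} \<subseteq> P" using Suc.prems by blast
    then show "t x * (\<Sum>l\<in>dlists m (X - {x}). \<Sum>k<m. pt l * t (l ! k)) = 0"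
      by (simp only: Suc.IH mult_zero_right)
  qed
  also have "(\<Sum>l\<in>dlists (Suc m) X. pt l * t (l ! 0)) = (\<Sum>l\<in>dlists (Suc m) X. pt l * t (hd l))"
    by (rule sum.cong) (auto simp: dlists_def length_Suc_conv)
  also have "\<dots> = 0"
    unfolding sum_dlists_permutations[OF fX]
    by (intro sum.neutral ballI sum_permutations_hd) (use Suc.prems in auto)
  finally show ?case by simp
qed simp

text \<open>A further factor either is new and extends the list, or repeats an entry; the
  repetitions cancel by \<open>sum_dlists_repeat\<close>.\<close>

theorem power_sum: "(\<Sum>p\<in>P. t p) ^ m = (\<Sum>l\<in>dlists m P. pt l)"
proof (induction m)
  case (Suc m)
  have "(\<Sum>p\<in>P. t p) ^ Suc m = (\<Sum>l\<in>dlists m P. \<Sum>p\<in>P. pt l * t p)"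
    by (simp only: power_Suc2 Suc.IH sum_product)
  also have "\<dots> = (\<Sum>l\<in>dlists m P. (\<Sum>p\<in>P - set l. pt (l @ [p])) + (\<Sum>k<m. pt l * t (l ! k)))"
  proof (rule sum.cong[OF refl])
    fix l assume "l \<in> dlists m P"
    then have l: "length l = m" "distinct l" "set l \<subseteq> P" by (auto simp: dlists_def)
    have "(\<Sum>p\<in>P. pt l * t p) = (\<Sum>p\<in>P - set l. pt l * t p) + (\<Sum>p\<in>set l. pt l * t p)"
      by (rule sum.subset_diff[OF l(3) fin])
    also have "(\<Sum>p\<in>set l. pt l * t p) = (\<Sum>k<m. pt l * t (l ! k))"
      using l by (intro sum.reindex_bij_betw[symmetric] bij_betw_nth) auto
    finally show "(\<Sum>p\<in>P. pt l * t p) = (\<Sum>p\<in>P - set l. pt (l @ [p])) + (\<Sum>k<m. pt l * t (l ! k))" by simp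
  qed
  also have "\<dots> = (\<Sum>l\<in>dlists (Suc m) P. pt l)"
    by (simp only: sum.distrib sum_dlists_repeat[OF order_refl] sum_dlists_snoc[OF fin] add_0_right)
  finally show ?case .
qed (simp add: dlists_0)

end

section \<open>Powers of the theta series\<close>

lemma locfin_br: "locfin (br a) I"
  unfolding locfin_def
proof
  fix C
  have "{j \<in> I. \<exists>u. wide C u \<and> br a j u \<noteq> (0 :: 'a)} \<subseteq> {a - \<bar>C\<bar>..a + \<bar>C\<bar>}" using br_wide by blast
  then show "finite {j \<in> I. \<exists>u. wide C u \<and> br a j u \<noteq> (0 :: 'a)}" by (rule finite_subset) simp
qed

lemma locfin_add:
  assumes "locfin F I" "locfin G I"
  shows "locfin (\<lambda>x. F x + G x) I"
  unfolding locfin_def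
proof
  fix C
  have "{x \<in> I. \<exists>u. wide C u \<and> (F x + G x) u \<noteq> 0} \<subseteq>
    {x \<in> I. \<exists>u. wide C u \<and> F x u \<noteq> 0} \<union> {x \<in> I. \<exists>u. wide C u \<and> G x u \<noteq> 0}" by auto
  then show "finite {x \<in> I. \<exists>u. wide C u \<and> (F x + G x) u \<noteq> 0}"
    using assms unfolding locfin_def by (meson finite_UnI finite_subset)
qed

lemma locfin_uminus: "locfin F I \<Longrightarrow> locfin (\<lambda>x. - F x) I"
  by (simp add: locfin_def)

lemma locfin_diff: "locfin F I \<Longrightarrow> locfin G I \<Longrightarrow> locfin (\<lambda>x. F x - G x) I"
  using locfin_add[of F I "\<lambda>x. - G x"] locfin_uminus[of G I] by (simp del: plus_fun_def)

lemma locfin_mult: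
  assumes F: "locfin F I" and G: "locfin G J"
  shows "locfin (\<lambda>(x, y). F x \<odot> G y) (I \<times> J)"
  unfolding locfin_def
proof
  fix C
  let ?A = "{x \<in> I. \<exists>u. wide C u \<and> F x u \<noteq> 0}" and ?B = "{y \<in> J. \<exists>u. wide C u \<and> G y u \<noteq> 0}"
  have "{p \<in> I \<times> J. \<exists>u. wide C u \<and> (case p of (x, y) \<Rightarrow> F x \<odot> G y) u \<noteq> 0} \<subseteq> ?A \<times> ?B"
  proof
    fix p assume "p \<in> {p \<in> I \<times> J. \<exists>u. wide C u \<and> (case p of (x, y) \<Rightarrow> F x \<odot> G y) u \<noteq> 0}"
    then obtain x y u where p: "p = (x, y)" "x \<in> I" "y \<in> J" "wide C u" "(F x \<odot> G y) u \<noteq> 0" by auto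
    then obtain v w where vw: "u = v @ w" "F x v \<noteq> 0" "G y w \<noteq> 0" by (auto elim: series_mult_nz)
    then have "wide C v" "wide C w" using p(4) by (auto simp: wide_def)
    then show "p \<in> ?A \<times> ?B" using p vw by auto
  qed
  moreover have "finite (?A \<times> ?B)" using F G by (auto simp: locfin_def)
  ultimately show "finite {p \<in> I \<times> J. \<exists>u. wide C u \<and> (case p of (x, y) \<Rightarrow> F x \<odot> G y) u \<noteq> 0}"
    by (rule finite_subset)
qed

lemma locfin_reindex:
  assumes F: "locfin F I" and h: "inj_on h K" "h ` K \<subseteq> I"
  shows "locfin (\<lambda>x. F (h x)) K"
  unfolding locfin_def
proof
  fix C
  let ?A = "{x \<in> K. \<exists>u. wide C u \<and> F (h x) u \<noteq> 0}"
  have "h ` ?A \<subseteq> {x \<in> I. \<exists>u. wide C u \<and> F x u \<noteq> 0}" using h(2) by auto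
  then have "finite (h ` ?A)" using F finite_subset unfolding locfin_def by blast
  then show "finite ?A" by (rule finite_imageD) (rule inj_on_subset[OF h(1)], auto)
qed

lemma series_sum_UN:
  assumes K: "finite K" "\<And>k l. k \<in> K \<Longrightarrow> l \<in> K \<Longrightarrow> k \<noteq> l \<Longrightarrow> A k \<inter> A l = {}"
    and F: "\<And>u. finite {x \<in> (\<Union>k\<in>K. A k). F x u \<noteq> 0}"
  shows "series_sum F (\<Union>k\<in>K. A k) = (\<Sum>k\<in>K. series_sum F (A k))"
proof
  fix u
  have "{x. x \<in> (\<Union>k\<in>K. A k) \<and> F x u \<noteq> 0} = (\<Union>k\<in>K. {x \<in> A k. F x u \<noteq> 0})" by auto
  then have "series_sum F (\<Union>k\<in>K. A k) u = (\<Sum>x\<in>(\<Union>k\<in>K. {x \<in> A k. F x u \<noteq> 0}). F x u)"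
    by (simp only: series_sum_def)
  also have "\<dots> = (\<Sum>k\<in>K. \<Sum>x | x \<in> A k \<and> F x u \<noteq> 0. F x u)"
  proof (rule sum.UNION_disjoint[OF K(1)])
    show "\<forall>k\<in>K. finite {x \<in> A k. F x u \<noteq> 0}"
      by (intro ballI finite_subset[OF _ F[of u]]) blast
    show "\<forall>k\<in>K. \<forall>l\<in>K. k \<noteq> l \<longrightarrow> {x \<in> A k. F x u \<noteq> 0} \<inter> {x \<in> A l. F x u \<noteq> 0} = {}" using K(2) by blast
  qed
  finally show "series_sum F (\<Union>k\<in>K. A k) u = (\<Sum>k\<in>K. series_sum F (A k)) u"
    by (simp only: sum_series_apply series_sum_def)
qed

text \<open>The members differ by elements of the ideal, and these form a locally finite family.
  This lets relations be applied under an infinite sum.\<close>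

lemma cls_series_sum_cong:
  assumes n: "n \<ge> 2" and I: "countable I" and lf: "locfin F I" "locfin G I"
    and mem: "\<And>x. x \<in> I \<Longrightarrow> F x \<in> inv_alg n" "\<And>x. x \<in> I \<Longrightarrow> G x \<in> inv_alg n"
    and eq: "\<And>x. x \<in> I \<Longrightarrow> cls n (F x) = cls n (G x)"
    and sums: "series_sum F I \<in> inv_alg n" "series_sum G I \<in> inv_alg n"
  shows "cls n (series_sum F I) = cls n (series_sum G I)"
proof -
  have "series_sum (\<lambda>x. F x - G x) I \<in> fk_ideal n"
  proof (rule series_sum_ideal[OF n I _ locfin_diff[OF lf]])
    fix x assume x: "x \<in> I"
    show "F x - G x \<in> fk_ideal n" using cls_eq_iff[OF n mem(1,2)[OF x]] eq[OF x] by blast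
  qed
  moreover have "series_sum (\<lambda>x. F x - G x) I = series_sum F I - series_sum G I"
    by (rule series_sum_diff) (rule locfinD[OF lf(1)], rule locfinD[OF lf(2)])
  ultimately show ?thesis using cls_eq_iff[OF n sums] by simp
qed

section \<open>Splitting theta by residues\<close>

definition res :: "nat \<Rightarrow> int \<Rightarrow> int set" where
  "res n r = {j. j mod int n = r}"

definition theta_res :: "nat \<Rightarrow> int \<Rightarrow> int \<Rightarrow> 'k::comm_ring_1 series" where
  "theta_res n a r = series_sum (br a) (res n r)"

definition residues_but :: "nat \<Rightarrow> int \<Rightarrow> int set" where
  "residues_but n a = {0..<int n} - {a mod int n}"

lemma res_not_cong: "j \<in> res n r \<Longrightarrow> r \<noteq> a mod int n \<Longrightarrow> \<not> [a = j] (mod int n)"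
  by (auto simp: res_def cong_def)

lemma inv_alg_theta_res:
  assumes "n \<ge> 2" "r \<noteq> a mod int n"
  shows "theta_res n a r \<in> inv_alg n"
proof (rule width_fin_inv_alg[OF assms(1)])
  have "width_fin n (br a j)" if "j \<in> res n r" for j
    using width_fin_br_prod[of "[j]" a n] res_not_cong[OF that assms(2)] by (simp add: br_prod_def series_mult_one)
  then show "width_fin n (theta_res n a r)"
    unfolding theta_res_def by (intro width_fin_series_sum locfin_br)
qed

lemma theta_res_mult:
  "theta_res n a r \<odot> theta_res n b s = series_sum (\<lambda>(x, y). br a x \<odot> br b y) (res n r \<times> res n s)"
  unfolding theta_res_def by (intro series_sum_mult locfinD locfin_br)

lemma B_shift:
  assumes n: "n \<ge> 2" and ij: "\<not> [i = j] (mod int n)" and k: "int n dvd k"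
  shows "B n (i + k) (j + k) = (B n i j :: 'k::comm_ring_1 fk_alg)"
proof -
  have 1: "B n (i + int n * int m) (j + int n * int m) = (B n i j :: 'k fk_alg)" if "\<not> [i = j] (mod int n)" for i j m
  proof (induction m)
    case (Suc m)
    have "\<not> [i + int n * int m = j + int n * int m] (mod int n)" using that by (simp add: cong_add_rcancel)
    then have "cls n (br (i + int n * int m) (j + int n * int m)) =
      (cls n (br (i + int n * int m + int n) (j + int n * int m + int n)) :: 'k fk_alg)"
      by (intro cls_rel[OF n] fk_rels.e)
    then show ?case using Suc by (simp add: algebra_simps)
  qed simp
  obtain q where q: "k = int n * q" using k by blast
  show ?thesis
  proof (cases "q \<ge> 0")
    case True
    then show ?thesis using 1[OF ij, of "nat q"] q by simp
  next
    case False
    \<comment> \<open>For a negative shift the positive case is applied to the shifted pair.\<close>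
    have "\<not> [i + k = j + k] (mod int n)" using ij by (simp add: cong_add_rcancel)
    from 1[OF this, of "nat (- q)"] show ?thesis using False q by simp
  qed
qed

text \<open>The double sum in relation \<open>d\<close> factors as \<open>?T \<odot> ?U\<close>. By
  translation invariance and antisymmetry, \<open>?U\<close> has the class of
  \<open>-?T\<close>.\<close>

lemma theta_res_sq:
  assumes n: "n \<ge> 2" and r: "r \<noteq> a mod int n" "r \<in> {0..<int n}"
  shows "cls n (theta_res n a r) * cls n (theta_res n a r) = (0 :: 'k::comm_ring_1 fk_alg)"
proof -
  let ?T = "theta_res n a r :: 'k series" and ?U = "theta_res n r (a mod int n) :: 'k series"
  have r': "r mod int n = r" using r(2) by simp
  have Ti: "?T \<in> inv_alg n" by (rule inv_alg_theta_res[OF n r(1)])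
  have Ui: "?U \<in> inv_alg n" by (rule inv_alg_theta_res[OF n]) (use r r' in auto)
  let ?d = "series_sum (\<lambda>(i', j'). br a j' \<odot> br r i') {(i', j'). [i' = a] (mod int n) \<and> [j' = r] (mod int n)} :: 'k series"
  have "?d = series_sum (\<lambda>p. (\<lambda>(x, y). br a x \<odot> br r y) (prod.swap p)) (res n (a mod int n) \<times> res n r)"
    by (rule arg_cong2[of _ _ _ _ series_sum]) (auto simp: res_def cong_def r' fun_eq_iff)
  also have "\<dots> = ?T \<odot> ?U"
    unfolding theta_res_mult by (rule series_sum_reindex[symmetric]) (auto simp: bij_betw_def inj_on_def image_iff)
  finally have d: "?d = ?T \<odot> ?U" .
  have "\<not> [a = r] (mod int n)" using r r' by (auto simp: cong_def)
  then have "cls n ?d = cls n 0" by (intro cls_rel[OF n] fk_rels.d)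
  then have TU: "cls n ?T * cls n ?U = 0" using n Ti Ui unfolding d by (simp only: cls_mult cls_0)
  \<comment> \<open>Translation by \<open>j - r\<close> takes \<open>[r, r + a - j]\<close> to
    \<open>[j, a] = -[a, j]\<close>.\<close>
  let ?h = "\<lambda>j. r + a - j"
  have bij: "bij_betw ?h (res n r) (res n (a mod int n))"
  proof (rule bij_betw_byWitness[of _ ?h])
    have "(r + a - j) mod int n = a mod int n" if "j mod int n = r" for j
      by (metis add.commute add_diff_cancel_right' mod_diff_right_eq r' that mod_diff_eq)
    then show "?h ` res n r \<subseteq> res n (a mod int n)" by (auto simp: res_def)
    have "(r + a - j) mod int n = r" if "j mod int n = a mod int n" for j
      by (metis add_diff_cancel_right' mod_diff_right_eq r' that)
    then show "?h ` res n (a mod int n) \<subseteq> res n r" by (auto simp: res_def)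
  qed auto
  have U: "?U = series_sum (\<lambda>j. br r (?h j)) (res n r)"
    unfolding theta_res_def by (rule series_sum_reindex[OF bij])
  have rel: "B n r (?h j) = cls n (- br a j :: 'k series)" if j: "j \<in> res n r" for j
  proof -
    have nc: "\<not> [a = j] (mod int n)" by (rule res_not_cong[OF j r(1)])
    have d: "int n dvd j - r" using j r' unfolding res_def mem_Collect_eq by (metis mod_eq_dvd_iff)
    have "\<not> [r = ?h j] (mod int n)"
    proof -
      have "?h j \<in> res n (a mod int n)" using bij j by (auto simp: bij_betw_def)
      then show ?thesis by (rule res_not_cong) (use r r' in auto)
    qed
    then have "B n (r + (j - r)) (?h j + (j - r)) = (B n r (?h j) :: 'k fk_alg)" by (rule B_shift[OF n _ d])
    then have "B n r (?h j) = (B n j a :: 'k fk_alg)" by simp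
    also have "\<dots> = cls n (- br a j)"
      by (simp only: B_swap[OF n nc] cls_uminus[OF inv_alg_br[OF n nc]])
    finally show ?thesis .
  qed
  have "cls n (series_sum (\<lambda>j. br r (?h j)) (res n r)) = cls n (series_sum (\<lambda>j. - br a j :: 'k series) (res n r))"
  proof (rule cls_series_sum_cong[OF n _ _ _ _ _ rel])
    show "locfin (\<lambda>j. br r (?h j) :: 'k series) (res n r)"
      by (rule locfin_reindex[OF locfin_br[of r UNIV]]) (auto simp: inj_on_def)
    show "locfin (\<lambda>j. - br a j :: 'k series) (res n r)" by (rule locfin_uminus[OF locfin_br])
    show "(br r (?h j) :: 'k series) \<in> inv_alg n" if "j \<in> res n r" for j
    proof (rule inv_alg_br[OF n])
      have "?h j \<in> res n (a mod int n)" using bij that by (auto simp: bij_betw_def)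
      then show "\<not> [r = ?h j] (mod int n)" by (rule res_not_cong) (use r r' in auto)
    qed
    show "(- br a j :: 'k series) \<in> inv_alg n" if "j \<in> res n r" for j
      by (intro inv_alg_uminus inv_alg_br[OF n] res_not_cong[OF that r(1)])
    show "series_sum (\<lambda>j. br r (?h j) :: 'k series) (res n r) \<in> inv_alg n" using Ui unfolding U .
    show "series_sum (\<lambda>j. - br a j :: 'k series) (res n r) \<in> inv_alg n"
      using inv_alg_uminus[OF Ti] unfolding series_sum_uminus theta_res_def .
  qed simp
  then have "cls n ?U = - cls n ?T"
    unfolding U[symmetric] series_sum_uminus theta_res_def[symmetric] cls_uminus[OF Ti] .
  then show ?thesis using TU by simp
qed

text \<open>Termwise this is relation \<open>b\<close>: the four endpoints have distinct residues.
  The exchange of the factors becomes a swap of the summation indices.\<close>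

lemma theta_res_comm:
  assumes n: "n \<ge> 2" and d: "distinct [a mod int n, p, q, r]" "{p, q, r} \<subseteq> {0..<int n}"
  shows "cls n (theta_res n p q) * cls n (theta_res n a r) = cls n (theta_res n a r) * (cls n (theta_res n p q) :: 'k::comm_ring_1 fk_alg)"
proof -
  have p: "p mod int n = p" using d by simp
  let ?U = "theta_res n p q :: 'k series" and ?T = "theta_res n a r :: 'k series"
  have i: "?U \<in> inv_alg n" "?T \<in> inv_alg n" using d p by (auto intro!: inv_alg_theta_res[OF n])
  have TU: "?T \<odot> ?U = series_sum (\<lambda>z. (\<lambda>(y, x). br a y \<odot> br p x) (prod.swap z)) (res n q \<times> res n r)"
    unfolding theta_res_mult by (rule series_sum_reindex) (auto simp: bij_betw_def inj_on_def image_iff)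
  have br: "(br p x :: 'k series) \<in> inv_alg n" "(br a y :: 'k series) \<in> inv_alg n" if "x \<in> res n q" "y \<in> res n r" for x y
    by (rule inv_alg_br[OF n res_not_cong[OF that(1)]] inv_alg_br[OF n res_not_cong[OF that(2)]]; use d p in auto)+
  have "cls n (?U \<odot> ?T) = cls n (?T \<odot> ?U)"
    unfolding TU theta_res_mult[of n p q]
  proof (rule cls_series_sum_cong[OF n])
    show "locfin (\<lambda>(x, y). br p x \<odot> br a y :: 'k series) (res n q \<times> res n r)"
      by (intro locfin_mult locfin_br)
    show "locfin (\<lambda>z. (\<lambda>(y, x). br a y \<odot> br p x :: 'k series) (prod.swap z)) (res n q \<times> res n r)"
      by (rule locfin_reindex[OF locfin_mult[OF locfin_br[of a "res n r"] locfin_br[of p "res n q"]]]) (auto simp: inj_on_def)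
    fix z assume "z \<in> res n q \<times> res n r"
    then obtain x y where z: "z = (x, y)" "x \<in> res n q" "y \<in> res n r" by blast
    note b = br[OF z(2,3)]
    show "((case z of (x, y) \<Rightarrow> br p x \<odot> br a y) :: 'k series) \<in> inv_alg n"
      unfolding z prod.case using n b by (intro inv_alg_mult) auto
    show "(\<lambda>(y, x). br a y \<odot> br p x :: 'k series) (prod.swap z) \<in> inv_alg n"
      unfolding z swap_simp prod.case using n b by (intro inv_alg_mult) auto
    have "distinct [p mod int n, x mod int n, a mod int n, y mod int n]"
      using d z p by (auto simp: res_def)
    then show "cls n ((case z of (x, y) \<Rightarrow> br p x \<odot> br a y) :: 'k series) = cls n ((\<lambda>(y, x). br a y \<odot> br p x) (prod.swap z))"
      unfolding z swap_simp prod.case by (intro cls_rel[OF n] fk_rels.b)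
  next
    show "series_sum (\<lambda>(x, y). br p x \<odot> br a y :: 'k series) (res n q \<times> res n r) \<in> inv_alg n"
      using inv_alg_mult[OF _ i] n unfolding theta_res_mult by simp
    show "series_sum (\<lambda>z. (\<lambda>(y, x). br a y \<odot> br p x :: 'k series) (prod.swap z)) (res n q \<times> res n r) \<in> inv_alg n"
      using inv_alg_mult[OF _ i(2,1)] n unfolding TU by simp
  qed simp
  then show ?thesis using n i by (simp only: cls_mult)
qed

text \<open>For fixed \<open>j\<close> and \<open>k\<close> it is \<open>tri'\<close> at
  \<open>a, j, k\<close>. The letter \<open>[jk]\<close> is translated so as to start at
  \<open>p\<close>, and then both terms on the right run through full products of two of the
  series.\<close>

lemma theta_res_rel:
  assumes n: "n \<ge> 2" and d: "distinct [a mod int n, p, q]" "{p, q} \<subseteq> {0..<int n}"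
  shows "cls n (theta_res n a p) * cls n (theta_res n a q) =
    cls n (theta_res n p q) * cls n (theta_res n a p) - cls n (theta_res n a q) * (cls n (theta_res n p q) :: 'k::comm_ring_1 fk_alg)"
proof -
  have m: "p mod int n = p" "q mod int n = q" using d by auto
  let ?T = "\<lambda>r. theta_res n a r :: 'k series" and ?U = "theta_res n p q :: 'k series"
  \<comment> \<open>Since \<open>[jk]\<close> equals \<open>[p, k + p - j]\<close>, the terms
    \<open>[jk][aj]\<close> and \<open>[ak][jk]\<close> have the free endpoints recorded by
    \<open>?h\<close> and \<open>?g\<close>.\<close>
  let ?I = "res n p \<times> res n q" and ?h = "\<lambda>(j, k). (k + p - j, j)" and ?g = "\<lambda>(j, k). (k, k + p - j)"
  let ?F = "\<lambda>(x, y). br p x \<odot> br a y :: 'k series" and ?G = "\<lambda>(x, y). br a x \<odot> br p y :: 'k series"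
  have i: "?T p \<in> inv_alg n" "?T q \<in> inv_alg n" "?U \<in> inv_alg n" using d m by (auto intro!: inv_alg_theta_res[OF n])
  have h0: "k + p - j \<in> res n q" if "j \<in> res n p" "k \<in> res n q" for j k
    using that m unfolding res_def mem_Collect_eq by (metis add_diff_cancel_right' mod_diff_right_eq mod_diff_left_eq)
  have h1: "x + y - p \<in> res n q" if "x \<in> res n q" "y \<in> res n p" for x y
    using that m unfolding res_def mem_Collect_eq by (metis add_diff_cancel_right' mod_diff_cong)
  have h2: "k + p - x \<in> res n p" if "k \<in> res n q" "x \<in> res n q" for k x
    using that m unfolding res_def mem_Collect_eq by (metis add_diff_cancel_left' mod_diff_cong)
  have bh: "bij_betw ?h ?I (res n q \<times> res n p)"
    by (rule bij_betw_byWitness[of _ "\<lambda>(x, y). (y, x + y - p)"]) (auto simp: h0 h1)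
  have bg: "bij_betw ?g ?I (res n q \<times> res n q)"
    by (rule bij_betw_byWitness[of _ "\<lambda>(k, x). (k + p - x, k)"]) (auto simp: h0 h2)
  have UT: "?U \<odot> ?T p = series_sum (\<lambda>z. ?F (?h z)) ?I"
    unfolding theta_res_mult by (rule series_sum_reindex[OF bh])
  have TU: "?T q \<odot> ?U = series_sum (\<lambda>z. ?G (?g z)) ?I"
    unfolding theta_res_mult by (rule series_sum_reindex[OF bg])
  have l1: "locfin (\<lambda>z. ?F (?h z)) ?I"
    by (rule locfin_reindex[OF locfin_mult[OF locfin_br[of p "res n q"] locfin_br[of a "res n p"]]])
       (use bh in \<open>auto simp: bij_betw_def\<close>)
  have l2: "locfin (\<lambda>z. ?G (?g z)) ?I"
    by (rule locfin_reindex[OF locfin_mult[OF locfin_br[of a "res n q"] locfin_br[of p "res n q"]]])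
       (use bg in \<open>auto simp: bij_betw_def\<close>)
  have D: "series_sum (\<lambda>z. ?F (?h z) - ?G (?g z)) ?I = ?U \<odot> ?T p - ?T q \<odot> ?U"
    unfolding UT TU by (rule series_sum_diff) (rule locfinD[OF l1], rule locfinD[OF l2])
  have Di: "?U \<odot> ?T p - ?T q \<odot> ?U \<in> inv_alg n" using n i by (intro inv_alg_diff inv_alg_mult) auto
  have br: "(br a j :: 'k series) \<in> inv_alg n" "(br a k :: 'k series) \<in> inv_alg n" "(br p (k + p - j) :: 'k series) \<in> inv_alg n"
    "B n p (k + p - j) = (B n j k :: 'k fk_alg)" "distinct [a mod int n, j mod int n, k mod int n]"
    if "j \<in> res n p" "k \<in> res n q" for j k
  proof -
    have jk: "j mod int n = p" "k mod int n = q" using that by (auto simp: res_def)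
    then show dd: "distinct [a mod int n, j mod int n, k mod int n]" using d by auto
    then show "(br a j :: 'k series) \<in> inv_alg n" "(br a k :: 'k series) \<in> inv_alg n"
      by (auto intro!: inv_alg_br[OF n] simp: cong_def)
    have nc: "\<not> [p = k + p - j] (mod int n)" by (rule res_not_cong[OF h0[OF that]]) (use d m in auto)
    then show "(br p (k + p - j) :: 'k series) \<in> inv_alg n" by (rule inv_alg_br[OF n])
    have "int n dvd j - p" using jk(1) m(1) by (metis mod_eq_dvd_iff)
    from B_shift[OF n nc this, where 'k = 'k] show "B n p (k + p - j) = (B n j k :: 'k fk_alg)" by simp
  qed
  have "cls n (?T p \<odot> ?T q) = cls n (series_sum (\<lambda>z. ?F (?h z) - ?G (?g z)) ?I)"
    unfolding theta_res_mult
  proof (rule cls_series_sum_cong[OF n])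
    show "locfin (\<lambda>(x, y). br a x \<odot> br a y :: 'k series) ?I" by (intro locfin_mult locfin_br)
    show "locfin (\<lambda>z. ?F (?h z) - ?G (?g z)) ?I" by (rule locfin_diff[OF l1 l2])
    fix z assume "z \<in> ?I"
    then obtain j k where z: "z = (j, k)" "j \<in> res n p" "k \<in> res n q" by blast
    note b = br[OF z(2,3)]
    show "((case z of (x, y) \<Rightarrow> br a x \<odot> br a y) :: 'k series) \<in> inv_alg n"
      unfolding z prod.case using n b by (intro inv_alg_mult) auto
    show "?F (?h z) - ?G (?g z) \<in> inv_alg n"
      unfolding z prod.case using n b by (intro inv_alg_diff inv_alg_mult) auto
    have "finite {a, j, k}" "inj_on (\<lambda>x. x mod int n) {a, j, k}" using b(5) by (auto simp: inj_on_def)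
    then interpret fk_system "{a, j, k}" "B n :: int \<Rightarrow> int \<Rightarrow> 'k fk_alg" by (rule B_fk_system[OF n])
    have "distinct [a, j, k]" using b(5) by auto
    then have "B n a j * B n a k = (B n j k * B n a j - B n a k * B n j k :: 'k fk_alg)" by (intro tri') auto
    then show "cls n ((case z of (x, y) \<Rightarrow> br a x \<odot> br a y) :: 'k series) = cls n (?F (?h z) - ?G (?g z))"
      unfolding z prod.case using n b(1-4) by (simp only: cls_mult cls_diff inv_alg_mult)
  next
    show "series_sum (\<lambda>(x, y). br a x \<odot> br a y :: 'k series) ?I \<in> inv_alg n"
      using inv_alg_mult[OF _ i(1,2)] n unfolding theta_res_mult by simp
    show "series_sum (\<lambda>z. ?F (?h z) - ?G (?g z)) ?I \<in> inv_alg n" using Di unfolding D .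
  qed simp
  moreover have "n > 0" using n by simp
  ultimately show ?thesis unfolding D using n i by (simp only: cls_mult cls_diff inv_alg_mult)
qed

lemma theta_dunkl_system:
  assumes n: "n \<ge> 2"
  shows "dunkl_system (residues_but n a) (\<lambda>r. cls n (theta_res n a r)) (\<lambda>p q. cls n (theta_res n p q) :: 'k::comm_ring_1 fk_alg)"
proof
  show "finite (residues_but n a)" by (simp add: residues_but_def)
  show "cls n (theta_res n a p) * cls n (theta_res n a p) = (0 :: 'k fk_alg)" if "p \<in> residues_but n a" for p
    by (rule theta_res_sq[OF n]) (use that in \<open>auto simp: residues_but_def\<close>)
  show "cls n (theta_res n a p) * cls n (theta_res n a q) =
    cls n (theta_res n p q) * cls n (theta_res n a p) - cls n (theta_res n a q) * (cls n (theta_res n p q) :: 'k fk_alg)"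
    if "p \<in> residues_but n a" "q \<in> residues_but n a" "p \<noteq> q" for p q
    by (rule theta_res_rel[OF n]) (use that in \<open>auto simp: residues_but_def\<close>)
  show "cls n (theta_res n p q) * cls n (theta_res n a r) = cls n (theta_res n a r) * (cls n (theta_res n p q) :: 'k fk_alg)"
    if "{p, q, r} \<subseteq> residues_but n a" "distinct [p, q, r]" for p q r
    by (rule theta_res_comm[OF n]) (use that in \<open>auto simp: residues_but_def\<close>)
qed

lemma theta_series_sum:
  assumes n: "n \<ge> 2"
  shows "theta_series n a = (\<Sum>r\<in>residues_but n a. theta_res n a r :: 'k::comm_ring_1 series)"
proof -
  have "{j. \<not> [j = a] (mod int n)} = (\<Union>r\<in>residues_but n a. res n r)"
    using n by (auto simp: residues_but_def res_def cong_def)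
  then have "theta_series n a = (series_sum (br a) (\<Union>r\<in>residues_but n a. res n r) :: 'k series)"
    by (simp only: theta_series_def)
  also have "\<dots> = (\<Sum>r\<in>residues_but n a. theta_res n a r)"
    unfolding theta_res_def
  proof (rule series_sum_UN)
    show "finite {x \<in> \<Union> (res n ` residues_but n a). br a x u \<noteq> (0 :: 'k)}" for u by (rule locfinD[OF locfin_br])
  qed (auto simp: residues_but_def res_def)
  finally show ?thesis .
qed

definition lifts :: "nat \<Rightarrow> int list \<Rightarrow> int list set" where
  "lifts n rs = {js. map (\<lambda>x. x mod int n) js = rs}"

lemma series_sum_lifts_Cons:
  "series_sum (br_prod a) (lifts n (r # rs)) = theta_res n a r \<odot> series_sum (br_prod a) (lifts n rs)"
proof -
  have lf: "locfin (br_prod a) (lifts n rs)"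
    by (rule locfin_subset[OF locfin_br_prod[of a "length rs"]]) (auto simp: lifts_def)
  have "bij_betw (\<lambda>(j, js). j # js) (res n r \<times> lifts n rs) (lifts n (r # rs))"
    by (auto simp: bij_betw_def inj_on_def lifts_def res_def image_iff map_eq_Cons_conv)
  then have "series_sum (br_prod a) (lifts n (r # rs)) =
    series_sum (\<lambda>z. br_prod a (case z of (j, js) \<Rightarrow> j # js)) (res n r \<times> lifts n rs)"
    by (rule series_sum_reindex)
  also have "\<dots> = series_sum (\<lambda>(j, js). br a j \<odot> br_prod a js) (res n r \<times> lifts n rs)"
    by (rule series_sum_cong) (auto simp: br_prod_Cons)
  also have "\<dots> = theta_res n a r \<odot> series_sum (br_prod a) (lifts n rs)"
    unfolding theta_res_def
    by (rule series_sum_mult(1)[symmetric]) (rule locfinD[OF locfin_br], rule locfinD[OF lf])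
  finally show ?thesis .
qed

lemma cls_lifts:
  assumes n: "n \<ge> 2" and rs: "rs \<noteq> []" "a mod int n \<notin> set rs"
  shows "series_sum (br_prod a) (lifts n rs) \<in> (inv_alg n :: 'k::comm_ring_1 series set) \<and>
    cls n (series_sum (br_prod a) (lifts n rs)) = (prod_list (map (\<lambda>r. cls n (theta_res n a r)) rs) :: 'k fk_alg)"
  using rs
proof (induction rs rule: list_nonempty_induct)
  case (single r)
  have "lifts n [] = {[]}" by (auto simp: lifts_def)
  then have "series_sum (br_prod a) (lifts n []) = (word [] :: 'k series)"
    by (auto simp: series_sum_def br_prod_def fun_eq_iff Collect_conv_if)
  then have "series_sum (br_prod a) (lifts n [r]) = (theta_res n a r :: 'k series)"
    unfolding series_sum_lifts_Cons by (simp add: series_mult_one)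
  then show ?case using inv_alg_theta_res[OF n, of r a, where 'a = 'k] single by simp
next
  case (cons r rs)
  have "(theta_res n a r :: 'k series) \<in> inv_alg n" using cons.prems by (intro inv_alg_theta_res[OF n]) auto
  then show ?case using cons n unfolding series_sum_lifts_Cons by (auto simp: cls_mult inv_alg_mult)
qed

text \<open>Grouping the leaf lists by their lists of residues turns the star series into the sum
  over distinct residues in \<open>power_sum\<close>.\<close>

lemma cls_star_series:
  assumes n: "n \<ge> 2" and m: "m > 0"
  shows "cls n (star_series n m a) = (cls n (theta_series n a) ^ m :: 'k::comm_ring_1 fk_alg)"
proof -
  let ?R = "residues_but n a"
  interpret dunkl_system ?R "\<lambda>r. cls n (theta_res n a r)" "\<lambda>p q. cls n (theta_res n p q) :: 'k fk_alg"
    by (rule theta_dunkl_system[OF n])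
  have "set (map (\<lambda>x. x mod int n) js) \<subseteq> ?R \<longleftrightarrow> a mod int n \<notin> set (map (\<lambda>x. x mod int n) js)" for js
    using n by (fastforce simp: residues_but_def image_iff)
  then have "star_lists n m a = (\<Union>rs\<in>dlists m ?R. lifts n rs)"
    by (auto simp del: set_map simp: star_lists_def dlists_def lifts_def)
  then have "star_series n m a = (series_sum (br_prod a) (\<Union>rs\<in>dlists m ?R. lifts n rs) :: 'k series)"
    by (simp only: star_series_def)
  also have "\<dots> = (\<Sum>rs\<in>dlists m ?R. series_sum (br_prod a) (lifts n rs))"
  proof (rule series_sum_UN)
    show "finite (dlists m ?R)" by (rule finite_dlists[OF fin])
    show "finite {x \<in> \<Union> (lifts n ` dlists m ?R). br_prod a x u \<noteq> (0 :: 'k)}" for u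
      by (rule locfinD, rule locfin_subset[OF locfin_br_prod[of a m]]) (auto simp: lifts_def dlists_def)
  qed (auto simp: lifts_def)
  finally have s: "star_series n m a = (\<Sum>rs\<in>dlists m ?R. series_sum (br_prod a) (lifts n rs) :: 'k series)" .
  have l: "(series_sum (br_prod a) (lifts n rs) :: 'k series) \<in> inv_alg n"
    "cls n (series_sum (br_prod a) (lifts n rs)) = (pt rs :: 'k fk_alg)" if "rs \<in> dlists m ?R" for rs
    using cls_lifts[OF n, of rs a, where 'k = 'k] that m by (auto simp: dlists_def residues_but_def)
  have "cls n (star_series n m a) = (\<Sum>rs\<in>dlists m ?R. cls n (series_sum (br_prod a) (lifts n rs)) :: 'k fk_alg)"
    unfolding s by (rule cls_sum[OF n l(1)])
  also have "\<dots> = (\<Sum>rs\<in>dlists m ?R. pt rs)" by (rule sum.cong[OF refl l(2)])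
  also have "\<dots> = (\<Sum>r\<in>?R. cls n (theta_res n a r)) ^ m" by (rule power_sum[symmetric])
  also have "(\<Sum>r\<in>?R. cls n (theta_res n a r)) = (cls n (theta_series n a) :: 'k fk_alg)"
    unfolding theta_series_sum[OF n]
    by (rule cls_sum[OF n, symmetric]) (auto intro!: inv_alg_theta_res[OF n] simp: residues_but_def)
  finally show ?thesis .
qed

section \<open>The action of the generators\<close>

text \<open>The generator exchanges only neighbours \<open>x\<close> and \<open>x + 1\<close> with
  \<open>x\<close> congruent to \<open>i\<close>; crossing the threshold would require
  \<open>x = c\<close>.\<close>

lemma aff_gen_le_iff:
  assumes "\<not> [i = c] (mod int n)"
  shows "aff_gen n i x \<le> c \<longleftrightarrow> x \<le> c"
proof -
  have "x \<noteq> c" if "[x = i] (mod int n)" using assms that cong_sym by blast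
  moreover have "x \<noteq> c + 1" if "[x = i + 1] (mod int n)"
    using assms that cong_sym cong_add_rcancel by blast
  ultimately show ?thesis by (auto simp: aff_gen_def aff_refl_def)
qed

lemma series_act_theta:
  assumes n: "n \<ge> 2"
  shows "series_act (aff_gen n a) (theta_series n a) = (theta_series n (a + 1) :: 'k::comm_ring_1 series)"
proof -
  let ?g = "aff_gen n a"
  have g: "?g \<in> aff_sym n" by (rule aff_gen_aff_sym[OF n])
  have ga: "?g a = a + 1" by (simp add: aff_gen_def aff_refl_def)
  have bij: "bij_betw ?g {j. \<not> [j = a] (mod int n)} {j. \<not> [j = a + 1] (mod int n)}"
  proof -
    have "[?g j = a + 1] (mod int n) \<longleftrightarrow> [j = a] (mod int n)" for j
      using aff_sym_cong[OF g, of j a] n ga by simp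
    moreover have "bij ?g" by (rule aff_symD(1)[OF g])
    ultimately show ?thesis unfolding bij_betw_def
      by (auto simp: inj_on_def image_iff bij_def surj_def) metis
  qed
  have "series_act ?g (theta_series n a) = series_sum (\<lambda>j. series_act ?g (br a j) :: 'k series) {j. \<not> [j = a] (mod int n)}"
    unfolding theta_series_def by (rule series_act_sum)
  also have "\<dots> = series_sum (\<lambda>j. br (a + 1) (?g j)) {j. \<not> [j = a] (mod int n)}"
  proof (rule series_sum_cong)
    fix j assume "j \<in> {j. \<not> [j = a] (mod int n)}"
    then have "a \<noteq> j" by auto
    then show "series_act ?g (br a j) = (br (a + 1) (?g j) :: 'k series)" using series_act_br[OF g] ga by metis
  qed
  also have "\<dots> = theta_series n (a + 1)"
    unfolding theta_series_def by (rule series_sum_reindex[OF bij, symmetric])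
  finally show ?thesis .
qed

lemma inv_alg_theta_series: "n \<ge> 2 \<Longrightarrow> theta_series n a \<in> (inv_alg n :: 'k::comm_ring_1 series set)"
  by (rule width_fin_inv_alg[OF _ width_fin_theta])

lemma cls_act:
  assumes n: "n \<ge> 2" and w: "w \<in> aff_sym n" and f: "f \<in> inv_alg n" and g: "g \<in> inv_alg n"
    and eq: "cls n f = cls n g"
  shows "cls n (series_act w f) = cls n (series_act w g)"
proof -
  have "f - g \<in> fk_ideal n" using eq cls_eq_iff[OF n f g] by blast
  then have "series_act w f - series_act w g \<in> fk_ideal n"
    unfolding series_act_diff[symmetric] by (rule fk_ideal_act[OF n w])
  moreover have "series_act w f \<in> inv_alg n" "series_act w g \<in> inv_alg n"
    using n w f g by (auto intro!: inv_alg_act)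
  ultimately show ?thesis using cls_eq_iff[OF n] by blast
qed

lemma fk_class_eqI:
  fixes f g :: "'k::comm_ring_1 series"
  assumes n: "n \<ge> 2" and f: "f \<in> inv_alg n" and g: "g \<in> inv_alg n" and eq: "cls n f = cls n g"
  shows "fk_class n f = fk_class n g"
proof -
  have fg: "f - g \<in> fk_ideal n" using eq cls_eq_iff[OF n f g] by blast
  then have gf: "g - f \<in> fk_ideal n" using eq cls_eq_iff[OF n g f] by simp
  note add = fk_ideal_closed(2)[OF n]
  show ?thesis
    unfolding fk_class_altdef
  proof (intro equalityI subsetI)
    fix x assume "x \<in> {h + f |h. h \<in> fk_ideal n}"
    then obtain h where h: "h \<in> fk_ideal n" "x = h + f" by blast
    have "h + (f - g) \<in> fk_ideal n" by (rule add[OF h(1) fg])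
    moreover have "x = (h + (f - g)) + g" using h(2) by (simp add: fun_eq_iff)
    ultimately show "x \<in> {h + g |h. h \<in> fk_ideal n}" by blast
  next
    fix x assume "x \<in> {h + g |h. h \<in> fk_ideal n}"
    then obtain h where h: "h \<in> fk_ideal n" "x = h + g" by blast
    have "h + (g - f) \<in> fk_ideal n" by (rule add[OF h(1) gf])
    moreover have "x = (h + (g - f)) + f" using h(2) by (simp add: fun_eq_iff)
    ultimately show "x \<in> {h + f |h. h \<in> fk_ideal n}" by blast
  qed
qed

text \<open>The new factor stands on the right, as in the recursion of the power in the ring
  record.\<close>

primrec theta_power :: "nat \<Rightarrow> nat \<Rightarrow> int \<Rightarrow> 'k::comm_ring_1 series" where
  "theta_power n 0 a = word []"
| "theta_power n (Suc m) a = theta_power n m a \<odot> theta_series n a"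

lemma inv_alg_theta_power: "n \<ge> 2 \<Longrightarrow> theta_power n m a \<in> inv_alg n"
  by (induction m) (auto intro!: inv_alg_mult inv_alg_word inv_alg_theta_series)

lemma theta_pow:
  assumes n: "n \<ge> 2"
  shows "theta n a [^]\<^bsub>FK n\<^esub> m = (fk_class n (theta_power n m a) :: 'k::comm_ring_1 series set)"
proof -
  interpret R: ring "FK n :: 'k series set ring" by (rule FK_ring[OF n])
  show ?thesis
  proof (induction m)
    case 0
    then show ?case using fk_class_hom(3)[OF n inv_alg_0[OF n] inv_alg_0[OF n]] by simp
  next
    case (Suc m)
    then show ?case
      using fk_class_hom(1)[OF n inv_alg_theta_power[OF n] inv_alg_theta_series[OF n]] by (simp add: theta_def)
  qed
qed

lemma cls_theta_power:
  assumes n: "n \<ge> 2" and m: "m > 0"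
  shows "cls n (theta_power n m a) = (cls n (theta_series n a) ^ m :: 'k::comm_ring_1 fk_alg)"
  using m
proof (induction m rule: nat_induct_non_zero)
  case 1
  then show ?case by (simp add: series_mult_one)
next
  case (Suc m)
  then show ?case
    by (simp only: theta_power.simps power_Suc2 cls_mult[OF n inv_alg_theta_power[OF n] inv_alg_theta_series[OF n]])
qed

lemma series_act_theta_power:
  assumes n: "n \<ge> 2"
  shows "series_act (aff_gen n a) (theta_power n m a) = theta_power n m (a + 1)"
  by (induction m) (simp_all add: series_act_one series_act_mult series_act_theta[OF n])

theorem theorem4p11:
  fixes n m :: nat and i a :: int
    and M :: "(int \<times> int) set \<Rightarrow> (int \<times> int) list set"
  assumes "n \<ge> 2" and "m > 0"
    and "i \<in> {0..<int n}" and "a \<in> {0..<int n}"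
    and "mn_reps n a m M"
  shows "fk_act (aff_gen n i) (mn_elem n M m a :: 'k::comm_ring_1 series set) =
    (if i \<noteq> a then mn_elem n M m a
     else mn_elem n M m i \<oplus>\<^bsub>FK n\<^esub> theta n (i + 1) [^]\<^bsub>FK n\<^esub> m
            \<ominus>\<^bsub>FK n\<^esub> theta n i [^]\<^bsub>FK n\<^esub> m)"
proof -
  note n = assms(1) and m = assms(2)
  interpret R: ring "FK n :: 'k series set ring" by (rule FK_ring[OF n])
  let ?g = "aff_gen n i" and ?p = "mn_series n M m a :: 'k series" and ?t = "\<lambda>c. tree_series n m c :: 'k series"
    and ?s = "\<lambda>c. theta_power n m c :: 'k series"
  have g: "?g \<in> aff_sym n" by (rule aff_gen_aff_sym[OF n])
  have pi: "?p \<in> inv_alg n" by (rule width_fin_inv_alg[OF n width_fin_mn[OF assms(5)]])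
  have ti: "?t c \<in> inv_alg n" and si: "?s c \<in> inv_alg n" for c
    by (rule width_fin_inv_alg[OF n width_fin_tree_series]) (rule inv_alg_theta_power[OF n])
  have gi: "series_act ?g f \<in> inv_alg n" if "f \<in> inv_alg n" for f :: "'k series"
    using inv_alg_act[OF _ that g] n by simp
  have pt: "cls n ?p = cls n (?t a)"
    using mn_series_tree_series[OF n m assms(5)] cls_eq_iff[OF n pi ti] by blast
  have gp: "cls n (series_act ?g ?p) = cls n (series_act ?g (?t a))" by (rule cls_act[OF n g pi ti pt])
  show ?thesis
  proof (cases "i = a")
    case False
    then have "\<not> [i = a] (mod int n)" using assms(3,4) by (simp add: cong_def)
    then have "series_act ?g (?t a) = ?t a" by (intro tree_series_act[OF n g] aff_gen_le_iff)
    then have "fk_class n (series_act ?g ?p) = fk_class n ?p"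
      using gp pt by (intro fk_class_eqI[OF n gi[OF pi] pi]) simp
    then show ?thesis using False unfolding mn_elem_def fk_act_class[OF n g] by simp
  next
    case True
    have step: "cls n (?t a) = cls n (?t (a - 1)) + cls n (?s a)"
    proof -
      have st: "star_series n m a \<in> (inv_alg n :: 'k series set)"
        by (rule width_fin_inv_alg[OF n width_fin_star_series])
      have "cls n (?t a - ?t (a - 1) - star_series n m a) = 0"
        using tree_series_step[OF n m, of a, where 'k = 'k] cls_eq_0_iff[OF n inv_alg_diff[OF inv_alg_diff[OF ti ti] st]] by blast
      then have "cls n (?t a) = cls n (?t (a - 1)) + cls n (star_series n m a)"
        using st ti by (simp only: cls_diff inv_alg_diff) (simp add: algebra_simps)
      then show ?thesis by (simp only: cls_star_series[OF n m] cls_theta_power[OF n m])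
    qed
    \<comment> \<open>The cut at \<open>a - 1\<close> is the one that the generator respects; this
      is why the tree series is first split at \<open>a - 1\<close>.\<close>
    have "\<not> [i = a - 1] (mod int n)"
    proof
      assume "[i = a - 1] (mod int n)"
      then have "int n dvd 1" using True by (simp add: cong_iff_dvd_diff)
      then show False using n by simp
    qed
    then have gt: "series_act ?g (?t (a - 1)) = ?t (a - 1)" by (intro tree_series_act[OF n g] aff_gen_le_iff)
    have gs: "series_act ?g (?s a) = ?s (a + 1)" unfolding True by (rule series_act_theta_power[OF n])
    \<comment> \<open>The identity is kept free of subtraction until it has been carried over from
      the ring type to the record.\<close>
    have "cls n (series_act ?g ?p + ?s a) = cls n (?p + ?s (a + 1))"
    proof -
      have "cls n (series_act ?g (?t a)) = cls n (series_act ?g (?t (a - 1) + ?s a))"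
        using step ti si by (intro cls_act[OF n g] inv_alg_add) (simp_all only: cls_add)
      also have "\<dots> = cls n (?t (a - 1)) + cls n (?s (a + 1))"
        using gt gs ti si gi by (simp only: series_act_add cls_add)
      finally show ?thesis
        using gp pt step pi si gi[OF pi] by (simp only: cls_add) (simp add: algebra_simps)
    qed
    then have "fk_class n (series_act ?g ?p + ?s a) = fk_class n (?p + ?s (a + 1))"
      by (intro fk_class_eqI[OF n] inv_alg_add gi pi si)
    then have eq: "fk_class n (series_act ?g ?p) \<oplus>\<^bsub>FK n\<^esub> fk_class n (?s a) = fk_class n ?p \<oplus>\<^bsub>FK n\<^esub> fk_class n (?s (a + 1))"
      by (simp only: fk_class_hom(2)[OF n] gi pi si)
    have c: "fk_class n f \<in> carrier (FK n)" if "f \<in> inv_alg n" for f :: "'k series"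
      using that unfolding FK_carrier by blast
    have "fk_class n (series_act ?g ?p) = fk_class n (series_act ?g ?p) \<oplus>\<^bsub>FK n\<^esub> fk_class n (?s a) \<ominus>\<^bsub>FK n\<^esub> fk_class n (?s a)"
      using c[OF gi[OF pi]] c[OF si[of a]] by (simp add: R.minus_eq R.a_assoc R.r_neg)
    then show ?thesis
      using True unfolding mn_elem_def fk_act_class[OF n g] theta_pow[OF n] eq by simp
  qed
qed

end
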